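(* Let $\mathbf X\in\mathscr C^p_\omega([0,T],V)$, and let all letters $U,U_i,S,R,W,Z$ denote finite-dimensional real vector spaces. 1. Let $\overline H\in\mathscr D_{\mathbf X}(U)$, $\mathbf H:=\uparrow_{\mathbf X}\overline H$ and $\overline K\in\mathscr D_{\mathbf H}(S)$. Then $\uparrow_{\mathbf X}(\overline K*\overline H)=\uparrow_{\mathbf H}\overline K$ in $\mathscr C^p_\omega([0,T],S)$. In particular $F_*(\uparrow_{\mathbf X}\overline H)=\uparrow_{\mathbf X}(F_*\overline H)$ for $F\in C^\infty(U,S)$, and furthermore $F_*(G_*\mathbf X)=(F\circ G)_*\mathbf X$ for $G\in C^\infty(V,U)$, $F\in C^\infty(U,S)$. 2. With $\overline H,\mathbf H,\overline K$ as in 1, and $\overline J\in\mathscr D_{\uparrow_{\mathbf H}\overline K}(R)$, one has $(\overline J*\overline K)*\overline H=\overline J*(\overline K*\overline H)$. In particular $F_*(G_*\overline H)=(F\circ G)_*\overline H$ for smooth $G\in C^\infty(U,S)$, $F\in C^\infty(S,R)$. 3. Let $\overline H\in\mathscr D_{\mathbf X}(U)$, $\mathbf H:=\uparrow_{\mathbf X}\overline H$, $\overline K\in\mathscr D_{\mathbf H}(\mathcal L(U_1,U_2))$, $\overline J\in\mathscr D_{\mathbf H}(\mathcal L(U_2,U_3))$. Then $(\overline J\cdot\overline K)*\overline H=(\overline J*\overline H)\cdot(\overline K*\overline H)$. In particular, for $A\in C^\infty(U,\mathcal L(U_2,U_3))$ and $B\in C^\infty(U,\mathcal L(U_1,U_2))$,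 $(A(\cdot)B(\cdot))_*\overline H=A_*\overline H\cdot B_*\overline H$, where $A(\cdot)B(\cdot)$ is the map $x\mapsto A(x)\circ B(x)$. 4. For $\overline H\in\mathscr D_{\mathbf X}(\mathcal L(U_1,U_2))$, $\overline K\in\mathscr D_{\mathbf X}(\mathcal L(U_2,U_3))$, $\overline J\in\mathscr D_{\mathbf X}(\mathcal L(U_3,U_4))$: $(\overline J\cdot\overline K)\cdot\overline H=\overline J\cdot(\overline K\cdot\overline H)$. 5. For $F\in C^\infty(V,W)$, $G\in C^\infty(W,Z)$ and $\overline H\in\mathscr D_{(G\circ F)_*\mathbf X}(\mathcal L(Z,U))$: $F^*(G^*\overline H)=(G\circ F)^*\overline H$.
   Context: All vector spaces are finite-dimensional and real; $T^N(V)=\bigoplus_{n=0}^N V^{\otimes n}$, with $a^n$ the component of $a$ in $V^{\otimes n}$. $T>0$, $p\ge1$, $\Delta_T=\{(s,t):0\le s\le t\le T\}$. A control is a continuous $\omega:\Delta_T\to[0,\infty)$ with $\omega(t,t)=0$ and $\omega(s,u)+\omega(u,t)\le\omega(s,t)$ for $s\le u\le t$. For a path $Y$, $Y_{st}:=Y_t-Y_s$; $\mathcal C^p_\omega([0,T],E)$ is the set of continuous $E$-valued paths with $|Y_{st}|\le C\omega(s,t)^{1/p}$ for some $C$. We write $a_{st}\approx_m b_{st}$ if $a_{st}-b_{st}=O(\omega(s,t)^{m/p})$, i.e. $|a_{st}-b_{st}|\le C\omega(s,t)^{m/p}$ for a constant $C$; $\approx$ means $\approx_{\lfloor p\rfloor+1}$.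 Shuffles: $\mathrm{Sh}(n_1,\ldots,n_m)$ is the set of permutations $\sigma$ of $\{1,\ldots,n_1+\cdots+n_m\}$ increasing on each of the consecutive blocks of sizes $n_1,\ldots,n_m$; $\overline{\mathrm{Sh}}(n_1,\ldots,n_m)$ (for $n_i\ge1$) is the subset of those with also $\sigma(n_1)<\sigma(n_1+n_2)<\cdots<\sigma(n_1+\cdots+n_m)$. For $n=n_1+\cdots+n_m$ define on $V^{\otimes n}$ $$\widetilde\Delta^{n_1,\ldots,n_m}_{\mathrm{osh}}(v_1\otimes\cdots\otimes v_n)=\sum_{\sigma\in\overline{\mathrm{Sh}}(n_1,\ldots,n_m)}(v_{\sigma(1)}\otimes\cdots\otimes v_{\sigma(n_1)})\boxtimes\cdots\boxtimes(v_{\sigma(n-n_m+1)}\otimes\cdots\otimes v_{\sigma(n)}),$$ and $\Delta^{a,b}_{\mathrm{sh}}$ on $V^{\otimes(a+b)}$ by the same formula with $\mathrm{Sh}(a,b)$ ($a,b\ge0$); $\boxtimes$ is the external tensor product. Rough paths: $\mathbf X\in\mathscr C^p_\omega([0,T],V)$ is a continuous map $\mathbf X:\Delta_T\to T^{\lfloor p\rfloor}(V)$ with $\mathbf X^0=1$ and: $|\mathbf X^n_{st}|\le C\omega(s,t)^{n/p}$ for $1\le n\le\lfloor p\rfloor$; $\mathbf X_{st}=\mathbf X_{su}\otimes\mathbf X_{ut}$ truncated at degree $\lfloor p\rfloor$, $s\le u\le t$; $\mathbf X^a_{st}\boxtimes\mathbf X^b_{st}=\Delta^{a,b}_{\mathrm{sh}}\mathbf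 X^{a+b}_{st}$ for $a+b\le\lfloor p\rfloor$. Its trace is the path $X$ with increments $\mathbf X^1$ and a given initial value $X_0$. Controlled paths: $\overline H\in\mathscr D_{\mathbf X}(U)$ is an element of $\mathcal C^p_\omega([0,T],\mathcal L(T^{\lfloor p\rfloor-1}(V),U))$ such that, with $\overline H_n:=\overline H|_{V^{\otimes n}}$, for $n=0,\ldots,\lfloor p\rfloor-2$ and $a\in V^{\otimes n}$: $\langle\overline H_{n;t},a\rangle\approx_{\lfloor p\rfloor-n}\sum_{k=0}^{\lfloor p\rfloor-1-n}\langle\overline H_{n+k;s},\mathbf X^k_{st}\otimes a\rangle$. Its trace is $H:=\overline H_0$. Lift: for $\overline H\in\mathscr D_{\mathbf X}(U)$, $\uparrow_{\mathbf X}\overline H$ is the unique element of $\mathscr C^p_\omega([0,T],U)$ (it exists), with trace $H$, such that $(\uparrow_{\mathbf X}\overline H)^m_{st}\approx\sum_{n_1,\ldots,n_m\ge1,\ n_1+\cdots+n_m\le\lfloor p\rfloor}\langle\overline H_{n_1;s}\boxtimes\cdots\boxtimes\overline H_{n_m;s},\widetilde\Delta^{n_1,\ldots,n_m}_{\mathrm{osh}}\mathbf X^{n_1+\cdots+n_m}_{st}\rangle$ for $2\le m\le\lfloor p\rfloor$. Smooth functions: for $F\in C^\infty(V,U)$, $\overline F(X):=(F(X),DF(X),\ldots,D^{\lfloor p\rfloor-1}F(X))\in\mathscr D_{\mathbf X}(U)$, and $F_*\mathbf X:=\uparrow_{\mathbf X}\overline F(X)$. Change of controlling path: for $\overline H\in\mathscr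 D_{\mathbf X}(U)$, $\mathbf H=\uparrow_{\mathbf X}\overline H$, $\overline K\in\mathscr D_{\mathbf H}(S)$, the controlled path $\overline K*\overline H\in\mathscr D_{\mathbf X}(S)$ is given by $(\overline K*\overline H)_0=K$ and, for $1\le n\le\lfloor p\rfloor-1$, $(\overline K*\overline H)_n=\sum_{m=1}^n\sum_{n_1,\ldots,n_m\ge1,\ n_1+\cdots+n_m=n}\overline K_m\circ(\overline H_{n_1}\boxtimes\cdots\boxtimes\overline H_{n_m})\circ\widetilde\Delta^{n_1,\ldots,n_m}_{\mathrm{osh}}$. Pushforward of controlled paths: for $F\in C^\infty(U,S)$, $F_*\overline H:=\overline F(H)*\overline H$, where $\overline F(H)\in\mathscr D_{\mathbf H}(S)$. Leibniz product: for $\overline H\in\mathscr D_{\mathbf X}(\mathcal L(U_1,U_2))$, $\overline K\in\mathscr D_{\mathbf X}(\mathcal L(U_2,U_3))$, $\overline K\cdot\overline H\in\mathscr D_{\mathbf X}(\mathcal L(U_1,U_3))$ is given by $(\overline K\cdot\overline H)_n=\sum_{a+b=n,\ a,b\ge0}\times\circ(\overline K_a\boxtimes\overline H_b)\circ\Delta^{a,b}_{\mathrm{sh}}$, with $\times(k\boxtimes h)=k\circ h$. Pullback: for $F\in C^\infty(V,W)$, $\overline H\in\mathscr D_{F_*\mathbf X}(\mathcal L(W,U))$, $F^*\overline H:=(\overline H*\overline F(X))\cdot\overline{DF}(X)\in\mathscr D_{\mathbf X}(\mathcal L(V,U))$, where $DF\in C^\infty(V,\mathcal L(V,W))$. *)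

theory Defs
  imports "HOL-Analysis.Analysis" "HOL-Combinatorics.Permutations"
begin

section \<open>Finite-dimensional real vector spaces\<close>

text \<open>
  The class \<open>euclidean_space\<close> is not closed under forming spaces of linear maps (the operator norm
  is not induced by an inner product). We use the class of all finite-dimensional real normed
  spaces, which contains every Euclidean space and is closed under \<open>\<Rightarrow>\<^sub>L\<close>; the choice of
  the norm is immaterial for everything below.
\<close>

class fin_dim = real_normed_vector +
  assumes finite_spanning: "\<exists>B. finite B \<and> (\<forall>x. \<exists>c. x = (\<Sum>b\<in>B. c b *\<^sub>R b))"

instance euclidean_space \<subseteq> fin_dim
  by standard (metis finite_Basis euclidean_representation)

lemma finite_spanning_set: "\<exists>B::'a::fin_dim set. finite B \<and> span B = UNIV"
proof -
  obtain B :: "'a set" where B: "finite B" "\<And>x. \<exists>c. x = (\<Sum>b\<in>B. c b *\<^sub>R b)"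
    using finite_spanning by blast
  then have "span B = UNIV" by (auto simp: span_finite)
  with B(1) show ?thesis by blast
qed

lemma independent_coeff_bound:
  fixes B :: "'a::real_normed_vector set"
  assumes "finite B" "independent B"
  shows "\<exists>C>0. \<forall>c. (\<Sum>b\<in>B. \<bar>c b\<bar>) \<le> C * norm (\<Sum>b\<in>B. c b *\<^sub>R b)"
  using assms
proof (induction B rule: finite_induct)
  case empty
  then show ?case by (auto intro: exI[of _ 1])
next
  case (insert a B)
  then have indB: "independent B" and aB: "a \<notin> span B"
    by (auto simp: independent_insert)
  then obtain C where C: "C > 0" and
    CB: "\<And>c. (\<Sum>b\<in>B. \<bar>c b\<bar>) \<le> C * norm (\<Sum>b\<in>B. c b *\<^sub>R b)"
    using insert.IH by blast
  have "\<exists>d>0. \<forall>c. d \<le> norm (a - (\<Sum>b\<in>B. c b *\<^sub>R b))"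
  proof (rule ccontr)
    assume neg: "\<not> (\<exists>d>0. \<forall>c. d \<le> norm (a - (\<Sum>b\<in>B. c b *\<^sub>R b)))"
    have "\<exists>c. norm (a - (\<Sum>b\<in>B. c b *\<^sub>R b)) < inverse (real (Suc n))" for n
      using neg by (metis not_le inverse_positive_iff_positive of_nat_0_less_iff zero_less_Suc)
    then obtain c where c: "\<And>n. norm (a - (\<Sum>b\<in>B. c n b *\<^sub>R b)) < inverse (real (Suc n))"
      by metis
    define x where "x n = (\<Sum>b\<in>B. c n b *\<^sub>R b)" for n
    have "(\<lambda>n. norm (x n - a)) \<longlonglongrightarrow> 0"
      by (rule tendsto_sandwich[OF _ _ tendsto_const LIMSEQ_inverse_real_of_nat])
        (use c in \<open>auto simp: x_def norm_minus_commute intro!: always_eventually less_imp_le\<close>)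
    then have xa: "x \<longlonglongrightarrow> a"
      by (simp add: tendsto_norm_zero_iff LIM_zero_iff)
    then have cx: "Cauchy x" by (rule LIMSEQ_imp_Cauchy)
    have "Cauchy (\<lambda>n. c n b)" if b: "b \<in> B" for b
    proof (rule metric_CauchyI)
      fix e :: real assume "e > 0"
      then have "e / C > 0" using C by simp
      then obtain M where M: "\<And>m n. m \<ge> M \<Longrightarrow> n \<ge> M \<Longrightarrow> dist (x m) (x n) < e / C"
        using metric_CauchyD[OF cx] by metis
      have "dist (c m b) (c n b) < e" if "m \<ge> M" "n \<ge> M" for m n
      proof -
        have "\<bar>c m b - c n b\<bar> \<le> (\<Sum>b\<in>B. \<bar>c m b - c n b\<bar>)"
          using b insert.hyps by (intro member_le_sum) auto
        also have "\<dots> \<le> C * norm (\<Sum>b\<in>B. (c m b - c n b) *\<^sub>R b)" by (rule CB)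
        also have "(\<Sum>b\<in>B. (c m b - c n b) *\<^sub>R b) = x m - x n"
          by (simp add: x_def scaleR_left_diff_distrib sum_subtractf)
        also have "C * norm (x m - x n) < e"
          using M[OF that] C by (simp add: dist_norm field_simps)
        finally show ?thesis by (simp add: dist_norm)
      qed
      then show "\<exists>M. \<forall>m\<ge>M. \<forall>n\<ge>M. dist (c m b) (c n b) < e" by blast
    qed
    then have "\<exists>l. (\<lambda>n. c n b) \<longlonglongrightarrow> l" if "b \<in> B" for b
      using that Cauchy_convergent_iff convergent_def by blast
    then obtain l where l: "\<And>b. b \<in> B \<Longrightarrow> (\<lambda>n. c n b) \<longlonglongrightarrow> l b" by metis
    have "x \<longlonglongrightarrow> (\<Sum>b\<in>B. l b *\<^sub>R b)"
      unfolding x_def by (intro tendsto_sum tendsto_scaleR tendsto_const l)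
    with xa have "a = (\<Sum>b\<in>B. l b *\<^sub>R b)" by (rule LIMSEQ_unique)
    also have "\<dots> \<in> span B" by (intro span_sum span_scale span_base)
    finally show False using aB by simp
  qed
  then obtain d where d: "d > 0" and dB: "\<And>c. d \<le> norm (a - (\<Sum>b\<in>B. c b *\<^sub>R b))" by blast
  show ?case
  proof (intro exI conjI allI)
    show "0 < 1 / d + C * (1 + norm a / d)"
      using C d by (intro add_pos_nonneg) auto
    fix c :: "'a \<Rightarrow> real"
    define s where "s = (\<Sum>b\<in>B. c b *\<^sub>R b)"
    define t where "t = c a *\<^sub>R a + s"
    have 1: "\<bar>c a\<bar> * d \<le> norm t"
    proof (cases "c a = 0")
      case False
      have "d \<le> norm (a - (\<Sum>b\<in>B. (- c b / c a) *\<^sub>R b))" by (rule dB)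
      also have "a - (\<Sum>b\<in>B. (- c b / c a) *\<^sub>R b) = (1 / c a) *\<^sub>R t"
        using False by (simp add: t_def s_def scaleR_right_distrib scaleR_sum_right sum_negf)
      finally show ?thesis using False by (simp add: field_simps)
    qed simp
    then have 2: "\<bar>c a\<bar> \<le> norm t / d" using d by (simp add: field_simps)
    have "norm s \<le> norm t + \<bar>c a\<bar> * norm a"
      unfolding t_def by (metis add_diff_cancel_left' norm_scaleR norm_triangle_ineq4)
    also have "\<dots> \<le> norm t + norm t / d * norm a"
      using 2 by (intro add_left_mono mult_right_mono) auto
    finally have 3: "norm s \<le> norm t * (1 + norm a / d)" by (simp add: algebra_simps)
    have "(\<Sum>b\<in>insert a B. \<bar>c b\<bar>) = \<bar>c a\<bar> + (\<Sum>b\<in>B. \<bar>c b\<bar>)"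
      using insert.hyps by simp
    also have "\<dots> \<le> norm t / d + C * norm s"
      using 2 CB[of c] by (simp add: s_def)
    also have "\<dots> \<le> norm t / d + C * (norm t * (1 + norm a / d))"
      using 3 C by (simp add: mult_left_mono)
    also have "\<dots> = (1 / d + C * (1 + norm a / d)) * norm t" by (simp add: algebra_simps)
    also have "t = (\<Sum>b\<in>insert a B. c b *\<^sub>R b)"
      using insert.hyps by (simp add: t_def s_def)
    finally show "(\<Sum>b\<in>insert a B. \<bar>c b\<bar>)
      \<le> (1 / d + C * (1 + norm a / d)) * norm (\<Sum>b\<in>insert a B. c b *\<^sub>R b)" .
  qed
qed

lemma fin_dim_basis:
  obtains B :: "'a::fin_dim set" and C :: real
  where "finite B" "independent B" "span B = UNIV" "C > 0"
    "\<And>x. (\<Sum>b\<in>B. representation B x b *\<^sub>R b) = x"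
    "\<And>x. (\<Sum>b\<in>B. \<bar>representation B x b\<bar>) \<le> C * norm x"
proof -
  obtain S :: "'a set" where S: "finite S" "span S = UNIV"
    using finite_spanning_set by auto
  obtain B where B: "B \<subseteq> S" "independent B" "S \<subseteq> span B"
    by (rule maximal_independent_subset)
  have fin: "finite B" using B S finite_subset by blast
  have sp: "span B = UNIV"
    using B(3) S(2) by (metis span_mono span_span top.extremum_uniqueI)
  have rep: "(\<Sum>b\<in>B. representation B x b *\<^sub>R b) = x" for x
    using sum_representation_eq[OF B(2), of x B] fin sp by auto
  obtain C where C: "C > 0" "\<And>c. (\<Sum>b\<in>B. \<bar>c b\<bar>) \<le> C * norm (\<Sum>b\<in>B. c b *\<^sub>R b)"
    using independent_coeff_bound[OF fin B(2)] by blast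
  show ?thesis
    using that[OF fin B(2) sp C(1) rep] C(2)[of "representation B _"] unfolding rep by blast
qed

lemma linear_imp_bounded_linear:
  fixes f :: "'a::fin_dim \<Rightarrow> 'b::real_normed_vector"
  assumes "linear f"
  shows "bounded_linear f"
proof -
  obtain B :: "'a set" and C where B: "finite B" "C > 0"
    "\<And>x. (\<Sum>b\<in>B. representation B x b *\<^sub>R b) = x"
    "\<And>x. (\<Sum>b\<in>B. \<bar>representation B x b\<bar>) \<le> C * norm x"
    by (metis fin_dim_basis)
  define M where "M = (\<Sum>b\<in>B. norm (f b))"
  have M: "norm (f b) \<le> M" if "b \<in> B" for b
    unfolding M_def using that B by (intro member_le_sum) auto
  have M0: "M \<ge> 0" by (simp add: M_def sum_nonneg)
  have "norm (f x) \<le> norm x * (C * M)" for x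
  proof -
    have "f x = (\<Sum>b\<in>B. representation B x b *\<^sub>R f b)"
      by (subst B(3)[of x, symmetric]) (simp add: linear_sum[OF assms] linear_scale[OF assms])
    also have "norm \<dots> \<le> (\<Sum>b\<in>B. \<bar>representation B x b\<bar> * norm (f b))"
      by (rule order_trans[OF norm_sum]) simp
    also have "\<dots> \<le> (\<Sum>b\<in>B. \<bar>representation B x b\<bar> * M)"
      by (intro sum_mono mult_left_mono M) auto
    also have "\<dots> = (\<Sum>b\<in>B. \<bar>representation B x b\<bar>) * M" by (simp add: sum_distrib_right)
    also have "\<dots> \<le> C * norm x * M" using B(4) M0 by (intro mult_right_mono)
    finally show ?thesis by (simp add: mult_ac)
  qed
  then show ?thesis
    using assms by (auto simp: bounded_linear_def bounded_linear_axioms_def)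
qed

instance blinfun :: (fin_dim, fin_dim) fin_dim
proof
  obtain B :: "'a set" and CB where B: "finite B" "independent B" "span B = UNIV"
    "\<And>x. (\<Sum>b\<in>B. representation B x b *\<^sub>R b) = x"
    by (metis fin_dim_basis)
  obtain D :: "'b set" and CD where D: "finite D"
    "\<And>x. (\<Sum>b\<in>D. representation D x b *\<^sub>R b) = x"
    by (metis fin_dim_basis)
  have lin: "linear (\<lambda>x. representation B x b *\<^sub>R d)" for b and d :: 'b
    using B by (intro linearI) (auto simp: representation_add representation_scale scaleR_left_distrib)
  define e where "e b d = Blinfun (\<lambda>x. representation B x b *\<^sub>R d)" for b and d :: 'b
  have e: "blinfun_apply (e b d) x = representation B x b *\<^sub>R d" for b d x
    unfolding e_def by (simp add: bounded_linear_Blinfun_apply linear_imp_bounded_linear lin)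
  define E where "E = (\<lambda>(b, d). e b d) ` (B \<times> D)"
  have "f \<in> span E" for f
  proof -
    have "f = (\<Sum>b\<in>B. \<Sum>d\<in>D. representation D (blinfun_apply f b) d *\<^sub>R e b d)"
    proof (rule blinfun_eqI)
      fix x
      have "blinfun_apply f x = (\<Sum>b\<in>B. representation B x b *\<^sub>R blinfun_apply f b)"
        by (subst B(4)[of x, symmetric]) (simp add: blinfun.sum_right blinfun.scaleR_right)
      also have "\<dots> = (\<Sum>b\<in>B. representation B x b *\<^sub>R
          (\<Sum>d\<in>D. representation D (blinfun_apply f b) d *\<^sub>R d))"
        by (simp add: D(2))
      finally show "blinfun_apply f x = blinfun_apply
          (\<Sum>b\<in>B. \<Sum>d\<in>D. representation D (blinfun_apply f b) d *\<^sub>R e b d) x"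
        by (simp add: blinfun.sum_left blinfun.scaleR_left e scaleR_sum_right mult.commute)
    qed
    also have "\<dots> \<in> span E"
      by (intro span_sum span_scale span_base) (auto simp: E_def)
    finally show ?thesis .
  qed
  moreover have "finite E" using B D by (simp add: E_def)
  ultimately have "finite E \<and> (\<forall>f. \<exists>c. f = (\<Sum>b\<in>E. c b *\<^sub>R b))"
    by (auto simp: span_finite)
  then show "\<exists>E::('a \<Rightarrow>\<^sub>L 'b) set. finite E \<and> (\<forall>f. \<exists>c. f = (\<Sum>b\<in>E. c b *\<^sub>R b))"
    by (rule exI)
qed


section \<open>The tensor algebra\<close>

text \<open>A map on words is multilinear if its restriction to words of each length is.\<close>

definition multilinear :: "('v::real_vector list \<Rightarrow> 'w::real_vector) \<Rightarrow> bool" where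
  "multilinear f \<longleftrightarrow> (\<forall>us ws. linear (\<lambda>v. f (us @ v # ws)))"

text \<open>
  \<open>'v tensor\<close> is the tensor algebra \<open>T(V) = (\<Oplus>n. V\<^sup>\<otimes>\<^sup>n)\<close>. A formal sum \<open>[(c\<^sub>1, w\<^sub>1), \<dots>]\<close> stands for
  \<open>c\<^sub>1 w\<^sub>1 + \<dots>\<close>, where the word \<open>w = [v\<^sub>1, \<dots>, v\<^sub>n]\<close> stands for \<open>v\<^sub>1 \<otimes> \<dots> \<otimes> v\<^sub>n\<close>; two formal sums are
  identified if no multilinear form separates them. That this is the tensor algebra is the
  universal property below: \<open>tensor_lift_tensor_of\<close>, \<open>linear_tensor_lift\<close> and \<open>tensor_lift_unique\<close>.
\<close>

definition formal_eval :: "('v list \<Rightarrow> 'w::real_vector) \<Rightarrow> (real \<times> 'v list) list \<Rightarrow> 'w" where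
  "formal_eval f x = (\<Sum>(c, w)\<leftarrow>x. c *\<^sub>R f w)"

definition tensor_rel :: "(real \<times> 'v::real_vector list) list \<Rightarrow> (real \<times> 'v list) list \<Rightarrow> bool" where
  "tensor_rel x y \<longleftrightarrow> (\<forall>f :: 'v list \<Rightarrow> real. multilinear f \<longrightarrow> formal_eval f x = formal_eval f y)"

quotient_type (overloaded) 'v tensor = "(real \<times> 'v::real_vector list) list" / tensor_rel
  by (rule equivpI) (auto simp: reflp_def symp_def transp_def tensor_rel_def)

lemma ex_abs_tensor: "\<exists>x. a = abs_tensor x"
  by (induction a rule: tensor.abs_induct) blast

lemma formal_eval_simps [simp]:
  "formal_eval f [] = 0"
  "formal_eval f ((c, w) # x) = c *\<^sub>R f w + formal_eval f x"
  "formal_eval f (x @ y) = formal_eval f x + formal_eval f y"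
  by (simp_all add: formal_eval_def)

lemma formal_eval_scale [simp]:
  "formal_eval f (map (\<lambda>(c, w). (r * c, w)) x) = r *\<^sub>R formal_eval f x"
  by (induction x) (auto simp: scaleR_right_distrib)

lemma formal_eval_uminus [simp]:
  "formal_eval f (map (\<lambda>(c, w). (- c, w)) x) = - formal_eval f x"
  by (induction x) auto

instantiation tensor :: (real_vector) real_vector
begin

lift_definition zero_tensor :: "'a tensor" is "[]" .

lift_definition plus_tensor :: "'a tensor \<Rightarrow> 'a tensor \<Rightarrow> 'a tensor" is "(@)"
  by (simp add: tensor_rel_def)

lift_definition scaleR_tensor :: "real \<Rightarrow> 'a tensor \<Rightarrow> 'a tensor"
  is "\<lambda>r. map (\<lambda>(c, w). (r * c, w))"
  by (simp add: tensor_rel_def)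

definition uminus_tensor :: "'a tensor \<Rightarrow> 'a tensor" where
  "uminus_tensor a = (-1) *\<^sub>R a"

definition minus_tensor :: "'a tensor \<Rightarrow> 'a tensor \<Rightarrow> 'a tensor" where
  "minus_tensor a b = a + - b"

instance
proof
  fix a b c :: "'a tensor" and r s :: real
  show "a + b + c = a + (b + c)" by transfer (simp add: tensor_rel_def)
  show "a + b = b + a" by transfer (simp add: tensor_rel_def)
  show "0 + a = a" by transfer (simp add: tensor_rel_def)
  show "- a + a = 0" unfolding uminus_tensor_def by transfer (simp add: tensor_rel_def)
  show "a - b = a + - b" by (rule minus_tensor_def)
  show "r *\<^sub>R (a + b) = r *\<^sub>R a + r *\<^sub>R b"
    by transfer (simp add: tensor_rel_def scaleR_right_distrib)
  show "(r + s) *\<^sub>R a = r *\<^sub>R a + s *\<^sub>R a"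
    by transfer (auto simp: tensor_rel_def, simp add: distrib_right)
  show "r *\<^sub>R s *\<^sub>R a = (r * s) *\<^sub>R a"
    by transfer (simp add: tensor_rel_def del: map_map)
  show "1 *\<^sub>R a = a" by transfer (simp add: tensor_rel_def)
qed

end

lift_definition tensor_of :: "'v::real_vector list \<Rightarrow> 'v tensor" is "\<lambda>w. [(1, w)]" .

text \<open>
  The linear map on \<open>T(V)\<close> induced by a multilinear map on words. (The value does not depend on the
  representative if \<open>f\<close> is multilinear; otherwise the operation is meaningless.)
\<close>

definition tensor_lift :: "('v::real_vector list \<Rightarrow> 'w::real_vector) \<Rightarrow> 'v tensor \<Rightarrow> 'w" where
  "tensor_lift f a = formal_eval f (rep_tensor a)"

lemma multilinear_compose_linear:
  assumes "multilinear f" "linear g"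
  shows "multilinear (\<lambda>w. g (f w))"
  using assms unfolding multilinear_def
  by (auto intro: linear_compose[unfolded o_def])

lemma tensor_rel_formal_eval:
  fixes f :: "'v::real_vector list \<Rightarrow> 'w::real_vector"
  assumes "multilinear f" "tensor_rel x y"
  shows "formal_eval f x = formal_eval f y"
proof (rule ccontr)
  define d where "d = formal_eval f x - formal_eval f y"
  assume "formal_eval f x \<noteq> formal_eval f y"
  then have "independent {d}" by (simp add: d_def)
  then obtain g :: "'w \<Rightarrow> real" where g: "linear g" "g d = 1"
    using linear_independent_extend[of "{d}" "\<lambda>_. 1::real"] by auto
  have "g (formal_eval f z) = formal_eval (\<lambda>w. g (f w)) z" for z
    by (induction z) (auto simp: linear_0[OF g(1)] linear_add[OF g(1)] linear_scale[OF g(1)])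
  moreover have "formal_eval (\<lambda>w. g (f w)) x = formal_eval (\<lambda>w. g (f w)) y"
    using assms(2) multilinear_compose_linear[OF assms(1) g(1)] unfolding tensor_rel_def by blast
  ultimately have "g d = 0" by (simp add: d_def linear_diff[OF g(1)])
  with g show False by simp
qed

lemma tensor_lift_abs:
  assumes "multilinear f"
  shows "tensor_lift f (abs_tensor x) = formal_eval f x"
  unfolding tensor_lift_def
  by (rule tensor_rel_formal_eval[OF assms])
    (metis Quotient_rel_rep Quotient_tensor Quotient_abs_rep tensor.abs_eq_iff)

lemma tensor_lift_tensor_of:
  assumes "multilinear f"
  shows "tensor_lift f (tensor_of w) = f w"
  by (simp add: tensor_of.abs_eq tensor_lift_abs[OF assms])

lemma linear_tensor_lift:
  assumes "multilinear f"
  shows "linear (tensor_lift f)"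
proof (rule linearI)
  fix a b :: "'a tensor" and r :: real
  obtain x y where [simp]: "a = abs_tensor x" "b = abs_tensor y"
    using ex_abs_tensor[of a] ex_abs_tensor[of b] by blast
  show "tensor_lift f (a + b) = tensor_lift f a + tensor_lift f b"
    by (simp add: plus_tensor.abs_eq tensor_lift_abs[OF assms])
  show "tensor_lift f (r *\<^sub>R a) = r *\<^sub>R tensor_lift f a"
    by (simp add: scaleR_tensor.abs_eq tensor_lift_abs[OF assms])
qed

lemma abs_tensor_eq_formal_eval: "abs_tensor x = formal_eval tensor_of x"
proof (induction x)
  case Nil
  then show ?case by (simp add: zero_tensor.abs_eq)
next
  case (Cons p x)
  obtain c w where p: "p = (c, w)" by (cases p)
  have "abs_tensor (p # x) = c *\<^sub>R tensor_of w + abs_tensor x"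
    unfolding p tensor_of.abs_eq by (simp add: plus_tensor.abs_eq scaleR_tensor.abs_eq)
  then show ?case by (simp add: p Cons.IH)
qed

lemma span_tensor_of: "span (range tensor_of) = UNIV"
proof -
  have "formal_eval tensor_of x \<in> span (range (tensor_of :: 'a list \<Rightarrow> _))" for x
    by (induction x) (auto intro!: span_zero span_add span_scale intro: span_base[OF rangeI])
  then have "a \<in> span (range tensor_of)" for a :: "'a tensor"
    using ex_abs_tensor[of a] by (auto simp: abs_tensor_eq_formal_eval)
  then show ?thesis by auto
qed

lemma tensor_lift_unique:
  assumes "multilinear f" "linear g" "\<And>w. g (tensor_of w) = f w"
  shows "g = tensor_lift f"
proof
  fix a :: "'a tensor"
  have "a \<in> span (range tensor_of)" by (simp add: span_tensor_of)
  moreover have "g b = tensor_lift f b" if "b \<in> range tensor_of" for b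
    using that assms(3) tensor_lift_tensor_of[OF assms(1)] by auto
  ultimately show "g a = tensor_lift f a"
    using linear_eq_on[OF assms(2) linear_tensor_lift[OF assms(1)]] by blast
qed

lemma multilinear_tensor_of: "multilinear tensor_of"
  unfolding multilinear_def
proof (intro allI linearI)
  fix us ws and x y :: 'a and r :: real
  have lin: "linear (\<lambda>v. f (us @ v # ws))" if "multilinear f" for f :: "'a list \<Rightarrow> real"
    using that unfolding multilinear_def by blast
  show "tensor_of (us @ (x + y) # ws) = tensor_of (us @ x # ws) + tensor_of (us @ y # ws)"
    unfolding tensor_of.abs_eq plus_tensor.abs_eq tensor.abs_eq_iff tensor_rel_def
  proof (intro allI impI)
    fix f :: "'a list \<Rightarrow> real" assume "multilinear f"
    then show "formal_eval f [(1, us @ (x + y) # ws)]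
        = formal_eval f ([(1, us @ x # ws)] @ [(1, us @ y # ws)])"
      using linear_add[OF lin, of f x y] by simp
  qed
  show "tensor_of (us @ (r *\<^sub>R x) # ws) = r *\<^sub>R tensor_of (us @ x # ws)"
    unfolding tensor_of.abs_eq scaleR_tensor.abs_eq tensor.abs_eq_iff tensor_rel_def
  proof (intro allI impI)
    fix f :: "'a list \<Rightarrow> real" assume "multilinear f"
    then show "formal_eval f [(1, us @ (r *\<^sub>R x) # ws)]
        = formal_eval f (map (\<lambda>(c, w). (r * c, w)) [(1, us @ x # ws)])"
      using linear_scale[OF lin, of f r x] by simp
  qed
qed

text \<open>The subspace \<open>V\<^sup>\<otimes>\<^sup>n\<close>, and the component \<open>a\<^sup>n\<close> of \<open>a\<close> in it.\<close>

definition tensor_power :: "nat \<Rightarrow> 'v::real_vector tensor set" where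
  "tensor_power n = span (tensor_of ` {w. length w = n})"

definition component :: "nat \<Rightarrow> 'v::real_vector tensor \<Rightarrow> 'v tensor" where
  "component n = tensor_lift (\<lambda>w. if length w = n then tensor_of w else 0)"

definition tensor_mult :: "'v::real_vector tensor \<Rightarrow> 'v tensor \<Rightarrow> 'v tensor"  (infixl \<open>\<otimes>\<^sub>t\<close> 70) where
  "a \<otimes>\<^sub>t b = tensor_lift (\<lambda>u. tensor_lift (\<lambda>w. tensor_of (u @ w)) b) a"

text \<open>The identifications \<open>V\<^sup>\<otimes>\<^sup>0 = \<real>\<close> and \<open>V\<^sup>\<otimes>\<^sup>1 = V\<close>.\<close>

definition scalar_part :: "'v::real_vector tensor \<Rightarrow> real" where
  "scalar_part = tensor_lift (\<lambda>w. if w = [] then 1 else 0)"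

definition vector_part :: "'v::real_vector tensor \<Rightarrow> 'v" where
  "vector_part = tensor_lift (\<lambda>w. case w of [v] \<Rightarrow> v | _ \<Rightarrow> 0)"

text \<open>
  The norm below is the projective one, \<open>inf (\<Sum>i. \<bar>c\<^sub>i\<bar> \<parallel>v\<^sub>i\<^sub>1\<parallel> \<dots> \<parallel>v\<^sub>i\<^sub>n\<parallel>)\<close> over all representations; on the
  finite-dimensional \<open>T\<^sup>N(V)\<close> all norms are equivalent.
\<close>

definition formal_size :: "(real \<times> 'v::real_normed_vector list) list \<Rightarrow> real" where
  "formal_size x = (\<Sum>(c, w)\<leftarrow>x. \<bar>c\<bar> * prod_list (map norm w))"

lemma multilinear_degree:
  assumes "multilinear f"
  shows "multilinear (\<lambda>w. if length w = n then f w else 0)"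
  unfolding multilinear_def
proof (intro allI)
  fix us ws
  have "linear (\<lambda>v. f (us @ v # ws))"
    using assms unfolding multilinear_def by blast
  then show "linear (\<lambda>v. if length (us @ v # ws) = n then f (us @ v # ws) else 0)"
    by (cases "length us + Suc (length ws) = n") (simp_all add: linear_iff)
qed

lemma multilinear_bounded:
  fixes f :: "'v::fin_dim list \<Rightarrow> 'w::real_normed_vector"
  assumes "multilinear f"
  shows "\<exists>C\<ge>0. \<forall>w. length w = n \<longrightarrow> norm (f w) \<le> C * prod_list (map norm w)"
  using assms
proof (induction n arbitrary: f)
  case 0
  then show ?case by (intro exI[of _ "norm (f [])"]) auto
next
  case (Suc n)
  obtain B :: "'v set" and C where B: "finite B" "C > 0"
    "\<And>x. (\<Sum>b\<in>B. representation B x b *\<^sub>R b) = x"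
    "\<And>x. (\<Sum>b\<in>B. \<bar>representation B x b\<bar>) \<le> C * norm x"
    by (metis fin_dim_basis)
  have "multilinear (\<lambda>w. f (b # w))" for b
    unfolding multilinear_def
  proof (intro allI)
    fix us ws
    show "linear (\<lambda>v. f (b # us @ v # ws))"
      using Suc.prems[unfolded multilinear_def, rule_format, of "b # us" ws] by simp
  qed
  then have "\<forall>b. \<exists>K. K \<ge> 0 \<and> (\<forall>w. length w = n \<longrightarrow> norm (f (b # w)) \<le> K * prod_list (map norm w))"
    using Suc.IH by blast
  from choice[OF this] obtain K where K: "\<And>b. K b \<ge> 0"
    "\<And>b w. length w = n \<Longrightarrow> norm (f (b # w)) \<le> K b * prod_list (map norm w)"
    by blast
  define M where "M = (\<Sum>b\<in>B. K b)"
  have M: "K b \<le> M" if "b \<in> B" for b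
    unfolding M_def using that B K by (intro member_le_sum) auto
  have M0: "M \<ge> 0" by (simp add: M_def sum_nonneg K)
  have "norm (f w) \<le> (C * M) * prod_list (map norm w)" if lw: "length w = Suc n" for w
  proof -
    obtain v u where w: "w = v # u" "length u = n" using lw by (cases w) auto
    define P where "P = prod_list (map norm u)"
    have P: "P \<ge> 0" unfolding P_def by (induction u) auto
    have lin: "linear (\<lambda>v. f (v # u))"
      using Suc.prems[unfolded multilinear_def, rule_format, of "[]" u] by simp
    have "f w = (\<Sum>b\<in>B. representation B v b *\<^sub>R f (b # u))"
      unfolding w by (subst B(3)[of v, symmetric]) (simp add: linear_sum[OF lin] linear_scale[OF lin])
    also have "norm \<dots> \<le> (\<Sum>b\<in>B. \<bar>representation B v b\<bar> * norm (f (b # u)))"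
      by (rule order_trans[OF norm_sum]) simp
    also have "\<dots> \<le> (\<Sum>b\<in>B. \<bar>representation B v b\<bar> * (M * P))"
    proof (intro sum_mono mult_left_mono)
      fix b assume "b \<in> B"
      then show "norm (f (b # u)) \<le> M * P"
        using K(2)[OF w(2), of b] mult_right_mono[OF M P, of b] unfolding P_def by linarith
    qed auto
    also have "\<dots> = (\<Sum>b\<in>B. \<bar>representation B v b\<bar>) * (M * P)" by (simp add: sum_distrib_right)
    also have "\<dots> \<le> C * norm v * (M * P)" using B(4) M0 P by (intro mult_right_mono) auto
    finally show ?thesis by (simp add: w P_def mult_ac)
  qed
  then show ?case using B M0 by (intro exI[of _ "C * M"]) auto
qed

lemma formal_size_simps [simp]:
  "formal_size [] = 0"
  "formal_size ((c, w) # x) = \<bar>c\<bar> * prod_list (map norm w) + formal_size x"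
  "formal_size (x @ y) = formal_size x + formal_size y"
  by (simp_all add: formal_size_def)

lemma prod_list_norm_nonneg: "prod_list (map norm w) \<ge> (0::real)"
  by (induction w) auto

lemma formal_size_nonneg: "formal_size x \<ge> 0"
  by (induction x) (auto simp: prod_list_norm_nonneg)

lemma formal_size_scale [simp]:
  "formal_size (map (\<lambda>(c, w). (r * c, w)) x) = \<bar>r\<bar> * formal_size x"
  by (induction x) (auto simp: abs_mult algebra_simps)

lemma norm_formal_eval_le:
  assumes "C \<ge> 0" "\<And>w. norm (f w) \<le> C * prod_list (map norm w)"
  shows "norm (formal_eval f x) \<le> C * formal_size x"
proof (induction x)
  case (Cons p x)
  obtain c w where p: "p = (c, w)" by (cases p)
  have "norm (c *\<^sub>R f w + formal_eval f x) \<le> \<bar>c\<bar> * norm (f w) + norm (formal_eval f x)"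
    using norm_triangle_ineq[of "c *\<^sub>R f w"] by simp
  also have "\<dots> \<le> \<bar>c\<bar> * (C * prod_list (map norm w)) + C * formal_size x"
    by (intro add_mono mult_left_mono assms Cons.IH) auto
  finally show ?case by (simp add: p algebra_simps)
qed simp

instantiation tensor :: (fin_dim) real_normed_vector
begin

definition norm_tensor :: "'a tensor \<Rightarrow> real" where
  "norm_tensor a = (INF x\<in>{x. abs_tensor x = a}. formal_size x)"

definition dist_tensor :: "'a tensor \<Rightarrow> 'a tensor \<Rightarrow> real" where
  "dist_tensor a b = norm (a - b)"

definition sgn_tensor :: "'a tensor \<Rightarrow> 'a tensor" where
  "sgn_tensor a = a /\<^sub>R norm a"

definition uniformity_tensor :: "('a tensor \<times> 'a tensor) filter" where
  "uniformity_tensor = (INF e\<in>{0<..}. principal {(a, b). dist a b < e})"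

definition open_tensor :: "'a tensor set \<Rightarrow> bool" where
  "open_tensor U = (\<forall>a\<in>U. eventually (\<lambda>(a', b). a' = a \<longrightarrow> b \<in> U) uniformity)"

instance
proof
  fix a b :: "'a tensor" and r :: real and U :: "'a tensor set"
  have ne: "{x. abs_tensor x = a} \<noteq> {}" for a :: "'a tensor"
    using ex_abs_tensor[of a] by auto
  have bdd: "bdd_below (formal_size ` A)" for A :: "(real \<times> 'a list) list set"
    by (rule bdd_belowI2[of _ 0]) (rule formal_size_nonneg)
  have le: "norm (abs_tensor x) \<le> formal_size x" for x :: "(real \<times> 'a list) list"
    unfolding norm_tensor_def by (intro cINF_lower bdd) auto
  have ex: "\<exists>x. abs_tensor x = a \<and> formal_size x < norm a + e" if "e > 0" for e and a :: "'a tensor"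
    using cINF_less_iff[OF ne bdd, of a "norm a + e"] that by (auto simp: norm_tensor_def)
  have nn: "norm a \<ge> 0" for a :: "'a tensor"
    unfolding norm_tensor_def by (intro cINF_greatest ne formal_size_nonneg)
  show "dist a b = norm (a - b)" by (rule dist_tensor_def)
  show "sgn a = a /\<^sub>R norm a" by (rule sgn_tensor_def)
  show "uniformity = (INF e\<in>{0<..}. principal {(a, b::'a tensor). dist a b < e})"
    by (rule uniformity_tensor_def)
  show "open U = (\<forall>a\<in>U. eventually (\<lambda>(a', b). a' = a \<longrightarrow> b \<in> U) uniformity)"
    by (rule open_tensor_def)
  show "norm (a + b) \<le> norm a + norm b"
  proof (rule field_le_epsilon)
    fix e :: real assume "e > 0"
    then have e: "e / 2 > 0" by simp
    obtain x where x: "abs_tensor x = a" "formal_size x < norm a + e / 2"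
      using ex[OF e] by blast
    obtain y where y: "abs_tensor y = b" "formal_size y < norm b + e / 2"
      using ex[OF e] by blast
    have "abs_tensor (x @ y) = a + b" using x y by (simp add: plus_tensor.abs_eq[symmetric])
    then show "norm (a + b) \<le> norm a + norm b + e"
      using le[of "x @ y"] x y by simp
  qed
  have sc: "norm (r *\<^sub>R a) \<le> \<bar>r\<bar> * norm a" for r and a :: "'a tensor"
  proof (rule field_le_epsilon)
    fix e :: real assume e: "e > 0"
    define d where "d = e / (\<bar>r\<bar> + 1)"
    have "d > 0" using e by (simp add: d_def add_nonneg_pos)
    then obtain x where x: "abs_tensor x = a" "formal_size x < norm a + d"
      using ex by blast
    have "abs_tensor (map (\<lambda>(c, w). (r * c, w)) x) = r *\<^sub>R a"
      using x by (simp add: scaleR_tensor.abs_eq[symmetric])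
    then have "norm (r *\<^sub>R a) \<le> \<bar>r\<bar> * formal_size x"
      using le[of "map (\<lambda>(c, w). (r * c, w)) x"] by simp
    also have "\<dots> \<le> \<bar>r\<bar> * (norm a + d)" using x by (intro mult_left_mono) auto
    finally have "norm (r *\<^sub>R a) \<le> \<bar>r\<bar> * norm a + \<bar>r\<bar> * d" by (simp add: algebra_simps)
    moreover have "\<bar>r\<bar> * d \<le> e"
      using e by (simp add: d_def divide_le_eq add_nonneg_pos algebra_simps)
    ultimately show "norm (r *\<^sub>R a) \<le> \<bar>r\<bar> * norm a + e" by linarith
  qed
  show "norm (r *\<^sub>R a) = \<bar>r\<bar> * norm a"
  proof (cases "r = 0")
    case True
    then show ?thesis using sc[of 0 a] nn[of "0 *\<^sub>R a"] by simp
  next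
    case False
    then have "\<bar>r\<bar> * norm a \<le> norm (r *\<^sub>R a)"
      using sc[of "1 / r" "r *\<^sub>R a"] by (simp add: field_simps)
    with sc[of r a] show ?thesis by simp
  qed
  show "norm a = 0 \<longleftrightarrow> a = 0"
  proof
    assume "a = 0"
    then show "norm a = 0" using sc[of 0 a] nn[of a] by simp
  next
    assume 0: "norm a = 0"
    obtain y where y: "a = abs_tensor y"
      using ex_abs_tensor[of a] by auto
    have deg: "formal_eval (\<lambda>w. if length w = n then f w else 0) y = 0"
      if f: "multilinear f" for f :: "'a list \<Rightarrow> real" and n
    proof -
      let ?g = "\<lambda>w. if length w = n then f w else 0"
      note g = multilinear_degree[OF f, of n]
      obtain C where C: "C \<ge> 0" "\<And>w. length w = n \<Longrightarrow> norm (f w) \<le> C * prod_list (map norm w)"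
        using multilinear_bounded[OF f] by blast
      have "\<bar>formal_eval ?g y\<bar> \<le> 0 + e" if e: "e > 0" for e
      proof -
        have "e / (C + 1) > 0" using e C by simp
        then obtain x where x: "abs_tensor x = a" "formal_size x < e / (C + 1)"
          using ex[of "e / (C + 1)" a] 0 by auto
        have "formal_eval ?g y = formal_eval ?g x"
          using tensor_lift_abs[OF g, of x] tensor_lift_abs[OF g, of y] x(1) y by simp
        also have "\<bar>\<dots>\<bar> \<le> C * formal_size x"
          unfolding real_norm_def[symmetric]
          by (rule norm_formal_eval_le) (use C prod_list_norm_nonneg in \<open>auto intro!: mult_nonneg_nonneg\<close>)
        also have "\<dots> \<le> C * (e / (C + 1))" using x C by (intro mult_left_mono) auto
        also have "\<dots> \<le> e" using e C by (simp add: field_simps)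
        finally show ?thesis by simp
      qed
      then have "\<bar>formal_eval ?g y\<bar> \<le> 0" by (rule field_le_epsilon)
      then show ?thesis by simp
    qed
    have "formal_eval f y = 0" if f: "multilinear f" for f :: "'a list \<Rightarrow> real"
    proof -
      obtain N where N: "\<And>c w. (c, w) \<in> set y \<Longrightarrow> length w < N"
      proof
        fix c w assume "(c, w) \<in> set y"
        then have "length w \<le> sum_list (map (\<lambda>(c, w). length w) y)"
          by (intro member_le_sum_list) (auto simp: image_iff intro!: bexI[of _ "(c, w)"])
        then show "length w < Suc (sum_list (map (\<lambda>(c, w). length w) y))" by simp
      qed
      then have "formal_eval f y = (\<Sum>n<N. formal_eval (\<lambda>w. if length w = n then f w else 0) y)"
      proof (induction y)
        case (Cons p y)
        obtain c w where p: "p = (c, w)" by (cases p)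
        have "length w < N" using Cons.prems p by auto
        then have "(\<Sum>n<N. c *\<^sub>R (if length w = n then f w else 0)) = c *\<^sub>R f w"
          by (simp add: if_distrib[of "\<lambda>x. c * x"] cong: if_cong)
        moreover have "formal_eval f y = (\<Sum>n<N. formal_eval (\<lambda>w. if length w = n then f w else 0) y)"
          using Cons.prems by (intro Cons.IH) auto
        ultimately show ?case by (simp add: p sum.distrib)
      qed simp
      then show ?thesis by (simp add: deg[OF f])
    qed
    then show "a = 0"
      unfolding y zero_tensor.abs_eq tensor.abs_eq_iff tensor_rel_def by simp
  qed
qed

end

text \<open>
  Linear maps on \<open>T\<^sup>N(V)\<close>, extended by zero to \<open>T(V)\<close>, are bounded; hence
  \<open>\<L>(T\<^sup>N\<^sup>-\<^sup>1(V), U)\<close> embeds into \<open>'v tensor \<Rightarrow>\<^sub>L 'u\<close>, and applications of \<open>Blinfun\<close> below are legitimate.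
\<close>

lemma bounded_linear_truncated:
  fixes f :: "'v::fin_dim tensor \<Rightarrow> 'u::real_normed_vector"
  assumes "linear f" "\<And>n a. n \<ge> N \<Longrightarrow> a \<in> tensor_power n \<Longrightarrow> f a = 0"
  shows "bounded_linear f"
proof -
  let ?g = "\<lambda>w. f (tensor_of w)"
  have g: "multilinear ?g"
    by (rule multilinear_compose_linear[OF multilinear_tensor_of assms(1)])
  have fg: "f = tensor_lift ?g" by (rule tensor_lift_unique[OF g assms(1)]) simp
  have "\<forall>n. \<exists>C. C \<ge> 0 \<and> (\<forall>w. length w = n \<longrightarrow> norm (?g w) \<le> C * prod_list (map norm w))"
    using multilinear_bounded[OF g] by blast
  from choice[OF this] obtain C where
    "\<forall>n. C n \<ge> 0 \<and> (\<forall>w. length w = n \<longrightarrow> norm (?g w) \<le> C n * prod_list (map norm w))" ..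
  then have C: "C n \<ge> 0" "norm (?g w) \<le> C (length w) * prod_list (map norm w)" for n w
    by auto
  define K where "K = (\<Sum>n<N. C n)"
  have K0: "K \<ge> 0" by (simp add: K_def sum_nonneg C)
  have K: "norm (?g w) \<le> K * prod_list (map norm w)" for w
  proof (cases "length w < N")
    case True
    then have "C (length w) \<le> K" unfolding K_def by (intro member_le_sum) (auto simp: C)
    then show ?thesis
      using C(2)[of w] mult_right_mono[OF _ prod_list_norm_nonneg[of w], of "C (length w)" K]
      by linarith
  next
    case False
    have "tensor_of w \<in> tensor_power (length w)"
      unfolding tensor_power_def by (intro span_base) auto
    then have "?g w = 0" using False assms(2)[of "length w"] by simp
    then show ?thesis using K0 prod_list_norm_nonneg[of w] by simp
  qed
  have ne: "{x. abs_tensor x = a} \<noteq> {}" for a :: "'v tensor"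
    using ex_abs_tensor[of a] by auto
  have le: "norm (f (abs_tensor x)) \<le> K * formal_size x" for x
  proof -
    have "f (abs_tensor x) = formal_eval ?g x"
      using fg tensor_lift_abs[OF g, of x] by simp
    then show ?thesis using norm_formal_eval_le[of K ?g x, OF K0 K] by simp
  qed
  have "norm (f a) \<le> norm a * K" for a
  proof (cases "K = 0")
    case True
    obtain x where "a = abs_tensor x" using ne[of a] by blast
    then show ?thesis using le[of x] True by simp
  next
    case False
    with K0 have K0: "K > 0" by simp
    have "norm (f a) / K \<le> norm a"
      unfolding norm_tensor_def
      by (rule cINF_greatest[OF ne]) (use le K0 in \<open>auto simp: field_simps\<close>)
    then show ?thesis using K0 by (simp add: field_simps)
  qed
  then show ?thesis
    using assms(1) by (auto simp: bounded_linear_def bounded_linear_axioms_def)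
qed


section \<open>Shuffle coproducts\<close>

text \<open>
  Positions are counted from 0: block \<open>i\<close> of a composition \<open>ns = [n\<^sub>1, \<dots>, n\<^sub>m]\<close> of \<open>n\<close> consists of the
  positions \<open>block_start ns i, \<dots>, block_start ns (Suc i) - 1\<close> of \<open>{..<n}\<close>.
\<close>

definition block_start :: "nat list \<Rightarrow> nat \<Rightarrow> nat" where
  "block_start ns i = sum_list (take i ns)"

definition shuffle_perms :: "nat list \<Rightarrow> (nat \<Rightarrow> nat) set" where
  "shuffle_perms ns = {\<sigma>. \<sigma> permutes {..<sum_list ns} \<and>
     (\<forall>i<length ns. strict_mono_on {block_start ns i..<block_start ns (Suc i)} \<sigma>)}"

definition ordered_shuffle_perms :: "nat list \<Rightarrow> (nat \<Rightarrow> nat) set" where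
  "ordered_shuffle_perms ns = {\<sigma> \<in> shuffle_perms ns.
     strict_mono_on {..<length ns} (\<lambda>i. \<sigma> (block_start ns (Suc i) - 1))}"

text \<open>
  \<open>(v\<^sub>\<sigma>\<^sub>(\<^sub>1\<^sub>) \<otimes> \<dots> \<otimes> v\<^sub>\<sigma>\<^sub>(\<^sub>n\<^sub>1\<^sub>)) \<boxtimes> \<dots> \<boxtimes> (\<dots>)\<close>. External tensor products \<open>V\<^sup>\<otimes>\<^sup>n\<^sup>1 \<boxtimes> \<dots> \<boxtimes> V\<^sup>\<otimes>\<^sup>n\<^sup>m\<close> live in the degree \<open>m\<close> part
  of the tensor algebra over \<open>T(V)\<close>: \<open>a\<^sub>1 \<boxtimes> \<dots> \<boxtimes> a\<^sub>m = tensor_of [a\<^sub>1, \<dots>, a\<^sub>m]\<close>.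
\<close>

definition permuted_blocks ::
  "nat list \<Rightarrow> (nat \<Rightarrow> nat) \<Rightarrow> 'v::real_vector list \<Rightarrow> 'v tensor tensor" where
  "permuted_blocks ns \<sigma> w = tensor_of (map (\<lambda>i.
     tensor_of (map (\<lambda>k. w ! \<sigma> k) [block_start ns i..<block_start ns (Suc i)])) [0..<length ns])"

definition Delta_sh :: "nat \<Rightarrow> nat \<Rightarrow> 'v::real_vector tensor \<Rightarrow> 'v tensor tensor" where
  "Delta_sh a b = tensor_lift (\<lambda>w. if length w = a + b
     then \<Sum>\<sigma>\<in>shuffle_perms [a, b]. permuted_blocks [a, b] \<sigma> w else 0)"

definition Delta_osh :: "nat list \<Rightarrow> 'v::real_vector tensor \<Rightarrow> 'v tensor tensor" where
  "Delta_osh ns = tensor_lift (\<lambda>w. if length w = sum_list ns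
     then \<Sum>\<sigma>\<in>ordered_shuffle_perms ns. permuted_blocks ns \<sigma> w else 0)"

text \<open>\<open>f\<^sub>1 \<boxtimes> \<dots> \<boxtimes> f\<^sub>m\<close> for linear maps \<open>f\<^sub>i\<close>, with values in the \<open>m\<close>-fold tensor power of the target.\<close>

definition boxtimes_map ::
  "('a::real_vector \<Rightarrow> 'u::real_vector) list \<Rightarrow> 'a tensor \<Rightarrow> 'u tensor" where
  "boxtimes_map fs = tensor_lift (\<lambda>as. if length as = length fs
     then tensor_of (map2 (\<lambda>f a. f a) fs as) else 0)"

text \<open>The compositions \<open>n\<^sub>1 + \<dots> + n\<^sub>m = n\<close> with \<open>n\<^sub>i \<ge> 1\<close>.\<close>

definition compositions :: "nat \<Rightarrow> nat \<Rightarrow> nat list set" where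
  "compositions m n = {ns. length ns = m \<and> (\<forall>k\<in>set ns. 1 \<le> k) \<and> sum_list ns = n}"


section \<open>Controls and rough paths\<close>

definition time_simplex :: "real \<Rightarrow> (real \<times> real) set"  (\<open>\<Delta>\<^bsub>_\<^esub>\<close>) where
  "\<Delta>\<^bsub>T\<^esub> = {(s, t). 0 \<le> s \<and> s \<le> t \<and> t \<le> T}"

definition is_control :: "real \<Rightarrow> (real \<Rightarrow> real \<Rightarrow> real) \<Rightarrow> bool" where
  "is_control T \<omega> \<longleftrightarrow>
     continuous_on \<Delta>\<^bsub>T\<^esub> (\<lambda>(s, t). \<omega> s t) \<and>
     (\<forall>(s, t)\<in>\<Delta>\<^bsub>T\<^esub>. 0 \<le> \<omega> s t) \<and>
     (\<forall>t\<in>{0..T}. \<omega> t t = 0) \<and>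
     (\<forall>s u t. 0 \<le> s \<and> s \<le> u \<and> u \<le> t \<and> t \<le> T \<longrightarrow> \<omega> s u + \<omega> u t \<le> \<omega> s t)"

text \<open>\<open>a\<^sub>s\<^sub>t \<approx>\<^sub>m b\<^sub>s\<^sub>t\<close>; only used with \<open>m > 0\<close>, so that \<open>0 powr (m / p) = 0\<close> is the right value.\<close>

definition approx_eq :: "real \<Rightarrow> (real \<Rightarrow> real \<Rightarrow> real) \<Rightarrow> real \<Rightarrow> nat \<Rightarrow>
    (real \<Rightarrow> real \<Rightarrow> 'e::real_normed_vector) \<Rightarrow> (real \<Rightarrow> real \<Rightarrow> 'e) \<Rightarrow> bool" where
  "approx_eq p \<omega> T m a b \<longleftrightarrow>
     (\<exists>C. \<forall>(s, t)\<in>\<Delta>\<^bsub>T\<^esub>. norm (a s t - b s t) \<le> C * \<omega> s t powr (m / p))"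

definition holder_paths :: "real \<Rightarrow> (real \<Rightarrow> real \<Rightarrow> real) \<Rightarrow> real \<Rightarrow>
    (real \<Rightarrow> 'e::real_normed_vector) set" where
  "holder_paths p \<omega> T = {Y. continuous_on {0..T} Y \<and>
     (\<exists>C. \<forall>(s, t)\<in>\<Delta>\<^bsub>T\<^esub>. norm (Y t - Y s) \<le> C * \<omega> s t powr (1 / p))}"

abbreviation floor_nat :: "real \<Rightarrow> nat"  (\<open>\<lfloor>_\<rfloor>\<^sub>\<nat>\<close>) where
  "\<lfloor>p\<rfloor>\<^sub>\<nat> \<equiv> nat \<lfloor>p\<rfloor>"

text \<open>
  A rough path is a pair of the initial value of its trace and its increments. The increments are normalised to be \<open>0\<close>
  off \<open>\<Delta>\<^sub>T\<close> (they are a map on \<open>\<Delta>\<^sub>T\<close>), so that equality of rough paths is HOL equality.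
\<close>

type_synonym 'v rough_path = "'v \<times> (real \<Rightarrow> real \<Rightarrow> 'v tensor)"

abbreviation start :: "'v::real_vector rough_path \<Rightarrow> 'v" where "start \<equiv> fst"

abbreviation incr :: "'v::real_vector rough_path \<Rightarrow> real \<Rightarrow> real \<Rightarrow> 'v tensor" where "incr \<equiv> snd"

definition rough_paths :: "real \<Rightarrow> (real \<Rightarrow> real \<Rightarrow> real) \<Rightarrow> real \<Rightarrow> 'v::fin_dim rough_path set" where
  "rough_paths p \<omega> T = {\<X>.
     (\<forall>s t. (s, t) \<notin> \<Delta>\<^bsub>T\<^esub> \<longrightarrow> incr \<X> s t = 0) \<and>
     (\<forall>(s, t)\<in>\<Delta>\<^bsub>T\<^esub>. \<forall>n>\<lfloor>p\<rfloor>\<^sub>\<nat>. component n (incr \<X> s t) = 0) \<and>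
     continuous_on \<Delta>\<^bsub>T\<^esub> (\<lambda>(s, t). incr \<X> s t) \<and>
     (\<forall>(s, t)\<in>\<Delta>\<^bsub>T\<^esub>. component 0 (incr \<X> s t) = tensor_of []) \<and>
     (\<forall>n\<in>{1..\<lfloor>p\<rfloor>\<^sub>\<nat>}. \<exists>C. \<forall>(s, t)\<in>\<Delta>\<^bsub>T\<^esub>. norm (component n (incr \<X> s t)) \<le> C * \<omega> s t powr (n / p)) \<and>
     (\<forall>s u t. 0 \<le> s \<and> s \<le> u \<and> u \<le> t \<and> t \<le> T \<longrightarrow>
        incr \<X> s t = (\<Sum>n\<le>\<lfloor>p\<rfloor>\<^sub>\<nat>. component n (incr \<X> s u \<otimes>\<^sub>t incr \<X> u t))) \<and>
     (\<forall>(s, t)\<in>\<Delta>\<^bsub>T\<^esub>. \<forall>a b. a + b \<le> \<lfloor>p\<rfloor>\<^sub>\<nat> \<longrightarrow>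
        tensor_of [component a (incr \<X> s t), component b (incr \<X> s t)]
          = Delta_sh a b (component (a + b) (incr \<X> s t)))}"

definition path_trace :: "'v::real_vector rough_path \<Rightarrow> real \<Rightarrow> 'v" where
  "path_trace \<X> t = start \<X> + vector_part (incr \<X> 0 t)"


section \<open>Controlled paths\<close>

text \<open>
  Elements of \<open>\<L>(T\<^sup>N\<^sup>-\<^sup>1(V), U)\<close>, where \<open>N = \<lfloor>p\<rfloor>\<close>, are represented by their extension by zero to \<open>T(V)\<close>.
  As a controlled path only matters on \<open>[0, T]\<close>, two of them are equal if they agree there.
\<close>

definition degree_part :: "nat \<Rightarrow> ('v::fin_dim tensor \<Rightarrow>\<^sub>L 'u::real_normed_vector) \<Rightarrow> 'v tensor \<Rightarrow> 'u" where
  "degree_part n h a = blinfun_apply h (component n a)"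

definition ctrace :: "(real \<Rightarrow> 'v::fin_dim tensor \<Rightarrow>\<^sub>L 'u::real_normed_vector) \<Rightarrow> real \<Rightarrow> 'u" where
  "ctrace H t = degree_part 0 (H t) (tensor_of [])"

definition controlled :: "real \<Rightarrow> (real \<Rightarrow> real \<Rightarrow> real) \<Rightarrow> real \<Rightarrow> 'v::fin_dim rough_path \<Rightarrow>
    (real \<Rightarrow> 'v tensor \<Rightarrow>\<^sub>L 'u::fin_dim) set" where
  "controlled p \<omega> T \<X> = {H.
     (\<forall>t\<in>{0..T}. \<forall>n\<ge>\<lfloor>p\<rfloor>\<^sub>\<nat>. \<forall>a\<in>tensor_power n. blinfun_apply (H t) a = 0) \<and>
     H \<in> holder_paths p \<omega> T \<and>
     (\<forall>n. n + 2 \<le> \<lfloor>p\<rfloor>\<^sub>\<nat> \<longrightarrow> (\<forall>a\<in>tensor_power n.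
        approx_eq p \<omega> T (\<lfloor>p\<rfloor>\<^sub>\<nat> - n)
          (\<lambda>s t. degree_part n (H t) a)
          (\<lambda>s t. \<Sum>k\<le>\<lfloor>p\<rfloor>\<^sub>\<nat> - 1 - n. degree_part (n + k) (H s) (component k (incr \<X> s t) \<otimes>\<^sub>t a))))}"

definition rough_lift :: "real \<Rightarrow> (real \<Rightarrow> real \<Rightarrow> real) \<Rightarrow> real \<Rightarrow> 'v::fin_dim rough_path \<Rightarrow>
    (real \<Rightarrow> 'v tensor \<Rightarrow>\<^sub>L 'u::fin_dim) \<Rightarrow> 'u rough_path" where
  "rough_lift p \<omega> T \<X> H = (THE \<Y>.
     \<Y> \<in> rough_paths p \<omega> T \<and>
     (\<forall>t\<in>{0..T}. path_trace \<Y> t = ctrace H t) \<and>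
     (\<forall>m\<in>{2..\<lfloor>p\<rfloor>\<^sub>\<nat>}. approx_eq p \<omega> T (\<lfloor>p\<rfloor>\<^sub>\<nat> + 1)
        (\<lambda>s t. component m (incr \<Y> s t))
        (\<lambda>s t. \<Sum>n\<le>\<lfloor>p\<rfloor>\<^sub>\<nat>. \<Sum>ns\<in>compositions m n.
           boxtimes_map (map (\<lambda>k. degree_part k (H s)) ns)
             (Delta_osh ns (component n (incr \<X> s t))))))"

definition star :: "real \<Rightarrow> (real \<Rightarrow> 'u::fin_dim tensor \<Rightarrow>\<^sub>L 's::fin_dim) \<Rightarrow>
    (real \<Rightarrow> 'v::fin_dim tensor \<Rightarrow>\<^sub>L 'u) \<Rightarrow> real \<Rightarrow> 'v tensor \<Rightarrow>\<^sub>L 's" where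
  "star p K H t = Blinfun (\<lambda>a. scalar_part a *\<^sub>R ctrace K t +
     (\<Sum>n\<in>{1..\<lfloor>p\<rfloor>\<^sub>\<nat> - 1}. \<Sum>m\<in>{1..n}. \<Sum>ns\<in>compositions m n.
        degree_part m (K t) (boxtimes_map (map (\<lambda>k. degree_part k (H t)) ns)
          (Delta_osh ns (component n a)))))"

text \<open>\<open>\<times> \<circ> (k \<boxtimes> h)\<close> for maps \<open>k\<close>, \<open>h\<close> with values in \<open>\<L>(U\<^sub>2, U\<^sub>3)\<close> and \<open>\<L>(U\<^sub>1, U\<^sub>2)\<close>.\<close>

definition compose_boxtimes ::
  "('a::real_vector \<Rightarrow> 'u2::real_normed_vector \<Rightarrow>\<^sub>L 'u3::real_normed_vector) \<Rightarrow>
   ('a \<Rightarrow> 'u1::real_normed_vector \<Rightarrow>\<^sub>L 'u2) \<Rightarrow> 'a tensor \<Rightarrow> 'u1 \<Rightarrow>\<^sub>L 'u3" where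
  "compose_boxtimes k h = tensor_lift (\<lambda>as. case as of [a, b] \<Rightarrow> k a o\<^sub>L h b | _ \<Rightarrow> 0)"

definition leibniz :: "real \<Rightarrow> (real \<Rightarrow> 'v::fin_dim tensor \<Rightarrow>\<^sub>L ('u2::fin_dim \<Rightarrow>\<^sub>L 'u3::fin_dim)) \<Rightarrow>
    (real \<Rightarrow> 'v tensor \<Rightarrow>\<^sub>L ('u1::fin_dim \<Rightarrow>\<^sub>L 'u2)) \<Rightarrow> real \<Rightarrow> 'v tensor \<Rightarrow>\<^sub>L ('u1 \<Rightarrow>\<^sub>L 'u3)" where
  "leibniz p K H t = Blinfun (\<lambda>x. \<Sum>n<\<lfloor>p\<rfloor>\<^sub>\<nat>. \<Sum>a\<le>n.
     compose_boxtimes (degree_part a (K t)) (degree_part (n - a) (H t))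
       (Delta_sh a (n - a) (component n x)))"


section \<open>Smooth functions\<close>

primrec C_k :: "nat \<Rightarrow> ('a::fin_dim \<Rightarrow> 'b::fin_dim) \<Rightarrow> bool" where
  "C_k 0 F \<longleftrightarrow> continuous_on UNIV F"
| "C_k (Suc k) F \<longleftrightarrow> (\<forall>x. F differentiable (at x)) \<and>
     (\<forall>v. C_k k (\<lambda>x. frechet_derivative F (at x) v))"

definition smooth :: "('a::fin_dim \<Rightarrow> 'b::fin_dim) \<Rightarrow> bool" where
  "smooth F \<longleftrightarrow> (\<forall>k. C_k k F)"

text \<open>\<open>nth_deriv F [v\<^sub>1, \<dots>, v\<^sub>n] x = \<langle>D\<^sup>nF(x), v\<^sub>1 \<otimes> \<dots> \<otimes> v\<^sub>n\<rangle>\<close>.\<close>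

primrec nth_deriv :: "('a::fin_dim \<Rightarrow> 'b::fin_dim) \<Rightarrow> 'a list \<Rightarrow> 'a \<Rightarrow> 'b" where
  "nth_deriv F [] x = F x"
| "nth_deriv F (v # vs) x = frechet_derivative (nth_deriv F vs) (at x) v"

definition deriv_map :: "('a::fin_dim \<Rightarrow> 'b::fin_dim) \<Rightarrow> 'a \<Rightarrow> 'a \<Rightarrow>\<^sub>L 'b" where
  "deriv_map F x = Blinfun (frechet_derivative F (at x))"

text \<open>\<open>(F(X), DF(X), \<dots>, D\<^sup>N\<^sup>-\<^sup>1F(X))\<close> for a path \<open>X\<close>.\<close>

definition smooth_controlled :: "real \<Rightarrow> ('v::fin_dim \<Rightarrow> 'u::fin_dim) \<Rightarrow> (real \<Rightarrow> 'v) \<Rightarrow>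
    real \<Rightarrow> 'v tensor \<Rightarrow>\<^sub>L 'u" where
  "smooth_controlled p F X t =
     Blinfun (tensor_lift (\<lambda>w. if length w < \<lfloor>p\<rfloor>\<^sub>\<nat> then nth_deriv F w (X t) else 0))"

definition push_rough :: "real \<Rightarrow> (real \<Rightarrow> real \<Rightarrow> real) \<Rightarrow> real \<Rightarrow> ('v::fin_dim \<Rightarrow> 'u::fin_dim) \<Rightarrow>
    'v rough_path \<Rightarrow> 'u rough_path" where
  "push_rough p \<omega> T F \<X> = rough_lift p \<omega> T \<X> (smooth_controlled p F (path_trace \<X>))"

definition push_controlled :: "real \<Rightarrow> ('u::fin_dim \<Rightarrow> 's::fin_dim) \<Rightarrow>
    (real \<Rightarrow> 'v::fin_dim tensor \<Rightarrow>\<^sub>L 'u) \<Rightarrow> real \<Rightarrow> 'v tensor \<Rightarrow>\<^sub>L 's" where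
  "push_controlled p F H = star p (smooth_controlled p F (ctrace H)) H"

text \<open>The controlling rough path of \<open>H\<close> is \<open>F\<^sub>* \<X>\<close>.\<close>

definition pullback :: "real \<Rightarrow> 'v::fin_dim rough_path \<Rightarrow> ('v \<Rightarrow> 'w::fin_dim) \<Rightarrow>
    (real \<Rightarrow> 'w tensor \<Rightarrow>\<^sub>L ('w \<Rightarrow>\<^sub>L 'u::fin_dim)) \<Rightarrow> real \<Rightarrow> 'v tensor \<Rightarrow>\<^sub>L ('v \<Rightarrow>\<^sub>L 'u)" where
  "pullback p \<X> F H =
     leibniz p (star p H (smooth_controlled p F (path_trace \<X>)))
       (smooth_controlled p (deriv_map F) (path_trace \<X>))"

end

theory Submission
  imports Defs
begin

text \<open>
  Dually to the freeness of shuffle algebras as Zinbiel algebras, a linear map \<open>h\<close> from \<open>T(V)\<close> to \<open>U\<close> induces, by its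
  values on nonempty words, a homomorphism \<open>\<Phi>\<^sub>h\<close> from \<open>T(V)\<close> to \<open>T(U)\<close> of unshuffle coalgebras, and \<open>\<Phi>\<^sub>k \<circ> \<Phi>\<^sub>h = \<Phi>\<^sub>k\<^sub>\<circ>\<^sub>\<Phi>\<^sub>h\<close>. Both the lift and the
  operation \<open>*\<close> are given by \<open>\<Phi>\<close>: the lift of \<open>H\<close> is the rough path close to \<open>\<Phi>\<^sub>H\<^sub>(\<^sub>s\<^sub>) \<X>\<^sub>s\<^sub>t\<close>, and
  \<open>K * H = K \<circ> \<Phi>\<^sub>H\<close>. Hence the algebraic statements hold pointwise in time, those about \<open>D\<^sup>nF\<close> by Faa di
  Bruno's formula and the Leibniz rule. As \<open>\<X>\<close> is group-like, \<open>\<Phi>\<^sub>H\<^sub>(\<^sub>s\<^sub>) \<X>\<^sub>s\<^sub>t\<close> is multiplicative up to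
  \<open>O(\<omega>(s,t)\<^sup>(\<^sup>N\<^sup>+\<^sup>1\<^sup>)\<^sup>/\<^sup>p)\<close>, so that the sewing lemma yields a unique multiplicative functional near it. The
  defect of the shuffle relation of this functional is, degree by degree, additive and of superlinear order,
  hence zero. Finally \<open>\<Phi>\<^sub>K \<circ> \<Phi>\<^sub>H = \<Phi>\<^sub>K\<^sub>*\<^sub>H\<close> up to high degree identifies the lift of \<open>K\<close> with the lift of \<open>K * H\<close>
  by uniqueness.
\<close>

section \<open>Multilinear maps and the tensor algebra\<close>

text \<open>Two losses of order shape the estimates, with N the integer part of p. A controlled path
  stops at degree N - 1, so K * H forgets the value of K after Phi_H on words of length N. But a
  word of length at most N that is cut into two or more blocks has only blocks shorter than N: Phi_K
  after Phi_H agrees there with Phi of K * H in degrees m \<ge> 2, and degree 1 is prescribed by the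
  trace. Likewise the degree 1 part of Phi_H(s) applied to the increment of X misses the increment
  of the trace by order N, one too little. This is harmless because in all other degrees that part
  comes with a further factor of order at least 1. On a word of length n, H itself is known up to
  order N - n; the increment of X over that block returns the n, and each other block adds at least
  1.

  Permutations occur only in matching the two coproducts of the definitions with a recursion that
  sends every letter to one of two words. All later identities are inductions on words. External
  tensor products are avoided by pairing with multilinear maps, which separate tensors by
  construction.\<close>

lemma multilinearI:
  assumes "\<And>us ws x y. f (us @ (x + y) # ws) = f (us @ x # ws) + f (us @ y # ws)"
    and "\<And>us ws r x. f (us @ (r *\<^sub>R x) # ws) = r *\<^sub>R f (us @ x # ws)"
  shows "multilinear f"
  unfolding multilinear_def by (auto intro!: linearI assms)

lemma multilinearD: "multilinear f \<Longrightarrow> linear (\<lambda>v. f (us @ v # ws))"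
  unfolding multilinear_def by blast

lemma multilinear_add_arg:
  "multilinear f \<Longrightarrow> f (us @ (x + y) # ws) = f (us @ x # ws) + f (us @ y # ws)"
  using linear_add[OF multilinearD] .

lemma multilinear_scale_arg:
  "multilinear f \<Longrightarrow> f (us @ (r *\<^sub>R x) # ws) = r *\<^sub>R f (us @ x # ws)"
  using linear_scale[OF multilinearD] .

lemma multilinear_add: "multilinear f \<Longrightarrow> multilinear g \<Longrightarrow> multilinear (\<lambda>w. f w + g w)"
  unfolding multilinear_def by (auto intro: linear_compose_add)

lemma multilinear_append_left: "multilinear f \<Longrightarrow> multilinear (\<lambda>w. f (u @ w))"
  by (rule multilinearI)
    (simp_all add: multilinear_add_arg[of f "u @ _", simplified] multilinear_scale_arg[of f "u @ _", simplified])

lemma multilinear_append_right: "multilinear f \<Longrightarrow> multilinear (\<lambda>w. f (w @ u))"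
  unfolding multilinear_def by simp

lemma multilinear_Cons: "multilinear f \<Longrightarrow> multilinear (\<lambda>w. f (v # w))"
  using multilinear_append_left[of f "[v]"] by simp

lemma multilinear_if_length:
  assumes "multilinear f"
  shows "multilinear (\<lambda>w. if P (length w) then f w else 0)"
  unfolding multilinear_def
proof (intro allI)
  fix us ws
  show "linear (\<lambda>v. if P (length (us @ v # ws)) then f (us @ v # ws) else 0)"
    using multilinearD[OF assms, of us ws]
    by (cases "P (length us + Suc (length ws))") (auto simp: linear_iff)
qed

text \<open>Words span the tensor algebra. Most identities between linear maps below are reduced to
  words by this rule and then proved by induction on words.\<close>

lemma tensor_linear_eqI:
  assumes "linear f" "linear g" "\<And>w. f (tensor_of w) = g (tensor_of w)"
  shows "f a = g a"
  using linear_eq_on[OF assms(1,2), of a "range tensor_of"] assms(3) span_tensor_of by auto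

lemma tensor_lift_linear:
  assumes "linear g"
  shows "tensor_lift (\<lambda>w. g (tensor_of w)) = g"
  using tensor_lift_unique[OF multilinear_compose_linear[OF multilinear_tensor_of assms] assms]
  by simp

lemma multilinear_linear_tensor_of: "linear g \<Longrightarrow> multilinear (\<lambda>w. g (tensor_of w))"
  by (rule multilinear_compose_linear[OF multilinear_tensor_of])

lemma linear_compose': "linear f \<Longrightarrow> linear g \<Longrightarrow> linear (\<lambda>x. g (f x))"
  using linear_compose[of f g] by (simp add: o_def)

lemma tensor_lift_compose_linear:
  assumes "multilinear f" "linear g"
  shows "g (tensor_lift f a) = tensor_lift (\<lambda>w. g (f w)) a"
proof (rule tensor_linear_eqI)
  note gf = multilinear_compose_linear[OF assms]
  show "linear (\<lambda>a. g (tensor_lift f a))"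
    by (rule linear_compose'[OF linear_tensor_lift[OF assms(1)] assms(2)])
  show "linear (tensor_lift (\<lambda>w. g (f w)))" by (rule linear_tensor_lift[OF gf])
  show "g (tensor_lift f (tensor_of w)) = tensor_lift (\<lambda>w. g (f w)) (tensor_of w)" for w
    by (simp add: tensor_lift_tensor_of assms gf)
qed

lemma tensor_lift_add:
  assumes "multilinear f" "multilinear g"
  shows "tensor_lift (\<lambda>w. f w + g w) a = tensor_lift f a + tensor_lift g a"
proof (rule tensor_linear_eqI)
  note fg = multilinear_add[OF assms]
  show "linear (tensor_lift (\<lambda>w. f w + g w))" by (rule linear_tensor_lift[OF fg])
  show "linear (\<lambda>a. tensor_lift f a + tensor_lift g a)"
    by (intro linear_compose_add linear_tensor_lift assms)
  show "tensor_lift (\<lambda>w. f w + g w) (tensor_of w) = tensor_lift f (tensor_of w) + tensor_lift g (tensor_of w)" for w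
    by (simp add: tensor_lift_tensor_of assms fg)
qed

lemma tensor_lift_scale:
  assumes "multilinear f"
  shows "tensor_lift (\<lambda>w. r *\<^sub>R f w) a = r *\<^sub>R tensor_lift f a"
  using tensor_lift_compose_linear[OF assms linear_scale_self, of r a] by simp

section \<open>Extension of maps that are multilinear in two words\<close>

definition bimultilinear :: "('u::real_vector list \<Rightarrow> 'v::real_vector list \<Rightarrow> 'w::real_vector) \<Rightarrow> bool"
  where "bimultilinear f \<longleftrightarrow> (\<forall>x. multilinear (f x)) \<and> (\<forall>y. multilinear (\<lambda>x. f x y))"

lemma bimultilinearI:
  "(\<And>x. multilinear (f x)) \<Longrightarrow> (\<And>y. multilinear (\<lambda>x. f x y)) \<Longrightarrow> bimultilinear f"
  by (simp add: bimultilinear_def)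

lemma bimultilinearD:
  assumes "bimultilinear f"
  shows "multilinear (f x)" "multilinear (\<lambda>x. f x y)"
  using assms by (simp_all add: bimultilinear_def)

lemma bimultilinear_add:
  "bimultilinear f \<Longrightarrow> bimultilinear g \<Longrightarrow> bimultilinear (\<lambda>x y. f x y + g x y)"
  by (simp add: bimultilinear_def multilinear_add)

lemma bimultilinear_append:
  "bimultilinear f \<Longrightarrow> bimultilinear (\<lambda>x y. f (u @ x @ u') (w @ y @ w'))"
  unfolding bimultilinear_def
  using multilinear_append_right[OF multilinear_append_left, of "f _" w w']
    multilinear_append_right[OF multilinear_append_left, of "\<lambda>x. f x _" u u'] by simp

lemma bimultilinear_compose_linear:
  "bimultilinear f \<Longrightarrow> linear g \<Longrightarrow> bimultilinear (\<lambda>x y. g (f x y))"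
  by (auto simp: bimultilinear_def intro: multilinear_compose_linear)

lemma bimultilinear_bilinear:
  assumes "bilinear b" "multilinear f" "multilinear g"
  shows "bimultilinear (\<lambda>x y. b (f x) (g y))"
proof (rule bimultilinearI)
  show "multilinear (\<lambda>y. b (f x) (g y))" for x
    by (rule multilinear_compose_linear[OF assms(3)]) (use assms(1) in \<open>simp add: bilinear_def\<close>)
  show "multilinear (\<lambda>x. b (f x) (g y))" for y
    by (rule multilinear_compose_linear[OF assms(2)]) (use assms(1) in \<open>simp add: bilinear_def\<close>)
qed

text \<open>The pairing of \<open>f\<close> with the external product of two tensors. It takes the
  place of a linear map out of the tensor product of T(U) and T(V).\<close>

definition tensor_lift2 ::
  "('u::real_vector list \<Rightarrow> 'v::real_vector list \<Rightarrow> 'w::real_vector) \<Rightarrow> 'u tensor \<Rightarrow> 'v tensor \<Rightarrow> 'w"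
  where "tensor_lift2 f a b = tensor_lift (\<lambda>x. tensor_lift (f x) b) a"

lemma multilinear_tensor_lift_arg:
  assumes "bimultilinear f"
  shows "multilinear (\<lambda>x. tensor_lift (f x) b)"
proof (rule multilinearI)
  fix us ws x y r
  note f = bimultilinearD[OF assms]
  show "tensor_lift (f (us @ (x + y) # ws)) b =
       tensor_lift (f (us @ x # ws)) b + tensor_lift (f (us @ y # ws)) b"
    unfolding tensor_lift_add[OF f(1) f(1), symmetric]
    by (intro arg_cong2[of _ _ _ _ tensor_lift] ext multilinear_add_arg[OF f(2)] refl)
  show "tensor_lift (f (us @ (r *\<^sub>R x) # ws)) b = r *\<^sub>R tensor_lift (f (us @ x # ws)) b"
    unfolding tensor_lift_scale[OF f(1), symmetric]
    by (intro arg_cong2[of _ _ _ _ tensor_lift] ext multilinear_scale_arg[OF f(2)] refl)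
qed

lemma linear_tensor_lift2_left: "bimultilinear f \<Longrightarrow> linear (\<lambda>a. tensor_lift2 f a b)"
  unfolding tensor_lift2_def by (intro linear_tensor_lift multilinear_tensor_lift_arg)

lemma linear_tensor_lift2_right:
  assumes "bimultilinear f"
  shows "linear (tensor_lift2 f a)"
proof (rule linearI)
  note f = bimultilinearD[OF assms] and l = linear_tensor_lift[OF bimultilinearD(1)[OF assms]]
  fix b c r
  show "tensor_lift2 f a (b + c) = tensor_lift2 f a b + tensor_lift2 f a c"
    unfolding tensor_lift2_def
    by (subst tensor_lift_add[symmetric])
      (simp_all add: linear_add[OF l] multilinear_tensor_lift_arg assms)
  show "tensor_lift2 f a (r *\<^sub>R b) = r *\<^sub>R tensor_lift2 f a b"
    unfolding tensor_lift2_def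
    by (subst tensor_lift_scale[symmetric])
      (simp_all add: linear_scale[OF l] multilinear_tensor_lift_arg assms)
qed

lemma bilinear_tensor_lift2: "bimultilinear f \<Longrightarrow> bilinear (tensor_lift2 f)"
  unfolding bilinear_def by (simp add: linear_tensor_lift2_left linear_tensor_lift2_right)

lemma tensor_lift2_tensor_of:
  "bimultilinear f \<Longrightarrow> tensor_lift2 f (tensor_of x) (tensor_of y) = f x y"
  by (simp add: tensor_lift2_def tensor_lift_tensor_of multilinear_tensor_lift_arg bimultilinearD)

lemma tensor_bilinear_eqI:
  assumes f: "bilinear f" and g: "bilinear g"
    and eq: "\<And>x y. f (tensor_of x) (tensor_of y) = g (tensor_of x) (tensor_of y)"
  shows "f a b = g a b"
proof (rule tensor_linear_eqI[of "\<lambda>a. f a b" "\<lambda>a. g a b"])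
  show "linear (\<lambda>a. f a b)" "linear (\<lambda>a. g a b)" using f g by (simp_all add: bilinear_def)
  show "f (tensor_of x) b = g (tensor_of x) b" for x
  proof (rule tensor_linear_eqI)
    show "linear (f (tensor_of x))" "linear (g (tensor_of x))" using f g by (simp_all add: bilinear_def)
  qed (rule eq)
qed

section \<open>The concatenation product\<close>

lemma bilinear_tensor_mult: "bilinear ((\<otimes>\<^sub>t) :: 'v::real_vector tensor \<Rightarrow> _)"
proof -
  have b: "bimultilinear (\<lambda>x y. tensor_of (x @ y) :: 'v tensor)"
    by (intro bimultilinearI multilinear_append_left multilinear_append_right multilinear_tensor_of)
  have "(\<otimes>\<^sub>t) = tensor_lift2 (\<lambda>x y. tensor_of (x @ y) :: 'v tensor)"
    by (intro ext) (simp add: tensor_mult_def tensor_lift2_def)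
  with bilinear_tensor_lift2[OF b] show ?thesis by simp
qed

lemma tensor_mult_tensor_of [simp]: "tensor_of x \<otimes>\<^sub>t tensor_of y = tensor_of (x @ y)"
proof -
  have b: "bimultilinear (\<lambda>x y. tensor_of (x @ y) :: 'a tensor)"
    by (intro bimultilinearI multilinear_append_left multilinear_append_right multilinear_tensor_of)
  show ?thesis using tensor_lift2_tensor_of[OF b, of x y] by (simp add: tensor_mult_def tensor_lift2_def)
qed

lemma linear_tensor_mult_left: "linear (\<lambda>a. a \<otimes>\<^sub>t b)"
  and linear_tensor_mult_right: "linear (\<lambda>b. a \<otimes>\<^sub>t b)"
  using bilinear_tensor_mult by (auto simp: bilinear_def)

lemmas tensor_mult_add_left = linear_add[OF linear_tensor_mult_left]
  and tensor_mult_add_right = linear_add[OF linear_tensor_mult_right]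
  and tensor_mult_diff_left = linear_diff[OF linear_tensor_mult_left]
  and tensor_mult_diff_right = linear_diff[OF linear_tensor_mult_right]
  and tensor_mult_scale_left = linear_scale[OF linear_tensor_mult_left]
  and tensor_mult_scale_right = linear_scale[OF linear_tensor_mult_right]
  and tensor_mult_sum_left = linear_sum[OF linear_tensor_mult_left]
  and tensor_mult_sum_right = linear_sum[OF linear_tensor_mult_right]
  and tensor_mult_zero_left [simp] = linear_0[OF linear_tensor_mult_left]
  and tensor_mult_zero_right [simp] = linear_0[OF linear_tensor_mult_right]

lemma tensor_mult_assoc: "a \<otimes>\<^sub>t b \<otimes>\<^sub>t c = a \<otimes>\<^sub>t (b \<otimes>\<^sub>t c)"
proof -
  have "a \<otimes>\<^sub>t b \<otimes>\<^sub>t tensor_of z = a \<otimes>\<^sub>t (b \<otimes>\<^sub>t tensor_of z)" for z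
  proof (rule tensor_bilinear_eqI[of "\<lambda>a b. a \<otimes>\<^sub>t b \<otimes>\<^sub>t tensor_of z" "\<lambda>a b. a \<otimes>\<^sub>t (b \<otimes>\<^sub>t tensor_of z)"])
    show "bilinear (\<lambda>a b. a \<otimes>\<^sub>t b \<otimes>\<^sub>t tensor_of z)"
      unfolding bilinear_def
      using linear_compose'[OF linear_tensor_mult_left linear_tensor_mult_left]
        linear_compose'[OF linear_tensor_mult_right linear_tensor_mult_left] by blast
    show "bilinear (\<lambda>a b. a \<otimes>\<^sub>t (b \<otimes>\<^sub>t tensor_of z))"
      unfolding bilinear_def
      using linear_tensor_mult_left linear_compose'[OF linear_tensor_mult_left linear_tensor_mult_right]
      by blast
  qed simp
  then show ?thesis
    by (rule tensor_linear_eqI[OF linear_tensor_mult_right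
          linear_compose'[OF linear_tensor_mult_right linear_tensor_mult_right]])
qed

lemma tensor_mult_unit_left [simp]: "tensor_of [] \<otimes>\<^sub>t a = a"
  by (rule tensor_linear_eqI[OF linear_tensor_mult_right linear_id[unfolded id_def]]) simp

lemma tensor_mult_unit_right [simp]: "a \<otimes>\<^sub>t tensor_of [] = a"
  by (rule tensor_linear_eqI[OF linear_tensor_mult_left linear_id[unfolded id_def]]) simp

lemma linear_tensor_of_singleton: "linear (\<lambda>u. tensor_of [u])"
  using multilinearD[OF multilinear_tensor_of, of "[]" "[]"] by simp

section \<open>The grading\<close>

lemma multilinear_component: "multilinear (\<lambda>w. if length w = n then tensor_of w else 0)"
  by (rule multilinear_degree[OF multilinear_tensor_of])

lemma linear_component: "linear (component n)"
  unfolding component_def by (rule linear_tensor_lift[OF multilinear_component])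

lemma component_tensor_of [simp]:
  "component n (tensor_of w) = (if length w = n then tensor_of w else 0)"
  unfolding component_def by (rule tensor_lift_tensor_of[OF multilinear_component])

lemmas component_add [simp] = linear_add[OF linear_component]
  and component_diff [simp] = linear_diff[OF linear_component]
  and component_scale [simp] = linear_scale[OF linear_component]
  and component_sum = linear_sum[OF linear_component]
  and component_0 [simp] = linear_0[OF linear_component]

lemma component_component [simp]: "component m (component n a) = (if m = n then component n a else 0)"
proof (rule tensor_linear_eqI[of "\<lambda>a. component m (component n a)" "\<lambda>a. if m = n then component n a else 0"])
  show "linear (\<lambda>a. component m (component n a))"
    by (rule linear_compose'[OF linear_component linear_component])
  show "linear (\<lambda>a. if m = n then component n a else 0)"
    using linear_component by (cases "m = n") (auto simp: module_hom_zero)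
  show "component m (component n (tensor_of w)) = (if m = n then component n (tensor_of w) else 0)"
    for w :: "'a list" by auto
qed

lemma component_mult:
  "component n (a \<otimes>\<^sub>t b) = (\<Sum>i\<le>n. component i a \<otimes>\<^sub>t component (n - i) b)"
proof (rule tensor_bilinear_eqI[of "\<lambda>a b. component n (a \<otimes>\<^sub>t b)"
      "\<lambda>a b. \<Sum>i\<le>n. component i a \<otimes>\<^sub>t component (n - i) b"])
  show "bilinear (\<lambda>a b. component n (a \<otimes>\<^sub>t b))"
    unfolding bilinear_def
    using linear_compose'[OF linear_tensor_mult_left linear_component]
      linear_compose'[OF linear_tensor_mult_right linear_component] by blast
  show "bilinear (\<lambda>a b. \<Sum>i\<le>n. component i a \<otimes>\<^sub>t component (n - i) b)"
    unfolding bilinear_def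
    by (intro conjI allI linear_compose_sum ballI linear_compose'[OF linear_component linear_tensor_mult_left]
      linear_compose'[OF linear_component linear_tensor_mult_right])
  fix x y :: "'a list"
  have "component i (tensor_of x) \<otimes>\<^sub>t component (n - i) (tensor_of y) =
     (if i = length x then (if length y = n - i then tensor_of (x @ y) else 0) else 0)" for i
    by auto
  then have "(\<Sum>i\<le>n. component i (tensor_of x) \<otimes>\<^sub>t component (n - i) (tensor_of y))
      = (if length x \<le> n then (if length y = n - length x then tensor_of (x @ y) else 0) else 0)"
    by (simp only: sum.delta finite_atMost) auto
  then show "component n (tensor_of x \<otimes>\<^sub>t tensor_of y) =
     (\<Sum>i\<le>n. component i (tensor_of x) \<otimes>\<^sub>t component (n - i) (tensor_of y))"
    by auto
qed

lemma tensor_power_iff: "a \<in> tensor_power n \<longleftrightarrow> component n a = a"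
proof
  assume "a \<in> tensor_power n"
  then have "a \<in> span (tensor_of ` {w. length w = n})" by (simp add: tensor_power_def)
  then show "component n a = a"
    by (rule linear_eq_on[OF linear_component linear_id[unfolded id_def]]) auto
next
  have "component n b \<in> tensor_power n" for b :: "'a tensor"
  proof -
    have "b \<in> span (range tensor_of)" by (simp add: span_tensor_of)
    then show ?thesis
    proof (induction rule: span_induct_alt)
      case base
      then show ?case by (simp add: tensor_power_def span_zero)
    next
      case (step c x y)
      then obtain w where w: "x = tensor_of w" by blast
      have "component n x \<in> tensor_power n"
        by (cases "length w = n") (auto simp: w tensor_power_def span_base span_zero)
      with step show ?case
        by (simp add: tensor_power_def span_add span_scale)
    qed
  qed
  then show "component n a = a \<Longrightarrow> a \<in> tensor_power n" by metis
qed

lemma component_in_tensor_power [simp]: "component n a \<in> tensor_power n"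
  by (simp add: tensor_power_iff)

lemma tensor_of_in_tensor_power: "tensor_of w \<in> tensor_power (length w)"
  by (simp add: tensor_power_iff)

lemma ex_degree_bound: "\<exists>N. \<forall>n\<ge>N. component n a = 0"
proof -
  have "a \<in> span (range tensor_of)" by (simp add: span_tensor_of)
  then show ?thesis
  proof (induction rule: span_induct_alt)
    case (step c x y)
    then obtain w N where "x = tensor_of w" "\<forall>n\<ge>N. component n y = 0" by auto
    then show ?case by (intro exI[of _ "max N (Suc (length w))"]) auto
  qed auto
qed

lemma sum_components:
  assumes "\<And>n. n > N \<Longrightarrow> component n a = 0"
  shows "(\<Sum>n\<le>N. component n a) = a"
proof -
  \<comment> \<open>The bound on the degree is not inherited by the summands of a linear combination
    of words, so the induction claims the identity only for all large cut-offs.\<close>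
  have *: "\<exists>N0. \<forall>N\<ge>N0. (\<Sum>n\<le>N. component n b) = b" for b :: "'a tensor"
  proof -
    have "b \<in> span (range tensor_of)" by (simp add: span_tensor_of)
    then show ?thesis
    proof (induction rule: span_induct_alt)
      case (step c x y)
      then obtain w N where w: "x = tensor_of w" and N: "\<And>n. n \<ge> N \<Longrightarrow> (\<Sum>i\<le>n. component i y) = y" by blast
      have "(\<Sum>i\<le>n. component i (c *\<^sub>R x + y)) = c *\<^sub>R x + y" if "n \<ge> max N (length w)" for n
      proof -
        have "(\<Sum>i\<le>n. component i x) = (\<Sum>i\<le>n. if i = length w then x else 0)"
          by (rule sum.cong) (auto simp: w)
        also have "\<dots> = x" using that by simp
        finally show ?thesis
          using N[of n] that by (simp add: sum.distrib flip: scaleR_sum_right)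
      qed
      then show ?case by blast
    qed simp
  qed
  obtain N0 where N0: "\<And>n. n \<ge> N0 \<Longrightarrow> (\<Sum>i\<le>n. component i a) = a" using * by blast
  have "(\<Sum>n\<le>N. component n a) = (\<Sum>n\<le>max N N0. component n a)"
    by (rule sum.mono_neutral_left) (auto intro!: assms)
  also have "\<dots> = a" by (rule N0) simp
  finally show ?thesis .
qed

lemma tensor_eqI:
  assumes "\<And>n. component n a = component n b"
  shows "a = b"
proof -
  obtain N where N: "\<And>n. n \<ge> N \<Longrightarrow> component n a = 0" using ex_degree_bound[of a] by blast
  have "(\<Sum>n\<le>N. component n a) = a"
    by (rule sum_components, rule N) simp
  moreover have "(\<Sum>n\<le>N. component n b) = b"
    by (rule sum_components, subst assms[symmetric], rule N) simp
  moreover have "(\<Sum>n\<le>N. component n a) = (\<Sum>n\<le>N. component n b)"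
    by (rule sum.cong[OF refl assms])
  ultimately show ?thesis by metis
qed

section \<open>The unshuffle coproduct and ordered shuffles\<close>

text \<open>The pairing of \<open>f\<close> with the unshuffle coproduct of \<open>w\<close>: each letter goes to either factor.\<close>

fun unshuffle_sum :: "'v list \<Rightarrow> ('v list \<Rightarrow> 'v list \<Rightarrow> 'a::comm_monoid_add) \<Rightarrow> 'a" where
  "unshuffle_sum [] f = f [] []"
| "unshuffle_sum (v # w) f = unshuffle_sum w (\<lambda>x y. f (v # x) y) + unshuffle_sum w (\<lambda>x y. f x (v # y))"

text \<open>The condition on the lengths is what shows the recursive calls of
  \<open>osh_map\<close>, which occur under \<open>unshuffle_sum\<close>, to be on shorter
  words.\<close>

lemma unshuffle_sum_cong [fundef_cong]:
  assumes "w = w'" "\<And>x y. length x + length y = length w' \<Longrightarrow> f x y = g x y"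
  shows "unshuffle_sum w f = unshuffle_sum w' g"
  using assms(2) unfolding assms(1)
proof (induction w' arbitrary: f g)
  case (Cons v w)
  have "unshuffle_sum w (\<lambda>x y. f (v # x) y) = unshuffle_sum w (\<lambda>x y. g (v # x) y)"
    by (rule Cons.IH) (rule Cons.prems, simp)
  moreover have "unshuffle_sum w (\<lambda>x y. f x (v # y)) = unshuffle_sum w (\<lambda>x y. g x (v # y))"
    by (rule Cons.IH) (rule Cons.prems, simp)
  ultimately show ?case by simp
qed simp

lemma unshuffle_sum_append:
  "unshuffle_sum (w @ w') f = unshuffle_sum w (\<lambda>x y. unshuffle_sum w' (\<lambda>x' y'. f (x @ x') (y @ y')))"
  by (induction w arbitrary: f) simp_all

lemma unshuffle_sum_add: "unshuffle_sum w (\<lambda>x y. f x y + g x y) = unshuffle_sum w f + unshuffle_sum w g"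
proof (induction w arbitrary: f g)
  case (Cons v w)
  show ?case by (simp add: Cons.IH add_ac)
qed simp

lemma unshuffle_sum_snoc: "unshuffle_sum (w @ [v]) f = unshuffle_sum w (\<lambda>x y. f (x @ [v]) y) + unshuffle_sum w (\<lambda>x y. f x (y @ [v]))"
  by (simp add: unshuffle_sum_append unshuffle_sum_add)

lemma unshuffle_sum_zero: "unshuffle_sum w (\<lambda>x y. 0) = 0"
  by (induction w) simp_all

text \<open>Cocommutativity of the unshuffle coproduct.\<close>

lemma unshuffle_sum_swap: "unshuffle_sum w (\<lambda>x y. f y x) = unshuffle_sum w f"
proof (induction w arbitrary: f)
  case (Cons v w)
  show ?case
    using Cons.IH[of "\<lambda>x y. f (v # x) y"] Cons.IH[of "\<lambda>x y. f x (v # y)"] by (simp add: add.commute)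
qed simp

text \<open>Coassociativity: either way every letter is sent to one of three words.\<close>

lemma unshuffle_sum_assoc:
  "unshuffle_sum w (\<lambda>x y. unshuffle_sum x (\<lambda>a b. f a b y)) = unshuffle_sum w (\<lambda>x y. unshuffle_sum y (\<lambda>b c. f x b c))"
proof (induction w arbitrary: f)
  case (Cons v w)
  show ?case
    using Cons.IH[of "\<lambda>a. f (v # a)"] Cons.IH[of "\<lambda>a b. f a (v # b)"] Cons.IH[of "\<lambda>a b c. f a b (v # c)"]
    by (simp add: unshuffle_sum_add add_ac)
qed simp

lemma unshuffle_sum_linear: "linear g \<Longrightarrow> g (unshuffle_sum w f) = unshuffle_sum w (\<lambda>x y. g (f x y))"
  by (induction w arbitrary: f) (simp_all add: linear_add)

lemma unshuffle_sum_sum: "unshuffle_sum w (\<lambda>x y. \<Sum>i\<in>I. f i x y) = (\<Sum>i\<in>I. unshuffle_sum w (f i))"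
  by (induction w arbitrary: f) (simp_all add: sum.distrib)

lemma linear_unshuffle_sum:
  assumes "\<And>x y. length x + length y = length w \<Longrightarrow> linear (\<lambda>v. f v x y)"
  shows "linear (\<lambda>v. unshuffle_sum w (f v))"
  using assms
proof (induction w arbitrary: f)
  case (Cons u w)
  show ?case
    unfolding unshuffle_sum.simps
    by (intro linear_compose_add Cons.IH) (rule Cons.prems, simp)+
qed simp

lemma unshuffle_sum_split:
  "unshuffle_sum (us @ v # ws) f = unshuffle_sum us (\<lambda>x y. unshuffle_sum ws (\<lambda>x' y'. f (x @ v # x') (y @ y')))
    + unshuffle_sum us (\<lambda>x y. unshuffle_sum ws (\<lambda>x' y'. f (x @ x') (y @ v # y')))"
  by (simp add: unshuffle_sum_append unshuffle_sum_add)

lemma multilinear_unshuffle_sum: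
  assumes "bimultilinear f"
  shows "multilinear (\<lambda>w. unshuffle_sum w f)"
  unfolding multilinear_def unshuffle_sum_split
  using bimultilinearD[OF assms]
  by (intro allI linear_compose_add linear_unshuffle_sum) (auto simp: multilinear_def)

text \<open>
  \<open>\<Oplus>\<^sub>m \<Sum> h\<^sup>\<boxtimes>\<^sup>m \<circ> \<Delta>\<^sub>o\<^sub>s\<^sub>h\<close>, the sum over all compositions with \<open>m\<close> parts. In an ordered shuffle the last letter
  of the word ends the last block, so that splitting off this block gives the recursion.
\<close>

function osh_map :: "('v list \<Rightarrow> 'u::real_vector) \<Rightarrow> 'v list \<Rightarrow> 'u tensor" where
  "osh_map h w = (if w = [] then tensor_of []
     else unshuffle_sum (butlast w) (\<lambda>x y. osh_map h x \<otimes>\<^sub>t tensor_of [h (y @ [last w])]))"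
  by pat_completeness auto
termination
proof (relation "Wellfounded.measure (\<lambda>(h, w). length w)")
  fix h :: "'v list \<Rightarrow> 'u" and w x y :: "'v list"
  assume "w \<noteq> []" "length x + length y = length (butlast w)"
  then show "((h, x), h, w) \<in> Wellfounded.measure (\<lambda>(h, w). length w)" by (cases w rule: rev_cases) auto
qed simp

declare osh_map.simps [simp del]

lemma osh_map_Nil [simp]: "osh_map h [] = tensor_of []"
  by (simp add: osh_map.simps)

lemma osh_map_snoc: "osh_map h (w @ [v]) = unshuffle_sum w (\<lambda>x y. osh_map h x \<otimes>\<^sub>t tensor_of [h (y @ [v])])"
  by (subst osh_map.simps) simp

text \<open>The recursion for \<open>osh_map\<close> removes the last letter and then calls itself
  on arbitrary subwords of the rest. Hence the hypothesis covers all words that are at most as long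
  as the prefix.\<close>

lemma length_rev_induct [case_names Nil snoc]:
  assumes "P []" "\<And>w v. (\<And>x. length x \<le> length w \<Longrightarrow> P x) \<Longrightarrow> P (w @ [v])"
  shows "P w"
proof (induction w rule: length_induct)
  case (1 w)
  show ?case
  proof (cases w rule: rev_cases)
    case (snoc u v)
    show ?thesis unfolding snoc by (rule assms(2)) (use 1 snoc in auto)
  qed (simp add: assms(1))
qed

lemma osh_map_cong:
  assumes "\<And>x. x \<noteq> [] \<Longrightarrow> length x \<le> length w \<Longrightarrow> h x = h' x"
  shows "osh_map h w = osh_map h' w"
  using assms
proof (induction w rule: length_rev_induct)
  case (snoc w v)
  have "osh_map h x = osh_map h' x" if "length x \<le> length w" for x
    by (rule snoc.IH[OF that], rule snoc.prems) (use that in auto)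
  moreover have "h (y @ [v]) = h' (y @ [v])" if "length y \<le> length w" for y
    by (rule snoc.prems) (use that in auto)
  ultimately show ?case unfolding osh_map_snoc by (intro unshuffle_sum_cong) auto
qed simp

lemma multilinear_osh_map:
  fixes h :: "'v::real_vector list \<Rightarrow> 'u::real_vector"
  assumes h: "multilinear h"
  shows "multilinear (osh_map h)"
proof -
  \<comment> \<open>The position of the varying letter is quantified inside the induction because
    unshuffling moves it. It either is the last letter, and then ends the last block, or lies in the
    prefix and goes to one of the two words.\<close>
  have "\<forall>us v ws. w = us @ v # ws \<longrightarrow> linear (\<lambda>v. osh_map h (us @ v # ws))" for w
  proof (induction w rule: length_rev_induct)
    case (snoc w z)
    show ?case
    proof (intro allI impI)
      fix us v ws assume w: "w @ [z] = us @ v # ws"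
      show "linear (\<lambda>v. osh_map h (us @ v # ws))"
      proof (cases ws rule: rev_cases)
        case Nil
        have "linear (\<lambda>v. tensor_of [h (y @ [v])])" for y
          using linear_compose'[OF multilinearD[OF h, of y "[]"] linear_tensor_of_singleton] by simp
        then show ?thesis
          unfolding Nil osh_map_snoc by (intro linear_unshuffle_sum linear_compose'[OF _ linear_tensor_mult_right])
      next
        case (snoc ws' z')
        have len: "length w = length us + Suc (length ws')" and z: "z' = z"
          using w snoc by auto
        have 1: "linear (\<lambda>v. osh_map h (x @ v # x'))"
          if "length x \<le> length us" "length x' \<le> length ws'" for x x'
          using snoc.IH[of "x @ v # x'"] that len by auto
        have 2: "linear (\<lambda>v. tensor_of [h ((y @ v # y') @ [z])])" for y y'
          using linear_compose'[OF multilinearD[OF h, of y "y' @ [z]"] linear_tensor_of_singleton] by simp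
        have eq: "us @ u # ws = (us @ u # ws') @ [z]" for u using snoc z by simp
        show ?thesis
          unfolding eq osh_map_snoc unshuffle_sum_split
          by (intro linear_compose_add linear_unshuffle_sum linear_compose'[OF 1 linear_tensor_mult_left]
              linear_compose'[OF 2 linear_tensor_mult_right]) auto
      qed
    qed
  qed simp
  then show ?thesis unfolding multilinear_def by blast
qed

lemma component_Suc_mult_vector:
  "component (Suc m) (a \<otimes>\<^sub>t tensor_of [u]) = component m a \<otimes>\<^sub>t tensor_of [u]"
proof (rule tensor_linear_eqI[of "\<lambda>a. component (Suc m) (a \<otimes>\<^sub>t tensor_of [u])"])
  show "linear (\<lambda>a. component (Suc m) (a \<otimes>\<^sub>t tensor_of [u]))"
    by (rule linear_compose'[OF linear_tensor_mult_left linear_component])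
  show "linear (\<lambda>a. component m a \<otimes>\<^sub>t tensor_of [u])"
    by (rule linear_compose'[OF linear_component linear_tensor_mult_left])
qed simp

lemma component_0_mult_vector: "component 0 (a \<otimes>\<^sub>t tensor_of [u]) = 0"
  by (simp add: component_mult)

lemma component_osh_map_0 [simp]: "component 0 (osh_map h w) = (if w = [] then tensor_of [] else 0)"
  by (cases w rule: rev_cases)
    (simp_all add: osh_map_snoc unshuffle_sum_linear[OF linear_component] component_0_mult_vector unshuffle_sum_zero)

text \<open>There are \<open>m\<close> nonempty blocks in degree \<open>m\<close>, and these need at
  least \<open>m\<close> letters.\<close>

lemma component_osh_map_eq_0: "length w < m \<Longrightarrow> component m (osh_map h w) = 0"
proof (induction w arbitrary: m rule: length_rev_induct)
  case (snoc w v)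
  then obtain m' where m: "m = Suc m'" by (cases m) auto
  have "component m' (osh_map h x) = 0" if "length x \<le> length w" for x
    using snoc m that by auto
  then have "component m (osh_map h (w @ [v])) = unshuffle_sum w (\<lambda>x y. 0)"
    unfolding osh_map_snoc unshuffle_sum_linear[OF linear_component] m component_Suc_mult_vector
    by (intro unshuffle_sum_cong) auto
  then show ?case by (simp add: unshuffle_sum_zero)
qed simp

text \<open>The coproduct followed by the bilinear extension of \<open>f\<close>. All statements
  about the coproduct are made for every such \<open>f\<close>.\<close>

definition cop :: "('u::real_vector list \<Rightarrow> 'u list \<Rightarrow> 'w::real_vector) \<Rightarrow> 'u tensor \<Rightarrow> 'w" where
  "cop f = tensor_lift (\<lambda>w. unshuffle_sum w f)"

lemma cop_tensor_of: "bimultilinear f \<Longrightarrow> cop f (tensor_of w) = unshuffle_sum w f"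
  unfolding cop_def by (rule tensor_lift_tensor_of[OF multilinear_unshuffle_sum])

lemma linear_cop: "bimultilinear f \<Longrightarrow> linear (cop f)"
  unfolding cop_def by (rule linear_tensor_lift[OF multilinear_unshuffle_sum])

text \<open>A letter is primitive: appended to a tensor, it is appended to either factor of the
  coproduct.\<close>

lemma cop_mult_vector:
  assumes "bimultilinear f"
  shows "cop f (a \<otimes>\<^sub>t tensor_of [u]) = cop (\<lambda>x y. f (x @ [u]) y) a + cop (\<lambda>x y. f x (y @ [u])) a"
proof (rule tensor_linear_eqI[of "\<lambda>a. cop f (a \<otimes>\<^sub>t tensor_of [u])"])
  have l: "bimultilinear (\<lambda>x y. f (x @ [u]) y)" and r: "bimultilinear (\<lambda>x y. f x (y @ [u]))"
    using bimultilinear_append[OF assms, of "[]" "[u]" "[]" "[]"]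
      bimultilinear_append[OF assms, of "[]" "[]" "[]" "[u]"] by simp_all
  show "linear (\<lambda>a. cop f (a \<otimes>\<^sub>t tensor_of [u]))"
    by (rule linear_compose'[OF linear_tensor_mult_left linear_cop[OF assms]])
  show "linear (\<lambda>a. cop (\<lambda>x y. f (x @ [u]) y) a + cop (\<lambda>x y. f x (y @ [u])) a)"
    by (intro linear_compose_add linear_cop l r)
  show "cop f (tensor_of w \<otimes>\<^sub>t tensor_of [u])
      = cop (\<lambda>x y. f (x @ [u]) y) (tensor_of w) + cop (\<lambda>x y. f x (y @ [u])) (tensor_of w)" for w
    by (simp add: cop_tensor_of assms l r unshuffle_sum_snoc)
qed

lemma tensor_lift2_mult_left:
  assumes "bimultilinear f"
  shows "tensor_lift2 f (a \<otimes>\<^sub>t tensor_of u) b = tensor_lift2 (\<lambda>x y. f (x @ u) y) a b"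
proof -
  have l: "bimultilinear (\<lambda>x y. f (x @ u) y)"
    using bimultilinear_append[OF assms, of "[]" u "[]" "[]"] by simp
  show ?thesis
  proof (rule tensor_bilinear_eqI[of "\<lambda>a b. tensor_lift2 f (a \<otimes>\<^sub>t tensor_of u) b"])
    show "bilinear (\<lambda>a b. tensor_lift2 f (a \<otimes>\<^sub>t tensor_of u) b)"
      unfolding bilinear_def
      using linear_compose'[OF linear_tensor_mult_left linear_tensor_lift2_left[OF assms]]
        linear_tensor_lift2_right[OF assms] by blast
  qed (simp_all add: bilinear_tensor_lift2 l assms tensor_lift2_tensor_of)
qed

lemma tensor_lift2_mult_right:
  assumes "bimultilinear f"
  shows "tensor_lift2 f a (b \<otimes>\<^sub>t tensor_of u) = tensor_lift2 (\<lambda>x y. f x (y @ u)) a b"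
proof -
  have l: "bimultilinear (\<lambda>x y. f x (y @ u))"
    using bimultilinear_append[OF assms, of "[]" "[]" "[]" u] by simp
  show ?thesis
  proof (rule tensor_bilinear_eqI[of "\<lambda>a b. tensor_lift2 f a (b \<otimes>\<^sub>t tensor_of u)"])
    show "bilinear (\<lambda>a b. tensor_lift2 f a (b \<otimes>\<^sub>t tensor_of u))"
      unfolding bilinear_def
      using linear_compose'[OF linear_tensor_mult_left linear_tensor_lift2_right[OF assms]]
        linear_tensor_lift2_left[OF assms] by blast
  qed (simp_all add: bilinear_tensor_lift2 l assms tensor_lift2_tensor_of)
qed

text \<open>The block containing the last letter \<open>v\<close> becomes the last letter of the
  image and goes to one of the two factors. Up to this choice both sides distribute the other
  letters over three words: the rest of this block and the words producing the two factors.
  Coassociativity and cocommutativity identify the two ways of grouping them.\<close>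

theorem osh_map_coalgebra:
  assumes "bimultilinear f"
  shows "cop f (osh_map h w) = unshuffle_sum w (\<lambda>x y. tensor_lift2 f (osh_map h x) (osh_map h y))"
  using assms
proof (induction w arbitrary: f rule: length_rev_induct)
  case Nil
  then show ?case by (simp add: cop_tensor_of tensor_lift2_tensor_of)
next
  case (snoc w v)
  note f = snoc.prems
  let ?P = "osh_map h"
  let ?u = "\<lambda>y. h (y @ [v])"
  have l: "bimultilinear (\<lambda>x y. f (x @ [u]) y)" and r: "bimultilinear (\<lambda>x y. f x (y @ [u]))" for u
    using bimultilinear_append[OF f, of "[]" "[u]" "[]" "[]"]
      bimultilinear_append[OF f, of "[]" "[]" "[]" "[u]"] by simp_all
  have "cop f (?P (w @ [v])) = unshuffle_sum w (\<lambda>x y. cop f (?P x \<otimes>\<^sub>t tensor_of [?u y]))"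
    unfolding osh_map_snoc by (rule unshuffle_sum_linear[OF linear_cop[OF f]])
  also have "\<dots> = unshuffle_sum w (\<lambda>x y. unshuffle_sum x (\<lambda>a b. tensor_lift2 f (?P a \<otimes>\<^sub>t tensor_of [?u y]) (?P b)))
      + unshuffle_sum w (\<lambda>x y. unshuffle_sum x (\<lambda>a b. tensor_lift2 f (?P a) (?P b \<otimes>\<^sub>t tensor_of [?u y])))"
    unfolding unshuffle_sum_add[symmetric]
    by (rule unshuffle_sum_cong[OF refl])
      (simp add: cop_mult_vector f snoc.IH l r unshuffle_sum_add tensor_lift2_mult_left tensor_lift2_mult_right)
  also have "unshuffle_sum w (\<lambda>x y. unshuffle_sum x (\<lambda>a b. tensor_lift2 f (?P a) (?P b \<otimes>\<^sub>t tensor_of [?u y])))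
      = unshuffle_sum w (\<lambda>x y. tensor_lift2 f (?P x) (?P (y @ [v])))"
    unfolding osh_map_snoc unshuffle_sum_linear[OF linear_tensor_lift2_right[OF f]]
    by (rule unshuffle_sum_assoc)
  also have "unshuffle_sum w (\<lambda>x y. unshuffle_sum x (\<lambda>a b. tensor_lift2 f (?P a \<otimes>\<^sub>t tensor_of [?u y]) (?P b)))
      = unshuffle_sum w (\<lambda>x y. unshuffle_sum y (\<lambda>b c. tensor_lift2 f (?P x \<otimes>\<^sub>t tensor_of [?u c]) (?P b)))"
    by (rule unshuffle_sum_assoc)
  \<comment> \<open>Exchanging the second and third of the three words puts the block ended by
    \<open>v\<close> next to the left factor.\<close>
  also have "\<dots> = unshuffle_sum w (\<lambda>x y. unshuffle_sum y (\<lambda>c b. tensor_lift2 f (?P x \<otimes>\<^sub>t tensor_of [?u c]) (?P b)))"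
    by (subst unshuffle_sum_swap) rule
  also have "\<dots> = unshuffle_sum w (\<lambda>x y. unshuffle_sum x (\<lambda>a c. tensor_lift2 f (?P a \<otimes>\<^sub>t tensor_of [?u c]) (?P y)))"
    by (rule unshuffle_sum_assoc[symmetric])
  also have "\<dots> = unshuffle_sum w (\<lambda>x y. tensor_lift2 f (?P (x @ [v])) (?P y))"
    unfolding osh_map_snoc unshuffle_sum_linear[OF linear_tensor_lift2_left[OF f]] ..
  finally show ?case by (simp add: unshuffle_sum_snoc)
qed

text \<open>In a partition of the blocks, the group that contains the last block also contains the
  last letter. Splitting it off on the left side applies the coproduct to an image under
  \<open>osh_map h\<close>, so the coalgebra property turns it into a splitting of the letters
  themselves.\<close>

theorem osh_map_compose:
  fixes k :: "'u::real_vector list \<Rightarrow> 's::real_vector"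
  assumes k: "multilinear k"
  shows "tensor_lift (osh_map k) (osh_map h w) = osh_map (\<lambda>w. tensor_lift k (osh_map h w)) w"
proof (induction w rule: length_rev_induct)
  case Nil
  then show ?case by (simp add: tensor_lift_tensor_of multilinear_osh_map k)
next
  case (snoc w v)
  let ?P = "osh_map h" and ?K = "tensor_lift (osh_map k)"
  note mk = multilinear_osh_map[OF k]
  \<comment> \<open>One step of the recursion for \<open>osh_map k\<close> at the last letter
    \<open>u\<close>, as a map of the two words into which the prefix is split.\<close>
  define f where "f = (\<lambda>u x y. osh_map k x \<otimes>\<^sub>t tensor_of [k (y @ [u])])"
  have f: "bimultilinear (f u)" for u
    unfolding f_def
    by (rule bimultilinear_bilinear[OF bilinear_tensor_mult mk])
      (rule multilinear_compose_linear[OF multilinear_append_right[OF k] linear_tensor_of_singleton])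
  have 1: "?K (a \<otimes>\<^sub>t tensor_of [u]) = cop (f u) a" for a u
  proof (rule tensor_linear_eqI[of "\<lambda>a. ?K (a \<otimes>\<^sub>t tensor_of [u])"])
    show "linear (\<lambda>a. ?K (a \<otimes>\<^sub>t tensor_of [u]))"
      by (rule linear_compose'[OF linear_tensor_mult_left linear_tensor_lift[OF mk]])
    show "linear (cop (f u))" by (rule linear_cop[OF f])
    show "?K (tensor_of x \<otimes>\<^sub>t tensor_of [u]) = cop (f u) (tensor_of x)" for x
      unfolding cop_tensor_of[OF f] by (simp add: tensor_lift_tensor_of mk osh_map_snoc f_def)
  qed
  have 2: "tensor_lift2 (f u) a b = ?K a \<otimes>\<^sub>t tensor_of [tensor_lift k (b \<otimes>\<^sub>t tensor_of [u])]" for u a b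
  proof (rule tensor_bilinear_eqI[of "tensor_lift2 (f u)"])
    show "bilinear (\<lambda>a b. ?K a \<otimes>\<^sub>t tensor_of [tensor_lift k (b \<otimes>\<^sub>t tensor_of [u])])"
      unfolding bilinear_def
      using linear_compose'[OF linear_tensor_lift[OF mk] linear_tensor_mult_left]
        linear_compose'[OF linear_compose'[OF linear_compose'[OF linear_tensor_mult_left
          linear_tensor_lift[OF k]] linear_tensor_of_singleton] linear_tensor_mult_right] by blast
    show "bilinear (tensor_lift2 (f u))" by (rule bilinear_tensor_lift2[OF f])
    show "tensor_lift2 (f u) (tensor_of x) (tensor_of y)
        = ?K (tensor_of x) \<otimes>\<^sub>t tensor_of [tensor_lift k (tensor_of y \<otimes>\<^sub>t tensor_of [u])]" for x y
      unfolding tensor_lift2_tensor_of[OF f] by (simp add: f_def tensor_lift_tensor_of mk k)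
  qed
  have "?K (?P (w @ [v])) = unshuffle_sum w (\<lambda>x y. unshuffle_sum x (\<lambda>a b. tensor_lift2 (f (h (y @ [v]))) (?P a) (?P b)))"
    unfolding osh_map_snoc unshuffle_sum_linear[OF linear_tensor_lift[OF mk]] 1 osh_map_coalgebra[OF f] ..
  also have "\<dots> = unshuffle_sum w (\<lambda>x y. unshuffle_sum y (\<lambda>b c. tensor_lift2 (f (h (c @ [v]))) (?P x) (?P b)))"
    by (rule unshuffle_sum_assoc)
  also have "\<dots> = unshuffle_sum w (\<lambda>x y. ?K (?P x) \<otimes>\<^sub>t tensor_of [tensor_lift k (?P (y @ [v]))])"
    unfolding osh_map_snoc unshuffle_sum_linear[OF linear_tensor_lift[OF k]] 2
      unshuffle_sum_linear[OF linear_tensor_mult_right] unshuffle_sum_linear[OF linear_tensor_of_singleton] ..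
  also have "\<dots> = osh_map (\<lambda>w. tensor_lift k (?P w)) (w @ [v])"
    unfolding osh_map_snoc by (rule unshuffle_sum_cong[OF refl]) (simp add: snoc.IH)
  finally show ?case .
qed

section \<open>Shuffle permutations and ordered set partitions\<close>

definition subword :: "'v list \<Rightarrow> nat set \<Rightarrow> 'v list" where
  "subword w S = map ((!) w) (sorted_list_of_set S)"

lemma subword_empty [simp]: "subword w {} = []"
  by (simp add: subword_def)

lemma length_subword [simp]: "length (subword w S) = card S"
  by (simp add: subword_def)

lemma sorted_list_of_set_insert_greatest:
  assumes "finite S" "\<And>i. i \<in> S \<Longrightarrow> i < M"
  shows "sorted_list_of_set (insert (M::nat) S) = sorted_list_of_set S @ [M]"
proof -
  have "sorted_list_of_set (set (sorted_list_of_set S @ [M])) = sorted_list_of_set S @ [M]"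
    by (rule sorted_list_of_set.idem_if_sorted_distinct)
      (use assms in \<open>auto simp: sorted_append less_imp_le\<close>)
  with assms(1) show ?thesis by simp
qed

lemma subword_insert_greatest:
  "finite S \<Longrightarrow> (\<And>i. i \<in> S \<Longrightarrow> i < M) \<Longrightarrow> subword w (insert M S) = subword w S @ [w ! M]"
  unfolding subword_def by (subst sorted_list_of_set_insert_greatest) auto

lemma subword_all: "subword w {..<length w} = w"
proof -
  have "sorted_list_of_set {..<length w} = [0..<length w]"
    using sorted_list_of_set.idem_if_sorted_distinct[of "[0..<length w]"]
    by (simp add: atLeast0LessThan)
  then show ?thesis by (simp add: subword_def map_nth)
qed

lemma sum_Pow_insert:
  assumes "finite S" "M \<notin> S"
  shows "(\<Sum>A\<in>Pow (insert M S). g A) = (\<Sum>A\<in>Pow S. g A) + (\<Sum>A\<in>Pow S. g (insert M A))"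
proof -
  have "inj_on (insert M) (Pow S)"
    using assms(2) by (auto simp: inj_on_def)
  moreover have "Pow S \<inter> insert M ` Pow S = {}" using assms(2) by auto
  ultimately show ?thesis
    using assms(1) by (simp add: Pow_insert sum.union_disjoint sum.reindex)
qed

text \<open>To send each letter to one of two words is to choose the positions of the first word.
  The largest position is removed in each step, since \<open>subword\<close> then loses its last
  letter.\<close>

lemma unshuffle_sum_subword:
  assumes "finite S"
  shows "unshuffle_sum (subword w S) f = (\<Sum>A\<in>Pow S. f (subword w A) (subword w (S - A)))"
  using assms
proof (induction S arbitrary: f rule: finite_linorder_max_induct)
  case (insert M S)
  have fin: "finite A" and lt: "\<And>i. i \<in> A \<Longrightarrow> i < M" and M: "M \<notin> A" if "A \<subseteq> S" for A
    using insert that by (auto intro: finite_subset)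
  have 1: "f (subword w A @ [w ! M]) (subword w (S - A))
      = f (subword w (insert M A)) (subword w (insert M S - insert M A))" if "A \<in> Pow S" for A
  proof -
    have "insert M S - insert M A = S - A" using insert that by auto
    moreover have "subword w (insert M A) = subword w A @ [w ! M]"
      by (rule subword_insert_greatest) (use fin[of A] lt[of A] that in auto)
    ultimately show ?thesis by simp
  qed
  have 2: "f (subword w A) (subword w (S - A) @ [w ! M])
      = f (subword w A) (subword w (insert M S - A))" if "A \<in> Pow S" for A
  proof -
    have "insert M S - A = insert M (S - A)" using insert that by auto
    moreover have "subword w (insert M (S - A)) = subword w (S - A) @ [w ! M]"
      by (rule subword_insert_greatest) (use fin[of "S - A"] lt[of "S - A"] in auto)
    ultimately show ?thesis by simp
  qed
  have "subword w (insert M S) = subword w S @ [w ! M]"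
    using fin[of S] lt[of S] by (simp add: subword_insert_greatest)
  then have "unshuffle_sum (subword w (insert M S)) f
     = (\<Sum>A\<in>Pow S. f (subword w A @ [w ! M]) (subword w (S - A)))
     + (\<Sum>A\<in>Pow S. f (subword w A) (subword w (S - A) @ [w ! M]))"
    by (simp add: unshuffle_sum_snoc insert.IH)
  also have "\<dots> = (\<Sum>A\<in>Pow S. f (subword w (insert M A)) (subword w (insert M S - insert M A)))
     + (\<Sum>A\<in>Pow S. f (subword w A) (subword w (insert M S - A)))"
    by (intro arg_cong2[where f = "(+)"] sum.cong refl 1 2)
  also have "\<dots> = (\<Sum>A\<in>Pow (insert M S). f (subword w A) (subword w (insert M S - A)))"
    by (subst sum_Pow_insert) (use insert in \<open>auto simp: add.commute\<close>)
  finally show ?case .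
qed simp

section \<open>Consecutive blocks and their images under a shuffle\<close>

lemma block_start_Suc: "i < length ns \<Longrightarrow> block_start ns (Suc i) = block_start ns i + ns ! i"
  by (simp add: block_start_def take_Suc_conv_app_nth)

lemma block_start_mono: "i \<le> j \<Longrightarrow> block_start ns i \<le> block_start ns j"
  unfolding block_start_def
  by (metis le_add1 le_add_diff_inverse sum_list_append take_add)

lemma block_start_length: "block_start ns (length ns) = sum_list ns"
  by (simp add: block_start_def)

lemma ex_block: "k < sum_list ns \<Longrightarrow> \<exists>i<length ns. block_start ns i \<le> k \<and> k < block_start ns (Suc i)"
proof (induction ns rule: rev_induct)
  case (snoc n ns)
  have eq: "block_start (ns @ [n]) i = block_start ns i" if "i \<le> length ns" for i
    using that by (simp add: block_start_def)
  show ?case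
  proof (cases "k < sum_list ns")
    case True
    with snoc.IH obtain i where "i < length ns" "block_start ns i \<le> k" "k < block_start ns (Suc i)" by blast
    then show ?thesis using eq[of i] eq[of "Suc i"] by (intro exI[of _ i]) auto
  next
    case False
    then show ?thesis
      using snoc.prems eq[of "length ns"]
      by (intro exI[of _ "length ns"]) (auto simp: block_start_def)
  qed
qed simp

lemma nth_concat_block:
  assumes "i < length xss" "j < length (xss ! i)"
  shows "concat xss ! (block_start (map length xss) i + j) = xss ! i ! j"
  using assms
proof (induction xss arbitrary: i)
  case (Cons xs xss)
  then show ?case
    by (cases i) (auto simp: block_start_def nth_append add.assoc)
qed simp

text \<open>A shuffle is determined by the images of its blocks.\<close>

definition block_images :: "nat list \<Rightarrow> (nat \<Rightarrow> nat) \<Rightarrow> nat set list" where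
  "block_images ns \<sigma> = map (\<lambda>i. \<sigma> ` {block_start ns i..<block_start ns (Suc i)}) [0..<length ns]"

definition block_partitions :: "nat list \<Rightarrow> nat set list set" where
  "block_partitions ns = {As. (\<forall>A\<in>set As. finite A) \<and> map card As = ns \<and>
     (\<forall>i<length As. \<forall>j<length As. i \<noteq> j \<longrightarrow> As ! i \<inter> As ! j = {}) \<and> \<Union>(set As) = {..<sum_list ns}}"

lemma sorted_list_of_set_image_upt:
  assumes "strict_mono_on {a..<b} \<sigma>"
  shows "sorted_list_of_set (\<sigma> ` {a..<b}) = map \<sigma> [a..<b::nat]"
proof -
  have "sorted_wrt (<) (map \<sigma> [a..<b])"
    using assms unfolding sorted_wrt_map
    by (intro sorted_wrt_mono_rel[OF _ sorted_wrt_upt]) (auto simp: strict_mono_on_def)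
  then show ?thesis
    using sorted_list_of_set.idem_if_sorted_distinct[of "map \<sigma> [a..<b]"]
    by (simp add: strict_sorted_iff)
qed

lemma bij_betw_block_images:
  "bij_betw (block_images ns) (shuffle_perms ns) (block_partitions ns)"
proof (rule bij_betw_imageI)
  let ?I = "\<lambda>i. {block_start ns i..<block_start ns (Suc i)}"
  have nth: "block_images ns \<sigma> ! i = \<sigma> ` ?I i" if "i < length ns" for \<sigma> i
    using that by (simp add: block_images_def)
  have len: "length (block_images ns \<sigma>) = length ns" for \<sigma>
    by (simp add: block_images_def)
  have sl: "sorted_list_of_set (block_images ns \<sigma> ! i) = map \<sigma> [block_start ns i..<block_start ns (Suc i)]"
    if "\<sigma> \<in> shuffle_perms ns" "i < length ns" for \<sigma> i
    unfolding nth[OF that(2)]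
    by (rule sorted_list_of_set_image_upt) (use that in \<open>auto simp: shuffle_perms_def\<close>)
  have disj: "?I i \<inter> ?I j = {}" if "i < j" for i j
    using block_start_mono[of "Suc i" j ns] that by auto
  have Un: "(\<Union>i<length ns. ?I i) = {..<sum_list ns}"
  proof (intro equalityI subsetI)
    fix k assume "k \<in> (\<Union>i<length ns. ?I i)"
    then obtain i where "i < length ns" "k < block_start ns (Suc i)" by auto
    then show "k \<in> {..<sum_list ns}"
      using block_start_mono[of "Suc i" "length ns" ns] by (simp add: block_start_length)
  next
    fix k assume "k \<in> {..<sum_list ns}"
    then have "k < sum_list ns" by simp
    from ex_block[OF this] show "k \<in> (\<Union>i<length ns. ?I i)" by (simp add: Bex_def)
  qed
  show "inj_on (block_images ns) (shuffle_perms ns)"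
  proof (rule inj_onI)
    fix \<sigma> \<tau> assume *: "\<sigma> \<in> shuffle_perms ns" "\<tau> \<in> shuffle_perms ns"
      and eq: "block_images ns \<sigma> = block_images ns \<tau>"
    show "\<sigma> = \<tau>"
    proof
      fix k
      show "\<sigma> k = \<tau> k"
      proof (cases "k < sum_list ns")
        case True
        from ex_block[OF this] obtain i where i: "i < length ns" "k \<in> ?I i" by auto
        then have "map \<sigma> [block_start ns i..<block_start ns (Suc i)] = map \<tau> [block_start ns i..<block_start ns (Suc i)]"
          using sl[OF *(1) i(1)] sl[OF *(2) i(1)] eq by simp
        then show ?thesis using i by simp
      next
        case False
        then have "\<sigma> k = k" "\<tau> k = k"
          using * unfolding shuffle_perms_def by (auto intro: permutes_not_in)
        then show ?thesis by simp
      qed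
    qed
  qed
  show "block_images ns ` shuffle_perms ns = block_partitions ns"
  proof (intro equalityI subsetI)
    fix As assume "As \<in> block_images ns ` shuffle_perms ns"
    then obtain \<sigma> where \<sigma>: "\<sigma> permutes {..<sum_list ns}" and As: "As = block_images ns \<sigma>"
      by (auto simp: shuffle_perms_def)
    note inj = permutes_inj[OF \<sigma>]
    have "map card As = ns"
      by (rule nth_equalityI) (auto simp: As len nth card_image inj_on_subset[OF inj] block_start_Suc)
    moreover have "As ! i \<inter> As ! j = {}" if "i < length As" "j < length As" "i \<noteq> j" for i j
    proof -
      have "?I i \<inter> ?I j = {}" using disj[of i j] disj[of j i] that by (cases "i < j") auto
      then show ?thesis using that inj by (simp add: As len nth flip: image_Int)
    qed
    moreover have "\<Union>(set As) = \<sigma> ` (\<Union>i<length ns. ?I i)"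
      by (simp add: As block_images_def image_UN lessThan_atLeast0)
    ultimately show "As \<in> block_partitions ns"
      by (auto simp: block_partitions_def As block_images_def Un permutes_image[OF \<sigma>])
  next
    fix As assume "As \<in> block_partitions ns"
    then have fin: "\<And>A. A \<in> set As \<Longrightarrow> finite A" and card: "map card As = ns"
      and dj: "\<And>i j. i < length As \<Longrightarrow> j < length As \<Longrightarrow> i \<noteq> j \<Longrightarrow> As ! i \<inter> As ! j = {}"
      and U: "\<Union>(set As) = {..<sum_list ns}"
      by (auto simp: block_partitions_def)
    \<comment> \<open>The inverse map writes the sets one after another, each in increasing order;
      the permutation takes a position to the entry found there.\<close>
    define L where "L = concat (map sorted_list_of_set As)"
    define \<sigma> where "\<sigma> k = (if k < sum_list ns then L ! k else k)" for k
    have lenAs: "length As = length ns" using card by (metis length_map)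
    have nsi: "ns ! i = card (As ! i)" if "i < length ns" for i
      using that card lenAs by (metis nth_map)
    have lns: "map length (map sorted_list_of_set As) = ns"
      by (rule nth_equalityI) (simp_all add: lenAs nsi)
    have "length L = sum_list (map length (map sorted_list_of_set As))"
      unfolding L_def by (rule length_concat)
    then have lenL: "length L = sum_list ns" unfolding lns .
    have setL: "set L = {..<sum_list ns}" using U fin by (simp add: L_def)
    have dL: "distinct L"
      by (rule card_distinct) (simp add: lenL setL)
    have "bij_betw ((!) L) {..<sum_list ns} {..<sum_list ns}"
      by (rule bij_betw_nth[OF dL]) (simp_all add: lenL setL)
    moreover have "bij_betw \<sigma> {..<sum_list ns} {..<sum_list ns} \<longleftrightarrow> bij_betw ((!) L) {..<sum_list ns} {..<sum_list ns}"
      by (rule bij_betw_cong) (simp add: \<sigma>_def)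
    ultimately have "bij_betw \<sigma> {..<sum_list ns} {..<sum_list ns}" by simp
    then have perm: "\<sigma> permutes {..<sum_list ns}"
      by (rule bij_imp_permutes) (simp add: \<sigma>_def)
    have \<sigma>: "\<sigma> (block_start ns i + j) = sorted_list_of_set (As ! i) ! j"
      if "i < length ns" "j < ns ! i" for i j
    proof -
      have "block_start ns i + j < block_start ns (Suc i)" using that by (simp add: block_start_Suc)
      also have "\<dots> \<le> sum_list ns"
        using block_start_mono[of "Suc i" "length ns" ns] that by (simp add: block_start_length)
      finally show ?thesis
        using nth_concat_block[of i "map sorted_list_of_set As" j] that
        unfolding lns by (simp add: \<sigma>_def L_def lenAs nsi)
    qed
    have map_\<sigma>: "map \<sigma> [block_start ns i..<block_start ns (Suc i)] = sorted_list_of_set (As ! i)"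
      if "i < length ns" for i
      using that \<sigma> by (intro nth_equalityI) (auto simp: block_start_Suc nsi)
    have "strict_mono_on (?I i) \<sigma>" if i: "i < length ns" for i
    proof (rule strict_mono_onI)
      fix r s assume "r \<in> ?I i" "s \<in> ?I i" "r < s"
      then obtain a b where "r = block_start ns i + a" "s = block_start ns i + b" "a < b" "b < ns ! i"
        using i by (auto simp: block_start_Suc le_iff_add)
      then show "\<sigma> r < \<sigma> s"
        using i \<sigma>[of i a] \<sigma>[of i b] sorted_wrt_nth_less[OF strict_sorted_list_of_set, of a b "As ! i"]
        by (auto simp: nsi)
    qed
    with perm have "\<sigma> \<in> shuffle_perms ns" by (simp add: shuffle_perms_def)
    moreover have "block_images ns \<sigma> = As"
    proof (rule nth_equalityI)
      fix i assume "i < length (block_images ns \<sigma>)"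
      then have i: "i < length ns" by (simp add: len)
      have "\<sigma> ` ?I i = set (map \<sigma> [block_start ns i..<block_start ns (Suc i)])" by simp
      also have "\<dots> = As ! i" unfolding map_\<sigma>[OF i] using i lenAs fin by simp
      finally show "block_images ns \<sigma> ! i = As ! i" by (simp add: nth i)
    qed (simp add: len lenAs)
    ultimately show "As \<in> block_images ns ` shuffle_perms ns" by blast
  qed
qed

lemma permuted_blocks_eq:
  assumes "\<sigma> \<in> shuffle_perms ns"
  shows "permuted_blocks ns \<sigma> w = tensor_of (map (\<lambda>A. tensor_of (subword w A)) (block_images ns \<sigma>))"
proof -
  have "map (\<lambda>k. w ! \<sigma> k) [block_start ns i..<block_start ns (Suc i)]
      = subword w (\<sigma> ` {block_start ns i..<block_start ns (Suc i)})" if "i < length ns" for i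
    using assms that by (simp add: subword_def sorted_list_of_set_image_upt shuffle_perms_def)
  then show ?thesis
    unfolding permuted_blocks_def block_images_def map_map comp_def
    by (intro arg_cong[where f = tensor_of] map_cong[OF refl] arg_cong[where f = tensor_of]) simp
qed

lemma sum_shuffle_perms:
  "(\<Sum>\<sigma>\<in>shuffle_perms ns. permuted_blocks ns \<sigma> w)
    = (\<Sum>As\<in>block_partitions ns. tensor_of (map (\<lambda>A. tensor_of (subword w A)) As))"
  using sum.reindex_bij_betw[OF bij_betw_block_images, of "\<lambda>As. tensor_of (map (\<lambda>A. tensor_of (subword w A)) As)" ns]
  by (simp add: permuted_blocks_eq cong: sum.cong)

section \<open>Two blocks and the coproduct \<open>Delta_sh\<close>\<close>

lemma block_partitions_pair:
  "block_partitions [a, b] = (\<lambda>A. [A, {..<a + b} - A]) ` {A \<in> Pow {..<a + b}. card A = a}"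
proof (intro equalityI subsetI)
  fix As assume As: "As \<in> block_partitions [a, b]"
  then have "length As = 2" by (auto simp: block_partitions_def dest: arg_cong[of _ _ length])
  then obtain A B where AB: "As = [A, B]" by (auto simp: length_Suc_conv numeral_2_eq_2)
  have "\<forall>i<length As. \<forall>j<length As. i \<noteq> j \<longrightarrow> As ! i \<inter> As ! j = {}"
    using As by (simp add: block_partitions_def)
  from this[rule_format, of 0 1] have "A \<inter> B = {}" by (simp add: AB)
  moreover have "A \<union> B = {..<a + b}" "card A = a"
    using As by (auto simp: AB block_partitions_def)
  ultimately show "As \<in> (\<lambda>A. [A, {..<a + b} - A]) ` {A \<in> Pow {..<a + b}. card A = a}"
    by (intro image_eqI[of _ _ A]) (auto simp: AB)
next
  fix As assume "As \<in> (\<lambda>A. [A, {..<a + b} - A]) ` {A \<in> Pow {..<a + b}. card A = a}"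
  then obtain A where A: "A \<subseteq> {..<a + b}" "card A = a" and As: "As = [A, {..<a + b} - A]" by auto
  have fin: "finite A" using A(1) finite_subset by blast
  have "card ({..<a + b} - A) = b" using A fin by (simp add: card_Diff_subset)
  then show "As \<in> block_partitions [a, b]"
    using A fin by (auto simp: As block_partitions_def less_Suc_eq)
qed

lemma sum_shuffle_perms_pair:
  assumes "length w = a + b"
  shows "(\<Sum>\<sigma>\<in>shuffle_perms [a, b]. permuted_blocks [a, b] \<sigma> w)
    = unshuffle_sum w (\<lambda>x y. if length x = a then tensor_of [tensor_of x, tensor_of y] else 0)"
proof -
  have "inj_on (\<lambda>A. [A, {..<a + b} - A]) {A \<in> Pow {..<a + b}. card A = a}"
    by (auto simp: inj_on_def)
  then have "(\<Sum>\<sigma>\<in>shuffle_perms [a, b]. permuted_blocks [a, b] \<sigma> w)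
    = (\<Sum>A | A \<in> Pow {..<a + b} \<and> card A = a.
        tensor_of [tensor_of (subword w A), tensor_of (subword w ({..<a + b} - A))])"
    unfolding sum_shuffle_perms block_partitions_pair by (subst sum.reindex) (simp_all add: comp_def)
  also have "\<dots> = (\<Sum>A\<in>Pow {..<a + b}. if length (subword w A) = a
      then tensor_of [tensor_of (subword w A), tensor_of (subword w ({..<a + b} - A))] else 0)"
    by (subst sum.inter_filter[symmetric]) (simp_all add: Collect_conj_eq)
  also have "\<dots> = unshuffle_sum (subword w {..<a + b})
      (\<lambda>x y. if length x = a then tensor_of [tensor_of x, tensor_of y] else 0)"
    by (subst unshuffle_sum_subword) (auto intro!: sum.cong)
  also have "subword w {..<a + b} = w" using subword_all[of w] assms by simp
  finally show ?thesis .
qed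

lemma multilinear_tensor_of_pair_left: "multilinear (\<lambda>x. tensor_of [tensor_of x, b])"
  and multilinear_tensor_of_pair_right: "multilinear (\<lambda>y. tensor_of [b, tensor_of y])"
  using multilinear_compose_linear[OF multilinear_tensor_of multilinearD[OF multilinear_tensor_of, of "[]" "[b]"]]
    multilinear_compose_linear[OF multilinear_tensor_of multilinearD[OF multilinear_tensor_of, of "[b]" "[]"]]
  by simp_all

lemma bimultilinear_if_length:
  assumes "bimultilinear f"
  shows "bimultilinear (\<lambda>x y. if length x = a \<and> length y = b then f x y else 0)"
proof (rule bimultilinearI)
  show "multilinear (\<lambda>y. if length x = a \<and> length y = b then f x y else 0)" for x
    using multilinear_if_length[OF bimultilinearD(1)[OF assms], of "\<lambda>n. length x = a \<and> n = b" x] .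
  show "multilinear (\<lambda>x. if length x = a \<and> length y = b then f x y else 0)" for y
    using multilinear_if_length[OF bimultilinearD(2)[OF assms], of "\<lambda>n. n = a \<and> length y = b" y] .
qed

lemma bimultilinear_tensor_of_pair: "bimultilinear (\<lambda>x y. tensor_of [tensor_of x, tensor_of y])"
  by (intro bimultilinearI multilinear_tensor_of_pair_left multilinear_tensor_of_pair_right)

lemma Delta_sh_eq:
  "Delta_sh a b = cop (\<lambda>x y. if length x = a \<and> length y = b then tensor_of [tensor_of x, tensor_of y] else 0)"
proof -
  let ?f = "\<lambda>x y :: 'a list. if length x = a \<and> length y = b then tensor_of [tensor_of x, tensor_of y] else 0"
  have "(if length w = a + b then \<Sum>\<sigma>\<in>shuffle_perms [a, b]. permuted_blocks [a, b] \<sigma> w else 0)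
     = unshuffle_sum w ?f" for w :: "'a list"
  proof (cases "length w = a + b")
    case True
    then show ?thesis
      unfolding sum_shuffle_perms_pair[OF True] by (auto intro!: unshuffle_sum_cong)
  next
    case False
    then have "unshuffle_sum w ?f = unshuffle_sum w (\<lambda>x y. 0)" by (intro unshuffle_sum_cong) auto
    with False show ?thesis by (simp add: unshuffle_sum_zero)
  qed
  then show ?thesis unfolding Delta_sh_def cop_def by simp
qed

text \<open>The condition on the maxima selects one ordering of the blocks, so these lists
  correspond to the set partitions of \<open>S\<close> into \<open>m\<close> parts.\<close>

definition ordered_partitions :: "nat \<Rightarrow> nat set \<Rightarrow> nat set list set" where
  "ordered_partitions m S = {As. length As = m \<and> (\<forall>A\<in>set As. finite A \<and> A \<noteq> {}) \<and>
     (\<forall>i<m. \<forall>j<m. i \<noteq> j \<longrightarrow> As ! i \<inter> As ! j = {}) \<and> \<Union>(set As) = S \<and>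
     sorted_wrt (\<lambda>A B. Max A < Max B) As}"

lemma finite_ordered_partitions: "finite S \<Longrightarrow> finite (ordered_partitions m S)"
  by (rule finite_subset[of _ "{As. set As \<subseteq> Pow S \<and> length As = m}"])
    (auto simp: ordered_partitions_def intro: finite_lists_length_eq)

lemma ordered_partitions_0: "ordered_partitions 0 S = (if S = {} then {[]} else {})"
  by (auto simp: ordered_partitions_def)

lemma ordered_partitions_Suc_empty: "ordered_partitions (Suc m) {} = {}"
  by (auto simp: ordered_partitions_def length_Suc_conv)

text \<open>The greatest element \<open>M\<close> belongs to the block with the greatest maximum,
  which comes last; \<open>A\<close> is the union of the other blocks and is partitioned
  arbitrarily.\<close>

lemma ordered_partitions_Suc:
  assumes S: "finite S" and M: "\<And>i. i \<in> S \<Longrightarrow> i < M"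
  shows "bij_betw (\<lambda>(A, As). As @ [insert M S - A])
    (Sigma (Pow S) (ordered_partitions m)) (ordered_partitions (Suc m) (insert M S))"
proof (rule bij_betw_imageI)
  have "A = B" if "A \<in> Pow S" "B \<in> Pow S" "insert M S - A = insert M S - B" for A B
    using that by blast
  then show "inj_on (\<lambda>(A, As). As @ [insert M S - A]) (Sigma (Pow S) (ordered_partitions m))"
    by (auto simp: inj_on_def)
  show "(\<lambda>(A, As). As @ [insert M S - A]) ` Sigma (Pow S) (ordered_partitions m)
      = ordered_partitions (Suc m) (insert M S)"
  proof (intro equalityI subsetI)
    fix Bs assume "Bs \<in> (\<lambda>(A, As). As @ [insert M S - A]) ` Sigma (Pow S) (ordered_partitions m)"
    then obtain A As where A: "A \<subseteq> S" and As: "As \<in> ordered_partitions m A" and Bs: "Bs = As @ [insert M S - A]"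
      by auto
    have U: "\<Union>(set As) = A" and len: "length As = m" using As by (auto simp: ordered_partitions_def)
    have MA: "M \<notin> A" using A M by blast
    have sub: "B \<subseteq> A" if "B \<in> set As" for B using U that by auto
    have "Max (insert M S - A) = M"
      using S M MA by (intro Max_eqI) (auto simp: less_imp_le)
    moreover have "Max B < M" if "B \<in> set As" for B
    proof -
      have "Max B \<in> B" using As that by (intro Max_in) (auto simp: ordered_partitions_def)
      then show ?thesis using sub[OF that] A M by blast
    qed
    moreover have "Bs ! i \<inter> Bs ! j = {}" if "i < Suc m" "j < Suc m" "i \<noteq> j" for i j
    proof -
      have *: "As ! i \<inter> (insert M S - A) = {}" if "i < m" for i
        using sub[of "As ! i"] that len by auto
      have **: "As ! i \<inter> As ! j = {}" if "i < m" "j < m"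
        using As that \<open>i \<noteq> j\<close> by (simp add: ordered_partitions_def)
      consider "i < m" "j < m" | "i < m" "j = m" | "i = m" "j < m"
        using \<open>i < Suc m\<close> \<open>j < Suc m\<close> \<open>i \<noteq> j\<close> by linarith
      then show ?thesis
        using * ** len by cases (auto simp: Bs nth_append Int_commute)
    qed
    ultimately show "Bs \<in> ordered_partitions (Suc m) (insert M S)"
      using As S A MA U by (auto simp: ordered_partitions_def Bs sorted_wrt_append)
  next
    fix Bs assume B: "Bs \<in> ordered_partitions (Suc m) (insert M S)"
    then obtain As B where Bs: "Bs = As @ [B]" and len: "length As = m"
      by (cases Bs rule: rev_cases) (auto simp: ordered_partitions_def)
    have U: "\<Union>(set As) \<union> B = insert M S" using B by (auto simp: ordered_partitions_def Bs)
    have dj: "C \<inter> B = {}" if "C \<in> set As" for C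
    proof -
      obtain i where "i < m" "C = As ! i" using \<open>C \<in> set As\<close> len by (auto simp: in_set_conv_nth)
      moreover have BB: "\<forall>i<Suc m. \<forall>j<Suc m. i \<noteq> j \<longrightarrow> Bs ! i \<inter> Bs ! j = {}"
        using B by (simp add: ordered_partitions_def)
      ultimately show ?thesis
        using BB[rule_format, of i m] len by (simp add: Bs nth_append)
    qed
    \<comment> \<open>A block before \<open>B\<close> has a smaller maximum than \<open>B\<close>,
      hence smaller than \<open>M\<close>, and cannot contain \<open>M\<close>.\<close>
    have MB: "M \<in> B"
    proof (rule ccontr)
      assume "M \<notin> B"
      then obtain C where C: "C \<in> set As" "M \<in> C" using U by auto
      have "finite C" "finite B" "B \<noteq> {}" "Max C < Max B" "B \<subseteq> insert M S"
        using B C(1) U by (auto simp: ordered_partitions_def Bs sorted_wrt_append)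
      note * = this
      have "Max B \<in> B" using *(2,3) by (rule Max_in)
      then have "Max B \<in> insert M S" using *(5) by blast
      moreover have "M \<le> Max C" using *(1) C(2) by (rule Max_ge)
      ultimately show False using M[of "Max B"] *(4) by auto
    qed
    define A where "A = \<Union>(set As)"
    have AB: "A \<inter> B = {}" using dj by (auto simp: A_def)
    have U': "A \<union> B = insert M S" using U by (simp add: A_def)
    have "M \<notin> A" using IntI[of M A B] AB MB by auto
    moreover have "A \<subseteq> insert M S" unfolding U'[symmetric] by (rule Un_upper1)
    ultimately have "A \<subseteq> S" using subset_insert[of M A S] by simp
    moreover have "B = insert M S - A"
      unfolding U'[symmetric] using AB by (simp add: Un_Diff Diff_triv Int_commute)
    ultimately have A: "A \<subseteq> S" "B = insert M S - A" by simp_all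
    have "As ! i \<inter> As ! j = {}" if "i < m" "j < m" "i \<noteq> j" for i j
    proof -
      have BB: "\<forall>i<Suc m. \<forall>j<Suc m. i \<noteq> j \<longrightarrow> Bs ! i \<inter> Bs ! j = {}"
        using B by (simp add: ordered_partitions_def)
      have "Bs ! i = As ! i" "Bs ! j = As ! j" using that len by (simp_all add: Bs nth_append)
      then show ?thesis using BB[rule_format, of i j] that by simp
    qed
    moreover have "sorted_wrt (\<lambda>A B. Max A < Max B) As" "\<forall>A\<in>set As. finite A \<and> A \<noteq> {}"
      using B by (simp_all add: ordered_partitions_def Bs sorted_wrt_append)
    ultimately have "As \<in> ordered_partitions m A"
      using len by (simp add: ordered_partitions_def A_def)
    with A show "Bs \<in> (\<lambda>(A, As). As @ [insert M S - A]) ` Sigma (Pow S) (ordered_partitions m)"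
      by (intro image_eqI[of _ _ "(A, As)"]) (simp_all add: Bs)
  qed
qed

text \<open>Both sides obey the recursion that splits off the block of the greatest position: the
  left one by definition, the right one by \<open>ordered_partitions_Suc\<close>.\<close>

lemma component_osh_map_subword:
  assumes "finite S"
  shows "component m (osh_map h (subword w S))
    = (\<Sum>As\<in>ordered_partitions m S. tensor_of (map (\<lambda>A. h (subword w A)) As))"
  using assms
proof (induction m arbitrary: S)
  case 0
  then have "subword w S = [] \<longleftrightarrow> S = {}"
    by (metis length_subword length_0_conv card_0_eq)
  then show ?case by (simp add: ordered_partitions_0)
next
  case (Suc m)
  show ?case
  proof (cases "S = {}")
    case True
    then show ?thesis by (simp add: ordered_partitions_Suc_empty)
  next
    case False
    define M where "M = Max S"
    define S' where "S' = S - {M}"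
    have "M \<in> S" unfolding M_def using Suc.prems False by (rule Max_in)
    then have S: "S = insert M S'" "finite S'" using Suc.prems by (auto simp: S'_def)
    have lt: "i < M" if "i \<in> S'" for i
      using Max_ge[of S i] that Suc.prems by (simp add: S'_def M_def order_less_le)
    have sw: "subword w (insert M A) = subword w A @ [w ! M]" if "A \<subseteq> S'" for A
      using that S(2) lt by (intro subword_insert_greatest) (auto intro: finite_subset)
    have "component (Suc m) (osh_map h (subword w S))
       = (\<Sum>A\<in>Pow S'. component m (osh_map h (subword w A)) \<otimes>\<^sub>t tensor_of [h (subword w (S' - A) @ [w ! M])])"
      unfolding S(1) sw[OF subset_refl] osh_map_snoc
        unshuffle_sum_linear[OF linear_component] component_Suc_mult_vector
      by (rule unshuffle_sum_subword[OF S(2)])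
    also have "\<dots> = (\<Sum>A\<in>Pow S'. \<Sum>As\<in>ordered_partitions m A.
        tensor_of (map (\<lambda>A. h (subword w A)) (As @ [insert M S' - A])))"
    proof (rule sum.cong[OF refl])
      fix A assume A: "A \<in> Pow S'"
      have "insert M S' - A = insert M (S' - A)" using A lt by auto
      moreover have "component m (osh_map h (subword w A))
          = (\<Sum>As\<in>ordered_partitions m A. tensor_of (map (\<lambda>A. h (subword w A)) As))"
        by (rule Suc.IH) (use A S(2) finite_subset in auto)
      ultimately show "component m (osh_map h (subword w A)) \<otimes>\<^sub>t tensor_of [h (subword w (S' - A) @ [w ! M])]
         = (\<Sum>As\<in>ordered_partitions m A. tensor_of (map (\<lambda>A. h (subword w A)) (As @ [insert M S' - A])))"
        by (simp add: sw tensor_mult_sum_left)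
    qed
    also have "\<dots> = (\<Sum>(A, As)\<in>Sigma (Pow S') (ordered_partitions m).
        tensor_of (map (\<lambda>A. h (subword w A)) (As @ [insert M S' - A])))"
      by (rule sum.Sigma) (use S(2) in \<open>auto intro: finite_ordered_partitions finite_subset\<close>)
    also have "\<dots> = (\<Sum>As\<in>ordered_partitions (Suc m) S. tensor_of (map (\<lambda>A. h (subword w A)) As))"
      unfolding S(1)
      using sum.reindex_bij_betw[OF ordered_partitions_Suc[OF S(2) lt, of m],
          of "\<lambda>As. tensor_of (map (\<lambda>A. h (subword w A)) As)"]
      by (simp add: case_prod_unfold)
    finally show ?thesis .
  qed
qed

section \<open>External tensor products and the coproduct \<open>Delta_osh\<close>\<close>

lemma scalar_part_tensor_of [simp]: "scalar_part (tensor_of (w :: 'a::real_vector list)) = (if w = [] then 1 else 0)"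
  and linear_scalar_part: "linear (scalar_part :: 'a::real_vector tensor \<Rightarrow> real)"
proof -
  have "multilinear (\<lambda>w :: 'a list. if w = [] then 1 else (0::real))" by (rule multilinearI) auto
  note m = this
  show "scalar_part (tensor_of w) = (if w = [] then 1 else 0)"
    unfolding scalar_part_def by (rule tensor_lift_tensor_of[OF m])
  show "linear (scalar_part :: 'a tensor \<Rightarrow> real)"
    unfolding scalar_part_def by (rule linear_tensor_lift[OF m])
qed

lemma multilinear_boxtimes:
  assumes "\<And>f. f \<in> set fs \<Longrightarrow> linear f"
  shows "multilinear (\<lambda>as. if length as = length fs then tensor_of (map2 (\<lambda>f a. f a) fs as) else 0)"
  unfolding multilinear_def
proof (intro allI)
  fix us ws
  show "linear (\<lambda>v. if length (us @ v # ws) = length fs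
      then tensor_of (map2 (\<lambda>f a. f a) fs (us @ v # ws)) else 0)"
  proof (cases "length us + Suc (length ws) = length fs")
    case True
    then have fs: "fs = take (length us) fs @ fs ! length us # drop (Suc (length us)) fs"
      by (intro id_take_nth_drop) simp
    have "map2 (\<lambda>f a. f a) fs (us @ v # ws) = map2 (\<lambda>f a. f a) (take (length us) fs) us
        @ (fs ! length us) v # map2 (\<lambda>f a. f a) (drop (Suc (length us)) fs) ws" for v
      using True by (subst fs) (simp add: zip_append1)
    moreover have "linear (fs ! length us)" using True by (intro assms nth_mem) simp
    ultimately show ?thesis
      using True by (simp add: linear_compose'[OF _ multilinearD[OF multilinear_tensor_of]])
  next
    case False
    then show ?thesis by (simp add: linear_zero)
  qed
qed

lemma boxtimes_map_tensor_of:
  assumes "\<And>f. f \<in> set fs \<Longrightarrow> linear f"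
  shows "boxtimes_map fs (tensor_of as)
    = (if length as = length fs then tensor_of (map2 (\<lambda>f a. f a) fs as) else 0)"
  unfolding boxtimes_map_def by (rule tensor_lift_tensor_of[OF multilinear_boxtimes]) (rule assms)

lemma linear_boxtimes_map:
  "(\<And>f. f \<in> set fs \<Longrightarrow> linear f) \<Longrightarrow> linear (boxtimes_map fs)"
  unfolding boxtimes_map_def by (intro linear_tensor_lift multilinear_boxtimes)

text \<open>A shuffle increases on each block, so the image of the last position of a block is the
  maximum of the image of the block.\<close>

lemma ordered_shuffle_iff:
  assumes \<sigma>: "\<sigma> \<in> shuffle_perms ns" and ns: "\<And>n. n \<in> set ns \<Longrightarrow> n \<ge> 1"
  shows "\<sigma> \<in> ordered_shuffle_perms ns \<longleftrightarrow> sorted_wrt (\<lambda>A B. Max A < Max B) (block_images ns \<sigma>)"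
proof -
  have "Max (\<sigma> ` {block_start ns i..<block_start ns (Suc i)}) = \<sigma> (block_start ns (Suc i) - 1)"
    if i: "i < length ns" for i
  proof (rule Max_eqI)
    have lt: "block_start ns i < block_start ns (Suc i)"
      using ns[OF nth_mem[OF i]] by (simp add: block_start_Suc i)
    then show "\<sigma> (block_start ns (Suc i) - 1) \<in> \<sigma> ` {block_start ns i..<block_start ns (Suc i)}"
      by (intro imageI) auto
    have mono: "strict_mono_on {block_start ns i..<block_start ns (Suc i)} \<sigma>"
      using \<sigma> i by (simp add: shuffle_perms_def)
    fix y assume "y \<in> \<sigma> ` {block_start ns i..<block_start ns (Suc i)}"
    then obtain k where "k \<in> {block_start ns i..<block_start ns (Suc i)}" and y: "y = \<sigma> k" by auto
    then have "\<sigma> k \<le> \<sigma> (block_start ns (Suc i) - 1)"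
      by (intro strict_mono_on_leD[OF mono]) auto
    then show "y \<le> \<sigma> (block_start ns (Suc i) - 1)" by (simp add: y)
  qed simp
  then show ?thesis
    using \<sigma> by (auto simp: ordered_shuffle_perms_def strict_mono_on_def sorted_wrt_iff_nth_less block_images_def)
qed

lemma ordered_block_partitions:
  assumes ns: "\<And>n. n \<in> set ns \<Longrightarrow> n \<ge> 1"
  shows "{As \<in> block_partitions ns. sorted_wrt (\<lambda>A B. Max A < Max B) As}
    = {As \<in> ordered_partitions (length ns) {..<sum_list ns}. map card As = ns}"
proof -
  have ne: "A \<noteq> {}" if "A \<in> set As" "map card As = ns" for A As
  proof -
    have "card A \<in> set ns" using that by auto
    then have "card A \<ge> 1" by (rule ns)
    then show ?thesis by auto
  qed
  show ?thesis
  proof (rule Collect_cong)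
    fix As
    show "As \<in> block_partitions ns \<and> sorted_wrt (\<lambda>A B. Max A < Max B) As \<longleftrightarrow>
      As \<in> ordered_partitions (length ns) {..<sum_list ns} \<and> map card As = ns"
    proof (cases "map card As = ns")
      case True
      have len: "length As = length ns" unfolding True[symmetric] by simp
      have "(\<forall>A\<in>set As. finite A \<and> A \<noteq> {}) \<longleftrightarrow> (\<forall>A\<in>set As. finite A)" using ne True by blast
      then show ?thesis
        unfolding block_partitions_def ordered_partitions_def mem_Collect_eq len using True by argo
    qed (simp add: block_partitions_def)
  qed
qed

lemma sum_ordered_shuffle_perms:
  assumes ns: "\<And>n. n \<in> set ns \<Longrightarrow> n \<ge> 1"
  shows "(\<Sum>\<sigma>\<in>ordered_shuffle_perms ns. permuted_blocks ns \<sigma> w)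
    = (\<Sum>As | As \<in> ordered_partitions (length ns) {..<sum_list ns} \<and> map card As = ns.
        tensor_of (map (\<lambda>A. tensor_of (subword w A)) As))"
proof -
  let ?g = "\<lambda>As. tensor_of (map (\<lambda>A. tensor_of (subword w A)) As)"
  let ?Q = "\<lambda>As. sorted_wrt (\<lambda>A B. Max A < Max (B::nat set)) As"
  have bij: "bij_betw (block_images ns) (ordered_shuffle_perms ns) {As \<in> block_partitions ns. ?Q As}"
  proof (rule bij_betw_imageI)
    show "inj_on (block_images ns) (ordered_shuffle_perms ns)"
      using bij_betw_imp_inj_on[OF bij_betw_block_images]
      by (rule inj_on_subset) (auto simp: ordered_shuffle_perms_def)
    have im: "block_images ns ` shuffle_perms ns = block_partitions ns"
      by (rule bij_betw_imp_surj_on[OF bij_betw_block_images])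
    have sub: "\<sigma> \<in> shuffle_perms ns" if "\<sigma> \<in> ordered_shuffle_perms ns" for \<sigma>
      using that by (simp add: ordered_shuffle_perms_def)
    show "block_images ns ` ordered_shuffle_perms ns = {As \<in> block_partitions ns. ?Q As}"
    proof (intro equalityI subsetI)
      fix As assume "As \<in> block_images ns ` ordered_shuffle_perms ns"
      then obtain \<sigma> where "\<sigma> \<in> ordered_shuffle_perms ns" "As = block_images ns \<sigma>" by blast
      then show "As \<in> {As \<in> block_partitions ns. ?Q As}"
        using ordered_shuffle_iff[OF sub ns] sub im by blast
    next
      fix As assume *: "As \<in> {As \<in> block_partitions ns. ?Q As}"
      then obtain \<sigma> where "\<sigma> \<in> shuffle_perms ns" "As = block_images ns \<sigma>" using im by blast
      then show "As \<in> block_images ns ` ordered_shuffle_perms ns"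
        using ordered_shuffle_iff[OF _ ns] * by blast
    qed
  qed
  have "(\<Sum>\<sigma>\<in>ordered_shuffle_perms ns. permuted_blocks ns \<sigma> w)
      = (\<Sum>\<sigma>\<in>ordered_shuffle_perms ns. ?g (block_images ns \<sigma>))"
    by (intro sum.cong refl permuted_blocks_eq) (simp add: ordered_shuffle_perms_def)
  also have "\<dots> = (\<Sum>As\<in>{As \<in> block_partitions ns. ?Q As}. ?g As)"
    by (rule sum.reindex_bij_betw[OF bij])
  also have "{As \<in> block_partitions ns. ?Q As} = {As \<in> ordered_partitions (length ns) {..<sum_list ns}. map card As = ns}"
    by (rule ordered_block_partitions[OF ns])
  finally show ?thesis .
qed

lemma tensor_of_eq_0: "0 \<in> set w \<Longrightarrow> tensor_of w = 0"
  using linear_0[OF multilinearD[OF multilinear_tensor_of]] by (metis split_list)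

text \<open>The multilinearity is inherited from \<open>osh_map tensor_of\<close>, which keeps every
  block as a tensor of its own. Applying \<open>component\<close> to each block then retains exactly
  the partitions with block sizes \<open>ns\<close>.\<close>

lemma multilinear_Delta_osh:
  fixes ns :: "nat list"
  assumes ns: "\<And>n. n \<in> set ns \<Longrightarrow> n \<ge> 1"
  shows "multilinear (\<lambda>w :: 'v::real_vector list. if length w = sum_list ns
    then \<Sum>\<sigma>\<in>ordered_shuffle_perms ns. permuted_blocks ns \<sigma> w else 0)"
proof -
  let ?B = "boxtimes_map (map component ns) :: 'v tensor tensor \<Rightarrow> _"
  have lin: "linear f" if "f \<in> set (map component ns)" for f :: "'v tensor \<Rightarrow> 'v tensor"
    using that linear_component by auto
  have eq: "(\<Sum>\<sigma>\<in>ordered_shuffle_perms ns. permuted_blocks ns \<sigma> w) = ?B (component (length ns) (osh_map tensor_of w))"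
    if lw: "length w = sum_list ns" for w :: "'v list"
  proof -
    have project: "?B (tensor_of (map (\<lambda>A. tensor_of (subword w A)) As))
        = (if map card As = ns then tensor_of (map (\<lambda>A. tensor_of (subword w A)) As) else 0)"
      if As: "As \<in> ordered_partitions (length ns) {..<sum_list ns}" for As
    proof -
      have len: "length As = length ns" using As by (simp add: ordered_partitions_def)
      then have "?B (tensor_of (map (\<lambda>A. tensor_of (subword w A)) As))
          = tensor_of (map2 (\<lambda>f a. f a) (map component ns) (map (\<lambda>A. tensor_of (subword w A)) As))"
        by (subst boxtimes_map_tensor_of) (use lin in auto)
      also have "map2 (\<lambda>f a. f a) (map component ns) (map (\<lambda>A. tensor_of (subword w A)) As)
          = map2 (\<lambda>n A. if card A = n then tensor_of (subword w A) else 0) ns As"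
        by (simp add: zip_map1 zip_map2 case_prod_unfold)
      also have "tensor_of \<dots> = (if map card As = ns then tensor_of (map (\<lambda>A. tensor_of (subword w A)) As) else 0)"
      proof (cases "map card As = ns")
        case True
        have "map2 (\<lambda>n A. if card A = n then tensor_of (subword w A) else 0) ns As
            = map (\<lambda>A. tensor_of (subword w A)) As"
          unfolding True[symmetric] by (simp add: zip_map1 zip_same_conv_map)
        with True show ?thesis by simp
      next
        case False
        \<comment> \<open>A block of the wrong size is projected to 0, and a single zero entry
          annihilates the word.\<close>
        then obtain i where i: "i < length As" "card (As ! i) \<noteq> ns ! i"
          using len by (metis length_map nth_equalityI nth_map)
        then have "map2 (\<lambda>n A. if card A = n then tensor_of (subword w A) else 0) ns As ! i = 0"
          by (simp add: len)
        then have "0 \<in> set (map2 (\<lambda>n A. if card A = n then tensor_of (subword w A) else 0) ns As)"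
          using i len by (metis (no_types, lifting) in_set_conv_nth length_map length_zip min.idem)
        then have "tensor_of (map2 (\<lambda>n A. if card A = n then tensor_of (subword w A) else 0) ns As) = 0"
          by (rule tensor_of_eq_0)
        with False show ?thesis by (simp only: if_False)
      qed
      finally show ?thesis .
    qed
    have fin: "finite (ordered_partitions (length ns) {..<sum_list ns})"
      by (rule finite_ordered_partitions) simp
    have "component (length ns) (osh_map tensor_of w)
      = (\<Sum>As\<in>ordered_partitions (length ns) {..<sum_list ns}. tensor_of (map (\<lambda>A. tensor_of (subword w A)) As))"
      using component_osh_map_subword[of "{..<length w}" "length ns" tensor_of w] subword_all[of w]
      by (simp add: lw)
    then have "?B (component (length ns) (osh_map tensor_of w))
      = (\<Sum>As\<in>ordered_partitions (length ns) {..<sum_list ns}.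
          if map card As = ns then tensor_of (map (\<lambda>A. tensor_of (subword w A)) As) else 0)"
    proof -
      have "?B (\<Sum>As\<in>I. g As) = (\<Sum>As\<in>I. ?B (g As))" for I :: "nat set list set" and g
        by (rule linear_sum[OF linear_boxtimes_map[OF lin]])
      then show "component (length ns) (osh_map tensor_of w)
        = (\<Sum>As\<in>ordered_partitions (length ns) {..<sum_list ns}. tensor_of (map (\<lambda>A. tensor_of (subword w A)) As))
        \<Longrightarrow> ?thesis" by (simp add: project cong: sum.cong)
    qed
    also have "\<dots> = (\<Sum>As | As \<in> ordered_partitions (length ns) {..<sum_list ns} \<and> map card As = ns.
        tensor_of (map (\<lambda>A. tensor_of (subword w A)) As))"
      by (rule sum.inter_filter[OF fin, symmetric])
    also have "\<dots> = (\<Sum>\<sigma>\<in>ordered_shuffle_perms ns. permuted_blocks ns \<sigma> w)"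
      by (rule sum_ordered_shuffle_perms[OF ns, symmetric])
    finally show ?thesis ..
  qed
  have "multilinear (\<lambda>w. if length w = sum_list ns
      then ?B (component (length ns) (osh_map tensor_of w)) else 0)"
    by (intro multilinear_if_length multilinear_compose_linear[OF multilinear_compose_linear
        [OF multilinear_osh_map[OF multilinear_tensor_of] linear_component] linear_boxtimes_map[OF lin]])
  then show ?thesis using eq by (simp cong: if_cong)
qed

lemma linear_blinfun_apply: "linear (blinfun_apply f)"
  by (rule bounded_linear.linear[OF blinfun.bounded_linear_right])

lemma linear_degree_part: "linear (degree_part k H)"
  unfolding degree_part_def
  by (rule linear_compose'[OF linear_component linear_blinfun_apply])

lemma degree_part_tensor_of [simp]:
  "degree_part k H (tensor_of w) = (if length w = k then blinfun_apply H (tensor_of w) else 0)"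
  by (simp add: degree_part_def blinfun.zero_right)

lemma finite_compositions: "finite (compositions m n)"
proof (rule finite_subset)
  show "compositions m n \<subseteq> {ns. set ns \<subseteq> {..n} \<and> length ns = m}"
    using member_le_sum_list by (force simp: compositions_def)
  show "finite {ns. set ns \<subseteq> {..n} \<and> length ns = m}"
    by (rule finite_lists_length_eq) simp
qed

text \<open>The right-hand sides of the definitions of the lift and of \<open>\<overline>K * \<overline>H\<close> are governed by one linear
  map \<open>T(V) \<rightarrow> T(U)\<close>, dual to the homomorphism of Zinbiel algebras induced by \<open>\<overline>H\<close>.\<close>

lemma sum_compositions_boxtimes:
  fixes H :: "'v::fin_dim tensor \<Rightarrow>\<^sub>L 'u::real_normed_vector"
  defines "h \<equiv> \<lambda>w. blinfun_apply H (tensor_of w)"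
  shows "(\<Sum>ns\<in>compositions m n. boxtimes_map (map (\<lambda>k. degree_part k H) ns) (Delta_osh ns (component n a)))
    = component m (tensor_lift (osh_map h) (component n a))"
proof -
  have mh: "multilinear h" unfolding h_def by (rule multilinear_linear_tensor_of[OF linear_blinfun_apply])
  note mo = multilinear_osh_map[OF mh]
  have lin: "linear f" if "f \<in> set (map (\<lambda>k. degree_part k H) ns)" for f ns
    using that linear_degree_part by auto
  have mD: "multilinear (\<lambda>w :: 'v list. if length w = sum_list ns
      then \<Sum>\<sigma>\<in>ordered_shuffle_perms ns. permuted_blocks ns \<sigma> w else 0)" if "ns \<in> compositions m n" for ns
    by (rule multilinear_Delta_osh) (use that in \<open>auto simp: compositions_def\<close>)
  show ?thesis
  proof (rule tensor_linear_eqI[of "\<lambda>a. \<Sum>ns\<in>compositions m n. boxtimes_map (map (\<lambda>k. degree_part k H) ns)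
        (Delta_osh ns (component n a))" "\<lambda>a. component m (tensor_lift (osh_map h) (component n a))"])
    show "linear (\<lambda>a. \<Sum>ns\<in>compositions m n. boxtimes_map (map (\<lambda>k. degree_part k H) ns) (Delta_osh ns (component n a)))"
      unfolding Delta_osh_def
      by (intro linear_compose_sum ballI linear_compose'[OF linear_compose'[OF linear_component linear_tensor_lift[OF mD]]
          linear_boxtimes_map[OF lin]])
    show "linear (\<lambda>a. component m (tensor_lift (osh_map h) (component n a)))"
      by (rule linear_compose'[OF linear_compose'[OF linear_component linear_tensor_lift[OF mo]] linear_component])
    fix w :: "'v list"
    have D0: "Delta_osh ns (0 :: 'v tensor) = 0" if "ns \<in> compositions m n" for ns :: "nat list"
      unfolding Delta_osh_def by (rule linear_0[OF linear_tensor_lift[OF mD[OF that]]])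
    have B0: "boxtimes_map (map (\<lambda>k. degree_part k H) ns) 0 = 0" for ns
      by (rule linear_0[OF linear_boxtimes_map[OF lin]])
    show "(\<Sum>ns\<in>compositions m n. boxtimes_map (map (\<lambda>k. degree_part k H) ns) (Delta_osh ns (component n (tensor_of w))))
      = component m (tensor_lift (osh_map h) (component n (tensor_of w)))"
    proof (cases "length w = n")
      case False
      then show ?thesis
        by (simp add: D0 B0 linear_0[OF linear_tensor_lift[OF mo]] cong: sum.cong)
    next
      case True
      let ?g = "\<lambda>As. tensor_of (map (\<lambda>A. h (subword w A)) As)"
      have "boxtimes_map (map (\<lambda>k. degree_part k H) ns) (Delta_osh ns (tensor_of w))
          = (\<Sum>As | As \<in> ordered_partitions m {..<n} \<and> map card As = ns. ?g As)"
        if ns: "ns \<in> compositions m n" for ns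
      proof -
        have ns': "length ns = m" "sum_list ns = n" and "\<And>k. k \<in> set ns \<Longrightarrow> k \<ge> 1"
          using ns by (auto simp: compositions_def)
        then have "Delta_osh ns (tensor_of w) = (\<Sum>As | As \<in> ordered_partitions m {..<n} \<and> map card As = ns.
           tensor_of (map (\<lambda>A. tensor_of (subword w A)) As))"
          using True unfolding Delta_osh_def tensor_lift_tensor_of[OF mD[OF ns]]
          by (simp add: sum_ordered_shuffle_perms)
        then have "boxtimes_map (map (\<lambda>k. degree_part k H) ns) (Delta_osh ns (tensor_of w))
          = (\<Sum>As | As \<in> ordered_partitions m {..<n} \<and> map card As = ns.
              boxtimes_map (map (\<lambda>k. degree_part k H) ns) (tensor_of (map (\<lambda>A. tensor_of (subword w A)) As)))"
          by (simp only: linear_sum[OF linear_boxtimes_map[of "map (\<lambda>k. degree_part k H) ns", OF lin]])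
        also have "\<dots> = (\<Sum>As | As \<in> ordered_partitions m {..<n} \<and> map card As = ns. ?g As)"
        proof (rule sum.cong[OF refl])
          fix As assume "As \<in> {As. As \<in> ordered_partitions m {..<n} \<and> map card As = ns}"
          then have ns_eq: "ns = map card As" by simp
          have "map2 (\<lambda>f a. f a) (map (\<lambda>k. degree_part k H) ns) (map (\<lambda>A. tensor_of (subword w A)) As)
              = map (\<lambda>A. h (subword w A)) As"
            unfolding ns_eq h_def by (simp add: zip_map1 zip_map2 zip_same_conv_map)
          then show "boxtimes_map (map (\<lambda>k. degree_part k H) ns) (tensor_of (map (\<lambda>A. tensor_of (subword w A)) As)) = ?g As"
            by (subst boxtimes_map_tensor_of) (use linear_degree_part in \<open>auto simp: ns_eq\<close>)
        qed
        finally show ?thesis .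
      qed
      then have "(\<Sum>ns\<in>compositions m n. boxtimes_map (map (\<lambda>k. degree_part k H) ns) (Delta_osh ns (tensor_of w)))
        = (\<Sum>ns\<in>compositions m n. \<Sum>As | As \<in> ordered_partitions m {..<n} \<and> map card As = ns. ?g As)"
        by (rule sum.cong[OF refl])
      \<comment> \<open>A partition into \<open>m\<close> nonempty blocks determines the composition
        of its block sizes, so the double sum groups the partitions by this composition.\<close>
      also have "\<dots> = (\<Sum>As\<in>ordered_partitions m {..<n}. ?g As)"
      proof (rule sum.group[OF finite_ordered_partitions finite_compositions])
        show "map card ` ordered_partitions m {..<n} \<subseteq> compositions m n"
        proof
          fix ns assume "ns \<in> map card ` ordered_partitions m {..<n}"
          then obtain As where As: "As \<in> ordered_partitions m {..<n}" and ns: "ns = map card As" by auto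
          have "sum_list (map card As) = (\<Sum>i<m. card (As ! i))"
            using As by (simp add: ordered_partitions_def sum_list_sum_nth atLeast0LessThan)
          also have "\<dots> = card (\<Union>i<m. As ! i)"
            using As by (intro card_UN_disjoint[symmetric]) (auto simp: ordered_partitions_def)
          also have "(\<Union>i<m. As ! i) = \<Union>(set As)"
            using As by (auto simp: ordered_partitions_def set_conv_nth)
          also have "\<dots> = {..<n}" using As by (simp add: ordered_partitions_def)
          finally show "ns \<in> compositions m n"
            using As by (auto simp: ns compositions_def ordered_partitions_def Suc_le_eq card_gt_0_iff)
        qed
      qed simp
      also have "\<dots> = component m (osh_map h w)"
        using component_osh_map_subword[of "{..<length w}" m h w] subword_all[of w] by (simp add: True)
      finally show ?thesis using True by (simp add: tensor_lift_tensor_of mo)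
    qed
  qed
qed

section \<open>Algebra of controlled paths\<close>

lemma blinfun_tensor_eqI:
  fixes f g :: "'v::fin_dim tensor \<Rightarrow>\<^sub>L 'u::real_normed_vector"
  assumes "\<And>w. blinfun_apply f (tensor_of w) = blinfun_apply g (tensor_of w)"
  shows "f = g"
  by (rule blinfun_eqI) (rule tensor_linear_eqI[OF linear_blinfun_apply linear_blinfun_apply assms])

lemma tensor_lift_blinfun: "tensor_lift (\<lambda>w. blinfun_apply K (tensor_of w)) = blinfun_apply K"
  by (rule tensor_lift_linear[OF linear_blinfun_apply])

lemma multilinear_blinfun: "multilinear (\<lambda>w. blinfun_apply K (tensor_of w))"
  by (rule multilinear_linear_tensor_of[OF linear_blinfun_apply])

text \<open>The common form of all controlled paths constructed here: values on words, cut off at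
  length \<open>N\<close>. By \<open>blinfun_tensor_eqI\<close> it then suffices to compare values
  on words.\<close>

definition trunc_blinfun :: "nat \<Rightarrow> ('v::fin_dim list \<Rightarrow> 'u::real_normed_vector) \<Rightarrow> 'v tensor \<Rightarrow>\<^sub>L 'u" where
  "trunc_blinfun N g = Blinfun (tensor_lift (\<lambda>w. if length w < N then g w else 0))"

lemma multilinear_trunc: "multilinear g \<Longrightarrow> multilinear (\<lambda>w. if length w < N then g w else 0)"
  by (rule multilinear_if_length[of _ "\<lambda>n. n < N"])

lemma bounded_linear_trunc:
  fixes g :: "'v::fin_dim list \<Rightarrow> 'u::real_normed_vector"
  assumes "multilinear g"
  shows "bounded_linear (tensor_lift (\<lambda>w. if length w < N then g w else 0))"
proof (rule bounded_linear_truncated)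
  note m = multilinear_trunc[OF assms, of N]
  show lin: "linear (tensor_lift (\<lambda>w. if length w < N then g w else 0))"
    by (rule linear_tensor_lift[OF m])
  fix n :: nat and a :: "'v tensor" assume "N \<le> n" "a \<in> tensor_power n"
  then have "a \<in> span (tensor_of ` {w. length w = n})" by (simp add: tensor_power_def)
  then show "tensor_lift (\<lambda>w. if length w < N then g w else 0) a = 0"
    by (rule linear_eq_on[OF lin linear_zero]) (use \<open>N \<le> n\<close> in \<open>auto simp: tensor_lift_tensor_of[OF m]\<close>)
qed

lemma trunc_blinfun_tensor_of:
  assumes "multilinear g"
  shows "blinfun_apply (trunc_blinfun N g) (tensor_of w) = (if length w < N then g w else 0)"
  unfolding trunc_blinfun_def
  by (simp add: bounded_linear_Blinfun_apply[OF bounded_linear_trunc[OF assms]]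
      tensor_lift_tensor_of[OF multilinear_trunc[OF assms]])

lemma floor_nat_ge_1: "p \<ge> 1 \<Longrightarrow> \<lfloor>p\<rfloor>\<^sub>\<nat> \<ge> 1"
  by (simp add: nat_le_eq_zle le_nat_iff)

lemma star_eq:
  fixes K :: "real \<Rightarrow> 'u::fin_dim tensor \<Rightarrow>\<^sub>L 's::fin_dim" and H :: "real \<Rightarrow> 'v::fin_dim tensor \<Rightarrow>\<^sub>L 'u"
  assumes p: "p \<ge> 1"
  shows "star p K H t = trunc_blinfun \<lfloor>p\<rfloor>\<^sub>\<nat>
    (\<lambda>w. blinfun_apply (K t) (osh_map (\<lambda>x. blinfun_apply (H t) (tensor_of x)) w))"
proof -
  let ?N = "\<lfloor>p\<rfloor>\<^sub>\<nat>"
  let ?h = "\<lambda>x. blinfun_apply (H t) (tensor_of x)"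
  note mo = multilinear_osh_map[OF multilinear_blinfun[of "H t"]]
  have mk: "multilinear (\<lambda>w. blinfun_apply (K t) (osh_map ?h w))"
    by (rule multilinear_compose_linear[OF mo linear_blinfun_apply])
  note m = multilinear_trunc[OF mk, of ?N]
  have "(\<Sum>ns\<in>compositions m n. degree_part m (K t) (boxtimes_map (map (\<lambda>k. degree_part k (H t)) ns)
      (Delta_osh ns (component n a))))
    = blinfun_apply (K t) (component m (tensor_lift (osh_map ?h) (component n a)))" for m n and a :: "'v tensor"
    unfolding linear_sum[OF linear_degree_part, symmetric] sum_compositions_boxtimes
    by (simp add: degree_part_def)
  then have "(\<lambda>a. scalar_part a *\<^sub>R ctrace K t +
     (\<Sum>n\<in>{1..?N - 1}. \<Sum>m\<in>{1..n}. \<Sum>ns\<in>compositions m n.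
        degree_part m (K t) (boxtimes_map (map (\<lambda>k. degree_part k (H t)) ns) (Delta_osh ns (component n a)))))
    = (\<lambda>a. scalar_part a *\<^sub>R ctrace K t + (\<Sum>n\<in>{1..?N - 1}. \<Sum>m\<in>{1..n}.
        blinfun_apply (K t) (component m (tensor_lift (osh_map ?h) (component n a)))))"
    by (simp only:)
  also have "\<dots> = tensor_lift (\<lambda>w. if length w < ?N then blinfun_apply (K t) (osh_map ?h w) else 0)"
  proof (rule tensor_lift_unique[OF m])
    show "linear (\<lambda>a. scalar_part a *\<^sub>R ctrace K t + (\<Sum>n\<in>{1..?N - 1}. \<Sum>m\<in>{1..n}.
        blinfun_apply (K t) (component m (tensor_lift (osh_map ?h) (component n a)))))"
      by (intro linear_compose_add linear_compose_sum ballI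
        linear_compose'[OF linear_compose'[OF linear_compose'[OF linear_component linear_tensor_lift[OF mo]]
          linear_component] linear_blinfun_apply] linear_compose'[OF linear_scalar_part linear_scaleR_left])
    fix w :: "'v list"
    have inner: "(\<Sum>m\<in>{1..n}. blinfun_apply (K t) (component m (tensor_lift (osh_map ?h) (component n (tensor_of w)))))
        = (if n = length w then blinfun_apply (K t) (osh_map ?h w) else 0)" if "n \<ge> 1" for n
    proof (cases "n = length w")
      case True
      then have "w \<noteq> []" using that by auto
      \<comment> \<open>The image of a nonempty word of length \<open>n\<close> lives in degrees 1
        to \<open>n\<close>: degree 0 belongs to the empty word, which is accounted for by the
        summand with \<open>scalar_part\<close>.\<close>
      have "(\<Sum>m\<in>{1..n}. component m (osh_map ?h w)) = (\<Sum>m\<le>n. component m (osh_map ?h w))"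
        by (rule sum.mono_neutral_left) (auto simp: \<open>w \<noteq> []\<close> not_le Suc_le_eq)
      also have "\<dots> = osh_map ?h w"
        by (rule sum_components) (simp add: component_osh_map_eq_0 True)
      finally show ?thesis
        using True by (simp add: tensor_lift_tensor_of mo flip: blinfun.sum_right)
    next
      case False
      then show ?thesis
        by (simp add: linear_0[OF linear_tensor_lift[OF mo]] blinfun.zero_right)
    qed
    have "(\<Sum>n\<in>{1..?N - 1}. \<Sum>m\<in>{1..n}.
        blinfun_apply (K t) (component m (tensor_lift (osh_map ?h) (component n (tensor_of w)))))
      = (\<Sum>n\<in>{1..?N - 1}. if n = length w then blinfun_apply (K t) (osh_map ?h w) else 0)"
      by (rule sum.cong[OF refl], rule inner) simp
    also have "\<dots> = (if length w \<in> {1..?N - 1} then blinfun_apply (K t) (osh_map ?h w) else 0)"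
      by simp
    finally show "scalar_part (tensor_of w) *\<^sub>R ctrace K t + (\<Sum>n\<in>{1..?N - 1}. \<Sum>m\<in>{1..n}.
        blinfun_apply (K t) (component m (tensor_lift (osh_map ?h) (component n (tensor_of w)))))
      = (if length w < ?N then blinfun_apply (K t) (osh_map ?h w) else 0)"
      using floor_nat_ge_1[OF p] by (cases w) (auto simp: ctrace_def)
  qed
  finally show ?thesis unfolding star_def trunc_blinfun_def by simp
qed

lemma star_tensor_of:
  assumes p: "p \<ge> 1"
  shows "blinfun_apply (star p K H t) (tensor_of w) = (if length w < \<lfloor>p\<rfloor>\<^sub>\<nat>
    then blinfun_apply (K t) (osh_map (\<lambda>x. blinfun_apply (H t) (tensor_of x)) w) else 0)"
  unfolding star_eq[OF p]
  by (rule trunc_blinfun_tensor_of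
      [OF multilinear_compose_linear[OF multilinear_osh_map[OF multilinear_blinfun] linear_blinfun_apply]])

lemma bilinear_blinfun_compose: "bilinear (o\<^sub>L)"
  unfolding bilinear_def
  using bounded_linear.linear[OF bounded_bilinear.bounded_linear_left[OF bounded_bilinear_blinfun_compose]]
    bounded_linear.linear[OF bounded_bilinear.bounded_linear_right[OF bounded_bilinear_blinfun_compose]]
  by blast

lemma multilinear_pair:
  assumes "bilinear b"
  shows "multilinear (\<lambda>as. case as of [x, y] \<Rightarrow> b x y | _ \<Rightarrow> 0)"
  unfolding multilinear_def
proof (intro allI)
  fix us ws
  have l: "linear (\<lambda>x. b x y)" "linear (b x)" for x y using assms by (auto simp: bilinear_def)
  show "linear (\<lambda>v. case us @ v # ws of [x, y] \<Rightarrow> b x y | _ \<Rightarrow> 0)"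
  proof (cases us)
    case Nil
    then show ?thesis
      using l(1) linear_zero by (cases ws; cases "tl ws") simp_all
  next
    case (Cons a us')
    then show ?thesis
      using l(2) linear_zero by (cases us'; cases ws; cases "tl us'") simp_all
  qed
qed

lemma bilinear_compose_linear: "bilinear b \<Longrightarrow> linear f \<Longrightarrow> linear g \<Longrightarrow> bilinear (\<lambda>x y. b (f x) (g y))"
  unfolding bilinear_def using linear_compose'[of f "\<lambda>x. b x _"] linear_compose'[of g "b _"] by blast

text \<open>The Leibniz product is the convolution product of maps from the unshuffle coalgebra to
  linear maps under composition; summing over all degrees removes the restriction on the lengths of
  the two words.\<close>

lemma leibniz_eq:
  fixes K :: "real \<Rightarrow> 'v::fin_dim tensor \<Rightarrow>\<^sub>L ('u2::fin_dim \<Rightarrow>\<^sub>L 'u3::fin_dim)"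
    and H :: "real \<Rightarrow> 'v tensor \<Rightarrow>\<^sub>L ('u1::fin_dim \<Rightarrow>\<^sub>L 'u2)"
  shows "leibniz p K H t = trunc_blinfun \<lfloor>p\<rfloor>\<^sub>\<nat> (\<lambda>w. unshuffle_sum w
     (\<lambda>x y. blinfun_apply (K t) (tensor_of x) o\<^sub>L blinfun_apply (H t) (tensor_of y)))"
proof -
  let ?N = "\<lfloor>p\<rfloor>\<^sub>\<nat>"
  let ?f = "\<lambda>x y. blinfun_apply (K t) (tensor_of x) o\<^sub>L blinfun_apply (H t) (tensor_of y)"
  have f: "bimultilinear ?f"
    by (rule bimultilinear_bilinear[OF bilinear_blinfun_compose multilinear_blinfun multilinear_blinfun])
  note m = multilinear_trunc[OF multilinear_unshuffle_sum[OF f], of ?N]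
  let ?C = "\<lambda>a b. compose_boxtimes (degree_part a (K t)) (degree_part b (H t))"
  have mC: "multilinear (\<lambda>as. case as of [x, y] \<Rightarrow> degree_part a (K t) x o\<^sub>L degree_part b (H t) y | _ \<Rightarrow> 0)" for a b
    by (intro multilinear_pair bilinear_compose_linear[OF bilinear_blinfun_compose] linear_degree_part)
  have lC: "linear (?C a b)" for a b
    unfolding compose_boxtimes_def by (rule linear_tensor_lift[OF mC])
  have lD: "linear (Delta_sh a b)" for a b
    unfolding Delta_sh_eq by (intro linear_cop bimultilinear_if_length bimultilinear_tensor_of_pair)
  have CD: "?C a b (Delta_sh a b (tensor_of w)) = unshuffle_sum w (\<lambda>x y. if length x = a \<and> length y = b then ?f x y else 0)" for a b w
  proof -
    have "?C a b (Delta_sh a b (tensor_of w)) = unshuffle_sum w (\<lambda>x y.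
        ?C a b (if length x = a \<and> length y = b then tensor_of [tensor_of x, tensor_of y] else 0))"
      unfolding Delta_sh_eq cop_tensor_of[OF bimultilinear_if_length[OF bimultilinear_tensor_of_pair]]
      by (rule unshuffle_sum_linear[OF lC])
    also have "\<dots> = unshuffle_sum w (\<lambda>x y. if length x = a \<and> length y = b then ?f x y else 0)"
    proof (rule unshuffle_sum_cong[OF refl])
      fix x y
      have "?C a b (tensor_of [tensor_of x, tensor_of y]) = ?f x y" if "length x = a" "length y = b"
        unfolding compose_boxtimes_def tensor_lift_tensor_of[OF mC] using that by simp
      then show "?C a b (if length x = a \<and> length y = b then tensor_of [tensor_of x, tensor_of y] else 0)
          = (if length x = a \<and> length y = b then ?f x y else 0)"
        using linear_0[OF lC] by simp
    qed
    finally show ?thesis .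
  qed
  have "(\<lambda>x. \<Sum>n<?N. \<Sum>a\<le>n. ?C a (n - a) (Delta_sh a (n - a) (component n x)))
    = tensor_lift (\<lambda>w. if length w < ?N then unshuffle_sum w ?f else 0)"
  proof (rule tensor_lift_unique[OF m])
    show "linear (\<lambda>x. \<Sum>n<?N. \<Sum>a\<le>n. ?C a (n - a) (Delta_sh a (n - a) (component n x)))"
      by (intro linear_compose_sum ballI linear_compose'[OF linear_compose'[OF linear_component lD] lC])
    fix w :: "'v list"
    have "(\<Sum>a\<le>n. ?C a (n - a) (Delta_sh a (n - a) (component n (tensor_of w))))
        = (if n = length w then unshuffle_sum w ?f else 0)" for n
    proof (cases "n = length w")
      case True
      have "(\<Sum>a\<le>n. ?C a (n - a) (Delta_sh a (n - a) (tensor_of w)))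
        = unshuffle_sum w (\<lambda>x y. \<Sum>a\<le>n. if length x = a \<and> length y = n - a then ?f x y else 0)"
        unfolding CD unshuffle_sum_sum ..
      also have "\<dots> = unshuffle_sum w ?f"
      proof (rule unshuffle_sum_cong[OF refl])
        fix x y :: "'v list" assume "length x + length y = length w"
        then have "length x \<le> n" "(if length x = a \<and> length y = n - a then ?f x y else 0)
            = (if a = length x then ?f x y else 0)" for a
          using True by auto
        then show "(\<Sum>a\<le>n. if length x = a \<and> length y = n - a then ?f x y else 0) = ?f x y"
          by (simp only: sum.delta' sum.delta finite_atMost atMost_iff if_True)
      qed
      finally show ?thesis using True by simp
    next
      case False
      then show ?thesis by (simp add: linear_0[OF lD] linear_0[OF lC])
    qed
    then show "(\<Sum>n<?N. \<Sum>a\<le>n. ?C a (n - a) (Delta_sh a (n - a) (component n (tensor_of w))))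
      = (if length w < ?N then unshuffle_sum w ?f else 0)"
      by (simp only: sum.delta sum.delta' finite_lessThan lessThan_iff)
  qed
  then show ?thesis unfolding leibniz_def trunc_blinfun_def by simp
qed

lemma leibniz_tensor_of:
  fixes K :: "real \<Rightarrow> 'v::fin_dim tensor \<Rightarrow>\<^sub>L ('u2::fin_dim \<Rightarrow>\<^sub>L 'u3::fin_dim)"
    and H :: "real \<Rightarrow> 'v tensor \<Rightarrow>\<^sub>L ('u1::fin_dim \<Rightarrow>\<^sub>L 'u2)"
  shows "blinfun_apply (leibniz p K H t) (tensor_of w) = (if length w < \<lfloor>p\<rfloor>\<^sub>\<nat> then unshuffle_sum w
     (\<lambda>x y. blinfun_apply (K t) (tensor_of x) o\<^sub>L blinfun_apply (H t) (tensor_of y)) else 0)"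
  unfolding leibniz_eq
  by (intro trunc_blinfun_tensor_of multilinear_unshuffle_sum
      bimultilinear_bilinear[OF bilinear_blinfun_compose multilinear_blinfun multilinear_blinfun])

lemma ctrace_star:
  assumes p: "p \<ge> 1"
  shows "ctrace (star p K H) t = ctrace K t"
proof -
  have "length [] < \<lfloor>p\<rfloor>\<^sub>\<nat>"
    unfolding list.size using floor_nat_ge_1[OF p] by (rule less_le_trans[OF zero_less_one])
  then show ?thesis
    unfolding ctrace_def degree_part_tensor_of star_tensor_of[OF p] osh_map_Nil by (simp only: if_True list.size)
qed

text \<open>Truncated maps agree with the untruncated ones only on short words. This is enough for
  images under \<open>osh_map\<close> of words shorter than \<open>N\<close>, whose degrees stay
  below \<open>N\<close>.\<close>

lemma linear_agree_low_degree:
  fixes f g :: "'v::real_vector tensor \<Rightarrow> 'w::real_vector"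
  assumes "linear f" "linear g" "\<And>w. length w < N \<Longrightarrow> f (tensor_of w) = g (tensor_of w)"
    and "\<And>n. n \<ge> N \<Longrightarrow> component n a = 0"
  shows "f a = g a"
proof (cases N)
  case 0
  have "a = 0" by (rule tensor_eqI, subst assms(4)) (simp_all add: 0)
  then show ?thesis by (simp only: linear_0[OF assms(1)] linear_0[OF assms(2)])
next
  case (Suc M)
  have "f (component n a) = g (component n a)" if n: "n < N" for n
  proof -
    have "component n a \<in> span (tensor_of ` {w. length w = n})"
      using component_in_tensor_power[of n a] by (simp add: tensor_power_def)
    then show ?thesis
    proof (rule linear_eq_on[OF assms(1,2)])
      fix b :: "'v tensor" assume "b \<in> tensor_of ` {w. length w = n}"
      then obtain w where "b = tensor_of w" "length w < N" using n by auto
      then show "f b = g b" using assms(3) by simp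
    qed
  qed
  then have "(\<Sum>n\<le>M. f (component n a)) = (\<Sum>n\<le>M. g (component n a))"
    by (intro sum.cong) (auto simp: Suc)
  then have "f (\<Sum>n\<le>M. component n a) = g (\<Sum>n\<le>M. component n a)"
    by (simp only: linear_sum[OF assms(1)] linear_sum[OF assms(2)])
  moreover have "(\<Sum>n\<le>M. component n a) = a"
    by (rule sum_components) (rule assms(4), simp add: Suc)
  ultimately show ?thesis by (simp only:)
qed

text \<open>This is \<open>osh_map_compose\<close> evaluated by \<open>J\<close>. The truncations
  are invisible since \<open>osh_map\<close> neither raises the degree nor uses its argument on
  words longer than the given one.\<close>

theorem star_assoc:
  fixes J :: "real \<Rightarrow> 's::fin_dim tensor \<Rightarrow>\<^sub>L 'r::fin_dim" and K :: "real \<Rightarrow> 'u::fin_dim tensor \<Rightarrow>\<^sub>L 's"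
    and H :: "real \<Rightarrow> 'v::fin_dim tensor \<Rightarrow>\<^sub>L 'u"
  assumes p: "p \<ge> 1"
  shows "star p (star p J K) H t = star p J (star p K H) t"
proof (rule blinfun_tensor_eqI)
  fix w :: "'v list"
  let ?N = "\<lfloor>p\<rfloor>\<^sub>\<nat>"
  let ?h = "\<lambda>x. blinfun_apply (H t) (tensor_of x)" and ?k = "\<lambda>x. blinfun_apply (K t) (tensor_of x)"
  note mk = multilinear_osh_map[OF multilinear_blinfun[of "K t"]]
  show "blinfun_apply (star p (star p J K) H t) (tensor_of w) = blinfun_apply (star p J (star p K H) t) (tensor_of w)"
  proof (cases "length w < ?N")
    case True
    have "blinfun_apply (star p J K t) (osh_map ?h w) = blinfun_apply (J t) (tensor_lift (osh_map ?k) (osh_map ?h w))"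
    proof (rule linear_agree_low_degree[where N = ?N and f = "blinfun_apply (star p J K t)"
          and g = "\<lambda>a. blinfun_apply (J t) (tensor_lift (osh_map ?k) a)"])
      show "linear (\<lambda>a. blinfun_apply (J t) (tensor_lift (osh_map ?k) a))"
        by (rule linear_compose'[OF linear_tensor_lift[OF mk] linear_blinfun_apply])
    qed (use True in \<open>auto simp: linear_blinfun_apply star_tensor_of p tensor_lift_tensor_of mk component_osh_map_eq_0\<close>)
    also have "tensor_lift (osh_map ?k) (osh_map ?h w) = osh_map (\<lambda>x. blinfun_apply (K t) (osh_map ?h x)) w"
      unfolding osh_map_compose[OF multilinear_blinfun] tensor_lift_blinfun ..
    also have "\<dots> = osh_map (\<lambda>x. blinfun_apply (star p K H t) (tensor_of x)) w"
      by (rule osh_map_cong) (use True in \<open>simp add: star_tensor_of p\<close>)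
    finally show ?thesis using True by (simp add: star_tensor_of p)
  qed (simp add: star_tensor_of p)
qed

text \<open>Precomposition with a homomorphism of coalgebras respects convolution products, see
  \<open>osh_map_coalgebra\<close>.\<close>

theorem star_leibniz:
  fixes J :: "real \<Rightarrow> 'u::fin_dim tensor \<Rightarrow>\<^sub>L ('u2::fin_dim \<Rightarrow>\<^sub>L 'u3::fin_dim)"
    and K :: "real \<Rightarrow> 'u tensor \<Rightarrow>\<^sub>L ('u1::fin_dim \<Rightarrow>\<^sub>L 'u2)" and H :: "real \<Rightarrow> 'v::fin_dim tensor \<Rightarrow>\<^sub>L 'u"
  assumes p: "p \<ge> 1"
  shows "star p (leibniz p J K) H t = leibniz p (star p J H) (star p K H) t"
proof (rule blinfun_tensor_eqI)
  fix w :: "'v list"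
  let ?N = "\<lfloor>p\<rfloor>\<^sub>\<nat>"
  let ?h = "\<lambda>x. blinfun_apply (H t) (tensor_of x)"
  let ?f = "\<lambda>x y. blinfun_apply (J t) (tensor_of x) o\<^sub>L blinfun_apply (K t) (tensor_of y)"
  have f: "bimultilinear ?f"
    by (rule bimultilinear_bilinear[OF bilinear_blinfun_compose multilinear_blinfun multilinear_blinfun])
  show "blinfun_apply (star p (leibniz p J K) H t) (tensor_of w)
      = blinfun_apply (leibniz p (star p J H) (star p K H) t) (tensor_of w)"
  proof (cases "length w < ?N")
    case True
    have "blinfun_apply (leibniz p J K t) (osh_map ?h w) = cop ?f (osh_map ?h w)"
      by (rule linear_agree_low_degree[where N = ?N and f = "blinfun_apply (leibniz p J K t)" and g = "cop ?f"])
        (use True in \<open>auto simp: linear_blinfun_apply linear_cop f leibniz_tensor_of cop_tensor_of component_osh_map_eq_0\<close>)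
    also have "\<dots> = unshuffle_sum w (\<lambda>x y. tensor_lift2 ?f (osh_map ?h x) (osh_map ?h y))"
      by (rule osh_map_coalgebra[OF f])
    also have "\<dots> = unshuffle_sum w (\<lambda>x y. blinfun_apply (star p J H t) (tensor_of x) o\<^sub>L blinfun_apply (star p K H t) (tensor_of y))"
    proof (rule unshuffle_sum_cong[OF refl])
      fix x y :: "'v list" assume "length x + length y = length w"
      have "tensor_lift2 ?f a b = blinfun_apply (J t) a o\<^sub>L blinfun_apply (K t) b" for a b
        by (rule tensor_bilinear_eqI[of "tensor_lift2 ?f"])
          (auto simp: bilinear_tensor_lift2 f tensor_lift2_tensor_of
            intro!: bilinear_compose_linear bilinear_blinfun_compose linear_blinfun_apply)
      then show "tensor_lift2 ?f (osh_map ?h x) (osh_map ?h y)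
          = blinfun_apply (star p J H t) (tensor_of x) o\<^sub>L blinfun_apply (star p K H t) (tensor_of y)"
        using True \<open>length x + length y = length w\<close> by (simp add: star_tensor_of p)
    qed
    finally show ?thesis using True by (simp add: star_tensor_of p leibniz_tensor_of)
  qed (simp add: star_tensor_of p leibniz_tensor_of)
qed

lemma blinfun_compose_assoc: "f o\<^sub>L g o\<^sub>L h = f o\<^sub>L (g o\<^sub>L h)"
  by (rule blinfun_eqI) simp

text \<open>Convolution is associative because the coproduct is coassociative and composition is
  associative.\<close>

theorem leibniz_assoc:
  fixes J :: "real \<Rightarrow> 'v::fin_dim tensor \<Rightarrow>\<^sub>L ('u3::fin_dim \<Rightarrow>\<^sub>L 'u4::fin_dim)"
    and K :: "real \<Rightarrow> 'v tensor \<Rightarrow>\<^sub>L ('u2::fin_dim \<Rightarrow>\<^sub>L 'u3)"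
    and H :: "real \<Rightarrow> 'v tensor \<Rightarrow>\<^sub>L ('u1::fin_dim \<Rightarrow>\<^sub>L 'u2)"
  shows "leibniz p (leibniz p J K) H t = leibniz p J (leibniz p K H) t"
proof (rule blinfun_tensor_eqI)
  fix w :: "'v list"
  let ?N = "\<lfloor>p\<rfloor>\<^sub>\<nat>"
  let ?h = "\<lambda>x. blinfun_apply (H t) (tensor_of x)" and ?k = "\<lambda>x. blinfun_apply (K t) (tensor_of x)"
    and ?j = "\<lambda>x. blinfun_apply (J t) (tensor_of x)"
  show "blinfun_apply (leibniz p (leibniz p J K) H t) (tensor_of w)
      = blinfun_apply (leibniz p J (leibniz p K H) t) (tensor_of w)"
  proof (cases "length w < ?N")
    case True
    have "unshuffle_sum w (\<lambda>x y. blinfun_apply (leibniz p J K t) (tensor_of x) o\<^sub>L ?h y)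
        = unshuffle_sum w (\<lambda>x y. unshuffle_sum x (\<lambda>a b. ?j a o\<^sub>L ?k b o\<^sub>L ?h y))"
    proof (rule unshuffle_sum_cong[OF refl])
      fix x y :: "'v list" assume "length x + length y = length w"
      moreover have "linear (\<lambda>a. a o\<^sub>L ?h y)" using bilinear_blinfun_compose unfolding bilinear_def by blast
      ultimately show "blinfun_apply (leibniz p J K t) (tensor_of x) o\<^sub>L ?h y
          = unshuffle_sum x (\<lambda>a b. ?j a o\<^sub>L ?k b o\<^sub>L ?h y)"
        using True unshuffle_sum_linear[of "\<lambda>a. a o\<^sub>L ?h y" x] by (simp add: leibniz_tensor_of)
    qed
    also have "\<dots> = unshuffle_sum w (\<lambda>x y. unshuffle_sum y (\<lambda>b c. ?j x o\<^sub>L ?k b o\<^sub>L ?h c))"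
      by (rule unshuffle_sum_assoc)
    also have "\<dots> = unshuffle_sum w (\<lambda>x y. ?j x o\<^sub>L blinfun_apply (leibniz p K H t) (tensor_of y))"
    proof (rule unshuffle_sum_cong[OF refl])
      fix x y :: "'v list" assume "length x + length y = length w"
      have "linear (\<lambda>a :: 'u1 \<Rightarrow>\<^sub>L 'u3. ?j x o\<^sub>L a)" using bilinear_blinfun_compose unfolding bilinear_def by blast
      from unshuffle_sum_linear[OF this, of y] \<open>length x + length y = length w\<close> True
      show "unshuffle_sum y (\<lambda>b c. ?j x o\<^sub>L ?k b o\<^sub>L ?h c)
          = ?j x o\<^sub>L blinfun_apply (leibniz p K H t) (tensor_of y)"
        by (simp add: leibniz_tensor_of blinfun_compose_assoc)
    qed
    finally show ?thesis using True by (simp add: leibniz_tensor_of)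
  qed (simp add: leibniz_tensor_of)
qed

section \<open>Norm and coordinates of the tensor algebra\<close>

lemma norm_abs_tensor_le: "norm (abs_tensor x) \<le> formal_size x"
  unfolding norm_tensor_def
  by (rule cINF_lower) (auto intro!: bdd_belowI2[of _ 0] formal_size_nonneg)

lemma norm_tensor_of_le: "norm (tensor_of w) \<le> prod_list (map norm w)"
  using norm_abs_tensor_le[of "[(1, w)]"] by (simp add: tensor_of.abs_eq)

lemma norm_tensor_lift_le:
  fixes f :: "'v::fin_dim list \<Rightarrow> 'w::real_normed_vector"
  assumes f: "multilinear f" and K: "K \<ge> 0" "\<And>w. norm (f w) \<le> K * prod_list (map norm w)"
  shows "norm (tensor_lift f a) \<le> K * norm a"
proof (cases "K = 0")
  case True
  obtain x where x: "a = abs_tensor x" using ex_abs_tensor by blast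
  have "norm (formal_eval f x) \<le> K * formal_size x" by (rule norm_formal_eval_le[OF K])
  then show ?thesis using True by (simp add: x tensor_lift_abs[OF f])
next
  case False
  with K have K0: "K > 0" by simp
  have ne: "{x. abs_tensor x = a} \<noteq> {}" using ex_abs_tensor[of a] by auto
  have "norm (tensor_lift f a) / K \<le> norm a"
    unfolding norm_tensor_def
  proof (rule cINF_greatest[OF ne])
    fix x assume "x \<in> {x. abs_tensor x = a}"
    then have "norm (tensor_lift f a) \<le> K * formal_size x"
      using norm_formal_eval_le[OF K, of x] by (auto simp: tensor_lift_abs[OF f])
    then show "norm (tensor_lift f a) / K \<le> formal_size x"
      using K0 by (simp add: field_simps)
  qed
  then show ?thesis using K0 by (simp add: field_simps)
qed

lemma norm_component_le: "norm (component n a) \<le> norm a"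
proof -
  have "norm (if length w = n then tensor_of w else 0) \<le> 1 * prod_list (map norm w)" for w :: "'a list"
    using norm_tensor_of_le[of w] prod_list_norm_nonneg[of w] by simp
  from norm_tensor_lift_le[OF multilinear_component zero_le_one this, of a] show ?thesis
    by (simp add: component_def)
qed

lemma bounded_linear_component: "bounded_linear (component n)"
  unfolding bounded_linear_def bounded_linear_axioms_def
  using linear_component by (auto intro!: exI[of _ 1] norm_component_le)

lemma norm_tensor_mult_le: "norm (a \<otimes>\<^sub>t b) \<le> norm a * norm b"
proof -
  have b: "bimultilinear (\<lambda>x y. tensor_of (x @ y) :: 'a tensor)"
    by (intro bimultilinearI multilinear_append_left multilinear_append_right multilinear_tensor_of)
  have 1: "norm (tensor_lift (\<lambda>y. tensor_of (x @ y)) b) \<le> prod_list (map norm x) * norm b" for x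
    by (rule norm_tensor_lift_le[OF bimultilinearD(1)[OF b] prod_list_norm_nonneg])
      (use norm_tensor_of_le[of "x @ _"] in simp)
  have "norm (tensor_lift (\<lambda>x. tensor_lift (\<lambda>y. tensor_of (x @ y)) b) a) \<le> norm b * norm a"
    by (rule norm_tensor_lift_le[OF multilinear_tensor_lift_arg[OF b] norm_ge_zero])
      (use 1 in \<open>simp add: mult.commute\<close>)
  then show ?thesis by (simp add: tensor_mult_def mult.commute)
qed

lemma bounded_bilinear_tensor_mult: "bounded_bilinear ((\<otimes>\<^sub>t) :: 'v::fin_dim tensor \<Rightarrow> _)"
proof
  show "\<exists>K. \<forall>a b :: 'v tensor. norm (a \<otimes>\<^sub>t b) \<le> norm a * norm b * K"
    by (intro exI[of _ 1] allI) (simp add: norm_tensor_mult_le)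
qed (simp_all add: tensor_mult_add_left tensor_mult_add_right tensor_mult_scale_left tensor_mult_scale_right)

lemma bounded_linear_tensor_of_singleton: "bounded_linear (\<lambda>u :: 'u::fin_dim. tensor_of [u])"
  by (rule linear_imp_bounded_linear[OF linear_tensor_of_singleton])

section \<open>Coordinates with respect to words in a basis\<close>

definition basis_words :: "'v set \<Rightarrow> nat \<Rightarrow> 'v list set" where
  "basis_words B n = {w. set w \<subseteq> B \<and> length w = n}"

lemma basis_words_0: "basis_words B 0 = {[]}"
  by (auto simp: basis_words_def)

lemma sum_basis_words_Suc:
  assumes "finite B"
  shows "(\<Sum>w\<in>basis_words B (Suc n). g w) = (\<Sum>e\<in>B. \<Sum>w\<in>basis_words B n. g (e # w))"
proof -
  have "bij_betw (\<lambda>(e, w). e # w) (B \<times> basis_words B n) (basis_words B (Suc n))"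
    by (rule bij_betwI[of _ _ _ "\<lambda>w. (hd w, tl w)"]) (auto simp: basis_words_def length_Suc_conv)
  from sum.reindex_bij_betw[OF this, of g] show ?thesis
    by (simp add: sum.cartesian_product case_prod_unfold)
qed

primrec word_coeff :: "'v::real_vector set \<Rightarrow> 'v list \<Rightarrow> 'v list \<Rightarrow> real" where
  "word_coeff B [] w = (if w = [] then 1 else 0)"
| "word_coeff B (e # b) w = (case w of [] \<Rightarrow> 0 | v # w' \<Rightarrow> representation B v e * word_coeff B b w')"

lemma word_coeff_eq_0: "length w \<noteq> length b \<Longrightarrow> word_coeff B b w = 0"
  by (induction b arbitrary: w) (auto split: list.splits)

lemma multilinear_word_coeff:
  assumes B: "independent B" "span B = UNIV"
  shows "multilinear (word_coeff B b)"
proof (induction b)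
  case Nil
  show ?case by (rule multilinearI) auto
next
  case (Cons e b)
  show ?case
  proof (rule multilinearI)
    fix us ws x y r
    show "word_coeff B (e # b) (us @ (x + y) # ws) = word_coeff B (e # b) (us @ x # ws) + word_coeff B (e # b) (us @ y # ws)"
      using multilinear_add_arg[OF Cons.IH, of "tl us" x y ws] B
      by (cases us) (auto simp: representation_add algebra_simps)
    show "word_coeff B (e # b) (us @ (r *\<^sub>R x) # ws) = r *\<^sub>R word_coeff B (e # b) (us @ x # ws)"
      using multilinear_scale_arg[OF Cons.IH, of "tl us" r x ws] B
      by (cases us) (auto simp: representation_scale algebra_simps)
  qed
qed

lemma multilinear_expand:
  fixes f :: "'v::real_vector list \<Rightarrow> 'w::real_vector"
  assumes B: "finite B" "\<And>x. (\<Sum>b\<in>B. representation B x b *\<^sub>R b) = x" and f: "multilinear f"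
  shows "f w = (\<Sum>b\<in>basis_words B (length w). word_coeff B b w *\<^sub>R f b)"
  using f
proof (induction w arbitrary: f)
  case Nil
  then show ?case by (simp add: basis_words_0)
next
  case (Cons v w)
  have lin: "linear (\<lambda>v. f (v # w))" using multilinearD[OF Cons.prems, of "[]" w] by simp
  have "f (v # w) = (\<Sum>e\<in>B. representation B v e *\<^sub>R f (e # w))"
    by (subst B(2)[of v, symmetric]) (simp add: linear_sum[OF lin] linear_scale[OF lin])
  also have "\<dots> = (\<Sum>e\<in>B. representation B v e *\<^sub>R (\<Sum>b\<in>basis_words B (length w). word_coeff B b w *\<^sub>R f (e # b)))"
    by (intro sum.cong refl arg_cong2[of _ _ _ _ scaleR] Cons.IH multilinear_Cons Cons.prems)
  also have "\<dots> = (\<Sum>b\<in>basis_words B (length (v # w)). word_coeff B b (v # w) *\<^sub>R f b)"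
    by (simp add: sum_basis_words_Suc B(1) scaleR_sum_right)
  finally show ?case .
qed

definition tensor_coord :: "'v::real_vector set \<Rightarrow> 'v list \<Rightarrow> 'v tensor \<Rightarrow> real" where
  "tensor_coord B b = tensor_lift (word_coeff B b)"

text \<open>Through these coordinates, orders of magnitude, derivatives and sewing for tensors are
  reduced to finite sums. The last property says that the coordinate of a word \<open>b\<close> sees
  only the part of degree \<open>length b\<close>.\<close>

lemma ex_tensor_basis:
  obtains B :: "'v::fin_dim set" where "finite B"
    "\<And>b. bounded_linear (tensor_coord B b)"
    "\<And>n a. component n a = (\<Sum>b\<in>basis_words B n. tensor_coord B b a *\<^sub>R tensor_of b)"
    "\<And>b a n. tensor_coord B b (component n a) = (if length b = n then tensor_coord B b a else 0)"
proof -
  obtain B :: "'v set" where B: "finite B" "independent B" "span B = UNIV"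
    "\<And>x. (\<Sum>b\<in>B. representation B x b *\<^sub>R b) = x"
    by (metis fin_dim_basis)
  note m = multilinear_word_coeff[OF B(2,3)]
  have lin: "linear (tensor_coord B b)" for b
    unfolding tensor_coord_def by (rule linear_tensor_lift[OF m])
  have word: "tensor_coord B b (tensor_of w) = word_coeff B b w" for b w
    unfolding tensor_coord_def by (rule tensor_lift_tensor_of[OF m])
  have comp: "tensor_coord B b (component n a) = (if length b = n then tensor_coord B b a else 0)" for n b a
  proof (rule tensor_linear_eqI[of "\<lambda>a. tensor_coord B b (component n a)" "\<lambda>a. if length b = n then tensor_coord B b a else 0"])
    show "linear (\<lambda>a. tensor_coord B b (component n a))" by (rule linear_compose'[OF linear_component lin])
    show "linear (\<lambda>a. if length b = n then tensor_coord B b a else 0)"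
      using lin linear_zero by (cases "length b = n") simp_all
    show "tensor_coord B b (component n (tensor_of w)) = (if length b = n then tensor_coord B b (tensor_of w) else 0)" for w
      using word_coeff_eq_0[of w b B] by (auto simp: word linear_0[OF lin])
  qed
  show ?thesis
  proof
    show "bounded_linear (tensor_coord B b)" for b
    proof (rule bounded_linear_truncated[OF lin])
      fix n and a :: "'v tensor" assume "n \<ge> Suc (length b)" "a \<in> tensor_power n"
      then show "tensor_coord B b a = 0" using comp[of b n a] by (simp add: tensor_power_iff)
    qed
    show "component n a = (\<Sum>b\<in>basis_words B n. tensor_coord B b a *\<^sub>R tensor_of b)" for n a
    proof (rule tensor_linear_eqI[of "component n" "\<lambda>a. \<Sum>b\<in>basis_words B n. tensor_coord B b a *\<^sub>R tensor_of b"])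
      show "linear (\<lambda>a. \<Sum>b\<in>basis_words B n. tensor_coord B b a *\<^sub>R tensor_of b)"
        by (intro linear_compose_sum ballI linear_compose'[OF lin linear_scaleR_left])
      fix w :: "'v list"
      show "component n (tensor_of w) = (\<Sum>b\<in>basis_words B n. tensor_coord B b (tensor_of w) *\<^sub>R tensor_of b)"
      proof (cases "length w = n")
        case True
        show ?thesis
          unfolding word component_tensor_of if_P[OF True] unfolding True[symmetric]
          by (rule multilinear_expand[OF B(1,4) multilinear_tensor_of])
      next
        case False
        then show ?thesis by (simp add: word word_coeff_eq_0 basis_words_def)
      qed
    qed (rule linear_component)
  qed (rule B(1), rule comp)
qed

section \<open>Iterated derivatives\<close>

text \<open>Used in place of \<open>smooth\<close> because it can be verified by exhibiting all
  iterated derivatives, see \<open>nth_deriv_unique\<close>. For compositions these are explicit,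
  and the recursion for \<open>C_k\<close> need not be followed through the chain rule.\<close>

definition iter_differentiable :: "('a::fin_dim \<Rightarrow> 'b::fin_dim) \<Rightarrow> bool" where
  "iter_differentiable F \<longleftrightarrow> (\<forall>w x. nth_deriv F w differentiable (at x))"

lemma smooth_deriv: "smooth F \<Longrightarrow> smooth (\<lambda>x. frechet_derivative F (at x) v)"
  unfolding smooth_def by (metis C_k.simps(2))

lemma smooth_nth_deriv: "smooth F \<Longrightarrow> smooth (nth_deriv F w)"
proof (induction w)
  case (Cons v w)
  have "nth_deriv F (v # w) = (\<lambda>x. frechet_derivative (nth_deriv F w) (at x) v)" by (simp add: fun_eq_iff)
  then show ?case using smooth_deriv[OF Cons.IH[OF Cons.prems]] by simp
next
  case Nil
  have "nth_deriv F [] = F" by (simp add: fun_eq_iff)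
  with Nil show ?case by simp
qed

lemma smooth_imp_iter_differentiable: "smooth F \<Longrightarrow> iter_differentiable F"
  unfolding iter_differentiable_def using smooth_nth_deriv unfolding smooth_def by (metis C_k.simps(2))

lemma nth_deriv_Nil [simp]: "nth_deriv F [] = F"
  by (simp add: fun_eq_iff)

lemma nth_deriv_append: "nth_deriv F (u @ w) = nth_deriv (nth_deriv F w) u"
proof (induction u)
  case (Cons v u)
  show ?case by (rule ext) (simp add: Cons.IH)
qed simp

lemma has_derivative_nth_deriv:
  "iter_differentiable F \<Longrightarrow> (nth_deriv F w has_derivative (\<lambda>v. nth_deriv F (v # w) x)) (at x)"
  unfolding iter_differentiable_def using frechet_derivative_works by fastforce

lemma iter_differentiable_nth_deriv: "iter_differentiable F \<Longrightarrow> iter_differentiable (nth_deriv F w)"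
  unfolding iter_differentiable_def by (simp flip: nth_deriv_append)

lemma continuous_on_nth_deriv: "iter_differentiable F \<Longrightarrow> continuous_on S (nth_deriv F w)"
  by (meson continuous_at_imp_continuous_on has_derivative_continuous has_derivative_nth_deriv)

text \<open>A guess for all iterated derivatives is correct once it starts with \<open>F\<close> and
  differentiation adds a letter in front. The product rule, Faa di Bruno's formula and the
  derivatives of \<open>deriv_map F\<close> are obtained in this way.\<close>

lemma nth_deriv_unique:
  assumes "\<And>x. D [] x = F x" "\<And>w x. (D w has_derivative (\<lambda>v. D (v # w) x)) (at x)"
  shows "nth_deriv F w = D w" "iter_differentiable F"
proof -
  have eq: "nth_deriv F w = D w" for w
  proof (induction w)
    case Nil
    then show ?case using assms(1) by (simp add: fun_eq_iff)
  next
    case (Cons v w)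
    show ?case by (rule ext) (simp add: Cons.IH frechet_derivative_at[OF assms(2), symmetric])
  qed
  show "nth_deriv F w = D w" by (rule eq)
  show "iter_differentiable F"
    unfolding iter_differentiable_def eq using assms(2) differentiable_def by blast
qed

lemma nth_deriv_linear_combination:
  assumes "iter_differentiable F" "iter_differentiable G"
  shows "nth_deriv (\<lambda>x. r *\<^sub>R F x + s *\<^sub>R G x) w = (\<lambda>x. r *\<^sub>R nth_deriv F w x + s *\<^sub>R nth_deriv G w x)"
  by (rule nth_deriv_unique[where D = "\<lambda>w x. r *\<^sub>R nth_deriv F w x + s *\<^sub>R nth_deriv G w x"])
    (simp, intro has_derivative_add has_derivative_scaleR_right has_derivative_nth_deriv assms)

lemma multilinear_nth_deriv:
  assumes F: "iter_differentiable F"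
  shows "multilinear (\<lambda>w. nth_deriv F w x)"
proof (rule multilinearI)
  fix us ws a b and r :: real
  note d = iter_differentiable_nth_deriv[OF F]
  have lin: "linear (\<lambda>v. nth_deriv F (v # ws) x)" for x
    using has_derivative_nth_deriv[OF F] by (rule has_derivative_linear)
  have "nth_deriv F ((a + b) # ws) = (\<lambda>x. 1 *\<^sub>R nth_deriv F (a # ws) x + 1 *\<^sub>R nth_deriv F (b # ws) x)"
    using linear_add[OF lin] by (simp add: fun_eq_iff del: nth_deriv.simps)
  then have "nth_deriv F (us @ (a + b) # ws) = (\<lambda>x. 1 *\<^sub>R nth_deriv F (us @ a # ws) x + 1 *\<^sub>R nth_deriv F (us @ b # ws) x)"
    unfolding nth_deriv_append[of F us] using nth_deriv_linear_combination[OF d d] by metis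
  then show "nth_deriv F (us @ (a + b) # ws) x = nth_deriv F (us @ a # ws) x + nth_deriv F (us @ b # ws) x"
    by simp
  \<comment> \<open>The second coefficient 0 lets \<open>nth_deriv_linear_combination\<close> serve
    for scalar multiples as well.\<close>
  have "nth_deriv F ((r *\<^sub>R a) # ws) = (\<lambda>x. r *\<^sub>R nth_deriv F (a # ws) x + 0 *\<^sub>R nth_deriv F (a # ws) x)"
    using linear_scale[OF lin] by (simp add: fun_eq_iff del: nth_deriv.simps)
  then have "nth_deriv F (us @ (r *\<^sub>R a) # ws) = (\<lambda>x. r *\<^sub>R nth_deriv F (us @ a # ws) x + 0 *\<^sub>R nth_deriv F (us @ a # ws) x)"
    unfolding nth_deriv_append[of F us] using nth_deriv_linear_combination[OF d d] by metis
  then show "nth_deriv F (us @ (r *\<^sub>R a) # ws) x = r *\<^sub>R nth_deriv F (us @ a # ws) x"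
    by simp
qed

section \<open>The product rule and Faa di Bruno's formula\<close>

lemma has_derivative_unshuffle_sum:
  assumes "\<And>a b. length a + length b = length w \<Longrightarrow> (f a b has_derivative f' a b) net"
  shows "((\<lambda>x. unshuffle_sum w (\<lambda>a b. f a b x)) has_derivative (\<lambda>v. unshuffle_sum w (\<lambda>a b. f' a b v))) net"
  using assms
proof (induction w arbitrary: f f')
  case (Cons u w)
  show ?case
    unfolding unshuffle_sum.simps
    by (intro has_derivative_add Cons.IH) (rule Cons.prems, simp)+
qed simp

text \<open>A new derivative falls on one of the two factors, which is the recursion of
  \<open>unshuffle_sum\<close> at a new first letter.\<close>

theorem nth_deriv_compose_blinfun:
  fixes A :: "'a::fin_dim \<Rightarrow> 'u2::fin_dim \<Rightarrow>\<^sub>L 'u3::fin_dim" and B :: "'a \<Rightarrow> 'u1::fin_dim \<Rightarrow>\<^sub>L 'u2"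
  assumes "iter_differentiable A" "iter_differentiable B"
  shows "nth_deriv (\<lambda>x. A x o\<^sub>L B x) w = (\<lambda>x. unshuffle_sum w (\<lambda>a b. nth_deriv A a x o\<^sub>L nth_deriv B b x))"
  and "iter_differentiable (\<lambda>x. A x o\<^sub>L B x)"
proof -
  let ?D = "\<lambda>w x. unshuffle_sum w (\<lambda>a b. nth_deriv A a x o\<^sub>L nth_deriv B b x)"
  have "(?D w has_derivative (\<lambda>v. ?D (v # w) x)) (at x)" for w x
  proof -
    have "((\<lambda>x. nth_deriv A a x o\<^sub>L nth_deriv B b x) has_derivative
        (\<lambda>v. (nth_deriv A a x o\<^sub>L nth_deriv B (v # b) x) + (nth_deriv A (v # a) x o\<^sub>L nth_deriv B b x))) (at x)" for a b
      by (rule bounded_bilinear.FDERIV[OF bounded_bilinear_blinfun_compose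
        has_derivative_nth_deriv[OF assms(1)] has_derivative_nth_deriv[OF assms(2)]])
    then have "(?D w has_derivative (\<lambda>v. unshuffle_sum w (\<lambda>a b. (nth_deriv A a x o\<^sub>L nth_deriv B (v # b) x)
        + (nth_deriv A (v # a) x o\<^sub>L nth_deriv B b x)))) (at x)"
      by (rule has_derivative_unshuffle_sum)
    then show ?thesis by (simp add: unshuffle_sum_add add.commute del: nth_deriv.simps)
  qed
  from nth_deriv_unique[where D = ?D, OF _ this] show
    "nth_deriv (\<lambda>x. A x o\<^sub>L B x) w = ?D w" "iter_differentiable (\<lambda>x. A x o\<^sub>L B x)"
    by simp_all
qed

text \<open>Differentiation in direction \<open>v\<close> inserts \<open>v\<close> into one of the
  existing blocks. This gives all partitions of \<open>v # w\<close> except those in which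
  \<open>v\<close> is a block by itself. As \<open>v\<close> stands at the first position, such a
  block is also the first one, and the exceptional terms form the product that is
  subtracted.\<close>

lemma has_derivative_osh_map:
  fixes G :: "'a::fin_dim \<Rightarrow> 'u::fin_dim"
  assumes G: "iter_differentiable G"
  defines "P \<equiv> \<lambda>w x. osh_map (\<lambda>y. nth_deriv G y x) w"
  shows "(P w has_derivative (\<lambda>v. P (v # w) x - tensor_of [nth_deriv G [v] x] \<otimes>\<^sub>t P w x)) (at x)"
proof (induction w rule: length_rev_induct)
  case Nil
  have "P [v] x = tensor_of [nth_deriv G [v] x]" for v
    using osh_map_snoc[of "\<lambda>y. nth_deriv G y x" "[]" v] by (simp add: P_def)
  then show ?case by (simp add: P_def)
next
  case (snoc w u)
  let ?h = "\<lambda>y x. tensor_of [nth_deriv G (y @ [u]) x]"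
  let ?d = "\<lambda>v. tensor_of [nth_deriv G [v] x]"
  have h: "(?h y has_derivative (\<lambda>v. ?h (v # y) x)) (at x)" for y
    using bounded_linear.has_derivative[OF bounded_linear_tensor_of_singleton has_derivative_nth_deriv[OF G, of "y @ [u]"]]
    by simp
  have "((\<lambda>x. P a x \<otimes>\<^sub>t ?h b x) has_derivative
      (\<lambda>v. P a x \<otimes>\<^sub>t ?h (v # b) x + (P (v # a) x - ?d v \<otimes>\<^sub>t P a x) \<otimes>\<^sub>t ?h b x)) (at x)"
    if "length a + length b = length w" for a b
    by (rule bounded_bilinear.FDERIV[OF bounded_bilinear_tensor_mult snoc h]) (use that in simp)
  then have "((\<lambda>x. unshuffle_sum w (\<lambda>a b. P a x \<otimes>\<^sub>t ?h b x)) has_derivative (\<lambda>v. unshuffle_sum w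
      (\<lambda>a b. P a x \<otimes>\<^sub>t ?h (v # b) x + (P (v # a) x - ?d v \<otimes>\<^sub>t P a x) \<otimes>\<^sub>t ?h b x))) (at x)"
    by (rule has_derivative_unshuffle_sum)
  moreover have "unshuffle_sum w
      (\<lambda>a b. P a x \<otimes>\<^sub>t ?h (v # b) x + (P (v # a) x - ?d v \<otimes>\<^sub>t P a x) \<otimes>\<^sub>t ?h b x)
      = P (v # w @ [u]) x - ?d v \<otimes>\<^sub>t P (w @ [u]) x" for v
  proof -
    have "P (v # w @ [u]) x = unshuffle_sum w (\<lambda>a b. P (v # a) x \<otimes>\<^sub>t ?h b x)
        + unshuffle_sum w (\<lambda>a b. P a x \<otimes>\<^sub>t ?h (v # b) x)"
      unfolding P_def using osh_map_snoc[of "\<lambda>y. nth_deriv G y x" "v # w" u] by simp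
    moreover have "?d v \<otimes>\<^sub>t P (w @ [u]) x = unshuffle_sum w (\<lambda>a b. (?d v \<otimes>\<^sub>t P a x) \<otimes>\<^sub>t ?h b x)"
      unfolding P_def osh_map_snoc tensor_mult_assoc by (rule unshuffle_sum_linear[OF linear_tensor_mult_right])
    moreover have "unshuffle_sum w (\<lambda>a b. P (v # a) x \<otimes>\<^sub>t ?h b x)
        = unshuffle_sum w (\<lambda>a b. (P (v # a) x - ?d v \<otimes>\<^sub>t P a x) \<otimes>\<^sub>t ?h b x) + unshuffle_sum w (\<lambda>a b. (?d v \<otimes>\<^sub>t P a x) \<otimes>\<^sub>t ?h b x)"
      unfolding unshuffle_sum_add[symmetric] tensor_mult_diff_left by simp
    ultimately show ?thesis by (simp add: unshuffle_sum_add)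
  qed
  ultimately show ?case unfolding P_def osh_map_snoc by (simp add: osh_map_snoc)
qed

text \<open>Faa di Bruno's formula: ordered shuffles of \<open>w\<close> enumerate the set partitions of its letters.\<close>

theorem nth_deriv_compose:
  fixes G :: "'a::fin_dim \<Rightarrow> 'u::fin_dim" and F :: "'u \<Rightarrow> 's::fin_dim"
  assumes F: "iter_differentiable F" and G: "iter_differentiable G"
  shows "nth_deriv (F \<circ> G) w = (\<lambda>x. tensor_lift (\<lambda>u. nth_deriv F u (G x)) (osh_map (\<lambda>y. nth_deriv G y x) w))"
    and "iter_differentiable (F \<circ> G)"
proof -
  let ?P = "\<lambda>w x. osh_map (\<lambda>y. nth_deriv G y x) w"
  let ?L = "\<lambda>x. tensor_lift (\<lambda>u. nth_deriv F u (G x))"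
  let ?D = "\<lambda>w x. ?L x (?P w x)"
  note mF = multilinear_nth_deriv[OF F]
  have lL: "linear (?L x)" for x by (rule linear_tensor_lift[OF mF])
  obtain B :: "'u set" where B: "finite B" "\<And>b. bounded_linear (tensor_coord B b)"
    "\<And>n a. component n a = (\<Sum>b\<in>basis_words B n. tensor_coord B b a *\<^sub>R tensor_of b)"
    using ex_tensor_basis by metis
  \<comment> \<open>Both the form and the tensor depend on the base point. In coordinates their
    pairing becomes a finite sum of products, to which the ordinary product rule applies.\<close>
  have expand: "\<phi> a = (\<Sum>n\<le>N. \<Sum>b\<in>basis_words B n. tensor_coord B b a *\<^sub>R \<phi> (tensor_of b))"
    if \<phi>: "linear \<phi>" and a: "\<And>n. n > N \<Longrightarrow> component n a = 0" for \<phi> :: "'u tensor \<Rightarrow> 's" and a N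
  proof -
    have "\<phi> a = \<phi> (\<Sum>n\<le>N. component n a)" by (subst sum_components[OF a]) simp_all
    also have "\<dots> = (\<Sum>n\<le>N. \<phi> (component n a))" by (rule linear_sum[OF \<phi>])
    also have "\<dots> = (\<Sum>n\<le>N. \<Sum>b\<in>basis_words B n. tensor_coord B b a *\<^sub>R \<phi> (tensor_of b))"
      unfolding B(3) by (simp only: linear_sum[OF \<phi>] linear_scale[OF \<phi>])
    finally show ?thesis .
  qed
  have "(?D w has_derivative (\<lambda>v. ?D (v # w) x)) (at x)" for w x
  proof -
    let ?N = "Suc (length w)"
    have P0: "component n (?P w x) = 0" if "n > ?N" for n x
      using that by (simp add: component_osh_map_eq_0)
    \<comment> \<open>\<open>Q v\<close> collects the partitions of \<open>v # w\<close> in which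
      \<open>v\<close> joins a block of \<open>w\<close>. Those with \<open>v\<close> as a block of
      its own come from differentiating the outer function along \<open>G\<close>.\<close>
    define Q where "Q v = ?P (v # w) x - tensor_of [nth_deriv G [v] x] \<otimes>\<^sub>t ?P w x" for v
    have Q0: "component n (Q v) = 0" if n: "n > ?N" for n v
    proof -
      have "component i (tensor_of [nth_deriv G [v] x]) \<otimes>\<^sub>t component (n - i) (?P w x) = 0" for i
        using n by (cases "i = 1") (auto simp: component_osh_map_eq_0)
      then show ?thesis using n by (simp add: Q_def component_osh_map_eq_0 component_mult del: component_tensor_of)
    qed
    have D: "?D w = (\<lambda>x. \<Sum>n\<le>?N. \<Sum>b\<in>basis_words B n. tensor_coord B b (?P w x) *\<^sub>R nth_deriv F b (G x))"
      by (rule ext) (subst expand[OF lL P0], assumption, simp only: tensor_lift_tensor_of[OF mF])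
    have Gd: "(G has_derivative (\<lambda>v. nth_deriv G [v] x)) (at x)"
      using has_derivative_nth_deriv[OF G, of "[]"] by simp
    have "((\<lambda>x. tensor_coord B b (?P w x) *\<^sub>R nth_deriv F b (G x)) has_derivative
       (\<lambda>v. tensor_coord B b (?P w x) *\<^sub>R nth_deriv F (nth_deriv G [v] x # b) (G x)
          + tensor_coord B b (Q v) *\<^sub>R nth_deriv F b (G x))) (at x)" for b
      unfolding Q_def
      by (intro has_derivative_scaleR bounded_linear.has_derivative[OF B(2)] has_derivative_osh_map[OF G]
         has_derivative_compose[OF Gd, of "nth_deriv F b" "\<lambda>v. nth_deriv F (v # b) (G x)"] has_derivative_nth_deriv[OF F])
    then have "(?D w has_derivative (\<lambda>v. \<Sum>n\<le>?N. \<Sum>b\<in>basis_words B n.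
        tensor_coord B b (?P w x) *\<^sub>R nth_deriv F (nth_deriv G [v] x # b) (G x)
          + tensor_coord B b (Q v) *\<^sub>R nth_deriv F b (G x))) (at x)"
      unfolding D by (intro has_derivative_sum)
    moreover have "(\<Sum>n\<le>?N. \<Sum>b\<in>basis_words B n.
        tensor_coord B b (?P w x) *\<^sub>R nth_deriv F (nth_deriv G [v] x # b) (G x)
          + tensor_coord B b (Q v) *\<^sub>R nth_deriv F b (G x)) = ?D (v # w) x" for v
    proof -
      have l: "linear (\<lambda>a. ?L x (tensor_of [nth_deriv G [v] x] \<otimes>\<^sub>t a))"
        by (rule linear_compose'[OF linear_tensor_mult_right lL])
      have "?L x (tensor_of [nth_deriv G [v] x] \<otimes>\<^sub>t ?P w x)
          = (\<Sum>n\<le>?N. \<Sum>b\<in>basis_words B n. tensor_coord B b (?P w x) *\<^sub>R nth_deriv F (nth_deriv G [v] x # b) (G x))"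
        by (subst expand[OF l P0], assumption) (simp only: tensor_mult_tensor_of tensor_lift_tensor_of[OF mF] append.simps)
      moreover have "?L x (Q v) = (\<Sum>n\<le>?N. \<Sum>b\<in>basis_words B n. tensor_coord B b (Q v) *\<^sub>R nth_deriv F b (G x))"
        by (subst expand[OF lL Q0], assumption) (simp only: tensor_lift_tensor_of[OF mF])
      moreover have "?D (v # w) x = ?L x (tensor_of [nth_deriv G [v] x] \<otimes>\<^sub>t ?P w x) + ?L x (Q v)"
        unfolding linear_add[OF lL, symmetric] Q_def by simp
      ultimately show ?thesis by (simp only: sum.distrib)
    qed
    ultimately show ?thesis by simp
  qed
  from nth_deriv_unique[where D = ?D and F = "F \<circ> G", OF _ this] show
    "nth_deriv (F \<circ> G) w = ?D w" "iter_differentiable (F \<circ> G)"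
    by (simp_all add: tensor_lift_tensor_of mF)
qed

section \<open>Controlled paths obtained from smooth functions\<close>

lemma smooth_controlled_eq:
  "smooth_controlled p F X t = trunc_blinfun \<lfloor>p\<rfloor>\<^sub>\<nat> (\<lambda>w. nth_deriv F w (X t))"
  by (simp add: smooth_controlled_def trunc_blinfun_def)

lemma smooth_controlled_tensor_of:
  "iter_differentiable F \<Longrightarrow> blinfun_apply (smooth_controlled p F X t) (tensor_of w)
    = (if length w < \<lfloor>p\<rfloor>\<^sub>\<nat> then nth_deriv F w (X t) else 0)"
  unfolding smooth_controlled_eq by (rule trunc_blinfun_tensor_of[OF multilinear_nth_deriv])

lemma ctrace_smooth_controlled:
  assumes "p \<ge> 1" "iter_differentiable F"
  shows "ctrace (smooth_controlled p F X) t = F (X t)"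
proof -
  have "length [] < \<lfloor>p\<rfloor>\<^sub>\<nat>"
    unfolding list.size using floor_nat_ge_1[OF assms(1)] by (rule less_le_trans[OF zero_less_one])
  then show ?thesis
    unfolding ctrace_def degree_part_tensor_of smooth_controlled_tensor_of[OF assms(2)]
    by simp
qed

text \<open>Faa di Bruno's formula in the form \<open>nth_deriv_compose\<close> is the formula for
  \<open>star\<close> on words; for words shorter than \<open>N\<close> the truncation of the
  derivatives of \<open>F\<close> and \<open>G\<close> has no effect.\<close>

theorem star_smooth_controlled:
  fixes G :: "'v::fin_dim \<Rightarrow> 'u::fin_dim" and F :: "'u \<Rightarrow> 's::fin_dim"
  assumes p: "p \<ge> 1" and F: "iter_differentiable F" and G: "iter_differentiable G"
    and Y: "Y t = G (X t)"
  shows "star p (smooth_controlled p F Y) (smooth_controlled p G X) t = smooth_controlled p (F \<circ> G) X t"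
proof (rule blinfun_tensor_eqI)
  fix w :: "'v list"
  let ?N = "\<lfloor>p\<rfloor>\<^sub>\<nat>"
  let ?P = "osh_map (\<lambda>y. nth_deriv G y (X t)) w"
  note FG = nth_deriv_compose[OF F G]
  note mF = multilinear_nth_deriv[OF F]
  show "blinfun_apply (star p (smooth_controlled p F Y) (smooth_controlled p G X) t) (tensor_of w)
      = blinfun_apply (smooth_controlled p (F \<circ> G) X t) (tensor_of w)"
  proof (cases "length w < ?N")
    case True
    have "osh_map (\<lambda>x. blinfun_apply (smooth_controlled p G X t) (tensor_of x)) w = ?P"
      by (rule osh_map_cong) (use True in \<open>simp add: smooth_controlled_tensor_of G\<close>)
    moreover have "blinfun_apply (smooth_controlled p F Y t) ?P = tensor_lift (\<lambda>u. nth_deriv F u (Y t)) ?P"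
    proof (rule linear_agree_low_degree[where N = ?N and f = "blinfun_apply (smooth_controlled p F Y t)"
          and g = "tensor_lift (\<lambda>u. nth_deriv F u (Y t))"])
      show "component n ?P = 0" if "n \<ge> ?N" for n
        using that True by (intro component_osh_map_eq_0) simp
      show "blinfun_apply (smooth_controlled p F Y t) (tensor_of u) = tensor_lift (\<lambda>u. nth_deriv F u (Y t)) (tensor_of u)"
        if "length u < ?N" for u
        unfolding smooth_controlled_tensor_of[OF F] tensor_lift_tensor_of[OF mF] using that by simp
    qed (rule linear_blinfun_apply linear_tensor_lift mF)+
    ultimately show ?thesis
      using True unfolding star_tensor_of[OF p] smooth_controlled_tensor_of[OF FG(2)] FG(1) Y by simp
  next
    case False
    then show ?thesis unfolding star_tensor_of[OF p] smooth_controlled_tensor_of[OF FG(2)] by simp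
  qed
qed

theorem leibniz_smooth_controlled:
  fixes A :: "'v::fin_dim \<Rightarrow> 'u2::fin_dim \<Rightarrow>\<^sub>L 'u3::fin_dim" and B :: "'v \<Rightarrow> 'u1::fin_dim \<Rightarrow>\<^sub>L 'u2"
  assumes A: "iter_differentiable A" and B: "iter_differentiable B"
  shows "leibniz p (smooth_controlled p A X) (smooth_controlled p B X) t
    = smooth_controlled p (\<lambda>x. A x o\<^sub>L B x) X t"
proof (rule blinfun_tensor_eqI)
  fix w :: "'v list"
  note AB = nth_deriv_compose_blinfun[OF A B]
  have "unshuffle_sum w (\<lambda>x y. blinfun_apply (smooth_controlled p A X t) (tensor_of x)
        o\<^sub>L blinfun_apply (smooth_controlled p B X t) (tensor_of y))
      = unshuffle_sum w (\<lambda>a b. nth_deriv A a (X t) o\<^sub>L nth_deriv B b (X t))" if "length w < \<lfloor>p\<rfloor>\<^sub>\<nat>"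
    using that unfolding smooth_controlled_tensor_of[OF A] smooth_controlled_tensor_of[OF B]
    by (intro unshuffle_sum_cong) simp_all
  then show "blinfun_apply (leibniz p (smooth_controlled p A X) (smooth_controlled p B X) t) (tensor_of w)
      = blinfun_apply (smooth_controlled p (\<lambda>x. A x o\<^sub>L B x) X t) (tensor_of w)"
    unfolding leibniz_tensor_of smooth_controlled_tensor_of[OF AB(2)] AB(1) by simp
qed

text \<open>On a finite-dimensional domain pointwise differentiability suffices: a linear map is the
  sum over a basis of the rank one maps \<open>E b (f b)\<close>, which depend linearly on the
  values \<open>f b\<close>.\<close>

lemma has_derivative_blinfunI:
  fixes A :: "'a::real_normed_vector \<Rightarrow> 'c::fin_dim \<Rightarrow>\<^sub>L 'b::real_normed_vector"
  assumes "\<And>v. ((\<lambda>x. blinfun_apply (A x) v) has_derivative (\<lambda>u. blinfun_apply (A' u) v)) (at x)"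
  shows "(A has_derivative A') (at x)"
proof -
  obtain B :: "'c set" where B: "finite B" "independent B" "span B = UNIV"
    "\<And>x. (\<Sum>b\<in>B. representation B x b *\<^sub>R b) = x"
    by (metis fin_dim_basis)
  have rep: "bounded_linear (\<lambda>v. representation B v b)" for b
    using B by (intro linear_imp_bounded_linear linearI) (auto simp: representation_add representation_scale)
  define E where "E b c = blinfun_scaleR_left c o\<^sub>L Blinfun (\<lambda>v. representation B v b)" for b and c :: 'b
  have E: "blinfun_apply (E b c) v = representation B v b *\<^sub>R c" for b c v
    by (simp add: E_def bounded_linear_Blinfun_apply[OF rep])
  have bE: "bounded_linear (E b)" for b
    unfolding E_def
    by (rule bounded_linear_compose[OF bounded_bilinear.bounded_linear_left[OF bounded_bilinear_blinfun_compose]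
          bounded_linear_blinfun_scaleR_left])
  have expand: "f = (\<Sum>b\<in>B. E b (blinfun_apply f b))" for f
  proof (rule blinfun_eqI)
    fix v
    have "blinfun_apply f v = blinfun_apply f (\<Sum>b\<in>B. representation B v b *\<^sub>R b)" by (simp add: B(4))
    then show "blinfun_apply f v = blinfun_apply (\<Sum>b\<in>B. E b (blinfun_apply f b)) v"
      by (simp add: blinfun.sum_left blinfun.sum_right blinfun.scaleR_right E)
  qed
  have "((\<lambda>x. \<Sum>b\<in>B. E b (blinfun_apply (A x) b)) has_derivative (\<lambda>u. \<Sum>b\<in>B. E b (blinfun_apply (A' u) b))) (at x)"
    by (intro has_derivative_sum bounded_linear.has_derivative[OF bE] assms)
  then show ?thesis unfolding expand[symmetric] .
qed

lemma deriv_map_apply: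
  assumes F: "iter_differentiable F"
  shows "blinfun_apply (deriv_map F x) v = nth_deriv F [v] x"
proof -
  have "(F has_derivative (\<lambda>v. nth_deriv F [v] x)) (at x)"
    using has_derivative_nth_deriv[OF F, of "[]"] by simp
  then have "bounded_linear (frechet_derivative F (at x))"
    using has_derivative_bounded_linear frechet_derivative_at by metis
  then show ?thesis by (simp add: deriv_map_def bounded_linear_Blinfun_apply)
qed

text \<open>The argument of the linear map is the direction of the innermost derivative, hence the
  last letter of the word; further derivatives are added in front.\<close>

lemma iter_differentiable_deriv_map:
  fixes F :: "'a::fin_dim \<Rightarrow> 'b::fin_dim"
  assumes F: "iter_differentiable F"
  shows "iter_differentiable (deriv_map F)"
proof -
  let ?D = "\<lambda>w x. Blinfun (\<lambda>v. nth_deriv F (w @ [v]) x)"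
  have D: "blinfun_apply (?D w x) v = nth_deriv F (w @ [v]) x" for w x v
    using multilinearD[OF multilinear_nth_deriv[OF F], of w "[]" x]
    by (simp add: bounded_linear_Blinfun_apply linear_imp_bounded_linear)
  have "(?D w has_derivative (\<lambda>u. ?D (u # w) x)) (at x)" for w x
    unfolding D by (rule has_derivative_blinfunI, unfold D)
      (use has_derivative_nth_deriv[OF F, of "w @ [_]" x] in simp)
  moreover have "?D [] x = deriv_map F x" for x
    by (rule blinfun_eqI) (use D[of "[]" x] in \<open>simp only: append_Nil deriv_map_apply[OF F]\<close>)
  ultimately show ?thesis using nth_deriv_unique(2)[where D = ?D and F = "deriv_map F"] by blast
qed

lemma deriv_map_compose:
  assumes F: "iter_differentiable F" and G: "iter_differentiable G"
  shows "deriv_map (G \<circ> F) x = deriv_map G (F x) o\<^sub>L deriv_map F x"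
proof (rule blinfun_eqI)
  fix v
  have "(F has_derivative (\<lambda>v. nth_deriv F [v] x)) (at x)"
    using has_derivative_nth_deriv[OF F, of "[]"] by simp
  moreover have "(G has_derivative (\<lambda>v. nth_deriv G [v] (F x))) (at (F x))"
    using has_derivative_nth_deriv[OF G, of "[]"] by simp
  ultimately have "((\<lambda>x. G (F x)) has_derivative (\<lambda>v. nth_deriv G [nth_deriv F [v] x] (F x))) (at x)"
    by (rule has_derivative_compose)
  moreover have "(G \<circ> F has_derivative (\<lambda>v. nth_deriv (G \<circ> F) [v] x)) (at x)"
    using has_derivative_nth_deriv[OF nth_deriv_compose(2)[OF G F], of "[]" x] by simp
  ultimately have "(\<lambda>v. nth_deriv (G \<circ> F) [v] x) = (\<lambda>v. nth_deriv G [nth_deriv F [v] x] (F x))"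
    unfolding comp_def by (rule has_derivative_unique[rotated])
  then show "blinfun_apply (deriv_map (G \<circ> F) x) v = blinfun_apply (deriv_map G (F x) o\<^sub>L deriv_map F x) v"
    unfolding deriv_map_apply[OF nth_deriv_compose(2)[OF G F]] blinfun_apply_blinfun_compose
      deriv_map_apply[OF F] deriv_map_apply[OF G] by meson
qed

section \<open>Symmetry of derivatives and Taylor's formula\<close>

lemma norm_increment_bound:
  fixes \<phi> :: "real \<Rightarrow> 'b::real_normed_vector"
  assumes "0 \<le> h" "\<And>a. a \<in> {0..h} \<Longrightarrow> (\<phi> has_vector_derivative \<phi>' a) (at a)"
    and "\<And>a. a \<in> {0..h} \<Longrightarrow> norm (\<phi>' a - c) \<le> K"
  shows "norm (\<phi> h - \<phi> 0 - h *\<^sub>R c) \<le> K * h"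
proof -
  have "norm ((\<phi> h - h *\<^sub>R c) - (\<phi> 0 - 0 *\<^sub>R c)) \<le> K * norm (h - 0)"
  proof (rule differentiable_bound[where S = "{0..h}" and f = "\<lambda>a. \<phi> a - a *\<^sub>R c" and f' = "\<lambda>a t. t *\<^sub>R (\<phi>' a - c)"])
    fix a assume a: "a \<in> {0..h}"
    have "((\<lambda>a. \<phi> a - a *\<^sub>R c) has_vector_derivative \<phi>' a - 1 *\<^sub>R c) (at a)"
      by (intro has_vector_derivative_diff assms(2) a has_vector_derivative_scaleR[of "\<lambda>x. x" 1 _ _ "\<lambda>x. c" 0, simplified])
        (auto intro!: derivative_eq_intros)
    then show "((\<lambda>a. \<phi> a - a *\<^sub>R c) has_derivative (\<lambda>t. t *\<^sub>R (\<phi>' a - c))) (at a within {0..h})"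
      by (simp add: has_vector_derivative_def has_derivative_at_withinI)
    show "onorm (\<lambda>t. t *\<^sub>R (\<phi>' a - c)) \<le> K"
    proof (rule onorm_bound)
      show "0 \<le> K" using norm_ge_zero assms(3)[OF a] by (rule order_trans)
      show "norm (t *\<^sub>R (\<phi>' a - c)) \<le> K * norm t" for t
        using mult_left_mono[OF assms(3)[OF a], of "\<bar>t\<bar>"] by (simp add: mult.commute)
    qed
  qed (use assms(1) in auto)
  moreover have "(\<phi> h - h *\<^sub>R c) - (\<phi> 0 - 0 *\<^sub>R c) = \<phi> h - \<phi> 0 - h *\<^sub>R c" by simp
  ultimately show ?thesis using assms(1) by (simp only: diff_zero real_norm_def abs_of_nonneg)
qed

lemma nth_deriv_line:
  assumes F: "iter_differentiable F"
  shows "((\<lambda>a. nth_deriv F w (x + a *\<^sub>R u)) has_vector_derivative nth_deriv F (u # w) (x + a *\<^sub>R u)) (at a)"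
proof -
  have "((\<lambda>a. x + a *\<^sub>R u) has_derivative (\<lambda>t. t *\<^sub>R u)) (at a)"
    by (auto intro!: derivative_eq_intros)
  from has_derivative_compose[OF this has_derivative_nth_deriv[OF F, of w]]
  have "((\<lambda>a. nth_deriv F w (x + a *\<^sub>R u)) has_derivative (\<lambda>t. nth_deriv F (t *\<^sub>R u # w) (x + a *\<^sub>R u))) (at a)" .
  moreover have "nth_deriv F (t *\<^sub>R u # w) y = t *\<^sub>R nth_deriv F (u # w) y" for t y
    using multilinear_scale_arg[OF multilinear_nth_deriv[OF F], of "[]" t u w y] by (simp only: append_Nil)
  ultimately show ?thesis unfolding has_vector_derivative_def by (simp only:)
qed

text \<open>The mean value inequality is applied twice: to the difference of \<open>F\<close> along
  two parallel segments in direction \<open>u\<close>, and inside it to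
  \<open>nth_deriv F [u]\<close> in direction \<open>v\<close>.\<close>

lemma second_difference_bound:
  assumes F: "iter_differentiable F" and e: "e > 0"
  shows "\<exists>d>0. \<forall>h. 0 \<le> h \<and> h < d \<longrightarrow> norm (F (x + h *\<^sub>R u + h *\<^sub>R v) - F (x + h *\<^sub>R u) - F (x + h *\<^sub>R v) + F x
    - (h * h) *\<^sub>R nth_deriv F [v, u] x) \<le> e * (h * h)"
proof -
  have "isCont (nth_deriv F [v, u]) x" using has_derivative_nth_deriv[OF F] by (rule has_derivative_continuous)
  then obtain \<delta> where \<delta>: "\<delta> > 0" "\<And>y. norm (y - x) < \<delta> \<Longrightarrow> norm (nth_deriv F [v, u] y - nth_deriv F [v, u] x) < e"
    using e unfolding continuous_at_eps_delta dist_norm by blast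
  \<comment> \<open>For \<open>a, b \<le> h < d\<close> the point \<open>x + a u + b v\<close> stays
    within \<delta> of \<open>x\<close>; the summand 1 keeps the denominator positive.\<close>
  define d where "d = \<delta> / (norm u + norm v + 1)"
  have d: "d > 0" using \<delta> by (simp add: d_def add_nonneg_pos)
  have "norm (F (x + h *\<^sub>R u + h *\<^sub>R v) - F (x + h *\<^sub>R u) - F (x + h *\<^sub>R v) + F x
      - (h * h) *\<^sub>R nth_deriv F [v, u] x) \<le> e * (h * h)" if h: "0 \<le> h" "h < d" for h
  proof -
    have near: "norm (nth_deriv F [v, u] (x + a *\<^sub>R u + b *\<^sub>R v) - nth_deriv F [v, u] x) \<le> e"
      if "a \<in> {0..h}" "b \<in> {0..h}" for a b
    proof -
      have "norm (a *\<^sub>R u + b *\<^sub>R v) \<le> a * norm u + b * norm v"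
        using that norm_triangle_ineq[of "a *\<^sub>R u" "b *\<^sub>R v"] by simp
      also have "\<dots> \<le> h * norm u + h * norm v" using that by (intro add_mono mult_right_mono) auto
      also have "\<dots> \<le> h * (norm u + norm v + 1)" using h by (simp add: algebra_simps)
      also have "\<dots> < d * (norm u + norm v + 1)" using h by (intro mult_strict_right_mono) (auto simp: add_nonneg_pos)
      also have "\<dots> = \<delta>" using add_nonneg_pos[of "norm u + norm v" 1] by (simp add: d_def)
      finally show ?thesis using \<delta>(2)[of "x + a *\<^sub>R u + b *\<^sub>R v"] by (simp add: add.assoc less_imp_le)
    qed
    have inner: "norm (nth_deriv F [u] (x + h *\<^sub>R v + a *\<^sub>R u) - nth_deriv F [u] (x + a *\<^sub>R u)
        - h *\<^sub>R nth_deriv F [v, u] x) \<le> e * h" if "a \<in> {0..h}" for a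
      using norm_increment_bound[OF h(1), of "\<lambda>b. nth_deriv F [u] (x + a *\<^sub>R u + b *\<^sub>R v)", OF nth_deriv_line[OF F] near[OF that]]
      by (simp add: add_ac del: nth_deriv.simps)
    have "norm ((F (x + h *\<^sub>R v + h *\<^sub>R u) - F (x + h *\<^sub>R u)) - (F (x + h *\<^sub>R v + 0 *\<^sub>R u) - F (x + 0 *\<^sub>R u))
        - h *\<^sub>R (h *\<^sub>R nth_deriv F [v, u] x)) \<le> (e * h) * h"
    proof (rule norm_increment_bound[OF h(1) _ inner])
      fix a
      show "((\<lambda>a. F (x + h *\<^sub>R v + a *\<^sub>R u) - F (x + a *\<^sub>R u)) has_vector_derivative
         nth_deriv F [u] (x + h *\<^sub>R v + a *\<^sub>R u) - nth_deriv F [u] (x + a *\<^sub>R u)) (at a)"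
        using has_vector_derivative_diff[OF nth_deriv_line[OF F, of "[]"] nth_deriv_line[OF F, of "[]"]]
        unfolding nth_deriv_Nil .
    qed
    then show ?thesis by (simp add: algebra_simps)
  qed
  with d show ?thesis by blast
qed

text \<open>The second difference is symmetric in \<open>u\<close> and \<open>v\<close>, and after
  division by \<open>h * h\<close> it approaches both derivatives.\<close>

lemma nth_deriv_symmetric2:
  assumes F: "iter_differentiable F"
  shows "nth_deriv F [u, v] x = nth_deriv F [v, u] x"
proof -
  let ?a = "nth_deriv F [v, u] x" and ?b = "nth_deriv F [u, v] x"
  have "norm (?b - ?a) \<le> 0 + e" if e: "e > 0" for e
  proof -
    have e2: "e / 2 > 0" using e by simp
    obtain d1 where d1: "d1 > 0" "\<And>h. 0 \<le> h \<Longrightarrow> h < d1 \<Longrightarrow> norm (F (x + h *\<^sub>R u + h *\<^sub>R v) - F (x + h *\<^sub>R u) - F (x + h *\<^sub>R v) + F x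
      - (h * h) *\<^sub>R ?a) \<le> e / 2 * (h * h)" using second_difference_bound[OF F e2, of x u v] by blast
    obtain d2 where d2: "d2 > 0" "\<And>h. 0 \<le> h \<Longrightarrow> h < d2 \<Longrightarrow> norm (F (x + h *\<^sub>R v + h *\<^sub>R u) - F (x + h *\<^sub>R v) - F (x + h *\<^sub>R u) + F x
      - (h * h) *\<^sub>R ?b) \<le> e / 2 * (h * h)" using second_difference_bound[OF F e2, of x v u] by blast
    define h where "h = min d1 d2 / 2"
    have h: "h > 0" "h < d1" "h < d2" using d1(1) d2(1) by (auto simp: h_def)
    define D where "D = F (x + h *\<^sub>R u + h *\<^sub>R v) - F (x + h *\<^sub>R u) - F (x + h *\<^sub>R v) + F x"
    have "D = F (x + h *\<^sub>R v + h *\<^sub>R u) - F (x + h *\<^sub>R v) - F (x + h *\<^sub>R u) + F x" by (simp add: D_def algebra_simps)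
    then have 1: "norm (D - (h * h) *\<^sub>R ?a) \<le> e / 2 * (h * h)" "norm (D - (h * h) *\<^sub>R ?b) \<le> e / 2 * (h * h)"
      using d1(2)[of h] d2(2)[of h] h by (simp_all only: D_def less_imp_le)
    have "(h * h) * norm (?b - ?a) = norm ((D - (h * h) *\<^sub>R ?a) - (D - (h * h) *\<^sub>R ?b))"
      using h by (simp add: scaleR_diff_right[symmetric] del: nth_deriv.simps)
    also have "\<dots> \<le> e / 2 * (h * h) + e / 2 * (h * h)" using 1 by (rule norm_triangle_le_diff[OF add_mono])
    also have "\<dots> = (h * h) * e" by simp
    finally show ?thesis using h by simp
  qed
  then have "norm (?b - ?a) \<le> 0" by (rule field_le_epsilon)
  then show ?thesis by simp
qed

text \<open>The letters in \<open>w\<close> are differentiated first and those in \<open>z\<close>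
  last, so only the two innermost of the remaining derivatives are exchanged.\<close>

lemma nth_deriv_swap:
  assumes F: "iter_differentiable F"
  shows "nth_deriv F (z @ u # v # w) x = nth_deriv F (z @ v # u # w) x"
proof -
  have "nth_deriv F (u # v # w) = nth_deriv F (v # u # w)" 
    using nth_deriv_symmetric2[OF iter_differentiable_nth_deriv[OF F], of w u v]
      nth_deriv_append[of F "[u, v]" w] nth_deriv_append[of F "[v, u]" w]
    by (intro ext) (simp del: nth_deriv.simps)
  then show ?thesis unfolding nth_deriv_append[of F z] by (simp only:)
qed

text \<open>The factor 1/m! in front of \<open>M\<close> is given away, since only the order of the
  remainder matters later. This lets the induction on \<open>m\<close> pass to the derivative with
  the same bound.\<close>

lemma taylor_line_bound:
  assumes F: "iter_differentiable F"
    and M: "\<And>a. a \<in> {0..1} \<Longrightarrow> norm (nth_deriv F (replicate m v) (x + a *\<^sub>R v)) \<le> M"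
    and a: "a \<in> {0..1}"
  shows "norm (F (x + a *\<^sub>R v) - (\<Sum>k<m. (a ^ k / fact k) *\<^sub>R nth_deriv F (replicate k v) x)) \<le> M"
  using F M a
proof (induction m arbitrary: F a)
  case 0
  then show ?case by simp
next
  case (Suc m)
  let ?G = "nth_deriv F [v]"
  let ?R = "\<lambda>a. F (x + a *\<^sub>R v) - (\<Sum>k<Suc m. (a ^ k / fact k) *\<^sub>R nth_deriv F (replicate k v) x)"
  let ?S = "\<lambda>a. ?G (x + a *\<^sub>R v) - (\<Sum>k<m. (a ^ k / fact k) *\<^sub>R nth_deriv ?G (replicate k v) x)"
  have rep: "nth_deriv ?G (replicate k v) = nth_deriv F (replicate (Suc k) v)" for k
    by (simp add: replicate_append_same flip: nth_deriv_append del: nth_deriv.simps)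
  have S: "norm (?S b - 0) \<le> M" if "b \<in> {0..1}" for b
    unfolding diff_zero
    by (rule Suc.IH[OF iter_differentiable_nth_deriv[OF Suc.prems(1)] _ that], unfold rep, rule Suc.prems(2))
  \<comment> \<open>The derivative of the remainder with \<open>m + 1\<close> terms for
    \<open>F\<close> is the remainder with \<open>m\<close> terms for \<open>?G\<close>, which is at
    most \<open>M\<close> by induction.\<close>
  have "norm (?R a - ?R 0 - a *\<^sub>R 0) \<le> M * a"
  proof (rule norm_increment_bound)
    show "0 \<le> a" using Suc.prems by simp
    show "norm (?S b - 0) \<le> M" if "b \<in> {0..a}" for b using S[of b] that Suc.prems(3) by simp
    fix b
    have monomial: "((\<lambda>a. (a ^ k / fact k) *\<^sub>R y) has_vector_derivative (real k * b ^ (k - 1) / fact k) *\<^sub>R y) (at b)" for k and y :: 'b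
      by (auto simp: has_vector_derivative_def intro!: derivative_eq_intros)
    have "(?R has_vector_derivative nth_deriv F [v] (x + b *\<^sub>R v)
        - (\<Sum>k<Suc m. (real k * b ^ (k - 1) / fact k) *\<^sub>R nth_deriv F (replicate k v) x)) (at b)"
      using nth_deriv_line[OF Suc.prems(1), of "[]" x v b]
      by (intro has_vector_derivative_diff has_vector_derivative_sum monomial) simp
    also have "(\<Sum>k<Suc m. (real k * b ^ (k - 1) / fact k) *\<^sub>R nth_deriv F (replicate k v) x)
        = (\<Sum>k<m. (b ^ k / fact k) *\<^sub>R nth_deriv ?G (replicate k v) x)"
    proof -
      have "real (Suc k) * b ^ k / fact (Suc k) = b ^ k / fact k" for k
        by (simp add: fact_Suc del: of_nat_Suc)
      then show ?thesis
        unfolding sum.lessThan_Suc_shift rep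
        by (simp del: nth_deriv.simps of_nat_Suc fact_Suc replicate_Suc)
    qed
    finally show "(?R has_vector_derivative ?S b) (at b)" .
  qed
  moreover have "?R 0 = 0" by (simp add: power_0_left sum.lessThan_Suc_shift del: sum.lessThan_Suc)
  moreover have "0 \<le> M" using norm_ge_zero S[of 0] by (rule order_trans) simp
  then have "M * a \<le> M" using Suc.prems(3) mult_left_le[of a M] by simp
  ultimately show ?case by simp
qed

section \<open>Controls and sewing\<close>

lemma mem_time_simplex [simp]: "(s, t) \<in> \<Delta>\<^bsub>T\<^esub> \<longleftrightarrow> 0 \<le> s \<and> s \<le> t \<and> t \<le> T"
  by (auto simp: time_simplex_def)

locale control =
  fixes T :: real and \<omega> :: "real \<Rightarrow> real \<Rightarrow> real"
  assumes T_pos: "T > 0" and is_control: "is_control T \<omega>"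
begin

lemma control_nonneg: "0 \<le> s \<Longrightarrow> s \<le> t \<Longrightarrow> t \<le> T \<Longrightarrow> 0 \<le> \<omega> s t"
  using is_control unfolding is_control_def by (auto simp: time_simplex_def)

lemma control_refl: "0 \<le> t \<Longrightarrow> t \<le> T \<Longrightarrow> \<omega> t t = 0"
  using is_control unfolding is_control_def by auto

lemma control_superadditive:
  "0 \<le> s \<Longrightarrow> s \<le> u \<Longrightarrow> u \<le> t \<Longrightarrow> t \<le> T \<Longrightarrow> \<omega> s u + \<omega> u t \<le> \<omega> s t"
  using is_control unfolding is_control_def by auto

lemma control_mono:
  assumes "0 \<le> s" "s \<le> s'" "s' \<le> t'" "t' \<le> t" "t \<le> T"
  shows "\<omega> s' t' \<le> \<omega> s t"
  using control_superadditive[of s s' t] control_superadditive[of s' t' t]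
    control_nonneg[of s s'] control_nonneg[of t' t] assms by linarith

lemma continuous_on_control: "continuous_on \<Delta>\<^bsub>T\<^esub> (\<lambda>(s, t). \<omega> s t)"
  using is_control unfolding is_control_def by auto

text \<open>By continuity there is a point where the control on both sides is equal; by
  superadditivity it is then at most half of the total.\<close>

lemma control_midpoint:
  assumes "0 \<le> s" "s \<le> t" "t \<le> T"
  obtains u where "s \<le> u" "u \<le> t" "\<omega> s u \<le> \<omega> s t / 2" "\<omega> u t \<le> \<omega> s t / 2"
proof -
  have "continuous_on {s..t} (\<lambda>u. (\<lambda>(a, b). \<omega> a b) (s, u))"
    by (rule continuous_on_compose2[OF continuous_on_control]) (use assms in \<open>auto intro!: continuous_intros\<close>)
  moreover have "continuous_on {s..t} (\<lambda>u. (\<lambda>(a, b). \<omega> a b) (u, t))"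
    by (rule continuous_on_compose2[OF continuous_on_control]) (use assms in \<open>auto intro!: continuous_intros\<close>)
  ultimately have "continuous_on {s..t} (\<lambda>u. \<omega> s u - \<omega> u t)" by (auto intro: continuous_on_diff)
  moreover have "\<omega> s s - \<omega> s t \<le> 0" "0 \<le> \<omega> s t - \<omega> t t"
    using assms control_refl[of s] control_refl[of t] control_nonneg[of s t] by auto
  ultimately obtain u where u: "s \<le> u" "u \<le> t" "\<omega> s u - \<omega> u t = 0"
    using IVT'[of "\<lambda>u. \<omega> s u - \<omega> u t" s 0 t] assms(2) by blast
  then show ?thesis
    using that[of u] control_superadditive[of s u t] assms by auto
qed

lemma powr_half_sum:
  assumes "\<theta> > 1" "(x::real) \<ge> 0"
  shows "2 * (x / 2) powr \<theta> = 2 powr (1 - \<theta>) * x powr \<theta>"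
  using assms(2) by (simp add: powr_divide powr_diff)

text \<open>Each bisection at a midpoint of the control improves the bound by the factor
  \<open>q = 2 powr (1 - \<theta>)\<close>, which is less than 1.\<close>

lemma additive_superlinear_eq_0:
  fixes f :: "real \<Rightarrow> real \<Rightarrow> 'e::real_normed_vector"
  assumes add: "\<And>s u t. 0 \<le> s \<Longrightarrow> s \<le> u \<Longrightarrow> u \<le> t \<Longrightarrow> t \<le> T \<Longrightarrow> f s t = f s u + f u t"
    and bound: "\<And>s t. 0 \<le> s \<Longrightarrow> s \<le> t \<Longrightarrow> t \<le> T \<Longrightarrow> norm (f s t) \<le> C * \<omega> s t powr \<theta>"
    and \<theta>: "\<theta> > 1" and st: "0 \<le> s" "s \<le> t" "t \<le> T"
  shows "f s t = 0"
proof -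
  define q where "q = 2 powr (1 - \<theta>)"
  have q: "0 \<le> q" "q < 1" using \<theta> by (auto simp: q_def powr_less_one)
  have "norm (f s t) \<le> \<bar>C\<bar> * q ^ n * \<omega> s t powr \<theta>" if "0 \<le> s" "s \<le> t" "t \<le> T" for n s t
    using that
  proof (induction n arbitrary: s t)
    case 0
    have "C * \<omega> s t powr \<theta> \<le> \<bar>C\<bar> * \<omega> s t powr \<theta>" by (intro mult_right_mono) auto
    then show ?case using bound[OF 0] by simp
  next
    case (Suc n)
    obtain u where u: "s \<le> u" "u \<le> t" "\<omega> s u \<le> \<omega> s t / 2" "\<omega> u t \<le> \<omega> s t / 2"
      using control_midpoint[OF Suc.prems] .
    have c: "0 \<le> \<bar>C\<bar> * q ^ n" using q by simp
    have "norm (f s t) \<le> norm (f s u) + norm (f u t)"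
      using add[of s u t] u Suc.prems norm_triangle_ineq by simp
    also have "\<dots> \<le> \<bar>C\<bar> * q ^ n * \<omega> s u powr \<theta> + \<bar>C\<bar> * q ^ n * \<omega> u t powr \<theta>"
      using u Suc.prems by (intro add_mono Suc.IH) auto
    also have "\<dots> \<le> \<bar>C\<bar> * q ^ n * (\<omega> s t / 2) powr \<theta> + \<bar>C\<bar> * q ^ n * (\<omega> s t / 2) powr \<theta>"
      using u Suc.prems \<theta> by (intro add_mono mult_left_mono[OF _ c] powr_mono2 control_nonneg) auto
    also have "\<dots> = \<bar>C\<bar> * q ^ n * (2 * (\<omega> s t / 2) powr \<theta>)" by simp
    also have "\<dots> = \<bar>C\<bar> * q ^ Suc n * \<omega> s t powr \<theta>"
      using powr_half_sum[OF \<theta> control_nonneg[OF Suc.prems]] by (simp add: q_def mult_ac)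
    finally show ?case .
  qed
  then have "\<And>n. norm (f s t) \<le> \<bar>C\<bar> * q ^ n * \<omega> s t powr \<theta>" using st by blast
  moreover have "(\<lambda>n. \<bar>C\<bar> * q ^ n * \<omega> s t powr \<theta>) \<longlonglongrightarrow> \<bar>C\<bar> * 0 * \<omega> s t powr \<theta>"
    using q by (intro tendsto_intros LIMSEQ_realpow_zero)
  ultimately have "norm (f s t) \<le> \<bar>C\<bar> * 0 * \<omega> s t powr \<theta>"
    by (intro LIMSEQ_le_const) auto
  then show ?thesis by simp
qed

end

section \<open>Sums over partitions and the sewing lemma\<close>

fun consecutive_sum :: "('a \<Rightarrow> 'a \<Rightarrow> 'b::comm_monoid_add) \<Rightarrow> 'a list \<Rightarrow> 'b" where
  "consecutive_sum f (x # y # zs) = f x y + consecutive_sum f (y # zs)"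
| "consecutive_sum f _ = 0"

lemma consecutive_sum_append:
  "consecutive_sum f (xs @ u # ys) = consecutive_sum f (xs @ [u]) + consecutive_sum f (u # ys)"
proof (induction xs)
  case (Cons x xs)
  then show ?case by (cases xs) (simp_all add: add.assoc)
qed simp

text \<open>Partitions are sets of points, so that refinement is inclusion and a common refinement
  is a union. One set \<open>P\<close> serves all intervals; the end points count only if they
  belong to \<open>P\<close>.\<close>

definition partition_sum :: "(real \<Rightarrow> real \<Rightarrow> 'b::comm_monoid_add) \<Rightarrow> real set \<Rightarrow> real \<Rightarrow> real \<Rightarrow> 'b" where
  "partition_sum f P s t = consecutive_sum f (sorted_list_of_set (P \<inter> {s..t}))"

lemma sorted_list_of_set_split:
  fixes u :: real
  assumes "finite A" "finite B" "\<And>a. a \<in> A \<Longrightarrow> a < u" "\<And>b. b \<in> B \<Longrightarrow> u < b"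
  shows "sorted_list_of_set (A \<union> insert u B) = sorted_list_of_set A @ u # sorted_list_of_set B"
proof -
  have ab: "a < b" if "a \<in> A" "b \<in> B" for a b using assms(3)[OF that(1)] assms(4)[OF that(2)] by simp
  have "A \<inter> B = {}" using ab by (metis disjoint_iff less_irrefl)
  moreover have "u \<notin> A" "u \<notin> B" using assms(3)[of u] assms(4)[of u] by blast+
  moreover have "a \<le> u" if "a \<in> A" for a using assms(3)[OF that] by simp
  moreover have "u \<le> b" if "b \<in> B" for b using assms(4)[OF that] by simp
  moreover have "a \<le> b" if "a \<in> A" "b \<in> B" for a b using ab[OF that] by simp
  ultimately have "sorted_list_of_set (set (sorted_list_of_set A @ u # sorted_list_of_set B))
      = sorted_list_of_set A @ u # sorted_list_of_set B"
    using assms(1,2)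
    by (intro sorted_list_of_set.idem_if_sorted_distinct) (simp_all add: sorted_append)
  then show ?thesis using assms(1,2) by simp
qed

lemma partition_sum_split:
  assumes P: "finite P" "u \<in> P" and u: "s \<le> u" "u \<le> t"
  shows "partition_sum f P s t = partition_sum f P s u + partition_sum f P u t"
proof -
  let ?A = "P \<inter> {s..<u}" and ?B = "P \<inter> {u<..t}"
  have sets: "P \<inter> {s..t} = ?A \<union> insert u ?B" "P \<inter> {s..u} = ?A \<union> insert u {}" "P \<inter> {u..t} = {} \<union> insert u ?B"
    using assms by auto
  have "sorted_list_of_set (?A \<union> insert u ?B) = sorted_list_of_set ?A @ u # sorted_list_of_set ?B"
    "sorted_list_of_set (?A \<union> insert u {}) = sorted_list_of_set ?A @ [u]"
    "sorted_list_of_set ({} \<union> insert u ?B) = u # sorted_list_of_set ?B"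
    using P(1) sorted_list_of_set_split[of ?A ?B u] sorted_list_of_set_split[of ?A "{}" u]
      sorted_list_of_set_split[of "{}" ?B u] by simp_all
  then show ?thesis
    unfolding partition_sum_def sets by (simp only: consecutive_sum_append[of f _ u "sorted_list_of_set ?B"])
qed

lemma partition_sum_trivial:
  assumes "s \<in> P" "t \<in> P" "s < t" "P \<inter> {s<..<t} = {}"
  shows "partition_sum f P s t = f s t"
proof -
  have "P \<inter> {s..t} = {s, t}"
  proof (intro equalityI subsetI)
    fix x assume x: "x \<in> P \<inter> {s..t}"
    then have "x \<notin> {s<..<t}" using assms(4) by blast
    then show "x \<in> {s, t}" using x by auto
  qed (use assms in auto)
  moreover have "sorted_list_of_set {s, t} = [s, t]"
    using sorted_list_of_set.idem_if_sorted_distinct[of "[s, t]"] assms(3) by simp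
  ultimately show ?thesis by (simp add: partition_sum_def)
qed

lemma partition_sum_refl: "partition_sum f P s s = 0"
proof -
  have "P \<inter> {s..s} = {} \<or> P \<inter> {s..s} = {s}" by auto
  then show ?thesis
    unfolding partition_sum_def by (elim disjE) (simp_all del: atLeastAtMost_singleton)
qed

context control
begin

context
  fixes f :: "real \<Rightarrow> real \<Rightarrow> real" and C \<theta> K :: real
  assumes defect: "\<And>s u t. 0 \<le> s \<Longrightarrow> s \<le> u \<Longrightarrow> u \<le> t \<Longrightarrow> t \<le> T \<Longrightarrow> \<bar>f s t - f s u - f u t\<bar> \<le> C * \<omega> s t powr \<theta>"
    and C: "C \<ge> 0" and \<theta>: "\<theta> > 1"
  defines "K \<equiv> 2 * C / (1 - 2 powr (1 - \<theta>))"
begin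

text \<open>\<open>K\<close> is the fixed point of the induction in
  \<open>partition_sum_bound\<close>: the two halves contribute
  \<open>2 powr (1 - \<theta>) * K\<close>, and the two insertions of intermediate points contribute
  \<open>2 * C\<close>.\<close>

lemma sewing_const: "K \<ge> 0" "2 powr (1 - \<theta>) * K + 2 * C = K"
proof -
  have q: "1 - 2 powr (1 - \<theta>) > 0" using \<theta> by (simp add: powr_less_one)
  then show "K \<ge> 0" using C by (simp add: K_def)
  have "K * (1 - 2 powr (1 - \<theta>)) = 2 * C" using q \<theta> by (simp add: K_def)
  then show "2 powr (1 - \<theta>) * K + 2 * C = K" by (simp add: algebra_simps)
qed

text \<open>Young's argument: some consecutive points \<open>i < j\<close> of the partition satisfy \<open>\<omega>(s,i), \<omega>(j,t) \<le> \<omega>(s,t)/2\<close>.\<close>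

lemma partition_sum_bound:
  assumes "finite P" "s \<in> P" "t \<in> P" "0 \<le> s" "s \<le> t" "t \<le> T"
  shows "\<bar>partition_sum f P s t - f s t\<bar> \<le> K * \<omega> s t powr \<theta>"
  using assms
proof (induction "card (P \<inter> {s..t})" arbitrary: s t rule: less_induct)
  case less
  note P = less.prems(1-3) and st = less.prems(4-6)
  note K = sewing_const
  have w: "0 \<le> \<omega> s t" using control_nonneg[OF st] .
  have smaller: "card (P \<inter> {a..b}) < card (P \<inter> {s..t})"
    if "s \<le> a" "b \<le> t" "s < a \<or> b < t" for a b
  proof (rule psubset_card_mono)
    have "(if s < a then s else t) \<in> P \<inter> {s..t}" "(if s < a then s else t) \<notin> P \<inter> {a..b}"
      using P st that by auto
    moreover have "P \<inter> {a..b} \<subseteq> P \<inter> {s..t}" using that by auto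
    ultimately show "P \<inter> {a..b} \<subset> P \<inter> {s..t}" by blast
  qed (use P in simp)
  show ?case
  proof (cases "s = t")
    case True
    have "f s s = 0" using defect[of s s s] st True by (simp add: control_refl)
    then show ?thesis using True K w by (simp add: partition_sum_refl)
  next
    case False
    then have "s < t" using st by simp
    show ?thesis
    proof (cases "P \<inter> {s<..<t} = {}")
      case True
      then show ?thesis using partition_sum_trivial[of s P t f] P \<open>s < t\<close> K by simp
    next
      case False
      then obtain v where v: "v \<in> P" "s < v" "v < t" by auto
      show ?thesis
      proof (cases "\<omega> s t = 0")
        case True
        \<comment> \<open>Without control there is no half to stay below, and the choice of
          \<open>i\<close> further on could give \<open>t\<close>. As all bounds vanish here, any
          inner point will do.\<close>
        have 0: "\<omega> s v = 0" "\<omega> v t = 0"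
          using True v st control_mono[of s s v t] control_mono[of s v t t]
            control_nonneg[of s v] control_nonneg[of v t] by auto
        have "\<bar>partition_sum f P s v - f s v\<bar> \<le> K * \<omega> s v powr \<theta>"
          by (rule less.hyps[OF smaller]) (use v P st in auto)
        moreover have "\<bar>partition_sum f P v t - f v t\<bar> \<le> K * \<omega> v t powr \<theta>"
          by (rule less.hyps[OF smaller]) (use v P st in auto)
        moreover have "\<bar>f s t - f s v - f v t\<bar> \<le> C * \<omega> s t powr \<theta>"
          by (rule defect) (use v st in auto)
        ultimately show ?thesis
          using partition_sum_split[OF P(1) v(1), of s t f] v by (simp add: 0 True)
      next
        case w0: False
        \<comment> \<open>\<open>i\<close> is the last point up to which at most half of the control
          is used, and \<open>j\<close> is its successor. Up to \<open>j\<close> more than half is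
          used, so by superadditivity less than half is left after \<open>j\<close>.\<close>
        define A where "A = {x \<in> P \<inter> {s..t}. \<omega> s x \<le> \<omega> s t / 2}"
        define i where "i = Max A"
        have "finite A" using P by (simp add: A_def)
        moreover have "s \<in> A" using P st w by (simp add: A_def control_refl)
        ultimately have iA: "i \<in> A" and imax: "\<And>x. x \<in> A \<Longrightarrow> x \<le> i"
          unfolding i_def using Max_in by auto
        have i: "i \<in> P" "s \<le> i" "i \<le> t" "\<omega> s i \<le> \<omega> s t / 2" using iA by (auto simp: A_def)
        have "i \<noteq> t" using i(4) w w0 by auto
        then have "i < t" using i by simp
        define B where "B = {x \<in> P \<inter> {s..t}. i < x}"
        define j where "j = Min B"
        have "finite B" "t \<in> B" using P st \<open>i < t\<close> by (auto simp: B_def)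
        then have jB: "j \<in> B" and jmin: "\<And>x. x \<in> B \<Longrightarrow> j \<le> x"
          unfolding j_def using Min_in by auto
        have j: "j \<in> P" "i < j" "j \<le> t" using jB by (auto simp: B_def)
        have "j \<notin> A" using imax[of j] j by auto
        then have "\<omega> s j > \<omega> s t / 2" using j i by (auto simp: A_def)
        then have jt: "\<omega> j t \<le> \<omega> s t / 2"
          using control_superadditive[of s j t] j i st by auto
        have "P \<inter> {i<..<j} = {}"
        proof (rule ccontr)
          assume "P \<inter> {i<..<j} \<noteq> {}"
          then obtain x where x: "x \<in> P" "i < x" "x < j" by auto
          then have "x \<in> B" using i j by (auto simp: B_def)
          then show False using jmin[of x] x by simp
        qed
        then have ij: "partition_sum f P i j = f i j"
          by (intro partition_sum_trivial i j)
        have split: "partition_sum f P s t = partition_sum f P s i + f i j + partition_sum f P j t"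
          using partition_sum_split[OF P(1) i(1,2,3), of f] partition_sum_split[OF P(1) j(1) less_imp_le[OF j(2)] j(3), of f]
          by (simp add: ij)
        have IH1: "\<bar>partition_sum f P s i - f s i\<bar> \<le> K * \<omega> s i powr \<theta>"
          by (rule less.hyps[OF smaller]) (use P st i \<open>i < t\<close> in auto)
        have IH2: "\<bar>partition_sum f P j t - f j t\<bar> \<le> K * \<omega> j t powr \<theta>"
          by (rule less.hyps[OF smaller]) (use P st i j in auto)
        have d1: "\<bar>f s j - f s i - f i j\<bar> \<le> C * \<omega> s t powr \<theta>"
        proof -
          have "\<bar>f s j - f s i - f i j\<bar> \<le> C * \<omega> s j powr \<theta>" by (rule defect) (use i j st in auto)
          also have "\<dots> \<le> C * \<omega> s t powr \<theta>"
            using i j st C \<theta> by (intro mult_left_mono powr_mono2 control_mono control_nonneg) auto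
          finally show ?thesis .
        qed
        have d2: "\<bar>f s t - f s j - f j t\<bar> \<le> C * \<omega> s t powr \<theta>"
          by (rule defect) (use i j st in auto)
        have h1: "K * \<omega> s i powr \<theta> \<le> K * (\<omega> s t / 2) powr \<theta>"
          using i st K \<theta> by (intro mult_left_mono powr_mono2 control_nonneg) auto
        have h2: "K * \<omega> j t powr \<theta> \<le> K * (\<omega> s t / 2) powr \<theta>"
          using i j st K \<theta> jt by (intro mult_left_mono powr_mono2 control_nonneg) auto
        have "\<bar>partition_sum f P s t - f s t\<bar> \<le> K * (2 * (\<omega> s t / 2) powr \<theta>) + 2 * C * \<omega> s t powr \<theta>"
          unfolding split using IH1 IH2 d1 d2 h1 h2 by linarith
        also have "\<dots> = (2 powr (1 - \<theta>) * K + 2 * C) * \<omega> s t powr \<theta>"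
          using powr_half_sum[OF \<theta> w] by (simp add: algebra_simps)
        finally show ?thesis unfolding K(2) .
      qed
    qed
  qed
qed

text \<open>Every interval of \<open>Q\<close> contributes an error
  \<open>K * \<omega> powr \<theta>\<close>, at most
  \<open>K * e powr (\<theta> - 1) * \<omega>\<close>. These errors add up by
  superadditivity.\<close>

lemma partition_sum_refine:
  assumes "finite P" "Q \<subseteq> P" "s \<in> Q" "t \<in> Q" "0 \<le> s" "s \<le> t" "t \<le> T" "e \<ge> 0"
    and fine: "\<And>x y. 0 \<le> x \<Longrightarrow> x \<le> y \<Longrightarrow> y \<le> T \<Longrightarrow> Q \<inter> {x<..<y} = {} \<Longrightarrow> \<omega> x y \<le> e"
  shows "\<bar>partition_sum f P s t - partition_sum f Q s t\<bar> \<le> K * e powr (\<theta> - 1) * \<omega> s t"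
  using assms(1-8)
proof (induction "card (Q \<inter> {s..t})" arbitrary: s t rule: less_induct)
  case less
  note P = less.prems(1-4) and st = less.prems(5-7)
  have finQ: "finite Q" using P finite_subset by blast
  note K = sewing_const
  have smaller: "card (Q \<inter> {a..b}) < card (Q \<inter> {s..t})"
    if "s \<le> a" "b \<le> t" "s < a \<or> b < t" for a b
  proof (rule psubset_card_mono)
    have "(if s < a then s else t) \<in> Q \<inter> {s..t}" "(if s < a then s else t) \<notin> Q \<inter> {a..b}"
      using P st that by auto
    moreover have "Q \<inter> {a..b} \<subseteq> Q \<inter> {s..t}" using that by auto
    ultimately show "Q \<inter> {a..b} \<subset> Q \<inter> {s..t}" by blast
  qed (use finQ in simp)
  show ?case
  proof (cases "Q \<inter> {s<..<t} = {}")
    case True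
    have w: "\<omega> s t \<le> e" by (rule fine) (use st True in auto)
    have "\<bar>partition_sum f P s t - f s t\<bar> \<le> K * \<omega> s t powr \<theta>"
      by (rule partition_sum_bound) (use P st in auto)
    also have "\<omega> s t powr \<theta> = \<omega> s t powr (\<theta> - 1) * \<omega> s t"
      using control_nonneg[OF st] powr_mult_base[of "\<omega> s t" "\<theta> - 1"] by (simp add: mult.commute)
    also have "\<dots> \<le> e powr (\<theta> - 1) * \<omega> s t"
      using w control_nonneg[OF st] \<theta> by (intro mult_right_mono powr_mono2) auto
    finally have "\<bar>partition_sum f P s t - f s t\<bar> \<le> K * (e powr (\<theta> - 1) * \<omega> s t)"
      using K by (simp add: mult_left_mono)
    moreover have "partition_sum f Q s t = f s t"
    proof (cases "s = t")
      case True
      then have "f s s = 0" using defect[of s s s] st by (simp add: control_refl)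
      then show ?thesis using True by (simp add: partition_sum_refl)
    next
      case False
      then show ?thesis using partition_sum_trivial[of s Q t f] P st True by simp
    qed
    ultimately show ?thesis by (simp add: mult.assoc)
  next
    case False
    then obtain u where u: "u \<in> Q" "s < u" "u < t" by auto
    have "\<bar>partition_sum f P s u - partition_sum f Q s u\<bar> \<le> K * e powr (\<theta> - 1) * \<omega> s u"
      by (rule less.hyps[OF smaller]) (use P st u assms(8) in auto)
    moreover have "\<bar>partition_sum f P u t - partition_sum f Q u t\<bar> \<le> K * e powr (\<theta> - 1) * \<omega> u t"
      by (rule less.hyps[OF smaller]) (use P st u assms(8) in auto)
    ultimately have "\<bar>partition_sum f P s t - partition_sum f Q s t\<bar> \<le> K * e powr (\<theta> - 1) * (\<omega> s u + \<omega> u t)"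
      using partition_sum_split[OF finQ u(1), of s t f] partition_sum_split[OF P(1), of u s t f] P u
      by (auto simp: distrib_left)
    also have "\<dots> \<le> K * e powr (\<theta> - 1) * \<omega> s t"
      using control_superadditive[of s u t] st u K by (intro mult_left_mono) auto
    finally show ?thesis .
  qed
qed

text \<open>Fineness is measured by the control and not by length: the points are obtained by
  bisecting \<open>n\<close> times at midpoints of the control.\<close>

lemma ex_fine_partition:
  assumes "0 \<le> s" "s \<le> t" "t \<le> T"
  shows "\<exists>Q. finite Q \<and> Q \<subseteq> {s..t} \<and>
    (\<forall>x y. s \<le> x \<longrightarrow> x \<le> y \<longrightarrow> y \<le> t \<longrightarrow> Q \<inter> {x<..<y} = {} \<longrightarrow> \<omega> x y \<le> \<omega> s t / 2 ^ n)"
  using assms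
proof (induction n arbitrary: s t)
  case 0
  then show ?case using control_mono by (intro exI[of _ "{}"]) auto
next
  case (Suc n)
  obtain u where u: "s \<le> u" "u \<le> t" "\<omega> s u \<le> \<omega> s t / 2" "\<omega> u t \<le> \<omega> s t / 2"
    using control_midpoint[OF Suc.prems] .
  have u': "0 \<le> u" "u \<le> T" using u(1,2) Suc.prems by auto
  obtain Q1 where Q1: "finite Q1" "Q1 \<subseteq> {s..u}"
      "\<forall>x y. s \<le> x \<longrightarrow> x \<le> y \<longrightarrow> y \<le> u \<longrightarrow> Q1 \<inter> {x<..<y} = {} \<longrightarrow> \<omega> x y \<le> \<omega> s u / 2 ^ n"
    using Suc.IH[OF Suc.prems(1) u(1) u'(2)] by (elim exE conjE)
  obtain Q2 where Q2: "finite Q2" "Q2 \<subseteq> {u..t}"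
      "\<forall>x y. u \<le> x \<longrightarrow> x \<le> y \<longrightarrow> y \<le> t \<longrightarrow> Q2 \<inter> {x<..<y} = {} \<longrightarrow> \<omega> x y \<le> \<omega> u t / 2 ^ n"
    using Suc.IH[OF u'(1) u(2) Suc.prems(3)] by (elim exE conjE)
  have "\<omega> x y \<le> \<omega> s t / 2 ^ Suc n"
    if xy: "s \<le> x" "x \<le> y" "y \<le> t" "insert u (Q1 \<union> Q2) \<inter> {x<..<y} = {}" for x y
  proof -
    have "u \<notin> {x<..<y}" "Q1 \<inter> {x<..<y} = {}" "Q2 \<inter> {x<..<y} = {}" using xy(4) by auto
    then consider "y \<le> u" | "u \<le> x" by force
    then show ?thesis
    proof cases
      case 1
      then have "\<omega> x y \<le> \<omega> s u / 2 ^ n" by (rule Q1(3)[rule_format, OF xy(1,2) _ \<open>Q1 \<inter> {x<..<y} = {}\<close>])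
      also have "\<dots> \<le> (\<omega> s t / 2) / 2 ^ n" using u by (intro divide_right_mono) auto
      finally show ?thesis by (simp add: field_simps)
    next
      case 2
      then have "\<omega> x y \<le> \<omega> u t / 2 ^ n" by (rule Q2(3)[rule_format, OF _ xy(2,3) \<open>Q2 \<inter> {x<..<y} = {}\<close>])
      also have "\<dots> \<le> (\<omega> s t / 2) / 2 ^ n" using u by (intro divide_right_mono) auto
      finally show ?thesis by (simp add: field_simps)
    qed
  qed
  note fine = this
  have "finite (insert u (Q1 \<union> Q2))" "insert u (Q1 \<union> Q2) \<subseteq> {s..t}"
    using Q1(1,2) Q2(1,2) u(1,2) by auto
  with fine show ?case by blast
qed

text \<open>The sums are Cauchy under refinement. Choosing partitions \<open>Q n\<close> for the
  tolerances 1/(n + 1) and comparing any two of them through their union gives a Cauchy sequence,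
  whose limit is also the limit along all refinements.\<close>

lemma partition_sum_limit:
  assumes t: "0 \<le> t" "t \<le> T"
  shows "\<exists>l. \<forall>e>0. \<exists>Q. finite Q \<and> (\<forall>P. finite P \<longrightarrow> Q \<subseteq> P \<longrightarrow> \<bar>partition_sum f P 0 t - l\<bar> \<le> e)"
proof -
  have ex: "\<exists>Q. finite Q \<and> (\<forall>P. finite P \<longrightarrow> Q \<subseteq> P \<longrightarrow> \<bar>partition_sum f P 0 t - partition_sum f Q 0 t\<bar> < d)"
    if d: "d > 0" for d
  proof -
    have "(\<lambda>n. K * (\<omega> 0 T * (1 / 2) ^ n) powr (\<theta> - 1) * \<omega> 0 t) \<longlonglongrightarrow> K * (\<omega> 0 T * 0) powr (\<theta> - 1) * \<omega> 0 t"
      using \<theta> control_nonneg[of 0 T] T_pos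
      by (intro tendsto_intros tendsto_powr' LIMSEQ_realpow_zero) auto
    then have "(\<lambda>n. K * (\<omega> 0 T * (1 / 2) ^ n) powr (\<theta> - 1) * \<omega> 0 t) \<longlonglongrightarrow> 0" by simp
    then have "eventually (\<lambda>n. K * (\<omega> 0 T * (1 / 2) ^ n) powr (\<theta> - 1) * \<omega> 0 t < d) sequentially"
      using d by (rule order_tendstoD)
    then obtain n where n: "K * (\<omega> 0 T / 2 ^ n) powr (\<theta> - 1) * \<omega> 0 t < d"
      unfolding eventually_sequentially by (auto simp: power_divide)
    obtain Q where Q: "finite Q" "Q \<subseteq> {0..T}"
      "\<forall>x y. 0 \<le> x \<longrightarrow> x \<le> y \<longrightarrow> y \<le> T \<longrightarrow> Q \<inter> {x<..<y} = {} \<longrightarrow> \<omega> x y \<le> \<omega> 0 T / 2 ^ n"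
      using ex_fine_partition[OF order_refl less_imp_le[OF T_pos] order_refl, of n] by (elim exE conjE)
    have "\<bar>partition_sum f P 0 t - partition_sum f (insert 0 (insert t Q)) 0 t\<bar> < d"
      if P: "finite P" "insert 0 (insert t Q) \<subseteq> P" for P
    proof -
      have "\<bar>partition_sum f P 0 t - partition_sum f (insert 0 (insert t Q)) 0 t\<bar>
          \<le> K * (\<omega> 0 T / 2 ^ n) powr (\<theta> - 1) * \<omega> 0 t"
      proof (rule partition_sum_refine[OF P])
        show "0 \<le> \<omega> 0 T / 2 ^ n" using control_nonneg[of 0 T] T_pos by simp
        fix x y assume xy: "0 \<le> x" "x \<le> y" "y \<le> T" "insert 0 (insert t Q) \<inter> {x<..<y} = {}"
        then have "Q \<inter> {x<..<y} = {}" by blast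
        then show "\<omega> x y \<le> \<omega> 0 T / 2 ^ n" by (rule Q(3)[rule_format, OF xy(1-3)])
      qed (use t in auto)
      with n show ?thesis by simp
    qed
    moreover have "finite (insert 0 (insert t Q))" using Q(1) by simp
    ultimately show ?thesis by blast
  qed
  have "\<exists>Q. finite Q \<and> (\<forall>P. finite P \<longrightarrow> Q \<subseteq> P \<longrightarrow> \<bar>partition_sum f P 0 t - partition_sum f Q 0 t\<bar> < inverse (real (Suc n)))" for n
    by (rule ex) simp
  then have "\<exists>Q. \<forall>n. finite (Q n) \<and> (\<forall>P. finite P \<longrightarrow> Q n \<subseteq> P \<longrightarrow> \<bar>partition_sum f P 0 t - partition_sum f (Q n) 0 t\<bar> < inverse (real (Suc n)))"
    by (intro choice allI)
  then obtain Q where Q: "finite (Q n)"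
    "finite P \<Longrightarrow> Q n \<subseteq> P \<Longrightarrow> \<bar>partition_sum f P 0 t - partition_sum f (Q n) 0 t\<bar> < inverse (real (Suc n))" for n P
    by blast
  have small: "\<exists>M. \<forall>n\<ge>M. inverse (real (Suc n)) < e" if "e > 0" for e
    using order_tendstoD(2)[OF LIMSEQ_inverse_real_of_nat that] by (simp add: eventually_sequentially)
  have "Cauchy (\<lambda>n. partition_sum f (Q n) 0 t)"
  proof (rule metric_CauchyI)
    fix e :: real assume "e > 0"
    then obtain M where M: "\<And>n. n \<ge> M \<Longrightarrow> inverse (real (Suc n)) < e / 2" using small[of "e / 2"] by auto
    have "dist (partition_sum f (Q m) 0 t) (partition_sum f (Q n) 0 t) < e" if "m \<ge> M" "n \<ge> M" for m n
    proof -
      have fin: "finite (Q m \<union> Q n)" using Q(1) by simp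
      show ?thesis
        using Q(2)[OF fin Un_upper1] Q(2)[OF fin Un_upper2] M[OF that(1)] M[OF that(2)]
        unfolding dist_real_def by linarith
    qed
    then show "\<exists>M. \<forall>m\<ge>M. \<forall>n\<ge>M. dist (partition_sum f (Q m) 0 t) (partition_sum f (Q n) 0 t) < e" by blast
  qed
  then obtain l where l: "(\<lambda>n. partition_sum f (Q n) 0 t) \<longlonglongrightarrow> l"
    using Cauchy_convergent convergent_def by blast
  have "\<exists>Q. finite Q \<and> (\<forall>P. finite P \<longrightarrow> Q \<subseteq> P \<longrightarrow> \<bar>partition_sum f P 0 t - l\<bar> \<le> e)" if e: "e > 0" for e
  proof -
    obtain M where M: "\<And>n. n \<ge> M \<Longrightarrow> inverse (real (Suc n)) < e / 2" using small[of "e / 2"] e by auto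
    obtain M' where M': "\<And>n. n \<ge> M' \<Longrightarrow> \<bar>partition_sum f (Q n) 0 t - l\<bar> < e / 2"
      using LIMSEQ_D[OF l, of "e / 2"] e by auto
    let ?n = "max M M'"
    have "\<bar>partition_sum f P 0 t - l\<bar> \<le> e" if "finite P" "Q ?n \<subseteq> P" for P
      using Q(2)[OF that] M[of ?n] M'[of ?n] by linarith
    then show ?thesis using Q(1) by blast
  qed
  then show ?thesis by blast
qed

text \<open>For a partition that refines those belonging to \<open>s\<close> and to \<open>t\<close>
  and contains both points, the sum from 0 to \<open>t\<close> is the sum from 0 to \<open>s\<close>
  plus the one from \<open>s\<close> to \<open>t\<close>, and the latter is close to
  \<open>f s t\<close> by \<open>partition_sum_bound\<close>.\<close>

lemma sewing_real:
  "\<exists>l. \<forall>s t. 0 \<le> s \<longrightarrow> s \<le> t \<longrightarrow> t \<le> T \<longrightarrow> \<bar>l t - l s - f s t\<bar> \<le> K * \<omega> s t powr \<theta>"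
proof -
  have "\<exists>l. \<forall>t. 0 \<le> t \<longrightarrow> t \<le> T \<longrightarrow>
      (\<forall>e>0. \<exists>Q. finite Q \<and> (\<forall>P. finite P \<longrightarrow> Q \<subseteq> P \<longrightarrow> \<bar>partition_sum f P 0 t - l t\<bar> \<le> e))"
    using partition_sum_limit by (intro choice allI) blast
  then obtain l where l: "\<forall>t. 0 \<le> t \<longrightarrow> t \<le> T \<longrightarrow>
      (\<forall>e>0. \<exists>Q. finite Q \<and> (\<forall>P. finite P \<longrightarrow> Q \<subseteq> P \<longrightarrow> \<bar>partition_sum f P 0 t - l t\<bar> \<le> e))" ..
  have "\<bar>l t - l s - f s t\<bar> \<le> K * \<omega> s t powr \<theta>" if st: "0 \<le> s" "s \<le> t" "t \<le> T" for s t
  proof (rule field_le_epsilon)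
    fix e :: real assume e: "e > 0"
    have st': "0 \<le> t" "s \<le> T" and e2: "e / 2 > 0" using st e by auto
    obtain Q where Q: "finite Q" "\<forall>P. finite P \<longrightarrow> Q \<subseteq> P \<longrightarrow> \<bar>partition_sum f P 0 t - l t\<bar> \<le> e / 2"
      using l[rule_format, OF st'(1) st(3) e2] by (elim exE conjE)
    obtain Q' where Q': "finite Q'" "\<forall>P. finite P \<longrightarrow> Q' \<subseteq> P \<longrightarrow> \<bar>partition_sum f P 0 s - l s\<bar> \<le> e / 2"
      using l[rule_format, OF st(1) st'(2) e2] by (elim exE conjE)
    let ?P = "insert s (insert t (Q \<union> Q'))"
    have fin: "finite ?P" using Q Q' by simp
    have "partition_sum f ?P 0 t = partition_sum f ?P 0 s + partition_sum f ?P s t"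
      by (rule partition_sum_split[OF fin]) (use st in auto)
    moreover have "\<bar>partition_sum f ?P s t - f s t\<bar> \<le> K * \<omega> s t powr \<theta>"
      by (rule partition_sum_bound[OF fin]) (use st in auto)
    moreover have "\<bar>partition_sum f ?P 0 t - l t\<bar> \<le> e / 2" by (rule Q(2)[rule_format, OF fin]) blast
    moreover have "\<bar>partition_sum f ?P 0 s - l s\<bar> \<le> e / 2" by (rule Q'(2)[rule_format, OF fin]) blast
    ultimately show "\<bar>l t - l s - f s t\<bar> \<le> K * \<omega> s t powr \<theta> + e" by linarith
  qed
  then show ?thesis by blast
qed

end

end

section \<open>Orders of magnitude\<close>

lemma linear_expand_basis_words:
  fixes \<phi> :: "'v::fin_dim tensor \<Rightarrow> 'w::real_vector"
  assumes B: "\<And>n a. component n a = (\<Sum>b\<in>basis_words B n. tensor_coord B b a *\<^sub>R tensor_of b)"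
    and \<phi>: "linear \<phi>" and a: "\<And>n. n > M \<Longrightarrow> component n a = 0"
  shows "\<phi> a = (\<Sum>n\<le>M. \<Sum>b\<in>basis_words B n. tensor_coord B b a *\<^sub>R \<phi> (tensor_of b))"
proof -
  have "\<phi> a = \<phi> (\<Sum>n\<le>M. component n a)" by (subst sum_components[OF a]) simp_all
  also have "\<dots> = (\<Sum>n\<le>M. \<phi> (component n a))" by (rule linear_sum[OF \<phi>])
  also have "\<dots> = (\<Sum>n\<le>M. \<Sum>b\<in>basis_words B n. tensor_coord B b a *\<^sub>R \<phi> (tensor_of b))"
    unfolding B by (simp only: linear_sum[OF \<phi>] linear_scale[OF \<phi>])
  finally show ?thesis .
qed

lemma tensor_lift_mult_right:
  assumes "multilinear f"
  shows "tensor_lift f (a \<otimes>\<^sub>t tensor_of y) = tensor_lift (\<lambda>x. f (x @ y)) a"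
proof (rule tensor_linear_eqI[of "\<lambda>a. tensor_lift f (a \<otimes>\<^sub>t tensor_of y)"])
  note m = multilinear_append_right[OF assms, of y]
  show "linear (\<lambda>a. tensor_lift f (a \<otimes>\<^sub>t tensor_of y))"
    by (rule linear_compose'[OF linear_tensor_mult_left linear_tensor_lift[OF assms]])
  show "linear (tensor_lift (\<lambda>x. f (x @ y)))" by (rule linear_tensor_lift[OF m])
  show "tensor_lift f (tensor_of w \<otimes>\<^sub>t tensor_of y) = tensor_lift (\<lambda>x. f (x @ y)) (tensor_of w)" for w
    by (simp add: tensor_lift_tensor_of assms m)
qed

lemma tensor_lift2_bilinear:
  assumes "bilinear \<beta>" "multilinear f" "multilinear g"
  shows "tensor_lift2 (\<lambda>x y. \<beta> (f x) (g y)) a b = \<beta> (tensor_lift f a) (tensor_lift g b)"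
proof (rule tensor_bilinear_eqI[of "tensor_lift2 (\<lambda>x y. \<beta> (f x) (g y))"])
  note m = bimultilinear_bilinear[OF assms]
  show "bilinear (tensor_lift2 (\<lambda>x y. \<beta> (f x) (g y)))" by (rule bilinear_tensor_lift2[OF m])
  show "bilinear (\<lambda>a b. \<beta> (tensor_lift f a) (tensor_lift g b))"
    by (rule bilinear_compose_linear[OF assms(1) linear_tensor_lift[OF assms(2)] linear_tensor_lift[OF assms(3)]])
  show "tensor_lift2 (\<lambda>x y. \<beta> (f x) (g y)) (tensor_of x) (tensor_of y)
      = \<beta> (tensor_lift f (tensor_of x)) (tensor_lift g (tensor_of y))" for x y
    unfolding tensor_lift2_tensor_of[OF m] by (simp only: tensor_lift_tensor_of assms(2,3))
qed

lemma unshuffle_sum_commute: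
  "unshuffle_sum u (\<lambda>x y. unshuffle_sum w (f x y)) = unshuffle_sum w (\<lambda>x' y'. unshuffle_sum u (\<lambda>x y. f x y x' y'))"
  by (induction u arbitrary: f) (simp_all add: unshuffle_sum_add)

text \<open>The unshuffle coproduct is multiplicative for concatenation.\<close>

lemma cop_mult_right:
  assumes "bimultilinear f"
  shows "cop f (a \<otimes>\<^sub>t tensor_of w) = unshuffle_sum w (\<lambda>x' y'. cop (\<lambda>x y. f (x @ x') (y @ y')) a)"
proof (rule tensor_linear_eqI[of "\<lambda>a. cop f (a \<otimes>\<^sub>t tensor_of w)"])
  have m: "bimultilinear (\<lambda>x y. f (x @ x') (y @ y'))" for x' y'
    using bimultilinear_append[OF assms, of "[]" x' "[]" y'] by simp
  show "linear (\<lambda>a. cop f (a \<otimes>\<^sub>t tensor_of w))"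
    by (rule linear_compose'[OF linear_tensor_mult_left linear_cop[OF assms]])
  show "linear (\<lambda>a. unshuffle_sum w (\<lambda>x' y'. cop (\<lambda>x y. f (x @ x') (y @ y')) a))"
    by (intro linear_unshuffle_sum linear_cop m)
  show "cop f (tensor_of u \<otimes>\<^sub>t tensor_of w) = unshuffle_sum w (\<lambda>x' y'. cop (\<lambda>x y. f (x @ x') (y @ y')) (tensor_of u))" for u
  proof -
    have "cop f (tensor_of u \<otimes>\<^sub>t tensor_of w) = unshuffle_sum u (\<lambda>x y. unshuffle_sum w (\<lambda>x' y'. f (x @ x') (y @ y')))"
      by (simp add: cop_tensor_of assms unshuffle_sum_append)
    also have "\<dots> = unshuffle_sum w (\<lambda>x' y'. unshuffle_sum u (\<lambda>x y. f (x @ x') (y @ y')))"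
      by (rule unshuffle_sum_commute)
    finally show ?thesis unfolding cop_tensor_of[OF m] .
  qed
qed

lemma cop_component:
  assumes f: "bimultilinear f"
  shows "cop f (component n a) = (\<Sum>k\<le>n. cop (\<lambda>x y. if length x = k \<and> length y = n - k then f x y else 0) (component n a))"
proof (rule tensor_linear_eqI[of "\<lambda>a. cop f (component n a)"])
  note m = bimultilinear_if_length[OF f]
  show "linear (\<lambda>a. cop f (component n a))" by (rule linear_compose'[OF linear_component linear_cop[OF f]])
  show "linear (\<lambda>a. \<Sum>k\<le>n. cop (\<lambda>x y. if length x = k \<and> length y = n - k then f x y else 0) (component n a))"
    by (intro linear_compose_sum ballI linear_compose'[OF linear_component linear_cop[OF m]])
  fix w :: "'a list"
  show "cop f (component n (tensor_of w)) =
    (\<Sum>k\<le>n. cop (\<lambda>x y. if length x = k \<and> length y = n - k then f x y else 0) (component n (tensor_of w)))"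
  proof (cases "length w = n")
    case True
    have "(\<Sum>k\<le>n. cop (\<lambda>x y. if length x = k \<and> length y = n - k then f x y else 0) (tensor_of w))
        = unshuffle_sum w (\<lambda>x y. \<Sum>k\<le>n. if length x = k \<and> length y = n - k then f x y else 0)"
      unfolding cop_tensor_of[OF m] unshuffle_sum_sum ..
    also have "\<dots> = unshuffle_sum w f"
    proof (rule unshuffle_sum_cong[OF refl])
      fix x y :: "'a list" assume "length x + length y = length w"
      then have "length x \<le> n" "(if length x = k \<and> length y = n - k then f x y else 0)
          = (if k = length x then f x y else 0)" for k
        using True by auto
      then show "(\<Sum>k\<le>n. if length x = k \<and> length y = n - k then f x y else 0) = f x y"
        by (simp only: sum.delta' sum.delta finite_atMost atMost_iff if_True)
    qed
    finally show ?thesis using True by (simp add: cop_tensor_of f)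
  next
    case False
    then show ?thesis by (simp add: linear_0[OF linear_cop[OF m]] linear_0[OF linear_cop[OF f]])
  qed
qed

lemma component_unit [simp]: "component n (tensor_of [] :: 'a::real_vector tensor) = (if n = 0 then tensor_of [] else 0)"
  by simp

text \<open>Families are compared up to powers of a bounded scale, later \<open>\<omega>(s,t)\<^sup>1\<^sup>/\<^sup>p\<close>.\<close>

locale scale =
  fixes I :: "'i set" and \<rho> :: "'i \<Rightarrow> real" and R :: real
  assumes scale_nonneg: "\<And>i. i \<in> I \<Longrightarrow> 0 \<le> \<rho> i" and scale_le: "\<And>i. i \<in> I \<Longrightarrow> \<rho> i \<le> R"
begin

definition bigO :: "nat \<Rightarrow> ('i \<Rightarrow> 'e::real_normed_vector) \<Rightarrow> bool" where
  "bigO k f \<longleftrightarrow> (\<exists>C. \<forall>i\<in>I. norm (f i) \<le> C * \<rho> i ^ k)"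

lemma bigOI: "(\<And>i. i \<in> I \<Longrightarrow> norm (f i) \<le> C * \<rho> i ^ k) \<Longrightarrow> bigO k f"
  unfolding bigO_def by blast

lemma bigOE:
  assumes "bigO k f"
  obtains C where "C \<ge> 0" "\<And>i. i \<in> I \<Longrightarrow> norm (f i) \<le> C * \<rho> i ^ k"
proof -
  obtain C where C: "\<And>i. i \<in> I \<Longrightarrow> norm (f i) \<le> C * \<rho> i ^ k"
    using assms unfolding bigO_def by blast
  have "norm (f i) \<le> \<bar>C\<bar> * \<rho> i ^ k" if "i \<in> I" for i
    by (rule order_trans[OF C[OF that]]) (intro mult_right_mono abs_ge_self zero_le_power scale_nonneg that)
  then show ?thesis by (rule that[OF abs_ge_zero])
qed

text \<open>Excess powers of the scale are absorbed into the constant, as the scale is bounded by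
  \<open>R\<close>.\<close>

lemma bigO_mono:
  assumes "bigO l f" "k \<le> l"
  shows "bigO k f"
proof -
  obtain C where C: "C \<ge> 0" "\<And>i. i \<in> I \<Longrightarrow> norm (f i) \<le> C * \<rho> i ^ l" by (rule bigOE[OF assms(1)]) (rule that)
  show ?thesis
  proof (rule bigOI)
    fix i assume i: "i \<in> I"
    have "norm (f i) \<le> C * \<rho> i ^ l" by (rule C(2)[OF i])
    also have "\<rho> i ^ l = \<rho> i ^ (l - k) * \<rho> i ^ k" using assms(2) by (simp flip: power_add)
    also have "C * (\<rho> i ^ (l - k) * \<rho> i ^ k) \<le> C * (R ^ (l - k) * \<rho> i ^ k)"
      using scale_nonneg[OF i] scale_le[OF i] C(1) by (intro mult_left_mono mult_right_mono power_mono) auto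
    finally show "norm (f i) \<le> (C * R ^ (l - k)) * \<rho> i ^ k" by (simp add: mult.assoc)
  qed
qed

lemma bigO_cong: "(\<And>i. i \<in> I \<Longrightarrow> f i = g i) \<Longrightarrow> bigO k f \<longleftrightarrow> bigO k g"
  unfolding bigO_def by simp

lemma bigO_zero: "bigO k (\<lambda>i. 0)"
  by (rule bigOI[where C = 0]) simp

lemma bigO_eq_0: "(\<And>i. i \<in> I \<Longrightarrow> f i = 0) \<Longrightarrow> bigO k f"
  by (rule bigOI[where C = 0]) simp

lemma bigO_const: "bigO 0 (\<lambda>i. c)"
  by (rule bigOI[where C = "norm c"]) simp

lemma bigO_add:
  assumes "bigO k f" "bigO k g"
  shows "bigO k (\<lambda>i. f i + g i)"
proof -
  obtain C where C: "C \<ge> 0" "\<And>i. i \<in> I \<Longrightarrow> norm (f i) \<le> C * \<rho> i ^ k" by (rule bigOE[OF assms(1)]) (rule that)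
  obtain D where D: "D \<ge> 0" "\<And>i. i \<in> I \<Longrightarrow> norm (g i) \<le> D * \<rho> i ^ k" by (rule bigOE[OF assms(2)]) (rule that)
  show ?thesis
  proof (rule bigOI)
    fix i assume i: "i \<in> I"
    show "norm (f i + g i) \<le> (C + D) * \<rho> i ^ k"
      using norm_triangle_ineq[of "f i" "g i"] C(2)[OF i] D(2)[OF i] by (simp add: distrib_right)
  qed
qed

lemma bigO_bounded_linear:
  assumes "bounded_linear L" "bigO k f"
  shows "bigO k (\<lambda>i. L (f i))"
proof -
  obtain C where C: "C \<ge> 0" "\<And>i. i \<in> I \<Longrightarrow> norm (f i) \<le> C * \<rho> i ^ k" by (rule bigOE[OF assms(2)]) (rule that)
  obtain K where K: "K \<ge> 0" "\<And>x. norm (L x) \<le> norm x * K" using bounded_linear.nonneg_bounded[OF assms(1)] by blast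
  show ?thesis
  proof (rule bigOI)
    fix i assume i: "i \<in> I"
    have "norm (L (f i)) \<le> norm (f i) * K" by (rule K(2))
    also have "\<dots> \<le> (C * \<rho> i ^ k) * K" by (rule mult_right_mono[OF C(2)[OF i] K(1)])
    finally show "norm (L (f i)) \<le> (C * K) * \<rho> i ^ k" by (simp add: mult_ac)
  qed
qed

lemma bigO_minus: "bigO k f \<Longrightarrow> bigO k (\<lambda>i. - f i)"
  unfolding bigO_def by simp

lemma bigO_diff: "bigO k f \<Longrightarrow> bigO k g \<Longrightarrow> bigO k (\<lambda>i. f i - g i)"
  using bigO_add[OF _ bigO_minus, of k f g] by simp

lemma bigO_diff_trans: "bigO k (\<lambda>i. f i - g i) \<Longrightarrow> bigO k (\<lambda>i. g i - h i) \<Longrightarrow> bigO k (\<lambda>i. f i - h i)"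
  using bigO_add[of k "\<lambda>i. f i - g i" "\<lambda>i. g i - h i"] by simp

lemma bigO_sum: "(\<And>j. j \<in> J \<Longrightarrow> bigO k (f j)) \<Longrightarrow> bigO k (\<lambda>i. \<Sum>j\<in>J. f j i)"
proof (induction J rule: infinite_finite_induct)
  case (insert j J)
  have "bigO k (\<lambda>i. f j i + (\<Sum>j\<in>J. f j i))"
    by (rule bigO_add) (use insert in auto)
  then show ?case using insert.hyps by simp
qed (simp_all add: bigO_zero)

lemma bigO_bilinear:
  assumes "bounded_bilinear b" "bigO k f" "bigO l g" "m \<le> k + l"
  shows "bigO m (\<lambda>i. b (f i) (g i))"
proof -
  obtain C where C: "C \<ge> 0" "\<And>i. i \<in> I \<Longrightarrow> norm (f i) \<le> C * \<rho> i ^ k" by (rule bigOE[OF assms(2)]) (rule that)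
  obtain D where D: "D \<ge> 0" "\<And>i. i \<in> I \<Longrightarrow> norm (g i) \<le> D * \<rho> i ^ l" by (rule bigOE[OF assms(3)]) (rule that)
  obtain K where K: "K \<ge> 0" "\<And>x y. norm (b x y) \<le> norm x * norm y * K" using bounded_bilinear.nonneg_bounded[OF assms(1)] by blast
  have "bigO (k + l) (\<lambda>i. b (f i) (g i))"
  proof (rule bigOI)
    fix i assume i: "i \<in> I"
    have "norm (b (f i) (g i)) \<le> norm (f i) * norm (g i) * K" by (rule K(2))
    also have "\<dots> \<le> ((C * \<rho> i ^ k) * (D * \<rho> i ^ l)) * K"
      using scale_nonneg[OF i] C D K i by (intro mult_right_mono mult_mono) auto
    finally show "norm (b (f i) (g i)) \<le> (C * D * K) * \<rho> i ^ (k + l)" by (simp add: mult_ac power_add)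
  qed
  then show ?thesis by (rule bigO_mono[OF _ assms(4)])
qed

lemmas bigO_scaleR = bigO_bilinear[OF bounded_bilinear_scaleR]
  and bigO_tensor_mult = bigO_bilinear[OF bounded_bilinear_tensor_mult]

lemma bigO_unshuffle_sum:
  assumes "\<And>x y. length x + length y = length w \<Longrightarrow> bigO k (\<lambda>i. f i x y)"
  shows "bigO k (\<lambda>i. unshuffle_sum w (f i))"
  using assms
proof (induction w arbitrary: f)
  case (Cons v w)
  show ?case
    unfolding unshuffle_sum.simps by (intro bigO_add Cons.IH Cons.prems) simp_all
qed simp

text \<open>In coordinates the pairing is a finite sum, and in degree \<open>n\<close> the tensor
  contributes the order \<open>d n\<close> and the form the order \<open>e n\<close>. Where one of
  them vanishes, its order may be chosen freely.\<close>

lemma bigO_tensor_lift: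
  fixes \<phi> :: "'i \<Rightarrow> 'v::fin_dim list \<Rightarrow> 'e::real_normed_vector"
  assumes \<phi>: "\<And>i. multilinear (\<phi> i)" and a: "\<And>i n. n > M \<Longrightarrow> component n (a i) = 0"
    and b\<phi>: "\<And>w. length w \<le> M \<Longrightarrow> bigO (e (length w)) (\<lambda>i. \<phi> i w)"
    and ba: "\<And>n. n \<le> M \<Longrightarrow> bigO (d n) (\<lambda>i. component n (a i))"
    and k: "\<And>n. n \<le> M \<Longrightarrow> k \<le> d n + e n"
  shows "bigO k (\<lambda>i. tensor_lift (\<phi> i) (a i))"
proof -
  obtain B :: "'v set" where B: "finite B" "\<And>b. bounded_linear (tensor_coord B b)"
    "\<And>n a. component n a = (\<Sum>b\<in>basis_words B n. tensor_coord B b a *\<^sub>R tensor_of b)"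
    "\<And>b a n. tensor_coord B b (component n a) = (if length b = n then tensor_coord B b a else 0)"
    by (rule ex_tensor_basis) (rule that)
  have "tensor_lift (\<phi> i) (a i) = (\<Sum>n\<le>M. \<Sum>b\<in>basis_words B n. tensor_coord B b (a i) *\<^sub>R \<phi> i b)" for i
    by (subst linear_expand_basis_words[OF B(3) linear_tensor_lift[OF \<phi>] a]) (simp_all only: tensor_lift_tensor_of[OF \<phi>])
  moreover have "bigO k (\<lambda>i. \<Sum>n\<le>M. \<Sum>b\<in>basis_words B n. tensor_coord B b (a i) *\<^sub>R \<phi> i b)"
  proof (intro bigO_sum)
    fix n b assume n: "n \<in> {..M}" and b: "b \<in> basis_words B n"
    then have len: "length b = n" by (simp add: basis_words_def)
    have "bigO (d n) (\<lambda>i. tensor_coord B b (component n (a i)))"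
      by (rule bigO_bounded_linear[OF B(2) ba]) (use n in simp)
    then have "bigO (d n) (\<lambda>i. tensor_coord B b (a i))" using len by (simp add: B(4))
    moreover have "bigO (e n) (\<lambda>i. \<phi> i b)" using b\<phi>[of b] n len by simp
    ultimately show "bigO k (\<lambda>i. tensor_coord B b (a i) *\<^sub>R \<phi> i b)"
      by (rule bigO_scaleR) (use k n in simp)
  qed
  ultimately show ?thesis by (simp only:)
qed

lemma bigO_osh_map:
  fixes h :: "'i \<Rightarrow> 'v list \<Rightarrow> 'u::fin_dim"
  assumes h: "\<And>w. w \<noteq> [] \<Longrightarrow> bigO 0 (\<lambda>i. h i w)"
  shows "bigO 0 (\<lambda>i. osh_map (h i) w)"
proof (induction w rule: length_rev_induct)
  case Nil
  show ?case unfolding osh_map_Nil by (rule bigO_const)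
next
  case (snoc w v)
  show ?case
    unfolding osh_map_snoc
  proof (rule bigO_unshuffle_sum)
    fix x y :: "'v list" assume "length x + length y = length w"
    then show "bigO 0 (\<lambda>i. osh_map (h i) x \<otimes>\<^sub>t tensor_of [h i (y @ [v])])"
      by (intro bigO_tensor_mult[where k = 0 and l = 0] bigO_bounded_linear[OF bounded_linear_tensor_of_singleton] snoc h) auto
  qed
qed

text \<open>A block of length \<open>n\<close> contributes an error of order \<open>N - n\<close>, and the other blocks are nonempty.\<close>

lemma bigO_osh_map_diff:
  fixes h :: "'i \<Rightarrow> 'v list \<Rightarrow> 'u::fin_dim"
  assumes h: "\<And>w. w \<noteq> [] \<Longrightarrow> bigO 0 (\<lambda>i. h i w)" and h': "\<And>w. w \<noteq> [] \<Longrightarrow> bigO 0 (\<lambda>i. h' i w)"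
    and hh': "\<And>w. w \<noteq> [] \<Longrightarrow> bigO (N - length w) (\<lambda>i. h i w - h' i w)"
    and k: "k + length w + 1 \<le> N + m"
  shows "bigO k (\<lambda>i. component m (osh_map (h i) w - osh_map (h' i) w))"
  using k
proof (induction w arbitrary: m k rule: length_rev_induct)
  case Nil
  show ?case by (rule bigO_eq_0) simp
next
  case (snoc w v)
  show ?case
  proof (cases m)
    case 0
    show ?thesis by (rule bigO_eq_0) (simp add: 0)
  next
    case (Suc m')
    \<comment> \<open>The two maps are exchanged in one place at a time: in the blocks before the
      last one, covered by the induction hypothesis, and in the last block.\<close>
    have eq: "component m (osh_map (h i) (w @ [v]) - osh_map (h' i) (w @ [v]))
      = unshuffle_sum w (\<lambda>x y. component m' (osh_map (h i) x - osh_map (h' i) x) \<otimes>\<^sub>t tensor_of [h i (y @ [v])])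
      + unshuffle_sum w (\<lambda>x y. component m' (osh_map (h' i) x) \<otimes>\<^sub>t tensor_of [h i (y @ [v]) - h' i (y @ [v])])" for i
    proof -
      have "component m (osh_map g (w @ [v])) = unshuffle_sum w (\<lambda>x y. component m' (osh_map g x) \<otimes>\<^sub>t tensor_of [g (y @ [v])])" for g :: "'v list \<Rightarrow> 'u"
        unfolding osh_map_snoc unshuffle_sum_linear[OF linear_component] Suc component_Suc_mult_vector ..
      moreover have "unshuffle_sum w (\<lambda>x y. component m' (osh_map (h i) x) \<otimes>\<^sub>t tensor_of [h i (y @ [v])])
        = unshuffle_sum w (\<lambda>x y. component m' (osh_map (h i) x - osh_map (h' i) x) \<otimes>\<^sub>t tensor_of [h i (y @ [v])])
        + unshuffle_sum w (\<lambda>x y. component m' (osh_map (h' i) x) \<otimes>\<^sub>t tensor_of [h i (y @ [v]) - h' i (y @ [v])])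
        + unshuffle_sum w (\<lambda>x y. component m' (osh_map (h' i) x) \<otimes>\<^sub>t tensor_of [h' i (y @ [v])])"
        unfolding unshuffle_sum_add[symmetric] linear_diff[OF linear_tensor_of_singleton] component_diff
          tensor_mult_diff_left tensor_mult_diff_right by simp
      ultimately show ?thesis unfolding component_diff by simp
    qed
    show ?thesis
      unfolding eq
    proof (intro bigO_add bigO_unshuffle_sum)
      fix x y :: "'v list" assume len: "length x + length y = length w"
      show "bigO k (\<lambda>i. component m' (osh_map (h i) x - osh_map (h' i) x) \<otimes>\<^sub>t tensor_of [h i (y @ [v])])"
      proof (rule bigO_tensor_mult[where k = k and l = 0])
        show "bigO k (\<lambda>i. component m' (osh_map (h i) x - osh_map (h' i) x))"
          by (rule snoc.IH) (use len snoc.prems Suc in simp_all)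
        show "bigO 0 (\<lambda>i. tensor_of [h i (y @ [v])])"
          by (rule bigO_bounded_linear[OF bounded_linear_tensor_of_singleton h]) simp
      qed simp
      show "bigO k (\<lambda>i. component m' (osh_map (h' i) x) \<otimes>\<^sub>t tensor_of [h i (y @ [v]) - h' i (y @ [v])])"
      proof (cases "length x < m'")
        case True
        show ?thesis by (rule bigO_eq_0) (simp add: component_osh_map_eq_0[OF True])
      next
        case False
        \<comment> \<open>The word \<open>x\<close> holds \<open>m'\<close> nonempty blocks, so the
          last block has at most \<open>length w + 1 - m'\<close> letters and its error is of the
          required order \<open>k\<close>.\<close>
        have 1: "bigO 0 (\<lambda>i. component m' (osh_map (h' i) x))"
          by (rule bigO_bounded_linear[OF bounded_linear_component bigO_osh_map]) (rule h')
        have 2: "bigO (N - length (y @ [v])) (\<lambda>i. tensor_of [h i (y @ [v]) - h' i (y @ [v])])"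
          by (rule bigO_bounded_linear[OF bounded_linear_tensor_of_singleton hh']) simp
        show ?thesis
          by (rule bigO_tensor_mult[OF 1 2]) (use False len snoc.prems Suc in simp)
      qed
    qed
  qed
qed

text \<open>The size of the increments of a rough path: order \<open>n\<close> in degree
  \<open>n\<close>. The vanishing above \<open>N\<close> is demanded for all indices, so that
  expansions are finite without reference to the index set.\<close>

definition graded :: "nat \<Rightarrow> ('i \<Rightarrow> 'v::fin_dim tensor) \<Rightarrow> bool" where
  "graded N a \<longleftrightarrow> (\<forall>i n. n > N \<longrightarrow> component n (a i) = 0) \<and> (\<forall>n. bigO n (\<lambda>i. component n (a i)))"

text \<open>The shuffle relation, tested by bilinear maps. Their target cannot be quantified inside
  a definition and is therefore a type argument; targets other than the reals are needed in
  \<open>bigO_osh_map_mult_word\<close>.\<close>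

definition grouplike :: "nat \<Rightarrow> ('i \<Rightarrow> 'v::fin_dim tensor) \<Rightarrow> 'w::real_normed_vector itself \<Rightarrow> bool" where
  "grouplike N a _ \<longleftrightarrow> (\<forall>i\<in>I. \<forall>(f :: 'v list \<Rightarrow> 'v list \<Rightarrow> 'w) k l. bimultilinear f \<longrightarrow> k + l \<le> N \<longrightarrow>
     tensor_lift2 f (component k (a i)) (component l (a i))
       = cop (\<lambda>x y. if length x = k \<and> length y = l then f x y else 0) (component (k + l) (a i)))"

lemma bigO_tensor_lift2:
  fixes g :: "'i \<Rightarrow> 'v::fin_dim list \<Rightarrow> 'v list \<Rightarrow> 'e::real_normed_vector"
  assumes g: "\<And>i. bimultilinear (g i)" "\<And>x y. bigO 0 (\<lambda>i. g i x y)"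
    and a: "bigO k (\<lambda>i. component k (a i))" and b: "bigO l (\<lambda>i. component l (b i))"
  shows "bigO (k + l) (\<lambda>i. tensor_lift2 (g i) (component k (a i)) (component l (b i)))"
  unfolding tensor_lift2_def
proof (rule bigO_tensor_lift[where M = k and e = "\<lambda>_. l" and d = "\<lambda>_. k"])
  show "multilinear (\<lambda>x. tensor_lift (g i x) (component l (b i)))" for i
    by (rule multilinear_tensor_lift_arg[OF g(1)])
  show "bigO l (\<lambda>i. tensor_lift (g i w) (component l (b i)))" for w
  proof (rule bigO_tensor_lift[where M = l and e = "\<lambda>_. 0" and d = "\<lambda>_. l"])
    show "bigO l (\<lambda>i. component n (component l (b i)))" for n
      using b by (cases "n = l") (simp_all add: bigO_zero)
  qed (simp_all add: g bimultilinearD)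
  show "bigO k (\<lambda>i. component n (component k (a i)))" for n
    using a by (cases "n = k") (simp_all add: bigO_zero)
qed simp_all

text \<open>The shuffle relation is exact in bidegrees with \<open>k + l \<le> N\<close>. The
  remaining finitely many terms of the product have total degree, and hence order, at least
  \<open>N + 1\<close>.\<close>

lemma bigO_grouplike:
  fixes g :: "'i \<Rightarrow> 'v::fin_dim list \<Rightarrow> 'v list \<Rightarrow> 'e::real_normed_vector"
  assumes a: "graded N a" "grouplike N a TYPE('e)"
    and g: "\<And>i. bimultilinear (g i)" "\<And>x y. bigO 0 (\<lambda>i. g i x y)"
  shows "bigO (N + 1) (\<lambda>i. cop (g i) (a i) - tensor_lift2 (g i) (a i) (a i))"
proof -
  let ?L = "\<lambda>i k l. tensor_lift2 (g i) (component k (a i)) (component l (a i))"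
  have a0: "component n (a i) = 0" if "n > N" for n i using a(1) that by (simp add: graded_def)
  have sa: "(\<Sum>n\<le>N. component n (a i)) = a i" for i by (rule sum_components) (rule a0)
  have 1: "cop (g i) (a i) = (\<Sum>(k, l)\<in>{(k, l). k + l \<le> N}. ?L i k l)" if i: "i \<in> I" for i
  proof -
    have "cop (g i) (a i) = (\<Sum>n\<le>N. cop (g i) (component n (a i)))"
      by (subst sa[of i, symmetric]) (rule linear_sum[OF linear_cop[OF g(1)]])
    also have "\<dots> = (\<Sum>n\<le>N. \<Sum>k\<le>n. ?L i k (n - k))"
    proof (rule sum.cong[OF refl])
      fix n assume n: "n \<in> {..N}"
      have "cop (\<lambda>x y. if length x = k \<and> length y = n - k then g i x y else 0) (component n (a i)) = ?L i k (n - k)"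
        if "k \<in> {..n}" for k
      proof -
        have kn: "k + (n - k) = n" using that by simp
        have "\<forall>f k l. bimultilinear f \<longrightarrow> k + l \<le> N \<longrightarrow>
          tensor_lift2 f (component k (a i)) (component l (a i))
          = (cop (\<lambda>x y. if length x = k \<and> length y = l then f x y else 0) (component (k + l) (a i)) :: 'e)"
          using a(2) i unfolding grouplike_def by blast
        from this[rule_format, of "g i" k "n - k", OF g(1)] show ?thesis using n unfolding kn by simp
      qed
      then show "cop (g i) (component n (a i)) = (\<Sum>k\<le>n. ?L i k (n - k))"
        by (subst cop_component[OF g(1)]) (rule sum.cong[OF refl])
    qed
    also have "\<dots> = (\<Sum>(k, l)\<in>{(k, l). k + l \<le> N}. ?L i k l)"
      by (rule sum.triangle_reindex_eq[symmetric])
    finally show ?thesis .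
  qed
  let ?A = "{..N} \<times> {..N}" and ?T = "{(k, l). k + l \<le> N}"
  have sub: "?T \<subseteq> ?A" by auto
  have 2: "tensor_lift2 (g i) (a i) (a i) = (\<Sum>(k, l)\<in>?A. ?L i k l)" for i
  proof -
    have "tensor_lift2 (g i) (a i) (a i) = tensor_lift2 (g i) (\<Sum>k\<le>N. component k (a i)) (\<Sum>l\<le>N. component l (a i))"
      unfolding sa ..
    also have "\<dots> = (\<Sum>k\<le>N. \<Sum>l\<le>N. ?L i k l)"
      by (simp only: linear_sum[OF linear_tensor_lift2_left[OF g(1)]] linear_sum[OF linear_tensor_lift2_right[OF g(1)]])
        (rule sum.swap)
    finally show ?thesis unfolding sum.cartesian_product .
  qed
  have "cop (g i) (a i) - tensor_lift2 (g i) (a i) (a i) = - (\<Sum>(k, l)\<in>?A - ?T. ?L i k l)" if "i \<in> I" for i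
    unfolding 1[OF that] 2 using sum_diff[OF _ sub, of "\<lambda>(k, l). ?L i k l"] by simp
  then have "bigO (N + 1) (\<lambda>i. cop (g i) (a i) - tensor_lift2 (g i) (a i) (a i))
     \<longleftrightarrow> bigO (N + 1) (\<lambda>i. - (\<Sum>(k, l)\<in>?A - ?T. ?L i k l))"
    by (rule bigO_cong)
  moreover have "bigO (N + 1) (\<lambda>i. \<Sum>kl\<in>?A - ?T. ?L i (fst kl) (snd kl))"
  proof (rule bigO_sum)
    fix kl assume kl: "kl \<in> ?A - ?T"
    have "bigO (fst kl + snd kl) (\<lambda>i. ?L i (fst kl) (snd kl))"
      by (rule bigO_tensor_lift2[OF g]) (use a(1) in \<open>simp_all add: graded_def\<close>)
    then show "bigO (N + 1) (\<lambda>i. ?L i (fst kl) (snd kl))" by (rule bigO_mono) (use kl in auto)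
  qed
  ultimately show ?thesis by (simp add: bigO_minus case_prod_unfold)
qed

end

section \<open>Almost multiplicativity of the image of a group-like family\<close>

lemma unshuffle_sum_diff:
  "unshuffle_sum w (\<lambda>x y. f x y - g x y) = unshuffle_sum w f - (unshuffle_sum w g :: 'a::ab_group_add)"
proof (induction w arbitrary: f g)
  case (Cons v w)
  show ?case by (simp add: Cons.IH)
qed simp

context scale
begin

context
  fixes N :: nat and a :: "'i \<Rightarrow> 'v::fin_dim tensor" and h :: "'i \<Rightarrow> 'v list \<Rightarrow> 'u::fin_dim"
    and hA :: "'i \<Rightarrow> 'v list \<Rightarrow> 'u" and \<Phi> :: "'i \<Rightarrow> 'v tensor \<Rightarrow> 'u tensor"
  assumes a: "graded N a" "grouplike N a TYPE('u tensor)"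
    and h: "\<And>i. multilinear (h i)" "\<And>w. bigO 0 (\<lambda>i. h i w)"
  defines "hA \<equiv> \<lambda>i y. tensor_lift (h i) (a i \<otimes>\<^sub>t tensor_of y)"
    and "\<Phi> \<equiv> \<lambda>i. tensor_lift (osh_map (h i))"
begin

text \<open>\<open>hA i\<close> is \<open>h i\<close> after left multiplication by
  \<open>a i\<close>. For a controlled path and the increment over [s,u] it is the value at
  \<open>u\<close> predicted from time \<open>s\<close>.\<close>

lemma shifted_eq: "hA i y = tensor_lift (\<lambda>x. h i (x @ y)) (a i)"
  unfolding hA_def by (rule tensor_lift_mult_right[OF h(1)])

lemma multilinear_shifted: "multilinear (hA i)"
  unfolding hA_def
  by (rule multilinear_compose_linear[OF multilinear_tensor_of
      linear_compose'[OF linear_tensor_mult_right linear_tensor_lift[OF h(1)]]])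

lemma bigO_graded: "n \<le> M \<Longrightarrow> bigO n (\<lambda>i. component n (a i))"
  using a(1) by (simp add: graded_def)

lemma bigO_shifted: "bigO 0 (\<lambda>i. hA i y)"
  unfolding shifted_eq
proof (rule bigO_tensor_lift[where M = N and e = "\<lambda>_. 0" and d = "\<lambda>n. n"])
  show "component n (a i) = 0" if "n > N" for i n using a(1) that by (simp add: graded_def)
qed (simp_all add: h multilinear_append_right bigO_graded)

lemma linear_\<Phi>: "linear (\<Phi> i)"
  unfolding \<Phi>_def by (rule linear_tensor_lift[OF multilinear_osh_map[OF h(1)]])

lemma bigO_component_\<Phi>:
  assumes b: "graded N b"
  shows "bigO m (\<lambda>i. component m (\<Phi> i (b i)))"
proof -
  note mo = multilinear_osh_map[OF h(1)]
  have "bigO m (\<lambda>i. tensor_lift (\<lambda>w. component m (osh_map (h i) w)) (b i))"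
  \<comment> \<open>On words with fewer than \<open>m\<close> letters the coefficient vanishes;
    declaring it of order \<open>m\<close> there makes the total order at least \<open>m\<close> in
    every degree.\<close>
  proof (rule bigO_tensor_lift[where M = N and e = "\<lambda>n. if n < m then m else 0" and d = "\<lambda>n. n"])
    show "multilinear (\<lambda>w. component m (osh_map (h i) w))" for i
      by (rule multilinear_compose_linear[OF mo linear_component])
    show "component n (b i) = 0" if "n > N" for i n using b that by (simp add: graded_def)
    show "bigO n (\<lambda>i. component n (b i))" for n using b by (simp add: graded_def)
    show "bigO (if length w < m then m else 0) (\<lambda>i. component m (osh_map (h i) w))" for w
    proof (cases "length w < m")
      case True
      show ?thesis by (rule bigO_eq_0) (rule component_osh_map_eq_0[OF True])
    next
      case False
      have "bigO 0 (\<lambda>i. component m (osh_map (h i) w))"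
        by (rule bigO_bounded_linear[OF bounded_linear_component bigO_osh_map[OF h(2)]])
      with False show ?thesis by simp
    qed
  qed auto
  then show ?thesis unfolding \<Phi>_def tensor_lift_compose_linear[OF mo linear_component, symmetric] .
qed

text \<open>The coalgebra homomorphism turns the product \<open>a \<otimes> b\<close> with a group-like \<open>a\<close> into a product.\<close>

lemma bigO_osh_map_mult_word:
  "bigO (N + 1) (\<lambda>i. \<Phi> i (a i \<otimes>\<^sub>t tensor_of b) - \<Phi> i (a i) \<otimes>\<^sub>t osh_map (hA i) b)"
proof (induction b rule: length_rev_induct)
  case Nil
  show ?case by (rule bigO_eq_0) simp
next
  case (snoc b v)
  \<comment> \<open>With one step of the recursion as \<open>f i\<close>, the image of
    \<open>c v\<close> is the pairing of the coproduct of \<open>c\<close> with \<open>f i\<close>.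
    Taking \<open>c\<close> to be \<open>a i\<close> followed by \<open>b\<close>, the coproduct is
    multiplicative, and group-likeness applies to the factor \<open>a i\<close>.\<close>
  define f where "f i x y = osh_map (h i) x \<otimes>\<^sub>t tensor_of [h i (y @ [v])]" for i x y
  have mv: "multilinear (\<lambda>y. tensor_of [h i (y @ [v])])" for i
    by (rule multilinear_compose_linear[OF multilinear_append_right[OF h(1)] linear_tensor_of_singleton])
  have f: "bimultilinear (f i)" for i
    unfolding f_def by (rule bimultilinear_bilinear[OF bilinear_tensor_mult multilinear_osh_map[OF h(1)] mv])
  have fs: "bimultilinear (\<lambda>x y. f i (x @ x') (y @ y'))" for i x' y'
    using bimultilinear_append[where u = "[]" and u' = x' and w = "[]" and w' = y', OF f[of i]] by simp
  have bf: "bigO 0 (\<lambda>i. f i x y)" for x y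
    unfolding f_def
    by (rule bigO_tensor_mult[OF bigO_osh_map[OF h(2)] bigO_bounded_linear[OF bounded_linear_tensor_of_singleton h(2)]]) simp
  have 1: "\<Phi> i (a i \<otimes>\<^sub>t tensor_of (b @ [v])) = unshuffle_sum b (\<lambda>x' y'. cop (\<lambda>x y. f i (x @ x') (y @ y')) (a i))" for i
  proof -
    have "\<Phi> i (c \<otimes>\<^sub>t tensor_of [v]) = cop (f i) c" for c
    proof (rule tensor_linear_eqI[of "\<lambda>c. \<Phi> i (c \<otimes>\<^sub>t tensor_of [v])"])
      show "linear (\<lambda>c. \<Phi> i (c \<otimes>\<^sub>t tensor_of [v]))"
        by (rule linear_compose'[OF linear_tensor_mult_left linear_\<Phi>])
      show "linear (cop (f i))" by (rule linear_cop[OF f])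
      show "\<Phi> i (tensor_of w \<otimes>\<^sub>t tensor_of [v]) = cop (f i) (tensor_of w)" for w
        unfolding cop_tensor_of[OF f] tensor_mult_tensor_of \<Phi>_def
          tensor_lift_tensor_of[OF multilinear_osh_map[OF h(1)]] osh_map_snoc f_def ..
    qed
    from this[of "a i \<otimes>\<^sub>t tensor_of b"] show ?thesis
      unfolding cop_mult_right[OF f] tensor_mult_assoc tensor_mult_tensor_of .
  qed
  have 2: "tensor_lift2 (\<lambda>x y. f i (x @ x') (y @ y')) (a i) (a i)
      = \<Phi> i (a i \<otimes>\<^sub>t tensor_of x') \<otimes>\<^sub>t tensor_of [hA i (y' @ [v])]" for i x' y'
  proof -
    note m1 = multilinear_append_right[OF multilinear_osh_map[OF h(1)], of i x']
    have m2: "multilinear (\<lambda>y. h i ((y @ y') @ [v]))"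
      using multilinear_append_right[OF h(1), of i "y' @ [v]"] by simp
    have "tensor_lift2 (\<lambda>x y. f i (x @ x') (y @ y')) (a i) (a i)
      = tensor_lift (\<lambda>x. osh_map (h i) (x @ x')) (a i) \<otimes>\<^sub>t tensor_lift (\<lambda>y. tensor_of [h i ((y @ y') @ [v])]) (a i)"
      unfolding f_def
      by (rule tensor_lift2_bilinear[OF bilinear_tensor_mult m1 multilinear_compose_linear[OF m2 linear_tensor_of_singleton]])
    also have "tensor_lift (\<lambda>x. osh_map (h i) (x @ x')) (a i) = \<Phi> i (a i \<otimes>\<^sub>t tensor_of x')"
      unfolding \<Phi>_def by (rule tensor_lift_mult_right[OF multilinear_osh_map[OF h(1)], symmetric])
    also have "tensor_lift (\<lambda>y. tensor_of [h i ((y @ y') @ [v])]) (a i) = tensor_of [tensor_lift (\<lambda>y. h i ((y @ y') @ [v])) (a i)]"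
      by (rule tensor_lift_compose_linear[OF m2 linear_tensor_of_singleton, symmetric])
    also have "tensor_lift (\<lambda>y. h i ((y @ y') @ [v])) (a i) = hA i (y' @ [v])"
      unfolding shifted_eq by simp
    finally show ?thesis .
  qed
  \<comment> \<open>Up to order \<open>N + 1\<close> the coproduct of \<open>a i\<close> is
    \<open>a i\<close> paired with itself. One copy becomes part of the image of \<open>a i\<close>
    and \<open>x'\<close>, the other one turns \<open>h i\<close> into \<open>hA i\<close> on the
    last block.\<close>
  have 3: "bigO (N + 1) (\<lambda>i. \<Phi> i (a i \<otimes>\<^sub>t tensor_of (b @ [v]))
      - unshuffle_sum b (\<lambda>x' y'. \<Phi> i (a i \<otimes>\<^sub>t tensor_of x') \<otimes>\<^sub>t tensor_of [hA i (y' @ [v])]))"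
  proof -
    have eq: "unshuffle_sum b (\<lambda>x' y'. cop (\<lambda>x y. f i (x @ x') (y @ y')) (a i))
      - unshuffle_sum b (\<lambda>x' y'. \<Phi> i (a i \<otimes>\<^sub>t tensor_of x') \<otimes>\<^sub>t tensor_of [hA i (y' @ [v])])
      = unshuffle_sum b (\<lambda>x' y'. cop (\<lambda>x y. f i (x @ x') (y @ y')) (a i)
         - tensor_lift2 (\<lambda>x y. f i (x @ x') (y @ y')) (a i) (a i))" for i
      unfolding 2 by (simp add: unshuffle_sum_diff)
    show ?thesis
      unfolding 1 eq by (intro bigO_unshuffle_sum bigO_grouplike[OF a fs] bf)
  qed
  have 4: "bigO (N + 1) (\<lambda>i. unshuffle_sum b (\<lambda>x' y'. \<Phi> i (a i \<otimes>\<^sub>t tensor_of x') \<otimes>\<^sub>t tensor_of [hA i (y' @ [v])])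
      - \<Phi> i (a i) \<otimes>\<^sub>t osh_map (hA i) (b @ [v]))"
  proof -
    have eq: "unshuffle_sum b (\<lambda>x' y'. \<Phi> i (a i \<otimes>\<^sub>t tensor_of x') \<otimes>\<^sub>t tensor_of [hA i (y' @ [v])])
      - \<Phi> i (a i) \<otimes>\<^sub>t osh_map (hA i) (b @ [v])
      = unshuffle_sum b (\<lambda>x' y'. (\<Phi> i (a i \<otimes>\<^sub>t tensor_of x') - \<Phi> i (a i) \<otimes>\<^sub>t osh_map (hA i) x')
          \<otimes>\<^sub>t tensor_of [hA i (y' @ [v])])" for i
      unfolding osh_map_snoc unshuffle_sum_linear[OF linear_tensor_mult_right] tensor_mult_diff_left
        unshuffle_sum_diff tensor_mult_assoc ..
    show ?thesis
      unfolding eq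
    proof (rule bigO_unshuffle_sum)
      fix x y :: "'v list" assume "length x + length y = length b"
      then show "bigO (N + 1) (\<lambda>i. (\<Phi> i (a i \<otimes>\<^sub>t tensor_of x) - \<Phi> i (a i) \<otimes>\<^sub>t osh_map (hA i) x)
          \<otimes>\<^sub>t tensor_of [hA i (y @ [v])])"
        by (intro bigO_tensor_mult[where k = "N + 1" and l = 0] snoc
            bigO_bounded_linear[OF bounded_linear_tensor_of_singleton bigO_shifted]) simp_all
    qed
  qed
  show ?case by (rule bigO_diff_trans[OF 3 4])
qed

lemma bigO_osh_map_mult:
  assumes b: "graded N b"
  shows "bigO (N + 1) (\<lambda>i. \<Phi> i (a i \<otimes>\<^sub>t b i) - \<Phi> i (a i) \<otimes>\<^sub>t tensor_lift (osh_map (hA i)) (b i))"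
proof -
  note mo = multilinear_osh_map[OF multilinear_shifted]
  have l: "linear (\<lambda>c. \<Phi> i (a i \<otimes>\<^sub>t c) - \<Phi> i (a i) \<otimes>\<^sub>t tensor_lift (osh_map (hA i)) c)" for i
    by (intro linear_compose_sub linear_compose'[OF linear_tensor_mult_right linear_\<Phi>]
        linear_compose'[OF linear_tensor_lift[OF mo] linear_tensor_mult_right])
  have eq: "\<Phi> i (a i \<otimes>\<^sub>t c) - \<Phi> i (a i) \<otimes>\<^sub>t tensor_lift (osh_map (hA i)) c
      = tensor_lift (\<lambda>w. \<Phi> i (a i \<otimes>\<^sub>t tensor_of w) - \<Phi> i (a i) \<otimes>\<^sub>t osh_map (hA i) w) c" for i c
    using fun_cong[OF tensor_lift_linear[OF l, of i], of c] by (simp only: tensor_lift_tensor_of[OF mo])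
  have m: "multilinear (\<lambda>w. \<Phi> i (a i \<otimes>\<^sub>t tensor_of w) - \<Phi> i (a i) \<otimes>\<^sub>t osh_map (hA i) w)" for i
    using multilinear_linear_tensor_of[OF l, of i] by (simp only: tensor_lift_tensor_of[OF mo])
  show ?thesis
    unfolding eq
  proof (rule bigO_tensor_lift[where M = N and e = "\<lambda>_. N + 1" and d = "\<lambda>n. n"])
    show "component n (b i) = 0" if "n > N" for i n using b that by (simp add: graded_def)
    show "bigO n (\<lambda>i. component n (b i))" for n using b by (simp add: graded_def)
  qed (rule m bigO_osh_map_mult_word | simp)+
qed

text \<open>The family \<open>c\<close> is the product of \<open>a\<close> and \<open>b\<close> cut
  off above degree \<open>N\<close>; the parts cut off have order at least
  \<open>N + 1\<close>.\<close>

lemma bigO_osh_map_truncated: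
  assumes b: "graded N b" and c: "\<And>i n. n > N \<Longrightarrow> component n (c i) = 0"
    and chen: "\<And>i n. i \<in> I \<Longrightarrow> n \<le> N \<Longrightarrow> component n (c i) = component n (a i \<otimes>\<^sub>t b i)"
  shows "bigO (N + 1) (\<lambda>i. \<Phi> i (c i) - \<Phi> i (a i \<otimes>\<^sub>t b i))"
proof -
  have z: "component n (a i \<otimes>\<^sub>t b i) = 0" if "n > N + N" for i n
  proof -
    have "component j (a i) \<otimes>\<^sub>t component (n - j) (b i) = 0" for j
      using a(1) b that by (cases "j > N") (auto simp: graded_def)
    then show ?thesis by (simp add: component_mult)
  qed
  have "bigO (N + 1) (\<lambda>i. tensor_lift (osh_map (h i)) (c i - a i \<otimes>\<^sub>t b i))"
  proof (rule bigO_tensor_lift[where M = "N + N" and e = "\<lambda>_. 0" and d = "\<lambda>_. N + 1"])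
    show "component n (c i - a i \<otimes>\<^sub>t b i) = 0" if "n > N + N" for i n
      using c z that by simp
    show "bigO (N + 1) (\<lambda>i. component n (c i - a i \<otimes>\<^sub>t b i))" for n
    proof (cases "n \<le> N")
      case True
      show ?thesis by (rule bigO_eq_0) (simp add: chen True)
    next
      case False
      have "bigO n (\<lambda>i. \<Sum>j\<le>n. component j (a i) \<otimes>\<^sub>t component (n - j) (b i))"
        by (intro bigO_sum bigO_tensor_mult[OF bigO_graded[OF order_refl]]) (use b in \<open>auto simp: graded_def\<close>)
      then have "bigO (N + 1) (\<lambda>i. component n (a i \<otimes>\<^sub>t b i))"
        unfolding component_mult by (rule bigO_mono) (use False in simp)
      moreover have "component n (c i - a i \<otimes>\<^sub>t b i) = - component n (a i \<otimes>\<^sub>t b i)" for i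
        using c False by simp
      ultimately show ?thesis by (simp only: bigO_minus)
    qed
    show "bigO 0 (\<lambda>i. osh_map (h i) w)" for w by (rule bigO_osh_map[OF h(2)])
  qed (simp_all add: multilinear_osh_map h(1))
  then show ?thesis unfolding \<Phi>_def linear_diff[OF linear_tensor_lift[OF multilinear_osh_map[OF h(1)]]] .
qed

text \<open>Three replacements are made: the truncated product by the full one, its image by the
  product of images with the predicted map \<open>hA\<close>, and \<open>hA\<close> by the actual
  map \<open>h'\<close>. The last one is the delicate one, as the error on short words is the
  smallest and on long words the largest.\<close>

theorem bigO_osh_map_almost_multiplicative:
  assumes b: "graded N b" and c: "\<And>i n. n > N \<Longrightarrow> component n (c i) = 0"
    and chen: "\<And>i n. i \<in> I \<Longrightarrow> n \<le> N \<Longrightarrow> component n (c i) = component n (a i \<otimes>\<^sub>t b i)"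
    and h': "\<And>i. multilinear (h' i)" "\<And>w. bigO 0 (\<lambda>i. h' i w)"
    and hh': "\<And>w. w \<noteq> [] \<Longrightarrow> bigO (N - length w) (\<lambda>i. hA i w - h' i w)"
    and m: "m \<ge> 2"
  shows "bigO (N + 1) (\<lambda>i. component m (\<Phi> i (c i))
    - (\<Sum>j\<le>m. component j (\<Phi> i (a i)) \<otimes>\<^sub>t component (m - j) (tensor_lift (osh_map (h' i)) (b i))))"
proof -
  let ?\<Psi> = "\<lambda>i. tensor_lift (osh_map (hA i)) (b i)" and ?\<Psi>' = "\<lambda>i. tensor_lift (osh_map (h' i)) (b i)"
  note mo = multilinear_osh_map[OF multilinear_shifted] and mo' = multilinear_osh_map[OF h'(1)]
  have bA: "component n (b i) = 0" if "n > N" for i n using b that by (simp add: graded_def)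
  have bB: "bigO n (\<lambda>i. component n (b i))" for n using b by (simp add: graded_def)
  have "bigO (N + 1) (\<lambda>i. \<Phi> i (c i) - \<Phi> i (a i) \<otimes>\<^sub>t ?\<Psi> i)"
    by (rule bigO_diff_trans[OF bigO_osh_map_truncated[OF b c chen] bigO_osh_map_mult[OF b]])
  then have "bigO (N + 1) (\<lambda>i. component m (\<Phi> i (c i) - \<Phi> i (a i) \<otimes>\<^sub>t ?\<Psi> i))"
    by (rule bigO_bounded_linear[OF bounded_linear_component])
  then have 1: "bigO (N + 1) (\<lambda>i. component m (\<Phi> i (c i)) - (\<Sum>j\<le>m. component j (\<Phi> i (a i)) \<otimes>\<^sub>t component (m - j) (?\<Psi> i)))"
    by (simp only: component_diff component_mult)
  \<comment> \<open>A block of length l has an error of order \<open>N - l\<close>; its letters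
    return l, and the other \<open>n - 1\<close> blocks contribute at least 1 each. With the order
    \<open>j\<close> of the left factor, where \<open>j + n = m\<close>, the total is at least
    \<open>N + m - 1\<close>, which reaches \<open>N + 1\<close> because
    \<open>m \<ge> 2\<close>.\<close>
  have diff: "bigO (if n = 0 then N + 1 else N + n - 1) (\<lambda>i. component n (?\<Psi> i - ?\<Psi>' i))" for n
  proof -
    have eq: "component n (?\<Psi> i - ?\<Psi>' i) = tensor_lift (\<lambda>w. component n (osh_map (hA i) w - osh_map (h' i) w)) (b i)" for i
    proof -
      have l: "linear (\<lambda>c. component n (tensor_lift (osh_map (hA i)) c - tensor_lift (osh_map (h' i)) c))"
        by (intro linear_compose'[OF _ linear_component] linear_compose_sub linear_tensor_lift mo mo')
      show ?thesis
        using fun_cong[OF tensor_lift_linear[OF l], of "b i"] by (simp only: tensor_lift_tensor_of mo mo')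
    qed
    have ml: "multilinear (\<lambda>w. component n (osh_map (hA i) w - osh_map (h' i) w))" for i
    proof -
      have "linear (\<lambda>c. component n (tensor_lift (osh_map (hA i)) c - tensor_lift (osh_map (h' i)) c))"
        by (intro linear_compose'[OF _ linear_component] linear_compose_sub linear_tensor_lift mo mo')
      from multilinear_linear_tensor_of[OF this] show ?thesis by (simp only: tensor_lift_tensor_of mo mo')
    qed
    show ?thesis
    proof (cases "n = 0")
      case True
      have "bigO (N + 1) (\<lambda>i. tensor_lift (\<lambda>w. component n (osh_map (hA i) w - osh_map (h' i) w)) (b i))"
      proof (rule bigO_tensor_lift[OF ml bA _ bB, where e = "\<lambda>_. N + 1"])
        show "bigO (N + 1) (\<lambda>i. component n (osh_map (hA i) w - osh_map (h' i) w))" for w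
          by (rule bigO_eq_0) (simp add: True)
      qed simp_all
      then show ?thesis using True unfolding eq by simp
    next
      case False
      have "bigO (N + n - 1) (\<lambda>i. tensor_lift (\<lambda>w. component n (osh_map (hA i) w - osh_map (h' i) w)) (b i))"
      proof (rule bigO_tensor_lift[OF ml bA _ bB, where e = "\<lambda>l. N + n - 1 - l"])
        show "bigO (N + n - 1 - length w) (\<lambda>i. component n (osh_map (hA i) w - osh_map (h' i) w))" if "length w \<le> N" for w
        proof (rule bigO_osh_map_diff[where N = N])
          show "bigO (N - length x) (\<lambda>i. hA i x - h' i x)" if "x \<noteq> []" for x by (rule hh'[OF that])
          show "N + n - 1 - length w + length w + 1 \<le> N + n" using that False by simp
        qed (rule bigO_shifted h'(2))+
      qed simp_all
      then show ?thesis using False unfolding eq by simp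
    qed
  qed
  have 2: "bigO (N + 1) (\<lambda>i. (\<Sum>j\<le>m. component j (\<Phi> i (a i)) \<otimes>\<^sub>t component (m - j) (?\<Psi> i))
      - (\<Sum>j\<le>m. component j (\<Phi> i (a i)) \<otimes>\<^sub>t component (m - j) (?\<Psi>' i)))"
    unfolding sum_subtractf[symmetric] tensor_mult_diff_right[symmetric] component_diff[symmetric]
  proof (rule bigO_sum)
    fix j assume j: "j \<in> {..m}"
    show "bigO (N + 1) (\<lambda>i. component j (\<Phi> i (a i)) \<otimes>\<^sub>t component (m - j) (?\<Psi> i - ?\<Psi>' i))"
      by (rule bigO_tensor_mult[OF bigO_component_\<Phi>[OF a(1)] diff]) (use j m in auto)
  qed
  show ?thesis by (rule bigO_diff_trans[OF 1 2])
qed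

end

end

section \<open>Multiplicative functionals\<close>

lemma component_mult_agree:
  assumes "\<And>i. i \<le> n \<Longrightarrow> component i a = component i a'" "\<And>i. i \<le> n \<Longrightarrow> component i b = component i b'"
  shows "component n (a \<otimes>\<^sub>t b) = component n (a' \<otimes>\<^sub>t b')"
  unfolding component_mult by (rule sum.cong[OF refl], subst assms(1), simp, subst assms(2), simp_all)

text \<open>Below degree \<open>m\<close> the tensors \<open>E\<close> and \<open>F\<close> agree,
  and \<open>E\<close> lacks the part of degree \<open>m\<close>. In degree \<open>m\<close> of the
  product this part meets only the unit in \<open>A\<close>.\<close>

lemma component_mult_correct_right:
  assumes A: "component 0 A = tensor_of []" and E: "\<And>n. n < m \<Longrightarrow> component n E = component n F" "component m E = 0"
  shows "component m (A \<otimes>\<^sub>t E) = component m (A \<otimes>\<^sub>t F) - component m F"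
proof -
  have "component m (A \<otimes>\<^sub>t (F - E)) = component m (F - E)"
  proof -
    have "component i A \<otimes>\<^sub>t component (m - i) (F - E) = (if i = 0 then component m (F - E) else 0)" if "i \<le> m" for i
      using that A E(1)[of "m - i"] by (cases "i = 0") auto
    then have "component m (A \<otimes>\<^sub>t (F - E)) = (\<Sum>i\<le>m. if i = 0 then component m (F - E) else 0)"
      unfolding component_mult by (intro sum.cong) auto
    then show ?thesis by simp
  qed
  then show ?thesis using E(2) by (simp add: tensor_mult_diff_right algebra_simps)
qed

lemma component_mult_correct_left:
  assumes A: "component 0 A = tensor_of []" and E: "\<And>n. n < m \<Longrightarrow> component n E = component n F" "component m E = 0"
  shows "component m (E \<otimes>\<^sub>t A) = component m (F \<otimes>\<^sub>t A) - component m F"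
proof -
  have "component m ((F - E) \<otimes>\<^sub>t A) = component m (F - E)"
  proof -
    have "component i (F - E) \<otimes>\<^sub>t component (m - i) A = (if i = m then component m (F - E) else 0)" if "i \<le> m" for i
      using that A E(1)[of i] by (cases "i = m") auto
    then have "component m ((F - E) \<otimes>\<^sub>t A) = (\<Sum>i\<le>m. if i = m then component m (F - E) else 0)"
      unfolding component_mult by (intro sum.cong) auto
    then show ?thesis by simp
  qed
  then show ?thesis using E(2) by (simp add: tensor_mult_diff_left algebra_simps)
qed

lemma component_mult_split:
  assumes "component 0 a = tensor_of []" "component 0 b = tensor_of []" "m \<ge> 1"
  shows "component m (a \<otimes>\<^sub>t b) = component m a + component m b
    + (\<Sum>j\<in>{1..<m}. component j a \<otimes>\<^sub>t component (m - j) b)"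
proof -
  have "{..m} = insert 0 (insert m {1..<m})" using assms(3) by auto
  then show ?thesis unfolding component_mult using assms by (simp add: add_ac)
qed

locale rough_setting = control +
  fixes p :: real
  assumes p_ge_1: "p \<ge> 1"
begin

abbreviation N :: nat where "N \<equiv> \<lfloor>p\<rfloor>\<^sub>\<nat>"

definition r :: "real \<Rightarrow> real \<Rightarrow> real" where "r s t = \<omega> s t powr (1 / p)"

lemma N_ge_1: "N \<ge> 1" by (rule floor_nat_ge_1[OF p_ge_1])

text \<open>The exponent for sewing and for the vanishing of additive defects; it exceeds 1 because
  \<open>p < N + 1\<close>.\<close>

lemma exponent_gt_1: "real (N + 1) / p > 1"
proof -
  have "real N = of_int \<lfloor>p\<rfloor>" using p_ge_1 by simp
  then have "real (N + 1) > p" using floor_correct[of p] by linarith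
  then show ?thesis using p_ge_1 by simp
qed

text \<open>At \<open>\<omega> s t = 0\<close> the case \<open>n = 0\<close> has to be excluded:
  \<open>0 powr 0\<close> is 0, whereas \<open>0 ^ 0\<close> is 1.\<close>

lemma r_power:
  assumes "0 \<le> s" "s \<le> t" "t \<le> T" "n \<ge> 1"
  shows "\<omega> s t powr (real n / p) = r s t ^ n"
proof (cases "\<omega> s t = 0")
  case True
  then show ?thesis using assms(4) by (simp add: r_def)
next
  case False
  then have "r s t > 0" by (simp add: r_def)
  then have "r s t ^ n = r s t powr real n" by (simp add: powr_realpow)
  also have "\<dots> = \<omega> s t powr (real n / p)" by (simp add: r_def powr_powr)
  finally show ?thesis by simp
qed

lemma r_mono:
  assumes "0 \<le> s" "s \<le> s'" "s' \<le> t'" "t' \<le> t" "t \<le> T"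
  shows "r s' t' \<le> r s t"
  unfolding r_def using assms p_ge_1 by (intro powr_mono2 control_mono control_nonneg) auto

lemma r_nonneg: "r s t \<ge> 0" by (simp add: r_def)

definition triples :: "(real \<times> real \<times> real) set" where
  "triples = {(s, u, t). 0 \<le> s \<and> s \<le> u \<and> u \<le> t \<and> t \<le> T}"

sublocale pair: scale "\<Delta>\<^bsub>T\<^esub>" "\<lambda>(s, t). r s t" "r 0 T"
  by unfold_locales (auto simp: r_nonneg intro: r_mono)

sublocale tri: scale triples "\<lambda>(s, u, t). r s t" "r 0 T"
  by unfold_locales (auto simp: triples_def r_nonneg intro: r_mono)

lemma tri_bigO_of_pair:
  assumes "pair.bigO k (\<lambda>(s, t). f s t)"
  shows "tri.bigO k (\<lambda>(s, u, t). f s u)" "tri.bigO k (\<lambda>(s, u, t). f u t)" "tri.bigO k (\<lambda>(s, u, t). f s t)"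
proof -
  obtain C where C: "C \<ge> 0" "\<And>i. i \<in> \<Delta>\<^bsub>T\<^esub> \<Longrightarrow> norm (case i of (s, t) \<Rightarrow> f s t) \<le> C * (case i of (s, t) \<Rightarrow> r s t) ^ k"
    by (rule pair.bigOE[OF assms]) (rule that)
  have *: "norm (f a b) \<le> C * r s t ^ k" if "0 \<le> s" "s \<le> a" "a \<le> b" "b \<le> t" "t \<le> T" for a b s t
  proof -
    have "norm (f a b) \<le> C * r a b ^ k" using C(2)[of "(a, b)"] that by simp
    also have "\<dots> \<le> C * r s t ^ k" using that C(1) by (intro mult_left_mono power_mono r_mono r_nonneg) auto
    finally show ?thesis .
  qed
  show "tri.bigO k (\<lambda>(s, u, t). f s u)" "tri.bigO k (\<lambda>(s, u, t). f u t)" "tri.bigO k (\<lambda>(s, u, t). f s t)"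
    by (rule tri.bigOI[where C = C]; use * in \<open>auto simp: triples_def\<close>)+
qed

lemma pair_bigO_iff:
  assumes "m \<ge> 1"
  shows "pair.bigO m (\<lambda>(s, t). f s t) \<longleftrightarrow> (\<exists>C. \<forall>(s, t)\<in>\<Delta>\<^bsub>T\<^esub>. norm (f s t) \<le> C * \<omega> s t powr (real m / p))"
  unfolding pair.bigO_def using r_power[OF _ _ _ assms] by (intro ex_cong1 ball_cong refl) auto

lemma approx_eq_iff: "m \<ge> 1 \<Longrightarrow> approx_eq p \<omega> T m a b \<longleftrightarrow> pair.bigO m (\<lambda>(s, t). a s t - b s t)"
  unfolding approx_eq_def by (rule pair_bigO_iff[symmetric])

lemma pair_bigO_add:
  assumes "pair.bigO k (\<lambda>(s, t). f s t)" "pair.bigO k (\<lambda>(s, t). g s t)"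
  shows "pair.bigO k (\<lambda>(s, t). f s t + g s t)"
  using pair.bigO_add[OF assms] by (simp add: case_prod_unfold)

lemma additive_bigO_eq_0:
  assumes add: "\<And>s u t. 0 \<le> s \<Longrightarrow> s \<le> u \<Longrightarrow> u \<le> t \<Longrightarrow> t \<le> T \<Longrightarrow> f s t = f s u + f u t"
    and f: "pair.bigO (N + 1) (\<lambda>(s, t). f s t)" and st: "0 \<le> s" "s \<le> t" "t \<le> T"
  shows "f s t = 0"
proof -
  obtain C where C: "C \<ge> 0" "\<And>i. i \<in> \<Delta>\<^bsub>T\<^esub> \<Longrightarrow> norm (case i of (s, t) \<Rightarrow> f s t) \<le> C * (case i of (s, t) \<Rightarrow> r s t) ^ (N + 1)"
    by (rule pair.bigOE[OF f]) (rule that)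
  show ?thesis
  proof (rule additive_superlinear_eq_0[OF add _ exponent_gt_1 st])
    fix s t assume "0 \<le> s" "s \<le> t" "t \<le> T"
    then show "norm (f s t) \<le> C * \<omega> s t powr (real (N + 1) / p)"
      using C(2)[of "(s, t)"] r_power[of s t "N + 1"] by simp
  qed
qed

text \<open>The control is continuous and vanishes on the diagonal. Minimum and maximum bring the
  two times into order, so that limits from both sides are treated at once.\<close>

lemma continuous_on_if_bigO_1:
  fixes J :: "real \<Rightarrow> 'e::real_normed_vector"
  assumes "pair.bigO 1 (\<lambda>(s, t). J t - J s)"
  shows "continuous_on {0..T} J"
proof -
  obtain C where C: "C \<ge> 0" "\<And>i. i \<in> \<Delta>\<^bsub>T\<^esub> \<Longrightarrow> norm (case i of (s, t) \<Rightarrow> J t - J s) \<le> C * (case i of (s, t) \<Rightarrow> r s t) ^ 1"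
    by (rule pair.bigOE[OF assms]) (rule that)
  have J: "norm (J t - J s) \<le> C * r (min s t) (max s t)" if "s \<in> {0..T}" "t \<in> {0..T}" for s t
    using C(2)[of "(min s t, max s t)"] that by (cases "s \<le> t") (auto simp: min_def max_def norm_minus_commute)
  have cont: "continuous_on {0..T} (\<lambda>t. r (min s t) (max s t))" if s: "s \<in> {0..T}" for s
  proof -
    have "continuous_on {0..T} (\<lambda>t. (\<lambda>(a, b). \<omega> a b) (min s t, max s t))"
      by (rule continuous_on_compose2[OF continuous_on_control continuous_on_Pair[OF
          continuous_on_min[OF continuous_on_const continuous_on_id] continuous_on_max[OF continuous_on_const continuous_on_id]]])
        (use s in \<open>auto simp: min_def max_def\<close>)
    then have "continuous_on {0..T} (\<lambda>t. \<omega> (min s t) (max s t))" by simp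
    then show ?thesis
      unfolding r_def
      by (rule continuous_on_powr') (use s p_ge_1 in \<open>auto intro!: continuous_intros control_nonneg simp: min_def max_def\<close>)
  qed
  show ?thesis
    unfolding continuous_on_def
  proof
    fix s assume s: "s \<in> {0..T}"
    have "((\<lambda>t. r (min s t) (max s t)) \<longlongrightarrow> r (min s s) (max s s)) (at s within {0..T})"
      using cont[OF s] s unfolding continuous_on_def by blast
    then have "((\<lambda>t. C * r (min s t) (max s t)) \<longlongrightarrow> C * 0) (at s within {0..T})"
      using s control_refl[of s] by (intro tendsto_mult tendsto_const) (simp add: r_def)
    moreover have ev: "eventually (\<lambda>t. norm (J t - J s) \<le> C * r (min s t) (max s t)) (at s within {0..T})"
      using J[OF s] by (simp add: eventually_at_filter)
    ultimately have "((\<lambda>t. J t - J s) \<longlongrightarrow> 0) (at s within {0..T})"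
      by (intro Lim_null_comparison[OF ev]) simp
    then show "(J \<longlongrightarrow> J s) (at s within {0..T})" by (rule LIM_zero_cancel)
  qed
qed

text \<open>The real sewing lemma is applied to each coordinate, and the resulting paths are
  assembled in degree \<open>m\<close>.\<close>

lemma sewing_tensor:
  fixes \<Psi> :: "real \<Rightarrow> real \<Rightarrow> 'u::fin_dim tensor"
  assumes \<Psi>: "\<And>s t. component m (\<Psi> s t) = \<Psi> s t"
    and defect: "tri.bigO (N + 1) (\<lambda>(s, u, t). \<Psi> s t - \<Psi> s u - \<Psi> u t)"
  obtains J where "\<And>t. component m (J t) = J t" "pair.bigO (N + 1) (\<lambda>(s, t). J t - J s - \<Psi> s t)"
proof -
  obtain B :: "'u set" where B: "finite B" "\<And>b. bounded_linear (tensor_coord B b)"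
    "\<And>n a. component n a = (\<Sum>b\<in>basis_words B n. tensor_coord B b a *\<^sub>R tensor_of b)"
    "\<And>b a n. tensor_coord B b (component n a) = (if length b = n then tensor_coord B b a else 0)"
    by (rule ex_tensor_basis) (rule that)
  have "\<exists>l. pair.bigO (N + 1) (\<lambda>(s, t). l t - l s - tensor_coord B b (\<Psi> s t))" for b
  proof -
    interpret bl: bounded_linear "tensor_coord B b" by (rule B(2))
    have "tri.bigO (N + 1) (\<lambda>i. tensor_coord B b (case i of (s, u, t) \<Rightarrow> \<Psi> s t - \<Psi> s u - \<Psi> u t))"
      by (rule tri.bigO_bounded_linear[OF B(2) defect])
    then obtain C where C: "C \<ge> 0" "\<And>i. i \<in> triples \<Longrightarrow> norm (tensor_coord B b (case i of (s, u, t) \<Rightarrow> \<Psi> s t - \<Psi> s u - \<Psi> u t))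
        \<le> C * (case i of (s, u, t) \<Rightarrow> r s t) ^ (N + 1)"
      by (rule tri.bigOE) (rule that)
    have "\<bar>tensor_coord B b (\<Psi> s t) - tensor_coord B b (\<Psi> s u) - tensor_coord B b (\<Psi> u t)\<bar>
        \<le> C * \<omega> s t powr (real (N + 1) / p)" if "0 \<le> s" "s \<le> u" "u \<le> t" "t \<le> T" for s u t
      using C(2)[of "(s, u, t)"] that r_power[of s t "N + 1"] by (simp add: triples_def bl.diff)
    from sewing_real[of "\<lambda>s t. tensor_coord B b (\<Psi> s t)", OF this C(1) exponent_gt_1]
    obtain l where l: "\<forall>s t. 0 \<le> s \<longrightarrow> s \<le> t \<longrightarrow> t \<le> T \<longrightarrow> \<bar>l t - l s - tensor_coord B b (\<Psi> s t)\<bar>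
        \<le> 2 * C / (1 - 2 powr (1 - real (N + 1) / p)) * \<omega> s t powr (real (N + 1) / p)" by blast
    have "pair.bigO (N + 1) (\<lambda>(s, t). l t - l s - tensor_coord B b (\<Psi> s t))"
      by (rule pair.bigOI[where C = "2 * C / (1 - 2 powr (1 - real (N + 1) / p))"])
        (use l r_power[of _ _ "N + 1"] in auto)
    then show ?thesis by blast
  qed
  then have "\<exists>l. \<forall>b. pair.bigO (N + 1) (\<lambda>(s, t). l b t - l b s - tensor_coord B b (\<Psi> s t))"
    by (intro choice allI)
  then obtain l where "\<forall>b. pair.bigO (N + 1) (\<lambda>(s, t). l b t - l b s - tensor_coord B b (\<Psi> s t))" ..
  then have l: "pair.bigO (N + 1) (\<lambda>(s, t). l b t - l b s - tensor_coord B b (\<Psi> s t))" for b ..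
  define J where "J t = (\<Sum>b\<in>basis_words B m. l b t *\<^sub>R tensor_of b)" for t
  have "component m (J t) = J t" for t
    unfolding J_def component_sum component_scale by (rule sum.cong) (auto simp: basis_words_def)
  moreover have "pair.bigO (N + 1) (\<lambda>(s, t). J t - J s - \<Psi> s t)"
  proof -
    have eq: "J t - J s - \<Psi> s t = (\<Sum>b\<in>basis_words B m. (l b t - l b s - tensor_coord B b (\<Psi> s t)) *\<^sub>R tensor_of b)" for s t
    proof -
      have "\<Psi> s t = (\<Sum>b\<in>basis_words B m. tensor_coord B b (\<Psi> s t) *\<^sub>R tensor_of b)"
        using B(3)[of m "\<Psi> s t"] \<Psi> by simp
      then show ?thesis
        unfolding J_def scaleR_diff_left sum_subtractf by (simp only:)
    qed
    have "pair.bigO (N + 1) (\<lambda>i. \<Sum>b\<in>basis_words B m. (case i of (s, t) \<Rightarrow> l b t - l b s - tensor_coord B b (\<Psi> s t)) *\<^sub>R tensor_of b)"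
      by (intro pair.bigO_sum pair.bigO_scaleR[OF l pair.bigO_const]) simp
    then show ?thesis unfolding eq by (simp add: case_prod_unfold)
  qed
  ultimately show ?thesis by (rule that)
qed

definition multiplicative :: "nat \<Rightarrow> (real \<Rightarrow> real \<Rightarrow> 'u::fin_dim tensor) \<Rightarrow> bool" where
  "multiplicative M Y \<longleftrightarrow> (\<forall>s t. component 0 (Y s t) = tensor_of []) \<and> (\<forall>s t n. n > M \<longrightarrow> component n (Y s t) = 0) \<and>
     (\<forall>s u t n. 0 \<le> s \<longrightarrow> s \<le> u \<longrightarrow> u \<le> t \<longrightarrow> t \<le> T \<longrightarrow> n \<le> M \<longrightarrow>
        component n (Y s t) = component n (Y s u \<otimes>\<^sub>t Y u t))"

text \<open>Sewing yields additive increments, whereas degree \<open>M + 1\<close> of a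
  multiplicative functional is additive only up to products of lower degrees. The path
  \<open>J\<close> to be sewn therefore stands for the part of degree \<open>M + 1\<close> of the
  functional from 0 to \<open>t\<close>: its increment is the new part plus the lower products of
  \<open>Y 0 s\<close> and \<open>Y s t\<close>, which is the germ \<open>\<Psi>\<close>.\<close>

lemma almost_multiplicative_step:
  fixes Z :: "nat \<Rightarrow> real \<Rightarrow> real \<Rightarrow> 'u::fin_dim tensor"
  assumes Z: "\<And>m s t. component m (Z m s t) = Z m s t"
    and ZO: "\<And>m. m \<in> {1..N} \<Longrightarrow> pair.bigO m (\<lambda>(s, t). Z m s t)"
    and ZM: "\<And>m. m \<in> {1..N} \<Longrightarrow> tri.bigO (N + 1) (\<lambda>(s, u, t). Z m s t - Z m s u - Z m u t
       - (\<Sum>j\<in>{1..<m}. Z j s u \<otimes>\<^sub>t Z (m - j) u t))"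
    and M: "M < N" and Y: "multiplicative M Y" "continuous_on \<Delta>\<^bsub>T\<^esub> (\<lambda>(s, t). Y s t)"
    and YZ: "\<And>m. m \<in> {1..M} \<Longrightarrow> pair.bigO (N + 1) (\<lambda>(s, t). component m (Y s t) - Z m s t)"
  shows "\<exists>Y'. multiplicative (Suc M) Y' \<and> continuous_on \<Delta>\<^bsub>T\<^esub> (\<lambda>(s, t). Y' s t) \<and>
     (\<forall>m\<in>{1..Suc M}. pair.bigO (N + 1) (\<lambda>(s, t). component m (Y' s t) - Z m s t))"
proof -
  let ?m = "Suc M"
  have Y0: "component 0 (Y s t) = tensor_of []" and Yhigh: "\<And>n. n > M \<Longrightarrow> component n (Y s t) = 0" for s t
    using Y(1) by (auto simp: multiplicative_def)
  have Ym: "component n (Y s t) = component n (Y s u \<otimes>\<^sub>t Y u t)"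
    if "0 \<le> s" "s \<le> u" "u \<le> t" "t \<le> T" "n < ?m" for s u t n
    using Y(1) that by (auto simp: multiplicative_def)
  have YO: "pair.bigO m (\<lambda>(s, t). component m (Y s t))" if "m \<in> {1..M}" for m
  proof -
    have "pair.bigO m (\<lambda>(s, t). Z m s t)" by (rule ZO) (use that M in auto)
    moreover have "pair.bigO m (\<lambda>(s, t). component m (Y s t) - Z m s t)"
      by (rule pair.bigO_mono[OF YZ[OF that]]) (use that M in auto)
    ultimately have "pair.bigO m (\<lambda>(s, t). Z m s t + (component m (Y s t) - Z m s t))" by (rule pair_bigO_add)
    then show ?thesis by simp
  qed
  define \<Psi> where "\<Psi> s t = Z ?m s t + component ?m (Y 0 s \<otimes>\<^sub>t Y s t)" for s t
  \<comment> \<open>\<open>Y\<close> is multiplicative below degree \<open>?m\<close> and has no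
    part in degree \<open>?m\<close>. Replacing \<open>Y s t\<close> or \<open>Y 0 u\<close> by a
    product thus costs the part of degree \<open>?m\<close> of that product; by associativity all
    but one of the terms cancel.\<close>
  have identity: "component ?m (Y 0 s \<otimes>\<^sub>t Y s t) - component ?m (Y 0 s \<otimes>\<^sub>t Y s u) - component ?m (Y 0 u \<otimes>\<^sub>t Y u t)
      = - component ?m (Y s u \<otimes>\<^sub>t Y u t)" if "0 \<le> s" "s \<le> u" "u \<le> t" "t \<le> T" for s u t
  proof -
    have 1: "component ?m (Y 0 s \<otimes>\<^sub>t Y s t) = component ?m (Y 0 s \<otimes>\<^sub>t (Y s u \<otimes>\<^sub>t Y u t)) - component ?m (Y s u \<otimes>\<^sub>t Y u t)"
      by (rule component_mult_correct_right[OF Y0 Ym Yhigh]) (use that in auto)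
    have 2: "component ?m (Y 0 u \<otimes>\<^sub>t Y u t) = component ?m ((Y 0 s \<otimes>\<^sub>t Y s u) \<otimes>\<^sub>t Y u t) - component ?m (Y 0 s \<otimes>\<^sub>t Y s u)"
      by (rule component_mult_correct_left[OF Y0 Ym Yhigh]) (use that in auto)
    show ?thesis unfolding 1 2 tensor_mult_assoc by simp
  qed
  have split: "component ?m (Y s u \<otimes>\<^sub>t Y v t) = (\<Sum>j\<in>{1..<?m}. component j (Y s u) \<otimes>\<^sub>t component (?m - j) (Y v t))" for s u v t
    using component_mult_split[OF Y0 Y0, of ?m] Yhigh[of ?m] by simp
  have defect: "tri.bigO (N + 1) (\<lambda>(s, u, t). \<Psi> s t - \<Psi> s u - \<Psi> u t)"
  proof -
    \<comment> \<open>The hypothesis on \<open>Z\<close> involves products of \<open>Z\<close>, the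
      identity above products of \<open>Y\<close>. They differ by products of an error of order
      \<open>N + 1\<close> with a factor of positive degree.\<close>
    have "tri.bigO (N + 1) (\<lambda>(s, u, t). (\<Sum>j\<in>{1..<?m}. Z j s u \<otimes>\<^sub>t Z (?m - j) u t)
        - (\<Sum>j\<in>{1..<?m}. component j (Y s u) \<otimes>\<^sub>t component (?m - j) (Y u t)))"
    proof -
      have "tri.bigO (N + 1) (\<lambda>i. \<Sum>j\<in>{1..<?m}.
          (case i of (s, u, t) \<Rightarrow> Z j s u - component j (Y s u)) \<otimes>\<^sub>t (case i of (s, u, t) \<Rightarrow> Z (?m - j) u t)
          + (case i of (s, u, t) \<Rightarrow> component j (Y s u)) \<otimes>\<^sub>t (case i of (s, u, t) \<Rightarrow> Z (?m - j) u t - component (?m - j) (Y u t)))"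
      proof (intro tri.bigO_sum tri.bigO_add)
        fix j assume j: "j \<in> {1..<?m}"
        have jM: "j \<in> {1..M}" "?m - j \<in> {1..M}" and jN: "?m - j \<in> {1..N}" using j M by auto
        have d: "pair.bigO (N + 1) (\<lambda>(s, t). Z k s t - component k (Y s t))" if "k \<in> {1..M}" for k
          using pair.bigO_minus[OF YZ[OF that]] by (simp add: case_prod_unfold)
        show "tri.bigO (N + 1) (\<lambda>i. (case i of (s, u, t) \<Rightarrow> Z j s u - component j (Y s u)) \<otimes>\<^sub>t (case i of (s, u, t) \<Rightarrow> Z (?m - j) u t))"
          by (rule tri.bigO_tensor_mult[OF tri_bigO_of_pair(1)[OF d[OF jM(1)]] tri_bigO_of_pair(2)[OF ZO[OF jN]]]) simp
        show "tri.bigO (N + 1) (\<lambda>i. (case i of (s, u, t) \<Rightarrow> component j (Y s u)) \<otimes>\<^sub>t (case i of (s, u, t) \<Rightarrow> Z (?m - j) u t - component (?m - j) (Y u t)))"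
          by (rule tri.bigO_tensor_mult[OF tri_bigO_of_pair(1)[OF YO[OF jM(1)]] tri_bigO_of_pair(2)[OF d[OF jM(2)]]]) simp
      qed
      moreover have "(\<Sum>j\<in>{1..<?m}. (Z j s u - component j (Y s u)) \<otimes>\<^sub>t Z (?m - j) u t
          + component j (Y s u) \<otimes>\<^sub>t (Z (?m - j) u t - component (?m - j) (Y u t)))
        = (\<Sum>j\<in>{1..<?m}. Z j s u \<otimes>\<^sub>t Z (?m - j) u t) - (\<Sum>j\<in>{1..<?m}. component j (Y s u) \<otimes>\<^sub>t component (?m - j) (Y u t))" for s u t
        unfolding sum_subtractf[symmetric] tensor_mult_diff_left tensor_mult_diff_right by (rule sum.cong) simp_all
      ultimately show ?thesis unfolding case_prod_unfold by (simp only: fst_conv snd_conv)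
    qed
    moreover have "tri.bigO (N + 1) (\<lambda>(s, u, t). Z ?m s t - Z ?m s u - Z ?m u t - (\<Sum>j\<in>{1..<?m}. Z j s u \<otimes>\<^sub>t Z (?m - j) u t))"
      by (rule ZM) (use M in auto)
    ultimately have A: "tri.bigO (N + 1) (\<lambda>i. (case i of (s, u, t) \<Rightarrow> Z ?m s t - Z ?m s u - Z ?m u t - (\<Sum>j\<in>{1..<?m}. Z j s u \<otimes>\<^sub>t Z (?m - j) u t))
      + (case i of (s, u, t) \<Rightarrow> (\<Sum>j\<in>{1..<?m}. Z j s u \<otimes>\<^sub>t Z (?m - j) u t)
        - (\<Sum>j\<in>{1..<?m}. component j (Y s u) \<otimes>\<^sub>t component (?m - j) (Y u t))))"
      by (intro tri.bigO_add)
    show ?thesis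
    proof (rule tri.bigO_cong[THEN iffD1, OF _ A])
      fix i assume "i \<in> triples"
      then obtain s u t where i: "i = (s, u, t)" "0 \<le> s" "s \<le> u" "u \<le> t" "t \<le> T" by (auto simp: triples_def)
      show "(case i of (s, u, t) \<Rightarrow> Z ?m s t - Z ?m s u - Z ?m u t - (\<Sum>j\<in>{1..<?m}. Z j s u \<otimes>\<^sub>t Z (?m - j) u t))
        + (case i of (s, u, t) \<Rightarrow> (\<Sum>j\<in>{1..<?m}. Z j s u \<otimes>\<^sub>t Z (?m - j) u t)
          - (\<Sum>j\<in>{1..<?m}. component j (Y s u) \<otimes>\<^sub>t component (?m - j) (Y u t)))
        = (case i of (s, u, t) \<Rightarrow> \<Psi> s t - \<Psi> s u - \<Psi> u t)"
        using identity[OF i(2-)] unfolding i(1) prod.case \<Psi>_def split[of s u u t, symmetric]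
        by (simp add: algebra_simps)
    qed
  qed
  have "component ?m (\<Psi> s t) = \<Psi> s t" for s t by (simp add: \<Psi>_def Z)
  then obtain J where J: "\<And>t. component ?m (J t) = J t" "pair.bigO (N + 1) (\<lambda>(s, t). J t - J s - \<Psi> s t)"
    by (rule sewing_tensor[OF _ defect]) (rule that)
  define D where "D s t = J t - J s - component ?m (Y 0 s \<otimes>\<^sub>t Y s t)" for s t
  define Y' where "Y' s t = Y s t + D s t" for s t
  have D: "component n (D s t) = (if n = ?m then D s t else 0)" for n s t
  proof -
    have "component n (J t) = (if n = ?m then J t else 0)" for t
      by (subst J(1)[symmetric], unfold component_component) (simp add: J(1))
    then show ?thesis by (simp add: D_def)
  qed
  have Y'n: "component n (Y' s t) = (if n = ?m then D s t else component n (Y s t))" for n s t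
    using Yhigh[of ?m s t] by (simp add: Y'_def D)
  have "pair.bigO (N + 1) (\<lambda>(s, t). component m (Y' s t) - Z m s t)" if "m \<in> {1..?m}" for m
  proof (cases "m = ?m")
    case True
    have "component m (Y' s t) - Z m s t = J t - J s - \<Psi> s t" for s t
      using True by (simp add: Y'n D_def \<Psi>_def)
    then show ?thesis using J(2) by simp
  next
    case False
    then have "pair.bigO (N + 1) (\<lambda>(s, t). component m (Y s t) - Z m s t)" using that by (intro YZ) auto
    then show ?thesis using False by (simp add: Y'n)
  qed
  moreover have "multiplicative ?m Y'"
    unfolding multiplicative_def
  proof (intro conjI allI impI)
    show "component 0 (Y' s t) = tensor_of []" for s t by (simp add: Y'n Y0)
    show "component n (Y' s t) = 0" if "n > ?m" for n s t using that by (simp add: Y'n Yhigh)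
    fix s u t n assume sut: "0 \<le> s" "s \<le> u" "u \<le> t" "t \<le> T" and n: "n \<le> ?m"
    show "component n (Y' s t) = component n (Y' s u \<otimes>\<^sub>t Y' u t)"
    proof (cases "n = ?m")
      case False
      then have "component n (Y' s u \<otimes>\<^sub>t Y' u t) = component n (Y s u \<otimes>\<^sub>t Y u t)"
        using n by (intro component_mult_agree) (auto simp: Y'n)
      then show ?thesis using False n Ym[OF sut, of n] by (simp add: Y'n)
    next
      case True
      have "component ?m (Y' s u \<otimes>\<^sub>t Y' u t) = component ?m (Y' s u) + component ?m (Y' u t)
          + (\<Sum>j\<in>{1..<?m}. component j (Y' s u) \<otimes>\<^sub>t component (?m - j) (Y' u t))"
        by (rule component_mult_split) (simp_all add: Y'n Y0)
      also have "(\<Sum>j\<in>{1..<?m}. component j (Y' s u) \<otimes>\<^sub>t component (?m - j) (Y' u t)) = component ?m (Y s u \<otimes>\<^sub>t Y u t)"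
        unfolding split by (rule sum.cong) (auto simp: Y'n)
      finally have prod: "component ?m (Y' s u \<otimes>\<^sub>t Y' u t) = D s u + D u t + component ?m (Y s u \<otimes>\<^sub>t Y u t)"
        by (simp only: Y'n simp_thms if_True)
      have "component ?m (Y 0 s \<otimes>\<^sub>t Y s t) = (component ?m (Y 0 s \<otimes>\<^sub>t Y s t) - component ?m (Y 0 s \<otimes>\<^sub>t Y s u)
          - component ?m (Y 0 u \<otimes>\<^sub>t Y u t)) + component ?m (Y 0 s \<otimes>\<^sub>t Y s u) + component ?m (Y 0 u \<otimes>\<^sub>t Y u t)" by simp
      then have "D s t = D s u + D u t + component ?m (Y s u \<otimes>\<^sub>t Y u t)"
        unfolding identity[OF sut] D_def by simp
      then show ?thesis unfolding True prod by (simp only: Y'n simp_thms if_True)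
    qed
  qed
  moreover have "continuous_on \<Delta>\<^bsub>T\<^esub> (\<lambda>(s, t). Y' s t)"
  proof -
    have cY: "continuous_on \<Delta>\<^bsub>T\<^esub> (\<lambda>x. Y (fst x) (snd x))" using Y(2) by (simp add: case_prod_unfold)
    have c0: "continuous_on \<Delta>\<^bsub>T\<^esub> (\<lambda>x. Y 0 (fst x))"
      by (rule continuous_on_compose2[OF cY, of _ "\<lambda>x. (0, fst x)", simplified])
        (auto intro!: continuous_intros)
    \<comment> \<open>The factor \<open>Y 0 s\<close> is merely bounded, but the factor
      \<open>Y s t\<close> enters in degree \<open>?m - j \<ge> 1\<close>.\<close>
    have bO: "pair.bigO 1 (\<lambda>(s, t). component ?m (Y 0 s \<otimes>\<^sub>t Y s t))"
    proof -
      have "pair.bigO 1 (\<lambda>i. \<Sum>j\<in>{1..<?m}. component j (Y 0 (fst i)) \<otimes>\<^sub>t (case i of (s, t) \<Rightarrow> component (?m - j) (Y s t)))"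
      proof (rule pair.bigO_sum)
        fix j assume j: "j \<in> {1..<?m}"
        have "pair.bigO j (\<lambda>(s, t). component j (Y s t))" by (rule YO) (use j in auto)
        then obtain C where C: "C \<ge> 0" "\<And>i. i \<in> \<Delta>\<^bsub>T\<^esub> \<Longrightarrow> norm (case i of (s, t) \<Rightarrow> component j (Y s t)) \<le> C * (case i of (s, t) \<Rightarrow> r s t) ^ j"
          by (rule pair.bigOE) (rule that)
        have "pair.bigO 0 (\<lambda>i. component j (Y 0 (fst i)))"
        proof (rule pair.bigOI[where C = "C * r 0 T ^ j"])
          fix i assume i: "i \<in> \<Delta>\<^bsub>T\<^esub>"
          then obtain s t where st: "i = (s, t)" "0 \<le> s" "s \<le> t" "t \<le> T" by (cases i) auto
          have "norm (component j (Y 0 s)) \<le> C * r 0 s ^ j" using C(2)[of "(0, s)"] st by simp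
          also have "\<dots> \<le> C * r 0 T ^ j" using st C(1) by (intro mult_left_mono power_mono r_mono r_nonneg) auto
          finally show "norm (component j (Y 0 (fst i))) \<le> C * r 0 T ^ j * (case i of (s, t) \<Rightarrow> r s t) ^ 0"
            by (simp add: st)
        qed
        moreover have "pair.bigO (?m - j) (\<lambda>(s, t). component (?m - j) (Y s t))" by (rule YO) (use j in auto)
        ultimately show "pair.bigO 1 (\<lambda>i. component j (Y 0 (fst i)) \<otimes>\<^sub>t (case i of (s, t) \<Rightarrow> component (?m - j) (Y s t)))"
          by (rule pair.bigO_tensor_mult) (use j in auto)
      qed
      then show ?thesis unfolding split by (simp add: case_prod_unfold)
    qed
    have "pair.bigO 1 (\<lambda>(s, t). Z ?m s t)" by (rule pair.bigO_mono[OF ZO]) (use M in auto)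
    then have "pair.bigO 1 (\<lambda>(s, t). \<Psi> s t)"
      unfolding \<Psi>_def using bO by (rule pair_bigO_add)
    moreover have "pair.bigO 1 (\<lambda>(s, t). J t - J s - \<Psi> s t)" by (rule pair.bigO_mono[OF J(2)]) simp
    ultimately have "pair.bigO 1 (\<lambda>(s, t). \<Psi> s t + (J t - J s - \<Psi> s t))" by (rule pair_bigO_add)
    then have "pair.bigO 1 (\<lambda>(s, t). J t - J s)" by simp
    then have cJ: "continuous_on {0..T} J" by (rule continuous_on_if_bigO_1)
    have "continuous_on \<Delta>\<^bsub>T\<^esub> (\<lambda>x. J (fst x))" "continuous_on \<Delta>\<^bsub>T\<^esub> (\<lambda>x. J (snd x))"
      by (rule continuous_on_compose2[OF cJ]; auto intro!: continuous_intros simp: time_simplex_def)+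
    then have "continuous_on \<Delta>\<^bsub>T\<^esub> (\<lambda>x. Y (fst x) (snd x) + (J (snd x) - J (fst x) - component ?m (Y 0 (fst x) \<otimes>\<^sub>t Y (fst x) (snd x))))"
      by (intro continuous_on_add continuous_on_diff cY
          bounded_linear.continuous_on[OF bounded_linear_component] bounded_bilinear.continuous_on[OF bounded_bilinear_tensor_mult] c0)
    then show ?thesis by (simp add: Y'_def D_def case_prod_unfold)
  qed
  ultimately show ?thesis by blast
qed

theorem almost_multiplicative_lift:
  fixes Z :: "nat \<Rightarrow> real \<Rightarrow> real \<Rightarrow> 'u::fin_dim tensor"
  assumes Z: "\<And>m s t. component m (Z m s t) = Z m s t"
    and ZO: "\<And>m. m \<in> {1..N} \<Longrightarrow> pair.bigO m (\<lambda>(s, t). Z m s t)"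
    and ZM: "\<And>m. m \<in> {1..N} \<Longrightarrow> tri.bigO (N + 1) (\<lambda>(s, u, t). Z m s t - Z m s u - Z m u t
       - (\<Sum>j\<in>{1..<m}. Z j s u \<otimes>\<^sub>t Z (m - j) u t))"
  shows "\<exists>Y. multiplicative N Y \<and> continuous_on \<Delta>\<^bsub>T\<^esub> (\<lambda>(s, t). Y s t) \<and>
     (\<forall>m\<in>{1..N}. pair.bigO (N + 1) (\<lambda>(s, t). component m (Y s t) - Z m s t))"
proof -
  have "\<exists>Y. multiplicative M Y \<and> continuous_on \<Delta>\<^bsub>T\<^esub> (\<lambda>(s, t). Y s t) \<and>
     (\<forall>m\<in>{1..M}. pair.bigO (N + 1) (\<lambda>(s, t). component m (Y s t) - Z m s t))" if "M \<le> N" for M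
    using that
  proof (induction M)
    case 0
    show ?case
      by (rule exI[of _ "\<lambda>s t. tensor_of []"]) (auto simp: multiplicative_def)
  next
    case (Suc M)
    then obtain Y where Y: "multiplicative M Y" "continuous_on \<Delta>\<^bsub>T\<^esub> (\<lambda>(s, t). Y s t)"
      "\<forall>m\<in>{1..M}. pair.bigO (N + 1) (\<lambda>(s, t). component m (Y s t) - Z m s t)"
      by auto
    show ?case
      by (rule almost_multiplicative_step[OF Z ZO ZM _ Y(1,2) Y(3)[rule_format]]) (use Suc.prems in auto)
  qed
  then show ?thesis by simp
qed

text \<open>If all lower degrees agree, the mixed products in the Chen relation agree, so the
  difference in degree \<open>m\<close> is additive. Being of order \<open>N + 1\<close>, it
  vanishes.\<close>

theorem multiplicative_unique:
  assumes Y: "multiplicative N Y" and Y': "multiplicative N Y'"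
    and diff: "\<And>m. m \<in> {1..N} \<Longrightarrow> pair.bigO (N + 1) (\<lambda>(s, t). component m (Y s t) - component m (Y' s t))"
    and st: "0 \<le> s" "s \<le> t" "t \<le> T"
  shows "Y s t = Y' s t"
proof -
  have "component m (Y s t) = component m (Y' s t)" if "0 \<le> s" "s \<le> t" "t \<le> T" for m s t
    using that
  proof (induction m arbitrary: s t rule: less_induct)
    case (less m)
    consider "m = 0" | "m > N" | "m \<in> {1..N}" by force
    then show ?case
    proof cases
      case 3
      have "component m (Y s t) - component m (Y' s t) = 0"
      proof (rule additive_bigO_eq_0[OF _ diff[OF 3] less.prems])
        fix s u t assume sut: "0 \<le> s" "s \<le> u" "u \<le> t" "t \<le> T"
        have "component m (W s t) = component m (W s u) + component m (W u t)
            + (\<Sum>j\<in>{1..<m}. component j (W s u) \<otimes>\<^sub>t component (m - j) (W u t))" if "multiplicative N W" for W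
          using that 3 sut component_mult_split[of "W s u" "W u t" m] by (auto simp: multiplicative_def)
        note split = this
        have "(\<Sum>j\<in>{1..<m}. component j (Y s u) \<otimes>\<^sub>t component (m - j) (Y u t))
            = (\<Sum>j\<in>{1..<m}. component j (Y' s u) \<otimes>\<^sub>t component (m - j) (Y' u t))"
        proof (rule sum.cong[OF refl])
          fix j assume j: "j \<in> {1..<m}"
          have "component j (Y s u) = component j (Y' s u)" by (rule less.IH) (use j sut in auto)
          moreover have "component (m - j) (Y u t) = component (m - j) (Y' u t)" by (rule less.IH) (use j sut in auto)
          ultimately show "component j (Y s u) \<otimes>\<^sub>t component (m - j) (Y u t) = component j (Y' s u) \<otimes>\<^sub>t component (m - j) (Y' u t)"
            by (simp only:)
        qed
        then show "component m (Y s t) - component m (Y' s t) = component m (Y s u) - component m (Y' s u)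
            + (component m (Y u t) - component m (Y' u t))"
          unfolding split[OF Y] split[OF Y'] by simp
      qed
      then show ?thesis by simp
    qed (use Y Y' in \<open>simp_all add: multiplicative_def\<close>)
  qed
  from this[OF st] show ?thesis by (rule tensor_eqI)
qed

end

section \<open>The shuffle relation\<close>

lemma bimultilinear_if_total_length:
  assumes "bimultilinear f"
  shows "bimultilinear (\<lambda>x y. if length x + length y = n then f x y else 0)"
proof (rule bimultilinearI)
  show "multilinear (\<lambda>y. if length x + length y = n then f x y else 0)" for x
    using multilinear_if_length[OF bimultilinearD(1)[OF assms], of "\<lambda>k. length x + k = n" x] .
  show "multilinear (\<lambda>x. if length x + length y = n then f x y else 0)" for y
    using multilinear_if_length[OF bimultilinearD(2)[OF assms], of "\<lambda>k. k + length y = n" y] .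
qed

lemma linear_eq_0_high_degree:
  assumes \<phi>: "linear \<phi>" and w: "\<And>w. length w > n \<Longrightarrow> \<phi> (tensor_of w) = 0"
    and c: "\<And>i. i \<le> n \<Longrightarrow> component i c = 0"
  shows "\<phi> c = 0"
proof -
  obtain M where M: "\<forall>i\<ge>M. component i c = 0" using ex_degree_bound[of c] by blast
  have "\<phi> (component i c) = 0" for i
  proof (cases "i \<le> n")
    case True
    then show ?thesis by (simp add: c linear_0[OF \<phi>])
  next
    case False
    have "component i c \<in> span (tensor_of ` {w. length w = i})"
      using component_in_tensor_power[of i c] by (simp add: tensor_power_def)
    then show ?thesis
    proof (rule linear_eq_on[OF \<phi> linear_zero])
      fix b :: "'a tensor" assume "b \<in> tensor_of ` {w. length w = i}"
      then show "\<phi> b = 0" using w False by auto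
    qed
  qed
  then have "\<phi> (\<Sum>i\<le>M. component i c) = 0" by (simp add: linear_sum[OF \<phi>])
  moreover have "(\<Sum>i\<le>M. component i c) = c" by (rule sum_components) (simp add: M)
  ultimately show ?thesis by simp
qed

definition homogeneous :: "nat \<Rightarrow> ('u::real_vector list \<Rightarrow> 'u list \<Rightarrow> 'w::real_vector) \<Rightarrow> bool" where
  "homogeneous n f \<longleftrightarrow> bimultilinear f \<and> (\<forall>x y. length x + length y \<noteq> n \<longrightarrow> f x y = 0)"

text \<open>The pairing of \<open>f\<close> with the external square of \<open>a\<close> minus the
  coproduct of \<open>a\<close>. For \<open>f\<close> homogeneous of degree at most \<open>N\<close>
  it is insensitive to truncation at \<open>N\<close>.\<close>

definition shuffle_defect :: "('u::real_vector list \<Rightarrow> 'u list \<Rightarrow> 'w::real_vector) \<Rightarrow> 'u tensor \<Rightarrow> 'w" where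
  "shuffle_defect f a = tensor_lift2 f a a - cop f a"

lemma cop_agree:
  assumes f: "homogeneous n f" and a: "component n a = component n b"
  shows "cop f a = cop f b"
proof -
  have bf: "bimultilinear f" using f by (simp add: homogeneous_def)
  have "cop f c = cop f (component n c)" for c
  proof (rule tensor_linear_eqI[OF linear_cop[OF bf] linear_compose'[OF linear_component linear_cop[OF bf]]])
    fix w
    have "unshuffle_sum w f = 0" if "length w \<noteq> n"
    proof -
      have "unshuffle_sum w f = unshuffle_sum w (\<lambda>x y. 0)"
        by (rule unshuffle_sum_cong[OF refl]) (use f that in \<open>simp add: homogeneous_def\<close>)
      then show ?thesis by (simp add: unshuffle_sum_zero)
    qed
    then show "cop f (tensor_of w) = cop f (component n (tensor_of w))"
      by (simp add: cop_tensor_of bf linear_0[OF linear_cop[OF bf]])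
  qed
  from this[of a] this[of b] a show ?thesis by simp
qed

lemma tensor_lift2_agree:
  assumes f: "homogeneous n f" and a: "\<And>i. i \<le> n \<Longrightarrow> component i a = component i a'"
    and b: "\<And>i. i \<le> n \<Longrightarrow> component i b = component i b'"
  shows "tensor_lift2 f a b = tensor_lift2 f a' b'"
proof -
  have bf: "bimultilinear f" using f by (simp add: homogeneous_def)
  note l = linear_tensor_lift2_left[OF bf] and r = linear_tensor_lift2_right[OF bf]
  have z: "f x = (\<lambda>y. 0)" "(\<lambda>x. f x y) = (\<lambda>x. 0)" if "length x > n" "length y > n" for x y
    using f that by (auto simp: homogeneous_def)
  have "tensor_lift2 f (a - a') b = 0"
  proof (rule linear_eq_0_high_degree[OF l])
    fix w :: "'a list" assume w: "length w > n"
    have "f w = (\<lambda>y. 0)" by (rule z[OF w w])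
    moreover have "tensor_lift (\<lambda>y. 0) b = (0 :: 'b)"
      using tensor_lift_linear[OF linear_zero] by metis
    ultimately show "tensor_lift2 f (tensor_of w) b = 0"
      by (simp add: tensor_lift2_def tensor_lift_tensor_of multilinear_tensor_lift_arg bf)
  qed (simp add: a)
  moreover have "tensor_lift2 f a' (b - b') = 0"
  proof (rule linear_eq_0_high_degree[OF r])
    fix w :: "'a list" assume w: "length w > n"
    have "(\<lambda>x. f x w) = (\<lambda>x. 0)" by (rule z[OF w w])
    moreover have "tensor_lift (\<lambda>x. 0) a' = (0 :: 'b)"
      using tensor_lift_linear[OF linear_zero] by metis
    ultimately show "tensor_lift2 f a' (tensor_of w) = 0"
      by (simp add: tensor_lift2_def tensor_lift_tensor_of bimultilinearD[OF bf])
  qed (simp add: b)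
  ultimately show ?thesis by (simp add: linear_diff[OF l] linear_diff[OF r])
qed

lemma shuffle_defect_agree:
  assumes "homogeneous n f" "\<And>i. i \<le> n \<Longrightarrow> component i a = component i b"
  shows "shuffle_defect f a = shuffle_defect f b"
  unfolding shuffle_defect_def
  using tensor_lift2_agree[OF assms assms(2)] cop_agree[OF assms(1) assms(2)] by simp

text \<open>Up to degree 1 the tensor is the unit plus a letter \<open>v\<close>, and a letter is
  primitive. The external square differs from the coproduct only by \<open>v\<close> paired with
  \<open>v\<close>, which has degree 2.\<close>

lemma shuffle_defect_low_degree:
  fixes a :: "'u::fin_dim tensor"
  assumes f: "homogeneous n f" and n: "n \<le> 1" and a: "component 0 a = tensor_of []"
  shows "shuffle_defect f a = 0"
proof -
  have bf: "bimultilinear f" using f by (simp add: homogeneous_def)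
  have "component 1 a \<in> span (tensor_of ` {w. length w = 1})"
    using component_in_tensor_power[of 1 a] by (simp add: tensor_power_def)
  also have "tensor_of ` {w. length w = 1} = range (\<lambda>v :: 'u. tensor_of [v])" by (auto simp: length_Suc_conv)
  also have "span (range (\<lambda>v :: 'u. tensor_of [v])) = range (\<lambda>v. tensor_of [v])"
    using linear_span_image[OF linear_tensor_of_singleton, of UNIV] by simp
  finally obtain v where v: "component 1 a = tensor_of [v]" by blast
  have "shuffle_defect f a = shuffle_defect f (tensor_of [] + tensor_of [v])"
  proof (rule shuffle_defect_agree[OF f])
    fix i assume "i \<le> n"
    then have "i = 0 \<or> i = 1" using n by auto
    then show "component i a = component i (tensor_of [] + tensor_of [v])" using a v by auto
  qed
  also have "\<dots> = 0"
  proof -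
    note l = linear_tensor_lift2_left[OF bf] and r = linear_tensor_lift2_right[OF bf]
    have "f [] [] = 0 \<or> (f [v] [] = 0 \<and> f [] [v] = 0)" "f [v] [v] = 0"
      using f n by (cases "n = 0"; simp add: homogeneous_def)+
    moreover have "tensor_lift2 f (tensor_of [] + tensor_of [v]) (tensor_of [] + tensor_of [v])
        = f [] [] + f [] [v] + f [v] [] + f [v] [v]"
      by (simp add: linear_add[OF l] linear_add[OF r] tensor_lift2_tensor_of bf)
    moreover have "cop f (tensor_of [] + tensor_of [v]) = f [] [] + f [v] [] + f [] [v]"
      by (simp add: linear_add[OF linear_cop[OF bf]] cop_tensor_of bf)
    ultimately show ?thesis by (simp add: shuffle_defect_def)
  qed
  finally show ?thesis .
qed

text \<open>After letters are appended to its arguments, a form paired with \<open>B\<close> becomes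
  a form in the appended letters. In this way \<open>shuffle_defect_mult\<close> treats the two
  factors of a product one after the other.\<close>

lemma bimultilinear_swap_args:
  assumes "bimultilinear f"
  shows "bimultilinear (\<lambda>x' y'. cop (\<lambda>x y. f (x @ x') (y @ y')) B)"
    and "bimultilinear (\<lambda>x' y'. tensor_lift2 (\<lambda>x y. f (x @ x') (y @ y')) B B')"
proof -
  note f = bimultilinearD[OF assms]
  have fs: "bimultilinear (\<lambda>x y. f (x @ x') (y @ y'))" for x' y'
    using bimultilinear_append[where u = "[]" and u' = x' and w = "[]" and w' = y', OF assms] by simp
  have 1: "multilinear (\<lambda>w. F w B)"
    if "\<And>w. linear (F w)" "\<And>z. multilinear (\<lambda>w. F w (tensor_of z))" for F :: "'a list \<Rightarrow> 'a tensor \<Rightarrow> 'b" and B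
  proof (rule multilinearI)
    fix us ws x y r
    show "F (us @ (x + y) # ws) B = F (us @ x # ws) B + F (us @ y # ws) B"
      by (rule tensor_linear_eqI[OF that(1) linear_compose_add[OF that(1) that(1)]]) (rule multilinear_add_arg[OF that(2)])
    show "F (us @ (r *\<^sub>R x) # ws) B = r *\<^sub>R F (us @ x # ws) B"
      by (rule tensor_linear_eqI[OF that(1) linear_compose_scale_right[OF that(1)]]) (rule multilinear_scale_arg[OF that(2)])
  qed
  have ml: "multilinear (\<lambda>w. unshuffle_sum z (\<lambda>x y. G x y w))"
    if "\<And>x y. multilinear (G x y)" for z and G :: "'a list \<Rightarrow> 'a list \<Rightarrow> 'a list \<Rightarrow> 'b"
    unfolding multilinear_def by (intro allI linear_unshuffle_sum multilinearD that)
  show "bimultilinear (\<lambda>x' y'. cop (\<lambda>x y. f (x @ x') (y @ y')) B)"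
  proof (rule bimultilinearI)
    show "multilinear (\<lambda>y'. cop (\<lambda>x y. f (x @ x') (y @ y')) B)" for x'
    proof (rule 1[OF linear_cop[OF fs]])
      show "multilinear (\<lambda>y'. cop (\<lambda>x y. f (x @ x') (y @ y')) (tensor_of z))" for z
        unfolding cop_tensor_of[OF fs] by (intro ml multilinear_append_left f)
    qed
    show "multilinear (\<lambda>x'. cop (\<lambda>x y. f (x @ x') (y @ y')) B)" for y'
    proof (rule 1[OF linear_cop[OF fs]])
      show "multilinear (\<lambda>x'. cop (\<lambda>x y. f (x @ x') (y @ y')) (tensor_of z))" for z
        unfolding cop_tensor_of[OF fs] by (intro ml multilinear_append_left[of "\<lambda>x. f x _"] f)
    qed
  qed
  show "bimultilinear (\<lambda>x' y'. tensor_lift2 (\<lambda>x y. f (x @ x') (y @ y')) B B')"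
  proof (rule bimultilinearI)
    show "multilinear (\<lambda>y'. tensor_lift2 (\<lambda>x y. f (x @ x') (y @ y')) B B')" for x'
    proof (rule 1[OF linear_tensor_lift2_left[OF fs]])
      show "multilinear (\<lambda>y'. tensor_lift2 (\<lambda>x y. f (x @ x') (y @ y')) (tensor_of z) B')" for z
      proof (rule 1[OF linear_tensor_lift2_right[OF fs]])
        show "multilinear (\<lambda>y'. tensor_lift2 (\<lambda>x y. f (x @ x') (y @ y')) (tensor_of z) (tensor_of z'))" for z'
          unfolding tensor_lift2_tensor_of[OF fs] by (intro multilinear_append_left f)
      qed
    qed
    show "multilinear (\<lambda>x'. tensor_lift2 (\<lambda>x y. f (x @ x') (y @ y')) B B')" for y'
    proof (rule 1[OF linear_tensor_lift2_left[OF fs]])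
      show "multilinear (\<lambda>x'. tensor_lift2 (\<lambda>x y. f (x @ x') (y @ y')) (tensor_of z) B')" for z
      proof (rule 1[OF linear_tensor_lift2_right[OF fs]])
        show "multilinear (\<lambda>x'. tensor_lift2 (\<lambda>x y. f (x @ x') (y @ y')) (tensor_of z) (tensor_of z'))" for z'
          unfolding tensor_lift2_tensor_of[OF fs] by (intro multilinear_append_left[of "\<lambda>x. f x _"] f)
      qed
    qed
  qed
qed

text \<open>In the lowest degree where it may fail, the shuffle relation has an additive defect.\<close>

lemma shuffle_defect_mult:
  fixes B C :: "'u::fin_dim tensor" and f :: "'u list \<Rightarrow> 'u list \<Rightarrow> real"
  assumes f: "homogeneous n f" and n: "n \<ge> 1"
    and B0: "component 0 B = tensor_of []" and C0: "component 0 C = tensor_of []"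
    and B: "\<And>k (g :: 'u list \<Rightarrow> 'u list \<Rightarrow> real). k < n \<Longrightarrow> homogeneous k g \<Longrightarrow> shuffle_defect g B = 0"
    and C: "\<And>k (g :: 'u list \<Rightarrow> 'u list \<Rightarrow> real). k < n \<Longrightarrow> homogeneous k g \<Longrightarrow> shuffle_defect g C = 0"
  shows "shuffle_defect f (B \<otimes>\<^sub>t C) = shuffle_defect f B + shuffle_defect f C"
proof -
  have bf: "bimultilinear f" using f by (simp add: homogeneous_def)
  let ?s = "\<lambda>x' y' x y. f (x @ x') (y @ y')"
  have fs: "bimultilinear (?s x' y')" for x' y'
    using bimultilinear_append[where u = "[]" and u' = x' and w = "[]" and w' = y', OF bf] by simp
  \<comment> \<open>\<open>G\<close> and \<open>E\<close> are the two sides of the shuffle relation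
    for \<open>B\<close>, tested by \<open>f\<close> with the letters coming from \<open>C\<close>
    still to be supplied; pairing them with \<open>C\<close> gives the two sides for the
    product.\<close>
  define G where "G x' y' = tensor_lift2 (?s x' y') B B" for x' y'
  define E where "E x' y' = cop (?s x' y') B" for x' y'
  have bG: "bimultilinear G" and bE: "bimultilinear E"
    unfolding G_def E_def by (rule bimultilinear_swap_args[OF bf])+
  have hs: "homogeneous (n - (length x' + length y')) (?s x' y')" if "length x' + length y' \<le> n" for x' y'
    using fs f that by (auto simp: homogeneous_def)
  have s0: "?s x' y' = (\<lambda>x y. 0)" if "length x' + length y' > n" for x' y'
    using f that by (auto simp: homogeneous_def fun_eq_iff)
  have z2: "tensor_lift2 (\<lambda>(x :: 'u list) (y :: 'u list). (0::real)) = (\<lambda>a b :: 'u tensor. 0)" and zc: "cop (\<lambda>(x :: 'u list) (y :: 'u list). (0::real)) = (\<lambda>a. 0)"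
  proof -
    have z: "tensor_lift (\<lambda>y :: 'u list. (0::real)) = (\<lambda>a. 0)" using tensor_lift_linear[OF linear_zero] .
    show "tensor_lift2 (\<lambda>(x :: 'u list) (y :: 'u list). (0::real)) = (\<lambda>a b :: 'u tensor. 0)" by (simp add: tensor_lift2_def z fun_eq_iff)
    show "cop (\<lambda>(x :: 'u list) (y :: 'u list). (0::real)) = (\<lambda>a. 0)" by (simp add: cop_def unshuffle_sum_zero z)
  qed
  \<comment> \<open>Once letters are appended, the form acting on \<open>B\<close> has degree below
    \<open>n\<close>, where \<open>B\<close> satisfies the relation, or it is zero.\<close>
  have GE: "G x' y' - E x' y' = (if x' = [] \<and> y' = [] then shuffle_defect f B else 0)" for x' y'
  proof -
    consider "x' = [] \<and> y' = []" | "length x' + length y' > n" | "length x' + length y' \<le> n" "\<not> (x' = [] \<and> y' = [])"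
      by linarith
    then show ?thesis
    proof cases
      case 1
      then show ?thesis by (simp add: G_def E_def shuffle_defect_def)
    next
      case 2
      then have "\<not> (x' = [] \<and> y' = [])" by auto
      then show ?thesis unfolding G_def E_def s0[OF 2] z2 zc by auto
    next
      case 3
      then have "n - (length x' + length y') < n" using n by (cases x'; cases y') auto
      from B[OF this hs[OF 3(1)]] show ?thesis using 3(2) by (auto simp: G_def E_def shuffle_defect_def)
    qed
  qed
  have Ghigh: "G x y = 0" if "length x + length y > n" for x y
    unfolding G_def s0[OF that] z2 ..
  have Gn: "G x y = f x y" if "length x + length y = n" for x y
  proof -
    have h0: "homogeneous 0 (?s x y)" using hs[of x y] that by simp
    have "G x y = tensor_lift2 (?s x y) (tensor_of []) (tensor_of [])"
      unfolding G_def by (rule tensor_lift2_agree[OF h0]) (use B0 in auto)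
    then show ?thesis by (simp add: tensor_lift2_tensor_of[OF fs])
  qed
  let ?G = "\<lambda>i x y. if length x + length y = i then G x y else 0"
  have bGi: "bimultilinear (?G i)" and hGi: "homogeneous i (?G i)" for i
    using bimultilinear_if_total_length[OF bG, of i] by (auto simp: homogeneous_def)
  have dG: "G x y = (\<Sum>i\<le>n. ?G i x y)" for x y
    using Ghigh[of x y] by (cases "length x + length y \<le> n") auto
  \<comment> \<open>Only the part of \<open>G\<close> of degree \<open>n\<close> can detect a defect
    of \<open>C\<close>, and this part is \<open>f\<close> because the scalar part of
    \<open>B\<close> is the unit.\<close>
  have "shuffle_defect G C = (\<Sum>i\<le>n. shuffle_defect (?G i) C)"
  proof -
    have "cop G C = (\<Sum>i\<le>n. cop (?G i) C)"
      by (rule tensor_linear_eqI[OF linear_cop[OF bG] linear_compose_sum])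
        (simp_all only: linear_cop[OF bGi] cop_tensor_of[OF bG] cop_tensor_of[OF bGi] unshuffle_sum_sum[symmetric] dG[symmetric] ball_simps, simp)
    moreover have "tensor_lift2 G a b = (\<Sum>i\<le>n. tensor_lift2 (?G i) a b)" for a b
    proof (rule tensor_bilinear_eqI[OF bilinear_tensor_lift2[OF bG]])
      show "bilinear (\<lambda>a b. \<Sum>i\<le>n. tensor_lift2 (?G i) a b)"
        unfolding bilinear_def
        by (intro conjI allI linear_compose_sum ballI linear_tensor_lift2_left linear_tensor_lift2_right bGi)
    qed (simp only: tensor_lift2_tensor_of[OF bG] tensor_lift2_tensor_of[OF bGi] dG[symmetric])
    ultimately show ?thesis by (simp only: shuffle_defect_def sum_subtractf)
  qed
  also have "\<dots> = (\<Sum>i\<le>n. if i = n then shuffle_defect f C else 0)"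
  proof (rule sum.cong[OF refl])
    fix i assume i: "i \<in> {..n}"
    show "shuffle_defect (?G i) C = (if i = n then shuffle_defect f C else 0)"
    proof (cases "i = n")
      case True
      have "?G n = f" using f Gn by (auto simp: fun_eq_iff homogeneous_def)
      then show ?thesis using True by simp
    next
      case False
      then show ?thesis using C[OF _ hGi] i by simp
    qed
  qed
  finally have dGC: "shuffle_defect G C = shuffle_defect f C" by simp
  have copBC: "cop f (B \<otimes>\<^sub>t C) = cop E C"
  proof (rule tensor_linear_eqI[of "\<lambda>C. cop f (B \<otimes>\<^sub>t C)"])
    show "linear (\<lambda>C. cop f (B \<otimes>\<^sub>t C))" by (rule linear_compose'[OF linear_tensor_mult_right linear_cop[OF bf]])
    show "linear (cop E)" by (rule linear_cop[OF bE])
    show "cop f (B \<otimes>\<^sub>t tensor_of w) = cop E (tensor_of w)" for w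
      unfolding cop_mult_right[OF bf] cop_tensor_of[OF bE] E_def ..
  qed
  have liftBC: "tensor_lift2 f (B \<otimes>\<^sub>t c) (B \<otimes>\<^sub>t d) = tensor_lift2 G c d" for c d
  proof (rule tensor_bilinear_eqI[of "\<lambda>c d. tensor_lift2 f (B \<otimes>\<^sub>t c) (B \<otimes>\<^sub>t d)"])
    show "bilinear (\<lambda>c d. tensor_lift2 f (B \<otimes>\<^sub>t c) (B \<otimes>\<^sub>t d))"
      by (rule bilinear_compose_linear[OF bilinear_tensor_lift2[OF bf] linear_tensor_mult_right linear_tensor_mult_right])
    show "bilinear (tensor_lift2 G)" by (rule bilinear_tensor_lift2[OF bG])
    fix x y
    have l: "bimultilinear (\<lambda>a b. f (a @ x) b)"
      using bimultilinear_append[where u = "[]" and u' = x and w = "[]" and w' = "[]", OF bf] by simp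
    show "tensor_lift2 f (B \<otimes>\<^sub>t tensor_of x) (B \<otimes>\<^sub>t tensor_of y) = tensor_lift2 G (tensor_of x) (tensor_of y)"
      unfolding tensor_lift2_mult_left[OF bf] tensor_lift2_mult_right[OF l] tensor_lift2_tensor_of[OF bG] G_def ..
  qed
  \<comment> \<open>The difference of \<open>G\<close> and \<open>E\<close> is supported on empty
    words, so from \<open>C\<close> only its scalar part, the unit, is used.\<close>
  have "cop G C - cop E C = shuffle_defect f B"
  proof -
    let ?d = "\<lambda>x y. G x y - E x y"
    have bd: "bimultilinear ?d"
      using bimultilinear_add[OF bG bimultilinear_compose_linear[OF bE linear_uminus]] by simp
    have "cop G C - cop E C = cop ?d C"
      by (rule tensor_linear_eqI[OF linear_compose_sub[OF linear_cop[OF bG] linear_cop[OF bE]] linear_cop[OF bd]])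
        (simp only: cop_tensor_of[OF bG] cop_tensor_of[OF bE] cop_tensor_of[OF bd] unshuffle_sum_diff)
    also have "\<dots> = cop ?d (tensor_of [])"
      by (rule cop_agree[of 0]) (use bd C0 GE in \<open>auto simp: homogeneous_def\<close>)
    also have "\<dots> = shuffle_defect f B" unfolding cop_tensor_of[OF bd] by (simp add: GE)
    finally show ?thesis .
  qed
  then show ?thesis
    using dGC unfolding shuffle_defect_def copBC liftBC by linarith
qed

text \<open>Tensors are by construction classes of formal sums that real multilinear forms cannot
  distinguish.\<close>

lemma tensor_eq_forms:
  fixes a b :: "'u::real_vector tensor"
  assumes "\<And>g :: 'u list \<Rightarrow> real. multilinear g \<Longrightarrow> tensor_lift g a = tensor_lift g b"
  shows "a = b"
proof -
  obtain x y where xy: "a = abs_tensor x" "b = abs_tensor y"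
    using ex_abs_tensor[of a] ex_abs_tensor[of b] by blast
  have "formal_eval g x = formal_eval g y" if "multilinear g" for g :: "'u list \<Rightarrow> real"
    using assms[OF that] by (simp add: xy tensor_lift_abs[OF that])
  then show ?thesis unfolding xy tensor.abs_eq_iff tensor_rel_def by blast
qed

lemma tensor_lift_Delta_sh:
  assumes g: "multilinear g"
  shows "tensor_lift g (Delta_sh k l c)
    = cop (\<lambda>x y. if length x = k \<and> length y = l then g [tensor_of x, tensor_of y] else 0) c"
proof -
  let ?d = "\<lambda>x y. if length x = k \<and> length y = l then tensor_of [tensor_of x, tensor_of y] else 0"
  have m: "multilinear (\<lambda>w. unshuffle_sum w ?d)"
    by (intro multilinear_unshuffle_sum bimultilinear_if_length bimultilinear_tensor_of_pair)
  have "tensor_lift g (?d x y) = (if length x = k \<and> length y = l then g [tensor_of x, tensor_of y] else 0)" for x y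
    by (simp add: tensor_lift_tensor_of g linear_0[OF linear_tensor_lift[OF g]])
  then show ?thesis
    unfolding Delta_sh_eq cop_def tensor_lift_compose_linear[OF m linear_tensor_lift[OF g]]
      unshuffle_sum_linear[OF linear_tensor_lift[OF g]] by simp
qed

lemma Delta_sh_imp_cop:
  assumes eq: "tensor_of [a, b] = Delta_sh k l c" and f: "bimultilinear f"
  shows "tensor_lift2 f a b = cop (\<lambda>x y. if length x = k \<and> length y = l then f x y else 0) c"
proof -
  let ?g = "\<lambda>as. case as of [x, y] \<Rightarrow> tensor_lift2 f x y | _ \<Rightarrow> 0"
  have g: "multilinear ?g" by (rule multilinear_pair[OF bilinear_tensor_lift2[OF f]])
  have "tensor_lift2 f a b = tensor_lift ?g (tensor_of [a, b])" by (simp add: tensor_lift_tensor_of[OF g])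
  moreover have "(\<lambda>x y. if length x = k \<and> length y = l then ?g [tensor_of x, tensor_of y] else 0)
      = (\<lambda>x y. if length x = k \<and> length y = l then f x y else 0)"
    by (intro ext) (simp add: tensor_lift2_tensor_of[OF f])
  ultimately show ?thesis unfolding eq tensor_lift_Delta_sh[OF g] by (simp only:)
qed

text \<open>A multilinear form on tensors restricts on words of length two to a bilinear form in
  \<open>a\<close> and \<open>b\<close>, so real bilinear forms detect the relation between
  \<open>a\<close>, \<open>b\<close> and \<open>c\<close>.\<close>

lemma cop_imp_Delta_sh:
  fixes a b c :: "'u::real_vector tensor"
  assumes "\<And>f :: 'u list \<Rightarrow> 'u list \<Rightarrow> real. bimultilinear f \<Longrightarrow>
    tensor_lift2 f a b = cop (\<lambda>x y. if length x = k \<and> length y = l then f x y else 0) c"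
  shows "tensor_of [a, b] = Delta_sh k l c"
proof (rule tensor_eq_forms)
  fix g :: "'u tensor list \<Rightarrow> real" assume g: "multilinear g"
  have bl: "bilinear (\<lambda>a b. g [a, b])"
    unfolding bilinear_def using multilinearD[OF g, of "[]" "[_]"] multilinearD[OF g, of "[_]" "[]"] by simp
  have f: "bimultilinear (\<lambda>x y. g [tensor_of x, tensor_of y])"
    by (rule bimultilinear_bilinear[OF bl multilinear_tensor_of multilinear_tensor_of])
  have "tensor_lift2 (\<lambda>x y. g [tensor_of x, tensor_of y]) a b = g [a, b]"
    by (rule tensor_bilinear_eqI[OF bilinear_tensor_lift2[OF f] bl]) (rule tensor_lift2_tensor_of[OF f])
  then show "tensor_lift g (tensor_of [a, b]) = tensor_lift g (Delta_sh k l c)"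
    unfolding tensor_lift_tensor_of[OF g] tensor_lift_Delta_sh[OF g] using assms[OF f] by simp
qed

section \<open>The lift of a controlled path\<close>

text \<open>The counit property of the unshuffle coproduct.\<close>

lemma unshuffle_sum_left_Nil: "unshuffle_sum w (\<lambda>x y. if x = [] then g y else 0) = g w"
proof (induction w arbitrary: g)
  case (Cons v w)
  show ?case using Cons.IH[of "\<lambda>y. g (v # y)"] by (simp add: unshuffle_sum_zero)
qed simp

lemma component_osh_map_1: "component 1 (osh_map h w) = (if w = [] then 0 else tensor_of [h w])"
proof (cases w rule: rev_cases)
  case (snoc u v)
  have "component (Suc 0) (osh_map h (u @ [v])) = unshuffle_sum u (\<lambda>x y. component 0 (osh_map h x) \<otimes>\<^sub>t tensor_of [h (y @ [v])])"
    unfolding osh_map_snoc unshuffle_sum_linear[OF linear_component] component_Suc_mult_vector ..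
  also have "\<dots> = unshuffle_sum u (\<lambda>x y. if x = [] then tensor_of [h (y @ [v])] else 0)"
    by (rule unshuffle_sum_cong) auto
  finally show ?thesis unfolding unshuffle_sum_left_Nil by (simp add: snoc)
qed simp

text \<open>With at least two blocks every block is a proper part of the word, so the value of
  \<open>h\<close> on the whole word does not enter.\<close>

lemma component_osh_map_cong:
  assumes "m \<ge> 2" "\<And>x. x \<noteq> [] \<Longrightarrow> length x < length w \<Longrightarrow> h x = h' x"
  shows "component m (osh_map h w) = component m (osh_map h' w)"
proof (cases w rule: rev_cases)
  case (snoc u v)
  obtain m' where m: "m = Suc m'" "m' \<ge> 1" using assms(1) by (cases m) auto
  have "component m' (osh_map h x) \<otimes>\<^sub>t tensor_of [h (y @ [v])] = component m' (osh_map h' x) \<otimes>\<^sub>t tensor_of [h' (y @ [v])]"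
    if len: "length x + length y = length u" for x y
  proof (cases "x = []")
    case True
    then show ?thesis using m by simp
  next
    case False
    then have "length (y @ [v]) < length w" using len snoc by (cases x) auto
    then have "h (y @ [v]) = h' (y @ [v])" by (intro assms(2)) simp
    moreover have "osh_map h x = osh_map h' x"
      by (rule osh_map_cong, rule assms(2)) (use len snoc in auto)
    ultimately show ?thesis by (simp only:)
  qed
  then show ?thesis
    unfolding snoc osh_map_snoc unshuffle_sum_linear[OF linear_component] m component_Suc_mult_vector
    by (rule unshuffle_sum_cong[OF refl])
qed simp

lemma linear_vector_part: "linear (vector_part :: 'v::real_vector tensor \<Rightarrow> 'v)"
  and vector_part_tensor_of: "vector_part (tensor_of w) = (case w of [v] \<Rightarrow> v | _ \<Rightarrow> (0 :: 'v))"
proof -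
  have m: "multilinear (\<lambda>w. case w of [v] \<Rightarrow> v | _ \<Rightarrow> (0 :: 'v))"
    unfolding multilinear_def
  proof (intro allI)
    fix us ws :: "'v list"
    show "linear (\<lambda>v. case us @ v # ws of [v] \<Rightarrow> v | _ \<Rightarrow> 0)"
      using linear_zero linear_id[unfolded id_def] by (cases us; cases ws; cases "tl us") auto
  qed
  show "linear (vector_part :: 'v tensor \<Rightarrow> 'v)"
    unfolding vector_part_def by (rule linear_tensor_lift[OF m])
  show "vector_part (tensor_of w) = (case w of [v] \<Rightarrow> v | _ \<Rightarrow> 0)"
    unfolding vector_part_def by (rule tensor_lift_tensor_of[OF m])
qed

lemma component_1_vector_part: "component 1 a = tensor_of [vector_part a]"
proof (rule tensor_linear_eqI[OF linear_component linear_compose'[OF linear_vector_part linear_tensor_of_singleton]])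
  show "component 1 (tensor_of w) = tensor_of [vector_part (tensor_of w)]" for w :: "'a list"
    using linear_0[OF linear_tensor_of_singleton]
    by (cases w; cases "tl w") (auto simp: vector_part_tensor_of)
qed

lemma vector_part_singleton [simp]: "vector_part (tensor_of [v]) = v"
  by (simp add: vector_part_tensor_of)

lemma bounded_linear_vector_part: "bounded_linear (vector_part :: 'v::fin_dim tensor \<Rightarrow> 'v)"
proof (rule bounded_linear_truncated[OF linear_vector_part, of 2])
  fix n and a :: "'v tensor" assume "n \<ge> 2" "a \<in> tensor_power n"
  then have "component 1 a = 0" by (metis component_component numeral_le_one_iff semiring_norm(69) tensor_power_iff)
  then have "tensor_of [vector_part a] = 0" unfolding component_1_vector_part .
  then have "vector_part (tensor_of [vector_part a]) = 0" using linear_0[OF linear_vector_part] by metis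
  then show "vector_part a = 0" by simp
qed

lemma tensor_lift2_if_length:
  assumes f: "bimultilinear f"
  shows "tensor_lift2 (\<lambda>x y. if length x = k \<and> length y = l then f x y else 0) a b
    = tensor_lift2 f (component k a) (component l b)"
proof (rule tensor_bilinear_eqI[OF bilinear_tensor_lift2[OF bimultilinear_if_length[OF f]]
      bilinear_compose_linear[OF bilinear_tensor_lift2[OF f] linear_component linear_component]])
  show "tensor_lift2 (\<lambda>x y. if length x = k \<and> length y = l then f x y else 0) (tensor_of x) (tensor_of y)
    = tensor_lift2 f (component k (tensor_of x)) (component l (tensor_of y))" for x y
    unfolding tensor_lift2_tensor_of[OF bimultilinear_if_length[OF f]]
    by (auto simp: tensor_lift2_tensor_of[OF f] linear_0[OF linear_tensor_lift2_left[OF f]] linear_0[OF linear_tensor_lift2_right[OF f]])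
qed

lemma tensor_lift2_components:
  assumes f: "homogeneous n f"
  shows "tensor_lift2 f a b = (\<Sum>k\<le>n. tensor_lift2 f (component k a) (component (n - k) b))"
proof -
  have bf: "bimultilinear f" using f by (simp add: homogeneous_def)
  note fk = bimultilinear_if_length[OF bf]
  let ?f = "\<lambda>k x y. if length x = k \<and> length y = n - k then f x y else 0"
  have "f x y = (\<Sum>k\<le>n. ?f k x y)" for x y
  proof (cases "length x + length y = n")
    case True
    then have "?f k x y = (if k = length x then f x y else 0)" for k by auto
    then show ?thesis using True by simp
  next
    case False
    then have "f x y = 0" using f by (auto simp: homogeneous_def)
    then show ?thesis by (simp cong: if_cong)
  qed
  note dec = this
  have "tensor_lift2 f a b = (\<Sum>k\<le>n. tensor_lift2 (?f k) a b)"
  proof (rule tensor_bilinear_eqI[OF bilinear_tensor_lift2[OF bf]])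
    show "bilinear (\<lambda>a b. \<Sum>k\<le>n. tensor_lift2 (?f k) a b)"
      unfolding bilinear_def
      by (intro conjI allI linear_compose_sum ballI linear_tensor_lift2_left linear_tensor_lift2_right fk)
  qed (simp only: tensor_lift2_tensor_of[OF bf] tensor_lift2_tensor_of[OF fk] dec[symmetric])
  then show ?thesis unfolding tensor_lift2_if_length[OF bf] .
qed

lemma (in scale) bigO_tensor_lift2_component:
  fixes g :: "'v::fin_dim list \<Rightarrow> 'v list \<Rightarrow> 'e::real_normed_vector"
  assumes g: "bimultilinear g" and a: "bigO e (\<lambda>i. component k (a i))" and b: "bigO e' (\<lambda>i. component l (b i))"
    and m: "m \<le> e + e'"
  shows "bigO m (\<lambda>i. tensor_lift2 g (component k (a i)) (component l (b i)))"
  unfolding tensor_lift2_def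
proof (rule bigO_tensor_lift[where M = k and e = "\<lambda>_. e'" and d = "\<lambda>_. e"])
  show "multilinear (\<lambda>x. tensor_lift (g x) (component l (b i)))" for i
    by (rule multilinear_tensor_lift_arg[OF g])
  show "bigO e' (\<lambda>i. tensor_lift (g w) (component l (b i)))" for w
  proof (rule bigO_tensor_lift[where M = l and e = "\<lambda>_. 0" and d = "\<lambda>_. e'"])
    show "bigO e' (\<lambda>i. component n (component l (b i)))" for n
      using b by (cases "n = l") (simp_all add: bigO_zero)
  qed (simp_all add: g bimultilinearD bigO_const)
  show "bigO e (\<lambda>i. component n (component k (a i)))" for n
    using a by (cases "n = k") (simp_all add: bigO_zero)
qed (use m in simp_all)

lemma cop_osh_map:
  fixes f :: "'u::real_vector list \<Rightarrow> 'u list \<Rightarrow> 'w::real_vector" and h :: "'v::real_vector list \<Rightarrow> 'u"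
  assumes f: "bimultilinear f" and h: "multilinear h"
  defines "g \<equiv> \<lambda>x y. tensor_lift2 f (osh_map h x) (osh_map h y)"
  shows "bimultilinear g" "cop f (tensor_lift (osh_map h) a) = cop g a"
    "tensor_lift2 f (tensor_lift (osh_map h) a) (tensor_lift (osh_map h) b) = tensor_lift2 g a b"
proof -
  note mo = multilinear_osh_map[OF h]
  show g: "bimultilinear g"
    unfolding g_def by (rule bimultilinear_bilinear[OF bilinear_tensor_lift2[OF f] mo mo])
  show "cop f (tensor_lift (osh_map h) a) = cop g a"
    by (rule tensor_linear_eqI[OF linear_compose'[OF linear_tensor_lift[OF mo] linear_cop[OF f]] linear_cop[OF g]])
      (simp only: tensor_lift_tensor_of[OF mo] osh_map_coalgebra[OF f] cop_tensor_of[OF g], simp only: g_def)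
  show "tensor_lift2 f (tensor_lift (osh_map h) a) (tensor_lift (osh_map h) b) = tensor_lift2 g a b"
    unfolding g_def by (rule tensor_lift2_bilinear[OF bilinear_tensor_lift2[OF f] mo mo, symmetric])
qed

context rough_setting
begin

text \<open>Increments set to the unit off \<open>\<Delta>\<^sub>T\<close>, so that the normalisations hold without side conditions.\<close>

definition incr1 :: "'v::fin_dim rough_path \<Rightarrow> real \<Rightarrow> real \<Rightarrow> 'v tensor" where
  "incr1 \<X> s t = (if (s, t) \<in> \<Delta>\<^bsub>T\<^esub> then incr \<X> s t else tensor_of [])"

lemma incr1_eq: "0 \<le> s \<Longrightarrow> s \<le> t \<Longrightarrow> t \<le> T \<Longrightarrow> incr1 \<X> s t = incr \<X> s t"
  by (simp add: incr1_def)

lemma multiplicative_incr1: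
  assumes X: "\<X> \<in> rough_paths p \<omega> T"
  shows "multiplicative N (incr1 \<X>)"
  unfolding multiplicative_def
proof (intro conjI allI impI)
  show "component 0 (incr1 \<X> s t) = tensor_of []" for s t
    using X unfolding rough_paths_def incr1_def by auto
  show "component n (incr1 \<X> s t) = 0" if "n > N" for s t n
  proof (cases "(s, t) \<in> \<Delta>\<^bsub>T\<^esub>")
    case True
    then have "component n (incr \<X> s t) = 0" using X that unfolding rough_paths_def by blast
    then show ?thesis using True by (simp add: incr1_def)
  next
    case False
    have "n \<noteq> 0" using that by simp
    then show ?thesis unfolding incr1_def if_not_P[OF False] by simp
  qed
  fix s u t n assume sut: "0 \<le> s" "s \<le> u" "u \<le> t" "t \<le> T" and n: "n \<le> N"
  have "incr \<X> s t = (\<Sum>n\<le>N. component n (incr \<X> s u \<otimes>\<^sub>t incr \<X> u t))"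
    using X sut unfolding rough_paths_def by blast
  then have "component n (incr \<X> s t) = (\<Sum>m\<le>N. component n (component m (incr \<X> s u \<otimes>\<^sub>t incr \<X> u t)))"
    by (simp only: component_sum)
  also have "\<dots> = component n (incr \<X> s u \<otimes>\<^sub>t incr \<X> u t)"
    unfolding component_component using n by (simp add: sum.delta')
  finally show "component n (incr1 \<X> s t) = component n (incr1 \<X> s u \<otimes>\<^sub>t incr1 \<X> u t)"
    using sut by (simp add: incr1_eq)
qed

lemma bigO_incr1:
  assumes X: "\<X> \<in> rough_paths p \<omega> T"
  shows "pair.bigO n (\<lambda>(s, t). component n (incr1 \<X> s t))"
proof -
  consider "n = 0" | "n \<in> {1..N}" | "n > N" by force
  then show ?thesis
  proof cases
    case 1
    then show ?thesis
      using multiplicative_incr1[OF X] pair.bigO_const[of "tensor_of []"] by (simp add: multiplicative_def case_prod_unfold)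
  next
    case 2
    then have "\<exists>C. \<forall>(s, t)\<in>\<Delta>\<^bsub>T\<^esub>. norm (component n (incr \<X> s t)) \<le> C * \<omega> s t powr (real n / p)"
      using X unfolding rough_paths_def by blast
    then have "pair.bigO n (\<lambda>(s, t). component n (incr \<X> s t))" using 2 by (subst pair_bigO_iff) auto
    then show ?thesis
      by (rule pair.bigO_cong[THEN iffD1, rotated]) (auto simp: incr1_eq)
  next
    case 3
    then show ?thesis
      using multiplicative_incr1[OF X] by (intro pair.bigO_eq_0) (auto simp: multiplicative_def)
  qed
qed

lemma graded_incr1:
  assumes X: "\<X> \<in> rough_paths p \<omega> T"
  shows "pair.graded N (\<lambda>(s, t). incr1 \<X> s t)" "tri.graded N (\<lambda>(s, u, t). incr1 \<X> s u)"
    "tri.graded N (\<lambda>(s, u, t). incr1 \<X> u t)"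
proof -
  have z: "component n (incr1 \<X> s t) = 0" if "n > N" for n s t
    using multiplicative_incr1[OF X] that by (simp add: multiplicative_def)
  note b = bigO_incr1[OF X]
  show "pair.graded N (\<lambda>(s, t). incr1 \<X> s t)"
    unfolding pair.graded_def using z b by (simp add: case_prod_unfold)
  show "tri.graded N (\<lambda>(s, u, t). incr1 \<X> s u)"
    unfolding tri.graded_def using z tri_bigO_of_pair(1)[OF b] by (simp add: case_prod_unfold)
  show "tri.graded N (\<lambda>(s, u, t). incr1 \<X> u t)"
    unfolding tri.graded_def using z tri_bigO_of_pair(2)[OF b] by (simp add: case_prod_unfold)
qed

lemma grouplike_incr:
  fixes f :: "'v::fin_dim list \<Rightarrow> 'v list \<Rightarrow> 'w::real_normed_vector"
  assumes X: "\<X> \<in> rough_paths p \<omega> T" and f: "bimultilinear f" and kl: "k + l \<le> N"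
    and st: "0 \<le> s" "s \<le> t" "t \<le> T"
  shows "tensor_lift2 f (component k (incr1 \<X> s t)) (component l (incr1 \<X> s t))
    = cop (\<lambda>x y. if length x = k \<and> length y = l then f x y else 0) (component (k + l) (incr1 \<X> s t))"
proof -
  have "tensor_of [component k (incr \<X> s t), component l (incr \<X> s t)] = Delta_sh k l (component (k + l) (incr \<X> s t))"
  proof -
    have "(s, t) \<in> \<Delta>\<^bsub>T\<^esub>" using st by simp
    then show ?thesis using X kl unfolding rough_paths_def by blast
  qed
  from Delta_sh_imp_cop[OF this f] show ?thesis using st by (simp add: incr1_eq)
qed

lemma grouplike_incr1:
  fixes \<X> :: "'v::fin_dim rough_path"
  assumes X: "\<X> \<in> rough_paths p \<omega> T"
  shows "pair.grouplike N (\<lambda>(s, t). incr1 \<X> s t) TYPE('w::real_normed_vector)"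
    "tri.grouplike N (\<lambda>(s, u, t). incr1 \<X> s u) TYPE('w)"
proof -
  show "pair.grouplike N (\<lambda>(s, t). incr1 \<X> s t) TYPE('w)"
    unfolding pair.grouplike_def
  proof (intro ballI allI impI)
    fix i and f :: "'v list \<Rightarrow> 'v list \<Rightarrow> 'w" and k l
    assume i: "i \<in> \<Delta>\<^bsub>T\<^esub>" and f: "bimultilinear f" and kl: "k + l \<le> N"
    obtain s t where st: "i = (s, t)" "0 \<le> s" "s \<le> t" "t \<le> T" using i by (cases i) auto
    show "tensor_lift2 f (component k (case i of (s, t) \<Rightarrow> incr1 \<X> s t)) (component l (case i of (s, t) \<Rightarrow> incr1 \<X> s t))
      = cop (\<lambda>x y. if length x = k \<and> length y = l then f x y else 0) (component (k + l) (case i of (s, t) \<Rightarrow> incr1 \<X> s t))"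
      unfolding st(1) prod.case by (rule grouplike_incr[OF X f kl st(2-)])
  qed
  show "tri.grouplike N (\<lambda>(s, u, t). incr1 \<X> s u) TYPE('w)"
    unfolding tri.grouplike_def
  proof (intro ballI allI impI)
    fix i and f :: "'v list \<Rightarrow> 'v list \<Rightarrow> 'w" and k l
    assume i: "i \<in> triples" and f: "bimultilinear f" and kl: "k + l \<le> N"
    obtain s u t where st: "i = (s, u, t)" "0 \<le> s" "s \<le> u" "u \<le> T" using i by (cases i) (auto simp: triples_def)
    show "tensor_lift2 f (component k (case i of (s, u, t) \<Rightarrow> incr1 \<X> s u)) (component l (case i of (s, u, t) \<Rightarrow> incr1 \<X> s u))
      = cop (\<lambda>x y. if length x = k \<and> length y = l then f x y else 0) (component (k + l) (case i of (s, u, t) \<Rightarrow> incr1 \<X> s u))"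
      unfolding st(1) prod.case by (rule grouplike_incr[OF X f kl st(2-)])
  qed
qed

lemma rough_pathI:
  fixes Y :: "real \<Rightarrow> real \<Rightarrow> 'u::fin_dim tensor"
  assumes Y: "multiplicative N Y" "continuous_on \<Delta>\<^bsub>T\<^esub> (\<lambda>(s, t). Y s t)"
    and bd: "\<And>n. n \<in> {1..N} \<Longrightarrow> pair.bigO n (\<lambda>(s, t). component n (Y s t))"
    and sh: "\<And>n (f :: 'u list \<Rightarrow> 'u list \<Rightarrow> real) s t. n \<le> N \<Longrightarrow> homogeneous n f \<Longrightarrow> 0 \<le> s \<Longrightarrow> s \<le> t \<Longrightarrow> t \<le> T \<Longrightarrow>
      shuffle_defect f (Y s t) = 0"
  shows "(x, \<lambda>s t. if (s, t) \<in> \<Delta>\<^bsub>T\<^esub> then Y s t else 0) \<in> rough_paths p \<omega> T"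
  unfolding rough_paths_def mem_Collect_eq fst_conv snd_conv
proof (intro conjI)
  let ?Y = "\<lambda>s t. if (s, t) \<in> \<Delta>\<^bsub>T\<^esub> then Y s t else 0"
  show "\<forall>s t. (s, t) \<notin> \<Delta>\<^bsub>T\<^esub> \<longrightarrow> ?Y s t = 0" by simp
  show "\<forall>(s, t)\<in>\<Delta>\<^bsub>T\<^esub>. \<forall>n>N. component n (?Y s t) = 0" using Y(1) by (auto simp: multiplicative_def)
  show "continuous_on \<Delta>\<^bsub>T\<^esub> (\<lambda>(s, t). ?Y s t)"
    by (rule continuous_on_cong[THEN iffD1, OF refl _ Y(2)]) auto
  show "\<forall>(s, t)\<in>\<Delta>\<^bsub>T\<^esub>. component 0 (?Y s t) = tensor_of []" using Y(1) by (auto simp: multiplicative_def)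
  show "\<forall>n\<in>{1..N}. \<exists>C. \<forall>(s, t)\<in>\<Delta>\<^bsub>T\<^esub>. norm (component n (?Y s t)) \<le> C * \<omega> s t powr (real n / p)"
  proof
    fix n assume n: "n \<in> {1..N}"
    then have "\<exists>C. \<forall>(s, t)\<in>\<Delta>\<^bsub>T\<^esub>. norm (component n (Y s t)) \<le> C * \<omega> s t powr (real n / p)"
      using bd[OF n] by (subst (asm) pair_bigO_iff) auto
    then show "\<exists>C. \<forall>(s, t)\<in>\<Delta>\<^bsub>T\<^esub>. norm (component n (?Y s t)) \<le> C * \<omega> s t powr (real n / p)"
      by (elim ex_forward) auto
  qed
  show "\<forall>s u t. 0 \<le> s \<and> s \<le> u \<and> u \<le> t \<and> t \<le> T \<longrightarrow> ?Y s t = (\<Sum>n\<le>N. component n (?Y s u \<otimes>\<^sub>t ?Y u t))"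
  proof (intro allI impI)
    fix s u t assume sut: "0 \<le> s \<and> s \<le> u \<and> u \<le> t \<and> t \<le> T"
    have "Y s t = (\<Sum>n\<le>N. component n (Y s t))"
      by (rule sum_components[symmetric]) (use Y(1) in \<open>simp add: multiplicative_def\<close>)
    also have "\<dots> = (\<Sum>n\<le>N. component n (Y s u \<otimes>\<^sub>t Y u t))"
      by (rule sum.cong[OF refl]) (use Y(1) sut in \<open>simp add: multiplicative_def\<close>)
    finally show "?Y s t = (\<Sum>n\<le>N. component n (?Y s u \<otimes>\<^sub>t ?Y u t))" using sut by simp
  qed
  show "\<forall>(s, t)\<in>\<Delta>\<^bsub>T\<^esub>. \<forall>a b. a + b \<le> N \<longrightarrow> tensor_of [component a (?Y s t), component b (?Y s t)]
      = Delta_sh a b (component (a + b) (?Y s t))"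
  proof (clarify)
    fix s t k l assume st: "(s, t) \<in> \<Delta>\<^bsub>T\<^esub>" and kl: "k + l \<le> N"
    have "tensor_of [component k (Y s t), component l (Y s t)] = Delta_sh k l (component (k + l) (Y s t))"
    proof (rule cop_imp_Delta_sh)
      fix f :: "'u list \<Rightarrow> 'u list \<Rightarrow> real" assume f: "bimultilinear f"
      \<comment> \<open>The relation in bidegree \<open>(k, l)\<close> is tested by the part of
        \<open>f\<close> supported there, which is homogeneous of degree
        \<open>k + l\<close>.\<close>
      let ?f = "\<lambda>x y. if length x = k \<and> length y = l then f x y else 0"
      have hf: "homogeneous (k + l) ?f"
        using bimultilinear_if_length[OF f] by (auto simp: homogeneous_def)
      have "shuffle_defect ?f (Y s t) = 0" by (rule sh[OF kl hf]) (use st in auto)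
      moreover have "cop ?f (component (k + l) (Y s t)) = cop ?f (Y s t)" by (rule cop_agree[OF hf]) simp
      ultimately show "tensor_lift2 f (component k (Y s t)) (component l (Y s t)) = cop ?f (component (k + l) (Y s t))"
        by (simp add: shuffle_defect_def tensor_lift2_if_length[OF f])
    qed
    then show "tensor_of [component k (?Y s t), component l (?Y s t)] = Delta_sh k l (component (k + l) (?Y s t))"
      using st by simp
  qed
qed

lemma path_trace_increment:
  assumes X: "\<X> \<in> rough_paths p \<omega> T" and st: "0 \<le> s" "s \<le> t" "t \<le> T"
  shows "component 1 (incr1 \<X> s t) = tensor_of [path_trace \<X> t - path_trace \<X> s]"
proof -
  have m: "component 1 (incr1 \<X> 0 t) = component 1 (incr1 \<X> 0 s \<otimes>\<^sub>t incr1 \<X> s t)"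
    and z: "\<And>s t. component 0 (incr1 \<X> s t) = tensor_of []"
    using multiplicative_incr1[OF X] N_ge_1 st by (auto simp: multiplicative_def)
  have "component 1 (incr1 \<X> s t) = component 1 (incr1 \<X> 0 t) - component 1 (incr1 \<X> 0 s)"
    unfolding m using component_mult_split[OF z z, of 1 0 s s t] by simp
  also have "\<dots> = tensor_of [vector_part (incr1 \<X> 0 t) - vector_part (incr1 \<X> 0 s)]"
    unfolding component_1_vector_part linear_diff[OF linear_tensor_of_singleton] ..
  also have "vector_part (incr1 \<X> 0 t) - vector_part (incr1 \<X> 0 s) = path_trace \<X> t - path_trace \<X> s"
    using st by (simp add: path_trace_def incr1_eq)
  finally show ?thesis .
qed

text \<open>The control vanishes on the diagonal, which forces the increment of degree 1 over [0,0]
  to be zero.\<close>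

lemma path_trace_0:
  assumes X: "\<X> \<in> rough_paths p \<omega> T"
  shows "path_trace \<X> 0 = start \<X>"
proof -
  obtain C where "\<And>i. i \<in> \<Delta>\<^bsub>T\<^esub> \<Longrightarrow> norm (case i of (s, t) \<Rightarrow> component 1 (incr1 \<X> s t)) \<le> C * (case i of (s, t) \<Rightarrow> r s t) ^ 1"
    by (rule pair.bigOE[OF bigO_incr1[OF X, of 1]]) (rule that)
  from this[of "(0, 0)"] have "component 1 (incr1 \<X> 0 0) = 0" using T_pos control_refl[of 0] by (simp add: r_def)
  then have "vector_part (component 1 (incr1 \<X> 0 0)) = 0" using linear_0[OF linear_vector_part] by metis
  then have "vector_part (incr1 \<X> 0 0) = 0" unfolding component_1_vector_part by simp
  then show ?thesis using T_pos by (simp add: path_trace_def incr1_eq)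
qed

lemma path_trace_holder:
  assumes X: "\<X> \<in> rough_paths p \<omega> T"
  shows "pair.bigO 1 (\<lambda>(s, t). path_trace \<X> t - path_trace \<X> s)"
proof -
  have "pair.bigO 1 (\<lambda>i. vector_part (case i of (s, t) \<Rightarrow> component 1 (incr1 \<X> s t)))"
    by (rule pair.bigO_bounded_linear[OF bounded_linear_vector_part bigO_incr1[OF X]])
  then show ?thesis
    by (rule pair.bigO_cong[THEN iffD1, rotated]) (auto simp: path_trace_increment[OF X, unfolded One_nat_def])
qed

end

definition osh_lift :: "('v::fin_dim tensor \<Rightarrow>\<^sub>L 'u::fin_dim) \<Rightarrow> 'v tensor \<Rightarrow> 'u tensor" where
  "osh_lift h = tensor_lift (osh_map (\<lambda>w. blinfun_apply h (tensor_of w)))"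

lemma linear_osh_lift: "linear (osh_lift h)"
  unfolding osh_lift_def by (rule linear_tensor_lift[OF multilinear_osh_map[OF multilinear_blinfun]])

lemma osh_lift_tensor_of: "osh_lift h (tensor_of w) = osh_map (\<lambda>w. blinfun_apply h (tensor_of w)) w"
  unfolding osh_lift_def by (rule tensor_lift_tensor_of[OF multilinear_osh_map[OF multilinear_blinfun]])

lemma component_0_osh_lift:
  assumes "component 0 a = tensor_of []"
  shows "component 0 (osh_lift h a) = tensor_of []"
proof -
  have "component 0 (osh_lift h a) = osh_lift h (component 0 a)"
  proof (rule tensor_linear_eqI[of "\<lambda>a. component 0 (osh_lift h a)" "\<lambda>a. osh_lift h (component 0 a)"])
    show "linear (\<lambda>a. component 0 (osh_lift h a))" by (rule linear_compose'[OF linear_osh_lift linear_component])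
    show "linear (\<lambda>a. osh_lift h (component 0 a))" by (rule linear_compose'[OF linear_component linear_osh_lift])
  qed (simp add: osh_lift_tensor_of linear_0[OF linear_osh_lift])
  then show ?thesis by (simp add: assms osh_lift_tensor_of)
qed

lemma component_1_osh_lift:
  "component 1 (osh_lift h a) = tensor_of [blinfun_apply h a - blinfun_apply h (component 0 a)]"
proof (rule tensor_linear_eqI[of "\<lambda>a. component 1 (osh_lift h a)"
    "\<lambda>a. tensor_of [blinfun_apply h a - blinfun_apply h (component 0 a)]"])
  show "linear (\<lambda>a. component 1 (osh_lift h a))" by (rule linear_compose'[OF linear_osh_lift linear_component])
  have "linear (\<lambda>a. blinfun_apply h a - blinfun_apply h (component 0 a))"
    by (intro linear_compose_sub linear_blinfun_apply linear_compose'[OF linear_component linear_blinfun_apply])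
  then show "linear (\<lambda>a. tensor_of [blinfun_apply h a - blinfun_apply h (component 0 a)])"
    by (rule linear_compose'[OF _ linear_tensor_of_singleton])
  show "component 1 (osh_lift h (tensor_of w)) = tensor_of [blinfun_apply h (tensor_of w) - blinfun_apply h (component 0 (tensor_of w))]" for w
    unfolding osh_lift_tensor_of component_osh_map_1
    using linear_0[OF linear_tensor_of_singleton] by (auto simp: blinfun.zero_right)
qed

lemma component_mult_tensor_of:
  "component (k + length w) (component k a \<otimes>\<^sub>t tensor_of w) = component k a \<otimes>\<^sub>t tensor_of w"
proof (rule tensor_linear_eqI[of "\<lambda>a. component (k + length w) (component k a \<otimes>\<^sub>t tensor_of w)" "\<lambda>a. component k a \<otimes>\<^sub>t tensor_of w"])
  have l: "linear (\<lambda>a. component k a \<otimes>\<^sub>t tensor_of w)" by (rule linear_compose'[OF linear_component linear_tensor_mult_left])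
  then show "linear (\<lambda>a. component k a \<otimes>\<^sub>t tensor_of w)" .
  show "linear (\<lambda>a. component (k + length w) (component k a \<otimes>\<^sub>t tensor_of w))" by (rule linear_compose'[OF l linear_component])
qed auto

lemma ctrace_eq: "ctrace H t = blinfun_apply (H t) (tensor_of [])"
  by (simp add: ctrace_def degree_part_tensor_of)

context rough_setting
begin

lemma pair_bigO_0:
  assumes "pair.bigO 1 (\<lambda>(s, t). J t - J s)"
  shows "pair.bigO 0 (\<lambda>(s, t). J s)" "pair.bigO 0 (\<lambda>(s, t). J t)"
proof -
  obtain C where C: "C \<ge> 0" "\<And>i. i \<in> \<Delta>\<^bsub>T\<^esub> \<Longrightarrow> norm (case i of (s, t) \<Rightarrow> J t - J s) \<le> C * (case i of (s, t) \<Rightarrow> r s t) ^ 1"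
    by (rule pair.bigOE[OF assms]) (rule that)
  have *: "norm (J s) \<le> norm (J 0) + C * r 0 T" if "0 \<le> s" "s \<le> T" for s
  proof -
    have "norm (J s) \<le> norm (J 0) + norm (J s - J 0)" by (metis add.commute diff_add_cancel norm_triangle_ineq)
    also have "norm (J s - J 0) \<le> C * r 0 s" using C(2)[of "(0, s)"] that by simp
    also have "\<dots> \<le> C * r 0 T" using that C(1) by (intro mult_left_mono r_mono) auto
    finally show ?thesis by simp
  qed
  show "pair.bigO 0 (\<lambda>(s, t). J s)" "pair.bigO 0 (\<lambda>(s, t). J t)"
    by (rule pair.bigOI[where C = "norm (J 0) + C * r 0 T"]; use * in auto)+
qed

lemma controlled_increment:
  assumes H: "H \<in> controlled p \<omega> T \<X>"
  shows "pair.bigO 1 (\<lambda>(s, t). blinfun_apply (H t) a - blinfun_apply (H s) a)"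
proof -
  have "\<exists>C. \<forall>(s, t)\<in>\<Delta>\<^bsub>T\<^esub>. norm (H t - H s) \<le> C * \<omega> s t powr (real 1 / p)"
    using H unfolding controlled_def holder_paths_def by simp
  then have "pair.bigO 1 (\<lambda>(s, t). H t - H s)" by (subst pair_bigO_iff) auto
  from pair.bigO_bounded_linear[OF blinfun.bounded_linear_left[of a] this]
  show ?thesis by (simp add: case_prod_unfold blinfun.diff_left)
qed

lemmas controlled_bounded = pair_bigO_0[OF controlled_increment]

lemma controlled_high_degree:
  assumes H: "H \<in> controlled p \<omega> T \<X>" and "0 \<le> s" "s \<le> T" and a: "component n a = a" "n \<ge> N"
  shows "blinfun_apply (H s) a = 0"
  using assms unfolding controlled_def by (auto simp: tensor_power_iff)

text \<open>\<open>H s\<close> vanishes in degrees \<open>N\<close> and above, so the expansion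
  stops at total degree \<open>N - 1\<close>, the range in the definition of
  \<open>controlled\<close>.\<close>

lemma controlled_shift:
  assumes X: "\<X> \<in> rough_paths p \<omega> T" and H: "H \<in> controlled p \<omega> T \<X>" and st: "0 \<le> s" "s \<le> t" "t \<le> T"
  shows "blinfun_apply (H s) (incr1 \<X> s t \<otimes>\<^sub>t tensor_of w)
    = (\<Sum>k<N - length w. blinfun_apply (H s) (component k (incr1 \<X> s t) \<otimes>\<^sub>t tensor_of w))"
proof -
  let ?a = "incr1 \<X> s t"
  let ?F = "\<lambda>k. blinfun_apply (H s) (component k ?a \<otimes>\<^sub>t tensor_of w)"
  have hi: "component n ?a = 0" if "n > N" for n using multiplicative_incr1[OF X] that by (simp add: multiplicative_def)
  have lin: "linear (\<lambda>a. blinfun_apply (H s) (a \<otimes>\<^sub>t tensor_of w))"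
    by (rule linear_compose'[OF linear_tensor_mult_left linear_blinfun_apply])
  have "blinfun_apply (H s) (?a \<otimes>\<^sub>t tensor_of w) = blinfun_apply (H s) ((\<Sum>k\<le>N. component k ?a) \<otimes>\<^sub>t tensor_of w)"
    using sum_components[of N ?a] hi by simp
  also have "\<dots> = (\<Sum>k\<le>N. ?F k)" by (rule linear_sum[OF lin])
  also have "\<dots> = (\<Sum>k<N - length w. ?F k)"
  proof (rule sum.mono_neutral_right)
    show "\<forall>k\<in>{..N} - {..<N - length w}. ?F k = 0"
    proof
      fix k assume k: "k \<in> {..N} - {..<N - length w}"
      show "?F k = 0"
        by (rule controlled_high_degree[OF H st(1) _ component_mult_tensor_of]) (use st k in auto)
    qed
  qed auto
  finally show ?thesis .
qed

text \<open>The expansion in \<open>controlled\<close> covers words of length up to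
  \<open>N - 2\<close>. For length \<open>N - 1\<close> it reduces to the regularity of order 1 of
  \<open>H\<close>, and longer words give zero with the vacuous order 0 of the truncated
  difference.\<close>

lemma controlled_remainder:
  assumes X: "\<X> \<in> rough_paths p \<omega> T" and H: "H \<in> controlled p \<omega> T \<X>"
  shows "pair.bigO (N - length w) (\<lambda>(s, t). blinfun_apply (H t) (tensor_of w) - blinfun_apply (H s) (incr1 \<X> s t \<otimes>\<^sub>t tensor_of w))"
proof -
  consider "length w + 2 \<le> N" | "length w = N - 1" | "length w \<ge> N" by linarith
  then show ?thesis
  proof cases
    case 1
    have tp: "tensor_of w \<in> tensor_power (length w)" by (rule tensor_of_in_tensor_power)
    have "approx_eq p \<omega> T (N - length w) (\<lambda>s t. degree_part (length w) (H t) (tensor_of w))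
        (\<lambda>s t. \<Sum>k\<le>N - 1 - length w. degree_part (length w + k) (H s) (component k (incr \<X> s t) \<otimes>\<^sub>t tensor_of w))"
      using H 1 tp unfolding controlled_def by blast
    then have "pair.bigO (N - length w) (\<lambda>(s, t). degree_part (length w) (H t) (tensor_of w) -
        (\<Sum>k\<le>N - 1 - length w. degree_part (length w + k) (H s) (component k (incr \<X> s t) \<otimes>\<^sub>t tensor_of w)))"
      using 1 by (subst (asm) approx_eq_iff) auto
    moreover have "degree_part (length w + k) (H s) (component k a \<otimes>\<^sub>t tensor_of w) = blinfun_apply (H s) (component k a \<otimes>\<^sub>t tensor_of w)" for k s a
    proof -
      have "component (k + length w) (component k a \<otimes>\<^sub>t tensor_of w) = component k a \<otimes>\<^sub>t tensor_of w" by (rule component_mult_tensor_of)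
      then show ?thesis unfolding degree_part_def by (simp only: add.commute)
    qed
    moreover have sh: "blinfun_apply (H s) (incr1 \<X> s t \<otimes>\<^sub>t tensor_of w)
        = (\<Sum>k\<le>N - Suc (length w). blinfun_apply (H s) (component k (incr \<X> s t) \<otimes>\<^sub>t tensor_of w))"
      if "0 \<le> s" "s \<le> t" "t \<le> T" for s t
    proof -
      have "{..<N - length w} = {..N - Suc (length w)}" using 1 by auto
      then show ?thesis using controlled_shift[OF X H that, of w] that by (simp add: incr1_eq)
    qed
    ultimately show ?thesis
      by (elim pair.bigO_cong[THEN iffD1, rotated])
        (use 1 in \<open>auto simp: sh degree_part_tensor_of\<close>)
  next
    case 2
    have "component 0 (incr1 \<X> s t) = tensor_of []" for s t
      using multiplicative_incr1[OF X] by (simp add: multiplicative_def)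
    moreover have "{..<N - length w} = {0}" using 2 N_ge_1 by auto
    ultimately have eq: "blinfun_apply (H s) (incr1 \<X> s t \<otimes>\<^sub>t tensor_of w) = blinfun_apply (H s) (tensor_of w)"
      if "0 \<le> s" "s \<le> t" "t \<le> T" for s t
      by (subst controlled_shift[OF X H that]) auto
    have "N - length w = 1" using 2 N_ge_1 by simp
    then show ?thesis
      using controlled_increment[OF H, of "tensor_of w"]
      by (elim ssubst, elim pair.bigO_cong[THEN iffD1, rotated]) (auto simp: eq)
  next
    case 3
    have "blinfun_apply (H t) (tensor_of w) = 0" if "0 \<le> t" "t \<le> T" for t
      by (rule controlled_high_degree[OF H that _ 3]) simp
    then show ?thesis using 3 by (intro pair.bigO_eq_0) (auto simp: controlled_shift[OF X H])
  qed
qed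

end

context rough_setting
begin

text \<open>In degree 1 the exact increment of the trace is used. That of \<open>osh_lift\<close>
  differs from it by order \<open>N\<close>, too much for sewing at order
  \<open>N + 1\<close>.\<close>

definition lift_germ :: "'v::fin_dim rough_path \<Rightarrow> (real \<Rightarrow> 'v tensor \<Rightarrow>\<^sub>L 'u::fin_dim) \<Rightarrow> nat \<Rightarrow> real \<Rightarrow> real \<Rightarrow> 'u tensor" where
  "lift_germ \<X> H m s t = (if m = 0 then tensor_of [] else if m = 1 then tensor_of [ctrace H t - ctrace H s]
     else component m (osh_lift (H s) (incr1 \<X> s t)))"

context
  fixes \<X> :: "'v::fin_dim rough_path" and H :: "real \<Rightarrow> 'v tensor \<Rightarrow>\<^sub>L 'u::fin_dim"
  assumes X: "\<X> \<in> rough_paths p \<omega> T" and H: "H \<in> controlled p \<omega> T \<X>"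
begin

lemma bigO_component_osh_lift: "pair.bigO m (\<lambda>(s, t). component m (osh_lift (H s) (incr1 \<X> s t)))"
proof -
  have "pair.bigO m (\<lambda>i. component m (tensor_lift (osh_map (\<lambda>w. blinfun_apply (H (fst i)) (tensor_of w))) (case i of (s, t) \<Rightarrow> incr1 \<X> s t)))"
    by (rule pair.bigO_component_\<Phi>[OF graded_incr1(1)[OF X] grouplike_incr1(1)[OF X] multilinear_blinfun _ graded_incr1(1)[OF X]])
      (use controlled_bounded(1)[OF H] in \<open>simp add: case_prod_unfold\<close>)
  then show ?thesis by (simp add: osh_lift_def case_prod_unfold)
qed

lemma lift_germ_1: "pair.bigO N (\<lambda>(s, t). component 1 (osh_lift (H s) (incr1 \<X> s t)) - lift_germ \<X> H 1 s t)"
proof -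
  have 0: "component 0 (incr1 \<X> s t) = tensor_of []" for s t
    using multiplicative_incr1[OF X] by (simp add: multiplicative_def)
  have L: "bounded_linear (\<lambda>v :: 'u. - tensor_of [v])"
    by (rule bounded_linear_minus[OF bounded_linear_tensor_of_singleton])
  have eq: "component 1 (osh_lift (H s) (incr1 \<X> s t)) - lift_germ \<X> H 1 s t
    = - tensor_of [blinfun_apply (H t) (tensor_of []) - blinfun_apply (H s) (incr1 \<X> s t \<otimes>\<^sub>t tensor_of [])]" for s t
    unfolding component_1_osh_lift lift_germ_def ctrace_eq 0
    by (simp add: linear_diff[OF linear_tensor_of_singleton])
  show ?thesis unfolding eq
    using pair.bigO_bounded_linear[OF L controlled_remainder[OF X H, of "[]"]] by (simp add: case_prod_unfold)
qed

lemma lift_germ_diff: "m \<ge> 1 \<Longrightarrow> pair.bigO N (\<lambda>(s, t). component m (osh_lift (H s) (incr1 \<X> s t)) - lift_germ \<X> H m s t)"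
  using lift_germ_1 by (cases "m = 1") (simp, intro pair.bigO_eq_0, auto simp: lift_germ_def)

lemma bigO_lift_germ: "pair.bigO m (\<lambda>(s, t). lift_germ \<X> H m s t)"
proof -
  consider "m = 0" | "m = 1" | "m \<ge> 2" by linarith
  then show ?thesis
  proof cases
    case 1
    then show ?thesis using pair.bigO_const by (simp add: lift_germ_def case_prod_unfold)
  next
    case 2
    then show ?thesis
      using pair.bigO_bounded_linear[OF bounded_linear_tensor_of_singleton controlled_increment[OF H, of "tensor_of []"]]
      by (simp add: lift_germ_def ctrace_eq case_prod_unfold)
  next
    case 3
    then show ?thesis using bigO_component_osh_lift[of m] by (simp add: lift_germ_def)
  qed
qed

text \<open>In degree 1 the germ is additive. In higher degrees the estimate is first obtained for
  \<open>osh_lift\<close>, and its mixed products are then replaced by those of the germ: an error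
  of order \<open>N\<close> in one factor is multiplied by a factor of order at least 1.\<close>

lemma lift_germ_almost_multiplicative:
  assumes m: "m \<ge> 1"
  shows "tri.bigO (N + 1) (\<lambda>(s, u, t). lift_germ \<X> H m s t - lift_germ \<X> H m s u - lift_germ \<X> H m u t
       - (\<Sum>j\<in>{1..<m}. lift_germ \<X> H j s u \<otimes>\<^sub>t lift_germ \<X> H (m - j) u t))"
proof (cases "m = 1")
  case True
  have "tensor_of [ctrace H t - ctrace H s] - tensor_of [ctrace H u - ctrace H s] - tensor_of [ctrace H t - ctrace H u] = 0" for s u t
    unfolding linear_diff[OF linear_tensor_of_singleton] by simp
  then show ?thesis using True by (intro tri.bigO_eq_0) (auto simp: lift_germ_def)
next
  case False
  then have m2: "m \<ge> 2" using m by simp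
  define W where "W j s t = component j (osh_lift (H s) (incr1 \<X> s t))" for j s t
  have W0: "W 0 s t = tensor_of []" for s t
    unfolding W_def using multiplicative_incr1[OF X] by (intro component_0_osh_lift) (simp add: multiplicative_def)
  have a: "tri.graded N (\<lambda>i. incr1 \<X> (fst i) (fst (snd i)))" "tri.grouplike N (\<lambda>i. incr1 \<X> (fst i) (fst (snd i))) TYPE('u tensor)"
    "tri.graded N (\<lambda>i. incr1 \<X> (fst (snd i)) (snd (snd i)))"
    using graded_incr1(2,3)[OF X] grouplike_incr1(2)[OF X, where 'w = "'u tensor"] by (simp_all add: case_prod_unfold)
  have h1: "tri.bigO 0 (\<lambda>i. blinfun_apply (H (fst i)) (tensor_of w))" for w
    using tri_bigO_of_pair(1)[OF controlled_bounded(1)[OF H, of "tensor_of w"]] by (simp add: case_prod_unfold)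
  have h2: "tri.bigO 0 (\<lambda>i. blinfun_apply (H (fst (snd i))) (tensor_of w))" for w
    using tri_bigO_of_pair(2)[OF controlled_bounded(1)[OF H, of "tensor_of w"]] by (simp add: case_prod_unfold)
  \<comment> \<open>The comparison of the predicted with the actual map: the controlled relation
    between the times \<open>s\<close> and \<open>u\<close>.\<close>
  have rem: "tri.bigO (N - length w) (\<lambda>i. tensor_lift (\<lambda>w. blinfun_apply (H (fst i)) (tensor_of w)) (incr1 \<X> (fst i) (fst (snd i)) \<otimes>\<^sub>t tensor_of w)
      - blinfun_apply (H (fst (snd i))) (tensor_of w))" for w
    using tri.bigO_minus[OF tri_bigO_of_pair(1)[OF controlled_remainder[OF X H, of w]]]
    by (simp add: case_prod_unfold tensor_lift_blinfun)
  have main: "tri.bigO (N + 1) (\<lambda>i. W m (fst i) (snd (snd i))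
      - (\<Sum>j\<le>m. W j (fst i) (fst (snd i)) \<otimes>\<^sub>t W (m - j) (fst (snd i)) (snd (snd i))))"
    unfolding W_def osh_lift_def
  proof (rule tri.bigO_osh_map_almost_multiplicative[OF a(1,2) multilinear_blinfun h1 a(3) _ _ multilinear_blinfun h2 rem m2])
    show "component n (incr1 \<X> (fst i) (snd (snd i))) = 0" if "n > N" for n i
      using multiplicative_incr1[OF X] that by (simp add: multiplicative_def)
    show "component n (incr1 \<X> (fst i) (snd (snd i))) = component n (incr1 \<X> (fst i) (fst (snd i)) \<otimes>\<^sub>t incr1 \<X> (fst (snd i)) (snd (snd i)))"
      if "i \<in> triples" "n \<le> N" for i n
      using multiplicative_incr1[OF X] that by (auto simp: multiplicative_def triples_def)
  qed
  have set: "{..m} = insert 0 (insert m {1..<m})" using m by auto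
  have main': "tri.bigO (N + 1) (\<lambda>(s, u, t). W m s t - W m s u - W m u t - (\<Sum>j\<in>{1..<m}. W j s u \<otimes>\<^sub>t W (m - j) u t))"
    using main m2 unfolding set by (simp add: W0 case_prod_unfold algebra_simps)
  have WO: "pair.bigO 1 (\<lambda>(s, t). W j s t)" and ZO: "pair.bigO 1 (\<lambda>(s, t). lift_germ \<X> H j s t)"
    and WZ: "pair.bigO N (\<lambda>(s, t). W j s t - lift_germ \<X> H j s t)" if "j \<ge> 1" for j
    using pair.bigO_mono[OF bigO_component_osh_lift that] pair.bigO_mono[OF bigO_lift_germ that] lift_germ_diff[OF that]
    by (simp_all add: W_def)
  have "tri.bigO (N + 1) (\<lambda>(s, u, t). W j s u \<otimes>\<^sub>t W (m - j) u t - lift_germ \<X> H j s u \<otimes>\<^sub>t lift_germ \<X> H (m - j) u t)" if j: "j \<in> {1..<m}" for j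
  proof -
    have j': "j \<ge> 1" "m - j \<ge> 1" using j by auto
    have 1: "tri.bigO (N + 1) (\<lambda>i. (W j (fst i) (fst (snd i)) - lift_germ \<X> H j (fst i) (fst (snd i))) \<otimes>\<^sub>t W (m - j) (fst (snd i)) (snd (snd i)))"
      by (rule tri.bigO_tensor_mult[where k = N and l = 1])
        (use tri_bigO_of_pair(1)[OF WZ[OF j'(1)]] tri_bigO_of_pair(2)[OF WO[OF j'(2)]] in \<open>simp_all add: case_prod_unfold\<close>)
    have 2: "tri.bigO (N + 1) (\<lambda>i. lift_germ \<X> H j (fst i) (fst (snd i)) \<otimes>\<^sub>t (W (m - j) (fst (snd i)) (snd (snd i)) - lift_germ \<X> H (m - j) (fst (snd i)) (snd (snd i))))"
      by (rule tri.bigO_tensor_mult[where k = 1 and l = N])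
        (use tri_bigO_of_pair(1)[OF ZO[OF j'(1)]] tri_bigO_of_pair(2)[OF WZ[OF j'(2)]] in \<open>simp_all add: case_prod_unfold\<close>)
    show ?thesis
      using tri.bigO_add[OF 1 2] by (simp add: case_prod_unfold tensor_mult_diff_left tensor_mult_diff_right)
  qed
  then have "tri.bigO (N + 1) (\<lambda>i. \<Sum>j\<in>{1..<m}. case i of (s, u, t) \<Rightarrow> W j s u \<otimes>\<^sub>t W (m - j) u t - lift_germ \<X> H j s u \<otimes>\<^sub>t lift_germ \<X> H (m - j) u t)"
    by (rule tri.bigO_sum)
  from tri.bigO_add[OF main' this] have "tri.bigO (N + 1) (\<lambda>(s, u, t). W m s t - W m s u - W m u t
       - (\<Sum>j\<in>{1..<m}. lift_germ \<X> H j s u \<otimes>\<^sub>t lift_germ \<X> H (m - j) u t))"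
    by (simp add: case_prod_unfold sum_subtractf)
  moreover have "W m s t = lift_germ \<X> H m s t" for s t using m2 by (simp add: W_def lift_germ_def)
  ultimately show ?thesis by simp
qed

lemma ex_lift_tensor: "\<exists>Y. multiplicative N Y \<and> continuous_on \<Delta>\<^bsub>T\<^esub> (\<lambda>(s, t). Y s t) \<and>
     (\<forall>m\<in>{1..N}. pair.bigO (N + 1) (\<lambda>(s, t). component m (Y s t) - lift_germ \<X> H m s t))"
proof (rule almost_multiplicative_lift)
  show "component m (lift_germ \<X> H m s t) = lift_germ \<X> H m s t" for m s t by (simp add: lift_germ_def)
qed (use bigO_lift_germ lift_germ_almost_multiplicative in auto)

end

end

lemma (in scale) bigO_tensor_lift2_components:
  assumes f: "homogeneous n f"
    and "\<And>k. k \<le> n \<Longrightarrow> bigO m (\<lambda>i. tensor_lift2 f (component k (a i)) (component (n - k) (b i)))"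
  shows "bigO m (\<lambda>i. tensor_lift2 f (a i) (b i))"
proof -
  have "bigO m (\<lambda>i. \<Sum>k\<le>n. tensor_lift2 f (component k (a i)) (component (n - k) (b i)))"
    by (rule bigO_sum) (use assms(2) in simp)
  then show ?thesis unfolding tensor_lift2_components[OF f, symmetric] .
qed

context rough_setting
begin

text \<open>The conditions that characterize the lift, with the sums over compositions contracted to
  \<open>osh_lift\<close> by \<open>lift_sum_eq\<close>.\<close>

definition is_lift :: "'v::fin_dim rough_path \<Rightarrow> (real \<Rightarrow> 'v tensor \<Rightarrow>\<^sub>L 'u::fin_dim) \<Rightarrow> 'u rough_path \<Rightarrow> bool" where
  "is_lift \<X> H \<Y> \<longleftrightarrow> \<Y> \<in> rough_paths p \<omega> T \<and> (\<forall>t\<in>{0..T}. path_trace \<Y> t = ctrace H t) \<and>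
     (\<forall>m\<in>{2..N}. pair.bigO (N + 1) (\<lambda>(s, t). component m (incr1 \<Y> s t) - component m (osh_lift (H s) (incr1 \<X> s t))))"

lemma lift_sum_eq:
  assumes X: "\<X> \<in> rough_paths p \<omega> T" and st: "0 \<le> s" "s \<le> t" "t \<le> T"
  shows "(\<Sum>n\<le>N. \<Sum>ns\<in>compositions m n. boxtimes_map (map (\<lambda>k. degree_part k (H s)) ns)
      (Delta_osh ns (component n (incr \<X> s t)))) = component m (osh_lift (H s) (incr1 \<X> s t))"
proof -
  have "(\<Sum>n\<le>N. \<Sum>ns\<in>compositions m n. boxtimes_map (map (\<lambda>k. degree_part k (H s)) ns)
      (Delta_osh ns (component n (incr \<X> s t)))) = (\<Sum>n\<le>N. component m (osh_lift (H s) (component n (incr \<X> s t))))"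
    unfolding osh_lift_def by (rule sum.cong[OF refl sum_compositions_boxtimes])
  also have "\<dots> = component m (osh_lift (H s) (\<Sum>n\<le>N. component n (incr \<X> s t)))"
    by (rule linear_sum[OF linear_compose'[OF linear_osh_lift linear_component], symmetric])
  also have "(\<Sum>n\<le>N. component n (incr \<X> s t)) = incr1 \<X> s t"
  proof -
    have "(\<Sum>n\<le>N. component n (incr1 \<X> s t)) = incr1 \<X> s t"
      by (rule sum_components) (use multiplicative_incr1[OF X] in \<open>simp add: multiplicative_def\<close>)
    then show ?thesis using st by (simp add: incr1_eq)
  qed
  finally show ?thesis .
qed

lemma rough_lift_eq_The:
  assumes X: "\<X> \<in> rough_paths p \<omega> T"
  shows "rough_lift p \<omega> T \<X> H = (THE \<Y>. is_lift \<X> H \<Y>)"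
proof -
  have "approx_eq p \<omega> T (N + 1) (\<lambda>s t. component m (incr \<Y> s t))
      (\<lambda>s t. \<Sum>n\<le>N. \<Sum>ns\<in>compositions m n. boxtimes_map (map (\<lambda>k. degree_part k (H s)) ns)
         (Delta_osh ns (component n (incr \<X> s t))))
    \<longleftrightarrow> pair.bigO (N + 1) (\<lambda>(s, t). component m (incr1 \<Y> s t) - component m (osh_lift (H s) (incr1 \<X> s t)))" for m \<Y>
  proof -
    have N1: "N + 1 \<ge> 1" by simp
    show ?thesis unfolding approx_eq_iff[OF N1]
      by (intro pair.bigO_cong) (auto simp: lift_sum_eq[OF X] incr1_eq)
  qed
  then show ?thesis unfolding rough_lift_def is_lift_def by (simp only:)
qed

text \<open>The trace fixes the initial value and degree 1, and the higher degrees are fixed up to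
  order \<open>N + 1\<close>, which is enough for \<open>multiplicative_unique\<close>. Outside the
  simplex both increments are 0.\<close>

lemma is_lift_unique:
  assumes Y: "is_lift \<X> H \<Y>" and Z: "is_lift \<X> H \<Z>"
  shows "\<Y> = \<Z>"
proof -
  have Y': "\<Y> \<in> rough_paths p \<omega> T" and Z': "\<Z> \<in> rough_paths p \<omega> T" using Y Z by (simp_all add: is_lift_def)
  have tr: "path_trace \<Y> t = path_trace \<Z> t" if "0 \<le> t" "t \<le> T" for t
    using Y Z that by (simp add: is_lift_def)
  have "pair.bigO (N + 1) (\<lambda>(s, t). component m (incr1 \<Y> s t) - component m (incr1 \<Z> s t))" if m: "m \<in> {1..N}" for m
  proof (cases "m = 1")
    case True
    then show ?thesis
      by (intro pair.bigO_eq_0)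
        (auto simp: path_trace_increment[OF Y', unfolded One_nat_def] path_trace_increment[OF Z', unfolded One_nat_def] tr)
  next
    case False
    then have m: "m \<in> {2..N}" using m by auto
    with Y Z have "pair.bigO (N + 1) (\<lambda>(s, t). component m (incr1 \<Y> s t) - component m (osh_lift (H s) (incr1 \<X> s t)))"
      "pair.bigO (N + 1) (\<lambda>(s, t). component m (incr1 \<Z> s t) - component m (osh_lift (H s) (incr1 \<X> s t)))"
      unfolding is_lift_def by blast+
    from pair.bigO_diff[OF this] show ?thesis by (simp add: case_prod_unfold)
  qed
  then have eq: "incr1 \<Y> s t = incr1 \<Z> s t" if "0 \<le> s" "s \<le> t" "t \<le> T" for s t
    using multiplicative_unique[OF multiplicative_incr1[OF Y'] multiplicative_incr1[OF Z'] _ that] by blast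
  have "incr \<Y> s t = incr \<Z> s t" for s t
  proof (cases "(s, t) \<in> \<Delta>\<^bsub>T\<^esub>")
    case True
    then show ?thesis using eq[of s t] by (simp add: incr1_eq)
  next
    case False
    then have "incr \<Y> s t = 0" using Y' unfolding rough_paths_def by blast
    moreover have "incr \<Z> s t = 0" using False Z' unfolding rough_paths_def by blast
    ultimately show ?thesis by simp
  qed
  moreover have "start \<Y> = start \<Z>"
    using path_trace_0[OF Y'] path_trace_0[OF Z'] tr[of 0] T_pos by simp
  ultimately show ?thesis by (simp add: prod_eq_iff fun_eq_iff)
qed

lemma rough_lift_eqI:
  assumes "\<X> \<in> rough_paths p \<omega> T" "is_lift \<X> H \<Y>"
  shows "rough_lift p \<omega> T \<X> H = \<Y>"
  unfolding rough_lift_eq_The[OF assms(1)] using assms(2) is_lift_unique by blast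

lemma rough_lift_cong:
  fixes H H' :: "real \<Rightarrow> 'v::fin_dim tensor \<Rightarrow>\<^sub>L 'u::fin_dim"
  assumes X: "\<X> \<in> rough_paths p \<omega> T" and eq: "\<And>t. 0 \<le> t \<Longrightarrow> t \<le> T \<Longrightarrow> H t = H' t"
  shows "rough_lift p \<omega> T \<X> H = rough_lift p \<omega> T \<X> H'"
proof -
  have "pair.bigO (N + 1) (\<lambda>(s, t). component m (incr1 \<Y> s t) - component m (osh_lift (H s) (incr1 \<X> s t)))
    \<longleftrightarrow> pair.bigO (N + 1) (\<lambda>(s, t). component m (incr1 \<Y> s t) - component m (osh_lift (H' s) (incr1 \<X> s t)))" for m and \<Y> :: "'u rough_path"
    by (rule pair.bigO_cong) (auto simp: eq)
  moreover have "(\<forall>t\<in>{0..T}. path_trace \<Y> t = ctrace H t) \<longleftrightarrow> (\<forall>t\<in>{0..T}. path_trace \<Y> t = ctrace H' t)" for \<Y> :: "'u rough_path"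
    by (simp add: ctrace_def eq)
  ultimately have "is_lift \<X> H = is_lift \<X> H'" unfolding is_lift_def fun_eq_iff by (simp only:) simp
  then show ?thesis unfolding rough_lift_eq_The[OF X] by simp
qed

context
  fixes \<X> :: "'v::fin_dim rough_path" and H :: "real \<Rightarrow> 'v tensor \<Rightarrow>\<^sub>L 'u::fin_dim" and Y :: "real \<Rightarrow> real \<Rightarrow> 'u tensor"
  assumes X: "\<X> \<in> rough_paths p \<omega> T" and H: "H \<in> controlled p \<omega> T \<X>"
    and Y: "multiplicative N Y"
    and YZ: "\<And>m. m \<in> {1..N} \<Longrightarrow> pair.bigO (N + 1) (\<lambda>(s, t). component m (Y s t) - lift_germ \<X> H m s t)"
begin

private definition W where "W s t = osh_lift (H s) (incr1 \<X> s t)"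

private lemma W0: "component 0 (W s t) = tensor_of []"
  unfolding W_def using multiplicative_incr1[OF X] by (intro component_0_osh_lift) (simp add: multiplicative_def)

private lemma Y0: "component 0 (Y s t) = tensor_of []"
  using Y by (simp add: multiplicative_def)

private lemma WO: "pair.bigO m (\<lambda>(s, t). component m (W s t))"
  using bigO_component_osh_lift[OF X H] by (simp add: W_def)

private lemma YW:
  assumes "m \<le> N"
  shows "pair.bigO (if m = 1 then N else N + 1) (\<lambda>(s, t). component m (Y s t - W s t))"
proof -
  consider "m = 0" | "m = 1" | "m \<ge> 2" by linarith
  then show ?thesis
  proof cases
    case 1
    then show ?thesis by (intro pair.bigO_eq_0) (auto simp: component_diff Y0 W0)
  next
    case 2
    have "pair.bigO N (\<lambda>(s, t). component 1 (Y s t) - lift_germ \<X> H 1 s t)"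
      by (rule pair.bigO_mono[OF YZ]) (use N_ge_1 in auto)
    from pair.bigO_diff[OF this lift_germ_1[OF X H]] show ?thesis
      using 2 by (simp add: component_diff W_def case_prod_unfold)
  next
    case 3
    then show ?thesis using YZ[of m] assms by (simp add: lift_germ_def component_diff W_def)
  qed
qed

private lemma YO: "m \<le> N \<Longrightarrow> pair.bigO m (\<lambda>(s, t). component m (Y s t))"
proof -
  assume m: "m \<le> N"
  have "pair.bigO m (\<lambda>(s, t). component m (Y s t - W s t))" by (rule pair.bigO_mono[OF YW[OF m]]) (use m in auto)
  from pair.bigO_add[OF this WO] show ?thesis by (simp add: component_diff case_prod_unfold)
qed

text \<open>A coalgebra homomorphism carries group-like elements to group-like elements. The
  truncation of the increment at degree \<open>N\<close> limits this to order
  \<open>N + 1\<close>.\<close>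

private lemma shuffle_defect_W:
  fixes f :: "'u list \<Rightarrow> 'u list \<Rightarrow> real"
  assumes f: "homogeneous n f"
  shows "pair.bigO (N + 1) (\<lambda>(s, t). shuffle_defect f (W s t))"
proof -
  have bf: "bimultilinear f" using f by (simp add: homogeneous_def)
  define h where "h s w = blinfun_apply (H s) (tensor_of w)" for s w
  have mh: "multilinear (h s)" for s unfolding h_def by (rule multilinear_blinfun)
  define g where "g s x y = tensor_lift2 f (osh_map (h s) x) (osh_map (h s) y)" for s x y
  have bg: "bimultilinear (g s)" for s unfolding g_def by (rule cop_osh_map(1)[OF bf mh])
  have ho: "pair.bigO 0 (\<lambda>i. h (fst i) w)" for w
    using controlled_bounded(1)[OF H] by (simp add: h_def case_prod_unfold)
  have co: "pair.bigO 0 (\<lambda>i. component k (osh_map (h (fst i)) x))" for k x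
    by (rule pair.bigO_bounded_linear[OF bounded_linear_component pair.bigO_osh_map[OF ho]])
  have go: "pair.bigO 0 (\<lambda>i. g (fst i) x y)" for x y
    unfolding g_def by (rule pair.bigO_tensor_lift2_components[OF f pair.bigO_tensor_lift2_component[OF bf co co]]) simp
  have "pair.bigO (N + 1) (\<lambda>i. cop (g (fst i)) (incr1 \<X> (fst i) (snd i)) - tensor_lift2 (g (fst i)) (incr1 \<X> (fst i) (snd i)) (incr1 \<X> (fst i) (snd i)))"
    using pair.bigO_grouplike[OF graded_incr1(1)[OF X] grouplike_incr1(1)[OF X] bg go] by (simp add: case_prod_unfold)
  from pair.bigO_minus[OF this] show ?thesis
    unfolding shuffle_defect_def W_def osh_lift_def h_def[symmetric] cop_osh_map(2,3)[OF bf mh] g_def by (simp add: case_prod_unfold)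
qed

text \<open>\<open>Y\<close> and \<open>W\<close> differ by order \<open>N + 1\<close>, except in
  degree 1, where it is \<open>N\<close>. In total degree \<open>n \<ge> 2\<close> an error in
  degree 1 is paired with a part of degree \<open>n - 1 \<ge> 1\<close>, which supplies the missing
  order.\<close>

private lemma shuffle_defect_bigO:
  fixes f :: "'u list \<Rightarrow> 'u list \<Rightarrow> real"
  assumes f: "homogeneous n f" and n: "n \<in> {2..N}"
  shows "pair.bigO (N + 1) (\<lambda>(s, t). shuffle_defect f (Y s t))"
proof -
  have bf: "bimultilinear f" using f by (simp add: homogeneous_def)
  define E where "E s t = Y s t - W s t" for s t
  have EO: "pair.bigO (if m = 1 then N else N + 1) (\<lambda>i. component m (E (fst i) (snd i)))" if "m \<le> N" for m
    using YW[OF that] by (simp add: E_def case_prod_unfold)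
  have Y': "pair.bigO m (\<lambda>i. component m (Y (fst i) (snd i)))" if "m \<le> N" for m
    using YO[OF that] by (simp add: case_prod_unfold)
  have W': "pair.bigO m (\<lambda>i. component m (W (fst i) (snd i)))" for m
    using WO by (simp add: case_prod_unfold)
  have 1: "pair.bigO (N + 1) (\<lambda>i. tensor_lift2 f (E (fst i) (snd i)) (Y (fst i) (snd i)))"
  proof (rule pair.bigO_tensor_lift2_components[OF f])
    fix k assume "k \<le> n"
    then show "pair.bigO (N + 1) (\<lambda>i. tensor_lift2 f (component k (E (fst i) (snd i))) (component (n - k) (Y (fst i) (snd i))))"
      by (intro pair.bigO_tensor_lift2_component[OF bf EO Y']) (use n in auto)
  qed
  have 2: "pair.bigO (N + 1) (\<lambda>i. tensor_lift2 f (W (fst i) (snd i)) (E (fst i) (snd i)))"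
  proof (rule pair.bigO_tensor_lift2_components[OF f])
    fix k assume "k \<le> n"
    then show "pair.bigO (N + 1) (\<lambda>i. tensor_lift2 f (component k (W (fst i) (snd i))) (component (n - k) (E (fst i) (snd i))))"
      by (intro pair.bigO_tensor_lift2_component[OF bf W' EO]) (use n in auto)
  qed
  have 3: "pair.bigO (N + 1) (\<lambda>i. cop f (component n (E (fst i) (snd i))))"
    unfolding cop_def
  proof (rule pair.bigO_tensor_lift[OF multilinear_unshuffle_sum[OF bf], where M = n and e = "\<lambda>_. 0" and d = "\<lambda>_. N + 1"])
    show "pair.bigO (N + 1) (\<lambda>i. component k (component n (E (fst i) (snd i))))" for k
      using EO[of n] n by (cases "k = n") (auto simp: pair.bigO_zero)
  qed (auto simp: pair.bigO_const)
  have eq: "shuffle_defect f (Y s t) = shuffle_defect f (W s t) + (tensor_lift2 f (E s t) (Y s t) + tensor_lift2 f (W s t) (E s t)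
      - cop f (component n (E s t)))" for s t
  proof -
    have "cop f (component n (E s t)) = cop f (E s t)" by (rule cop_agree[OF f]) simp
    also have "\<dots> = cop f (Y s t) - cop f (W s t)" unfolding E_def by (rule linear_diff[OF linear_cop[OF bf]])
    finally show ?thesis
      unfolding shuffle_defect_def E_def linear_diff[OF linear_tensor_lift2_left[OF bf]] linear_diff[OF linear_tensor_lift2_right[OF bf]]
      by simp
  qed
  show ?thesis
    unfolding eq using pair.bigO_add[OF shuffle_defect_W[OF f] pair.bigO_diff[OF pair.bigO_add[OF 1 2] 3]]
    by (simp add: case_prod_unfold)
qed

private lemma shuffle_defect_eq_0:
  fixes f :: "'u list \<Rightarrow> 'u list \<Rightarrow> real"
  assumes "n \<le> N" "homogeneous n f" "0 \<le> s" "s \<le> t" "t \<le> T"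
  shows "shuffle_defect f (Y s t) = 0"
  using assms
proof (induction n arbitrary: f s t rule: less_induct)
  case (less n)
  show ?case
  proof (cases "n \<le> 1")
    case True
    show ?thesis by (rule shuffle_defect_low_degree[OF less.prems(2) True Y0])
  next
    case False
    show ?thesis
    proof (rule additive_bigO_eq_0[of "\<lambda>s t. shuffle_defect f (Y s t)"])
      show "shuffle_defect f (Y s t) = shuffle_defect f (Y s u) + shuffle_defect f (Y u t)"
        if "0 \<le> s" "s \<le> u" "u \<le> t" "t \<le> T" for s u t
      proof -
        have "shuffle_defect f (Y s t) = shuffle_defect f (Y s u \<otimes>\<^sub>t Y u t)"
          by (rule shuffle_defect_agree[OF less.prems(2)]) (use Y that less.prems(1) in \<open>auto simp: multiplicative_def\<close>)
        also have "\<dots> = shuffle_defect f (Y s u) + shuffle_defect f (Y u t)"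
          by (rule shuffle_defect_mult[OF less.prems(2) _ Y0 Y0])
            (use False less.IH that less.prems(1) in auto)
        finally show ?thesis .
      qed
      show "pair.bigO (N + 1) (\<lambda>(s, t). shuffle_defect f (Y s t))"
        by (rule shuffle_defect_bigO[OF less.prems(2)]) (use False less.prems(1) in auto)
    qed (use less.prems in auto)
  qed
qed

lemma is_lift_of_tensor:
  assumes cont: "continuous_on \<Delta>\<^bsub>T\<^esub> (\<lambda>(s, t). Y s t)"
  shows "is_lift \<X> H (ctrace H 0, \<lambda>s t. if (s, t) \<in> \<Delta>\<^bsub>T\<^esub> then Y s t else 0)" (is "is_lift \<X> H ?Y")
  unfolding is_lift_def
proof (intro conjI ballI)
  show rp: "?Y \<in> rough_paths p \<omega> T"
    by (rule rough_pathI[OF Y cont YO shuffle_defect_eq_0]) auto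
  show "path_trace ?Y t = ctrace H t" if "t \<in> {0..T}" for t
  proof -
    have t: "0 \<le> t" "t \<le> T" using that by auto
    \<comment> \<open>In degree 1 both \<open>Y\<close> and the germ are additive, so their
      closeness of order \<open>N + 1\<close> is equality and the trace is exactly that of
      \<open>H\<close>.\<close>
    have "component 1 (Y 0 t) - lift_germ \<X> H 1 0 t = 0"
    proof (rule additive_bigO_eq_0[of "\<lambda>s t. component 1 (Y s t) - lift_germ \<X> H 1 s t"])
      show "pair.bigO (N + 1) (\<lambda>(s, t). component 1 (Y s t) - lift_germ \<X> H 1 s t)"
        by (rule YZ) (use N_ge_1 in auto)
      fix s u t assume sut: "0 \<le> s" "s \<le> u" "u \<le> t" "t \<le> T"
      have "component 1 (Y s t) = component 1 (Y s u \<otimes>\<^sub>t Y u t)" using Y N_ge_1 sut by (auto simp: multiplicative_def)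
      also have "\<dots> = component 1 (Y s u) + component 1 (Y u t)"
        using component_mult_split[OF Y0 Y0, of 1] by simp
      finally show "component 1 (Y s t) - lift_germ \<X> H 1 s t
          = component 1 (Y s u) - lift_germ \<X> H 1 s u + (component 1 (Y u t) - lift_germ \<X> H 1 u t)"
        by (simp add: lift_germ_def linear_diff[OF linear_tensor_of_singleton])
    qed (use t in auto)
    then have "tensor_of [vector_part (Y 0 t)] = tensor_of [ctrace H t - ctrace H 0]"
      unfolding component_1_vector_part by (simp add: lift_germ_def)
    then have "vector_part (Y 0 t) = ctrace H t - ctrace H 0" by (metis vector_part_singleton)
    then show ?thesis using t by (simp add: path_trace_def)
  qed
  show "pair.bigO (N + 1) (\<lambda>(s, t). component m (incr1 ?Y s t) - component m (osh_lift (H s) (incr1 \<X> s t)))"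
    if "m \<in> {2..N}" for m
  proof -
    have "pair.bigO (N + 1) (\<lambda>(s, t). component m (Y s t) - lift_germ \<X> H m s t)" by (rule YZ) (use that in auto)
    then show ?thesis
      by (rule pair.bigO_cong[THEN iffD1, rotated]) (use that in \<open>auto simp: incr1_def lift_germ_def\<close>)
  qed
qed

end

theorem is_lift_rough_lift:
  assumes X: "\<X> \<in> rough_paths p \<omega> T" and H: "H \<in> controlled p \<omega> T \<X>"
  shows "is_lift \<X> H (rough_lift p \<omega> T \<X> H)"
proof -
  obtain Y where Y: "multiplicative N Y" "continuous_on \<Delta>\<^bsub>T\<^esub> (\<lambda>(s, t). Y s t)"
    "\<forall>m\<in>{1..N}. pair.bigO (N + 1) (\<lambda>(s, t). component m (Y s t) - lift_germ \<X> H m s t)"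
    using ex_lift_tensor[OF X H] by blast
  have L: "is_lift \<X> H (ctrace H 0, \<lambda>s t. if (s, t) \<in> \<Delta>\<^bsub>T\<^esub> then Y s t else 0)"
    by (rule is_lift_of_tensor[OF X H Y(1) _ Y(2)]) (use Y(3) in blast)
  show ?thesis unfolding rough_lift_eqI[OF X L] by (rule L)
qed

lemma rough_lift_rough_path: "\<X> \<in> rough_paths p \<omega> T \<Longrightarrow> H \<in> controlled p \<omega> T \<X> \<Longrightarrow> rough_lift p \<omega> T \<X> H \<in> rough_paths p \<omega> T"
  by (drule (1) is_lift_rough_lift) (simp add: is_lift_def)

lemma path_trace_rough_lift:
  "\<X> \<in> rough_paths p \<omega> T \<Longrightarrow> H \<in> controlled p \<omega> T \<X> \<Longrightarrow> 0 \<le> t \<Longrightarrow> t \<le> T \<Longrightarrow> path_trace (rough_lift p \<omega> T \<X> H) t = ctrace H t"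
  by (drule (1) is_lift_rough_lift) (simp add: is_lift_def)

end

section \<open>Change of the controlling path\<close>

lemma component_osh_lift_eq_0:
  assumes a: "\<And>k. k > M \<Longrightarrow> component k a = 0" and n: "n > M"
  shows "component n (osh_lift h a) = 0"
proof -
  have z: "component n (osh_lift h (component k a)) = 0" if "k \<le> M" for k
  proof (rule tensor_linear_eqI[of "\<lambda>a. component n (osh_lift h (component k a))" "\<lambda>a. 0"])
    show "linear (\<lambda>a. component n (osh_lift h (component k a)))"
      by (intro linear_compose'[OF linear_component linear_compose'[OF linear_osh_lift linear_component]])
    show "component n (osh_lift h (component k (tensor_of w))) = 0" for w
      using that n by (simp add: osh_lift_tensor_of component_osh_map_eq_0 linear_0[OF linear_osh_lift])
  qed (rule linear_zero)
  have "component n (osh_lift h a) = component n (osh_lift h (\<Sum>k\<le>M. component k a))"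
    by (simp only: sum_components[OF a])
  also have "\<dots> = (\<Sum>k\<le>M. component n (osh_lift h (component k a)))"
    by (rule linear_sum[OF linear_compose'[OF linear_osh_lift linear_component]])
  finally show ?thesis using z by simp
qed

context rough_setting
begin

text \<open>On words of length at most \<open>N\<close>, inclusively, degree
  \<open>m \<ge> 2\<close> uses only blocks shorter than \<open>N\<close>, where \<open>star\<close>
  is not truncated.\<close>

lemma osh_lift_star:
  fixes K :: "real \<Rightarrow> 'u::fin_dim tensor \<Rightarrow>\<^sub>L 's::fin_dim" and H :: "real \<Rightarrow> 'v::fin_dim tensor \<Rightarrow>\<^sub>L 'u"
  assumes m: "m \<ge> 2" and a: "\<And>n. n > N \<Longrightarrow> component n a = 0"
  shows "component m (osh_lift (K s) (osh_lift (H s) a)) = component m (osh_lift (star p K H s) a)"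
proof (rule linear_agree_low_degree[of "\<lambda>a. component m (osh_lift (K s) (osh_lift (H s) a))" "\<lambda>a. component m (osh_lift (star p K H s) a)" "N + 1"])
  show "linear (\<lambda>a. component m (osh_lift (K s) (osh_lift (H s) a)))"
    by (rule linear_compose'[OF linear_osh_lift linear_compose'[OF linear_osh_lift linear_component]])
  show "linear (\<lambda>a. component m (osh_lift (star p K H s) a))"
    by (rule linear_compose'[OF linear_osh_lift linear_component])
  show "component m (osh_lift (K s) (osh_lift (H s) (tensor_of w))) = component m (osh_lift (star p K H s) (tensor_of w))"
    if w: "length w < N + 1" for w
  proof -
    have "osh_lift (K s) (osh_lift (H s) (tensor_of w))
      = osh_map (\<lambda>w. blinfun_apply (K s) (osh_map (\<lambda>x. blinfun_apply (H s) (tensor_of x)) w)) w"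
      unfolding osh_lift_tensor_of[of "H s"] unfolding osh_lift_def osh_map_compose[OF multilinear_blinfun] tensor_lift_blinfun ..
    moreover have "component m (osh_map (\<lambda>w. blinfun_apply (K s) (osh_map (\<lambda>x. blinfun_apply (H s) (tensor_of x)) w)) w)
      = component m (osh_map (\<lambda>w. blinfun_apply (star p K H s) (tensor_of w)) w)"
      by (rule component_osh_map_cong[OF m]) (use w in \<open>simp add: star_tensor_of[OF p_ge_1]\<close>)
    ultimately show ?thesis by (simp only: osh_lift_tensor_of)
  qed
qed (use a in auto)

theorem is_lift_star:
  fixes K :: "real \<Rightarrow> 'u::fin_dim tensor \<Rightarrow>\<^sub>L 's::fin_dim" and H :: "real \<Rightarrow> 'v::fin_dim tensor \<Rightarrow>\<^sub>L 'u"
  assumes X: "\<X> \<in> rough_paths p \<omega> T" and H: "H \<in> controlled p \<omega> T \<X>"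
    and K: "K \<in> controlled p \<omega> T (rough_lift p \<omega> T \<X> H)"
  shows "is_lift \<X> (star p K H) (rough_lift p \<omega> T (rough_lift p \<omega> T \<X> H) K)"
proof -
  define HH where "HH = rough_lift p \<omega> T \<X> H"
  have HHr: "HH \<in> rough_paths p \<omega> T" unfolding HH_def by (rule rough_lift_rough_path[OF X H])
  have K': "K \<in> controlled p \<omega> T HH" using K by (simp add: HH_def)
  define YY where "YY = rough_lift p \<omega> T HH K"
  have LH: "is_lift \<X> H HH" unfolding HH_def by (rule is_lift_rough_lift[OF X H])
  have LK: "is_lift HH K YY" unfolding YY_def by (rule is_lift_rough_lift[OF HHr K'])
  have Xhi: "component n (incr1 \<X> s t) = 0" if "n > N" for n s t
    using multiplicative_incr1[OF X] that by (simp add: multiplicative_def)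
  have X0: "component 0 (incr1 \<X> s t) = tensor_of []" for s t
    using multiplicative_incr1[OF X] by (simp add: multiplicative_def)
  have Hhi: "component n (incr1 HH s t) = 0" if "n > N" for n s t
    using multiplicative_incr1[OF HHr] that by (simp add: multiplicative_def)
  have H0: "component 0 (incr1 HH s t) = tensor_of []" for s t
    using multiplicative_incr1[OF HHr] by (simp add: multiplicative_def)
  \<comment> \<open>The error of replacing the lift of \<open>H\<close> by \<open>osh_lift\<close>:
    of order \<open>N\<close> in degree 1 and \<open>N + 1\<close> in the other degrees up to
    \<open>N\<close>.\<close>
  define D where "D s t = incr1 HH s t - osh_lift (H s) (incr1 \<X> s t)" for s t
  have DO: "pair.bigO (if n = 1 then N else N + 1) (\<lambda>(s, t). component n (D s t))" if "n \<le> N" for n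
  proof -
    consider "n = 0" | "n = 1" | "n \<ge> 2" by linarith
    then show ?thesis
    proof cases
      case 1
      then show ?thesis
        by (intro pair.bigO_eq_0) (auto simp: D_def component_diff H0 component_0_osh_lift[OF X0])
    next
      case 2
      have "pair.bigO N (\<lambda>(s, t). component 1 (D s t))"
      proof (rule pair.bigO_cong[THEN iffD1, OF _ pair.bigO_minus[OF lift_germ_1[OF X H]]])
        fix i assume i: "i \<in> \<Delta>\<^bsub>T\<^esub>"
        obtain s t where st: "i = (s, t)" "0 \<le> s" "s \<le> t" "t \<le> T" using i by (cases i) auto
        have "path_trace HH s = ctrace H s" "path_trace HH t = ctrace H t" using LH st by (auto simp: is_lift_def)
        then have "component 1 (incr1 HH s t) = lift_germ \<X> H 1 s t"
          unfolding path_trace_increment[OF HHr st(2-)] by (simp add: lift_germ_def)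
        then show "- (case i of (s, t) \<Rightarrow> component 1 (osh_lift (H s) (incr1 \<X> s t)) - lift_germ \<X> H 1 s t)
          = (case i of (s, t) \<Rightarrow> component 1 (D s t))"
          by (simp add: st(1) D_def component_diff)
      qed
      then show ?thesis using 2 by simp
    next
      case 3
      then have "pair.bigO (N + 1) (\<lambda>(s, t). component n (incr1 HH s t) - component n (osh_lift (H s) (incr1 \<X> s t)))"
        using LH that unfolding is_lift_def by simp
      then show ?thesis using 3 by (simp add: D_def component_diff)
    qed
  qed
  have DO': "pair.bigO (if n = 1 then N else N + 1) (\<lambda>i. component n (D (fst i) (snd i)))" if "n \<le> N" for n
    using DO[OF that] by (simp add: case_prod_unfold)
  have Dhi: "component n (D s t) = 0" if "n > N" for n s t
  proof -
    have "component n (osh_lift (H s) (incr1 \<X> s t)) = 0"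
      by (rule component_osh_lift_eq_0[OF _ that]) (rule Xhi)
    then show ?thesis unfolding D_def component_diff Hhi[OF that] by simp
  qed
  \<comment> \<open>In degree \<open>m \<ge> 2\<close> the map \<open>osh_map\<close> vanishes on
    single letters, so the one component of \<open>D\<close> that is only of order \<open>N\<close>
    is not seen.\<close>
  have KD: "pair.bigO (N + 1) (\<lambda>i. component m (osh_lift (K (fst i)) (D (fst i) (snd i))))" if m: "m \<ge> 2" for m
  proof -
    let ?\<phi> = "\<lambda>i w. component m (osh_map (\<lambda>x. blinfun_apply (K (fst i)) (tensor_of x)) w)"
    have m\<phi>: "multilinear (?\<phi> i)" for i :: "real \<times> real"
      by (rule multilinear_compose_linear[OF multilinear_osh_map[OF multilinear_blinfun] linear_component])
    have b\<phi>: "pair.bigO (if length w < m then N + 1 else 0) (\<lambda>i. ?\<phi> i w)" for w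
    proof (cases "length w < m")
      case True
      then show ?thesis by (simp add: component_osh_map_eq_0 pair.bigO_zero)
    next
      case False
      have "pair.bigO 0 (\<lambda>i. blinfun_apply (K (fst i)) (tensor_of x))" for x
        using controlled_bounded(1)[OF K'] by (simp add: case_prod_unfold)
      then show ?thesis using False by (simp add: pair.bigO_bounded_linear[OF bounded_linear_component pair.bigO_osh_map])
    qed
    have "pair.bigO (N + 1) (\<lambda>i. tensor_lift (?\<phi> i) (D (fst i) (snd i)))"
      by (rule pair.bigO_tensor_lift[where M = N and e = "\<lambda>n. if n < m then N + 1 else 0" and d = "\<lambda>n. if n = 1 then N else N + 1",
            OF m\<phi> Dhi b\<phi> DO'])
        (use m in auto)
    moreover have "tensor_lift (?\<phi> i) a = component m (osh_lift (K (fst i)) a)" for i :: "real \<times> real" and a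
      by (rule tensor_linear_eqI[of "tensor_lift (?\<phi> i)" "\<lambda>a. component m (osh_lift (K (fst i)) a)",
            OF linear_tensor_lift[OF m\<phi>] linear_compose'[OF linear_osh_lift linear_component]])
        (simp only: tensor_lift_tensor_of[OF m\<phi>] osh_lift_tensor_of)
    ultimately show ?thesis by simp
  qed
  have "pair.bigO (N + 1) (\<lambda>(s, t). component m (incr1 YY s t) - component m (osh_lift (star p K H s) (incr1 \<X> s t)))"
    if m: "m \<in> {2..N}" for m
  proof -
    have m2: "m \<ge> 2" using m by simp
    have eq: "component m (osh_lift (K s) (D s t)) = component m (osh_lift (K s) (incr1 HH s t)) - component m (osh_lift (star p K H s) (incr1 \<X> s t))" for s t
    proof -
      have "component m (osh_lift (K s) (osh_lift (H s) (incr1 \<X> s t))) = component m (osh_lift (star p K H s) (incr1 \<X> s t))"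
        by (rule osh_lift_star[OF m2]) (rule Xhi)
      then show ?thesis unfolding D_def linear_diff[OF linear_osh_lift] component_diff by simp
    qed
    have "pair.bigO (N + 1) (\<lambda>(s, t). component m (incr1 YY s t) - component m (osh_lift (K s) (incr1 HH s t)))"
      using LK m unfolding is_lift_def by blast
    from pair.bigO_add[OF this KD[OF m2]] show ?thesis unfolding eq by (simp add: case_prod_unfold)
  qed
  moreover have "YY \<in> rough_paths p \<omega> T" "\<forall>t\<in>{0..T}. path_trace YY t = ctrace (star p K H) t"
    using LK by (auto simp: is_lift_def ctrace_star[OF p_ge_1])
  ultimately show ?thesis unfolding is_lift_def YY_def HH_def by blast
qed

end

section \<open>Smooth functions of rough paths\<close>

text \<open>Each of the letters can be chosen to be moved to the front, and by invariance under
  adjacent transpositions every choice gives \<open>f w\<close>.\<close>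

lemma unshuffle_sum_symmetric:
  fixes f :: "'v list \<Rightarrow> 'a::real_vector"
  assumes "\<And>z u v w. f (z @ u # v # w) = f (z @ v # u # w)"
  shows "unshuffle_sum w (\<lambda>x y. if length x = 1 then f (x @ y) else 0) = real (length w) *\<^sub>R f w"
  using assms
proof (induction w arbitrary: f)
  case (Cons v w)
  have "unshuffle_sum w (\<lambda>x y. if length (v # x) = 1 then f ((v # x) @ y) else 0)
      = unshuffle_sum w (\<lambda>x y. if x = [] then f (v # y) else 0)"
    by (rule unshuffle_sum_cong[OF refl]) auto
  also have "\<dots> = f (v # w)" by (rule unshuffle_sum_left_Nil)
  finally have 1: "unshuffle_sum w (\<lambda>x y. if length (v # x) = 1 then f ((v # x) @ y) else 0) = f (v # w)" .
  have "unshuffle_sum w (\<lambda>x y. if length x = 1 then f (x @ v # y) else 0)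
      = unshuffle_sum w (\<lambda>x y. if length x = 1 then f (v # x @ y) else 0)"
  proof (rule unshuffle_sum_cong[OF refl])
    fix x y :: "'v list"
    show "(if length x = 1 then f (x @ v # y) else 0) = (if length x = 1 then f (v # x @ y) else 0)"
      using Cons.prems[of "[]"] by (cases x; cases "tl x") auto
  qed
  also have "\<dots> = real (length w) *\<^sub>R f (v # w)"
    by (rule Cons.IH[of "\<lambda>w. f (v # w)"]) (use Cons.prems[of "v # _"] in simp)
  finally have 2: "unshuffle_sum w (\<lambda>x y. if length x = 1 then f (x @ v # y) else 0) = real (length w) *\<^sub>R f (v # w)" .
  show ?case unfolding unshuffle_sum.simps 1 2 by (simp add: scaleR_left_distrib)
qed simp

context rough_setting
begin

text \<open>On symmetric forms, the shuffle relation between degrees 1 and \<open>k\<close> says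
  that pairing the increment of the trace with degree \<open>k\<close> gives \<open>k + 1\<close>
  times the pairing with degree \<open>k + 1\<close>. Hence the symmetric part in degree
  \<open>k\<close> is the tensor power of the increment divided by \<open>k!\<close>.\<close>

lemma symmetric_form_component:
  fixes f :: "'v::fin_dim list \<Rightarrow> 'e::real_normed_vector"
  assumes X: "\<X> \<in> rough_paths p \<omega> T" and st: "0 \<le> s" "s \<le> t" "t \<le> T"
    and f: "multilinear f" "\<And>z u v w. f (z @ u # v # w) = f (z @ v # u # w)" and k: "k \<le> N"
  shows "tensor_lift f (component k (incr1 \<X> s t)) = (1 / fact k) *\<^sub>R f (replicate k (path_trace \<X> t - path_trace \<X> s))"
  using f k
proof (induction k arbitrary: f)
  case 0
  have "component 0 (incr1 \<X> s t) = tensor_of []"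
    using multiplicative_incr1[OF X] by (simp add: multiplicative_def)
  then show ?case by (simp add: tensor_lift_tensor_of[OF 0(1)])
next
  case (Suc k)
  define v where "v = path_trace \<X> t - path_trace \<X> s"
  let ?a = "incr1 \<X> s t"
  have mv: "multilinear (\<lambda>y. f (x @ y))" for x
    unfolding multilinear_def
  proof (intro allI)
    fix us ws
    show "linear (\<lambda>v. f (x @ us @ v # ws))"
      using Suc.prems(1)[unfolded multilinear_def, rule_format, of "x @ us" ws] by simp
  qed
  have mv': "multilinear (\<lambda>x. f (x @ y))" for y
    unfolding multilinear_def
  proof (intro allI)
    fix us ws
    show "linear (\<lambda>v. f ((us @ v # ws) @ y))"
      using Suc.prems(1)[unfolded multilinear_def, rule_format, of us "ws @ y"] by simp
  qed
  have bf: "bimultilinear (\<lambda>x y. f (x @ y))"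
    unfolding bimultilinear_def using mv mv' by blast
  let ?g = "\<lambda>x y. if length x = 1 \<and> length y = k then f (x @ y) else 0"
  have bg: "bimultilinear ?g" by (rule bimultilinear_if_length[OF bf])
  have "cop ?g (component (1 + k) ?a) = real (Suc k) *\<^sub>R tensor_lift f (component (Suc k) ?a)"
  proof (rule tensor_linear_eqI[of "\<lambda>a. cop ?g (component (1 + k) a)" "\<lambda>a. real (Suc k) *\<^sub>R tensor_lift f (component (Suc k) a)"])
    show "linear (\<lambda>a. cop ?g (component (1 + k) a))" by (rule linear_compose'[OF linear_component linear_cop[OF bg]])
    have "linear (\<lambda>a. tensor_lift f (component (Suc k) a))"
      by (rule linear_compose'[OF linear_component linear_tensor_lift[OF Suc.prems(1)]])
    then show "linear (\<lambda>a. real (Suc k) *\<^sub>R tensor_lift f (component (Suc k) a))" by (rule linear_compose_scale_right)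
    fix w :: "'v list"
    show "cop ?g (component (1 + k) (tensor_of w)) = real (Suc k) *\<^sub>R tensor_lift f (component (Suc k) (tensor_of w))"
    proof (cases "length w = Suc k")
      case True
      have "cop ?g (tensor_of w) = unshuffle_sum w ?g" by (rule cop_tensor_of[OF bg])
      also have "\<dots> = unshuffle_sum w (\<lambda>x y. if length x = 1 then f (x @ y) else 0)"
        by (rule unshuffle_sum_cong[OF refl]) (use True in auto)
      also have "\<dots> = real (Suc k) *\<^sub>R f w"
        unfolding True[symmetric] by (rule unshuffle_sum_symmetric) (rule Suc.prems(2))
      finally show ?thesis using True by (simp add: tensor_lift_tensor_of[OF Suc.prems(1)])
    next
      case False
      then show ?thesis by (simp add: linear_0[OF linear_cop[OF bg], unfolded One_nat_def] linear_0[OF linear_tensor_lift[OF Suc.prems(1)]])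
    qed
  qed
  also have "cop ?g (component (1 + k) ?a) = tensor_lift2 (\<lambda>x y. f (x @ y)) (component 1 ?a) (component k ?a)"
    by (rule grouplike_incr[OF X bf _ st, symmetric]) (use Suc.prems in simp)
  also have "\<dots> = tensor_lift (\<lambda>y. f (v # y)) (component k ?a)"
  proof -
    have m: "multilinear (\<lambda>x. tensor_lift (\<lambda>y. f (x @ y)) (component k ?a))"
      using multilinear_tensor_lift_arg[OF bf] .
    show ?thesis
      unfolding path_trace_increment[OF X st] v_def[symmetric] tensor_lift2_def tensor_lift_tensor_of[OF m] by simp
  qed
  also have "\<dots> = (1 / fact k) *\<^sub>R f (v # replicate k v)"
    unfolding v_def
    by (rule Suc.IH[of "\<lambda>y. f ((path_trace \<X> t - path_trace \<X> s) # y)"])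
      (use mv[of "[path_trace \<X> t - path_trace \<X> s]"] Suc.prems(2)[of "(path_trace \<X> t - path_trace \<X> s) # _"] Suc.prems(3) in auto)
  finally have "(1 / real (Suc k)) *\<^sub>R real (Suc k) *\<^sub>R tensor_lift f (component (Suc k) ?a) = (1 / real (Suc k)) *\<^sub>R (1 / fact k) *\<^sub>R f (v # replicate k v)"
    by simp
  then show ?case unfolding v_def[symmetric] by (simp del: of_nat_Suc)
qed

context
  fixes \<X> :: "'v::fin_dim rough_path" and F :: "'v \<Rightarrow> 'u::fin_dim"
  assumes X: "\<X> \<in> rough_paths p \<omega> T" and F: "iter_differentiable F"
begin

private abbreviation "x \<equiv> path_trace \<X>"

text \<open>The Taylor remainder is evaluated between two points of the path, so the bound is needed
  on all chords. The chords are parametrized by a compact set.\<close>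

lemma segment_bounded:
  fixes g :: "'v \<Rightarrow> 'e::real_normed_vector"
  assumes g: "continuous_on UNIV g"
  obtains M where "\<And>s t a. 0 \<le> s \<Longrightarrow> s \<le> t \<Longrightarrow> t \<le> T \<Longrightarrow> a \<in> {0..1} \<Longrightarrow> norm (g (x s + a *\<^sub>R (x t - x s))) \<le> M"
proof -
  let ?q = "\<lambda>z. x (fst z) + snd (snd z) *\<^sub>R (x (fst (snd z)) - x (fst z))"
  let ?K = "{0..T} \<times> {0..T} \<times> {0..1::real}"
  have cx: "continuous_on {0..T} x" by (rule continuous_on_if_bigO_1[OF path_trace_holder[OF X]])
  have "continuous_on ?K ?q" by (intro continuous_intros continuous_on_compose2[OF cx]) auto
  then have "continuous_on ?K (\<lambda>z. g (?q z))" by (intro continuous_on_compose2[OF g]) auto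
  then have "compact ((\<lambda>z. g (?q z)) ` ?K)" by (intro compact_continuous_image compact_Times) auto
  then obtain M where M: "\<forall>y\<in>(\<lambda>z. g (?q z)) ` ?K. norm y \<le> M"
    using compact_imp_bounded bounded_iff by blast
  have "norm (g (x s + a *\<^sub>R (x t - x s))) \<le> M" if "0 \<le> s" "s \<le> t" "t \<le> T" "a \<in> {0..1}" for s t a
  proof -
    have "(s, t, a) \<in> ?K" using that by auto
    then show ?thesis using M by (metis (no_types, lifting) fst_conv image_eqI snd_conv)
  qed
  then show ?thesis by (rule that)
qed

lemma taylor_path:
  "pair.bigO m (\<lambda>(s, t). nth_deriv F w (x t) - (\<Sum>k<m. (1 / fact k) *\<^sub>R nth_deriv F (replicate k (x t - x s) @ w) (x s)))"
proof -
  \<comment> \<open>The position on the chord is included in the index, so that a single constant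
    bounds the derivative along all chords.\<close>
  interpret q: scale "\<Delta>\<^bsub>T\<^esub> \<times> {0..1::real}" "\<lambda>i. r (fst (fst i)) (snd (fst i))" "r 0 T"
    by unfold_locales (auto simp: r_nonneg intro: r_mono)
  let ?v = "\<lambda>i :: (real \<times> real) \<times> real. x (snd (fst i)) - x (fst (fst i))"
  let ?y = "\<lambda>i :: (real \<times> real) \<times> real. x (fst (fst i)) + snd i *\<^sub>R ?v i"
  note Fw = iter_differentiable_nth_deriv[OF F, of w]
  have vO: "q.bigO 1 (\<lambda>i. tensor_of [?v i])"
  proof -
    obtain C where C: "\<And>i. i \<in> \<Delta>\<^bsub>T\<^esub> \<Longrightarrow> norm (case i of (s, t) \<Rightarrow> x t - x s) \<le> C * (case i of (s, t) \<Rightarrow> r s t) ^ 1"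
      by (rule pair.bigOE[OF path_trace_holder[OF X]]) (rule that)
    have "q.bigO 1 ?v" by (rule q.bigOI[where C = C]) (use C in force)
    then show ?thesis by (rule q.bigO_bounded_linear[OF bounded_linear_tensor_of_singleton])
  qed
  have rO: "q.bigO k (\<lambda>i. tensor_of (replicate k (?v i)))" for k
  proof (induction k)
    case (Suc k)
    have "q.bigO (Suc k) (\<lambda>i. tensor_of [?v i] \<otimes>\<^sub>t tensor_of (replicate k (?v i)))"
      by (rule q.bigO_tensor_mult[OF vO Suc]) simp
    then show ?case by simp
  qed (simp add: q.bigO_const)
  note mF = multilinear_nth_deriv[OF Fw]
  have dO: "q.bigO 0 (\<lambda>i. nth_deriv (nth_deriv F w) u (?y i))" for u
  proof -
    obtain M where M: "\<And>s t a. 0 \<le> s \<Longrightarrow> s \<le> t \<Longrightarrow> t \<le> T \<Longrightarrow> a \<in> {0..1} \<Longrightarrow> norm (nth_deriv (nth_deriv F w) u (x s + a *\<^sub>R (x t - x s))) \<le> M"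
      by (rule segment_bounded[OF continuous_on_nth_deriv[OF Fw]]) (rule that)
    show ?thesis by (rule q.bigOI[where C = M]) (use M in force)
  qed
  \<comment> \<open>The \<open>m\<close>-th derivative along the chord is a bounded form paired with
    the \<open>m\<close>-th tensor power of the increment, which has order \<open>m\<close>.\<close>
  have "q.bigO m (\<lambda>i. tensor_lift (\<lambda>u. nth_deriv (nth_deriv F w) u (?y i)) (tensor_of (replicate m (?v i))))"
  proof (rule q.bigO_tensor_lift[where M = m and e = "\<lambda>_. 0" and d = "\<lambda>_. m"])
    show "q.bigO m (\<lambda>i. component n (tensor_of (replicate m (?v i))))" for n
      using rO[of m] by (cases "n = m") (auto simp: q.bigO_zero)
  qed (auto simp: mF dO)
  then have "q.bigO m (\<lambda>i. nth_deriv (nth_deriv F w) (replicate m (?v i)) (?y i))"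
    by (simp only: tensor_lift_tensor_of[OF mF])
  then obtain C where C: "\<And>i. i \<in> \<Delta>\<^bsub>T\<^esub> \<times> {0..1} \<Longrightarrow> norm (nth_deriv (nth_deriv F w) (replicate m (?v i)) (?y i)) \<le> C * r (fst (fst i)) (snd (fst i)) ^ m"
    by (rule q.bigOE) (rule that)
  show ?thesis
  proof (rule pair.bigOI[where C = C])
    fix i assume i: "i \<in> \<Delta>\<^bsub>T\<^esub>"
    obtain s t where st: "i = (s, t)" by (cases i) auto
    have "norm (nth_deriv (nth_deriv F w) (replicate m (x t - x s)) (x s + a *\<^sub>R (x t - x s))) \<le> C * r s t ^ m" if "a \<in> {0..1}" for a
      using C[of "((s, t), a)"] i that st by simp
    from taylor_line_bound[OF Fw this, of 1]
    have "norm (nth_deriv F w (x t) - (\<Sum>k<m. (1 / fact k) *\<^sub>R nth_deriv (nth_deriv F w) (replicate k (x t - x s)) (x s))) \<le> C * r s t ^ m"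
      by simp
    then show "norm (case i of (s, t) \<Rightarrow> nth_deriv F w (x t) - (\<Sum>k<m. (1 / fact k) *\<^sub>R nth_deriv F (replicate k (x t - x s) @ w) (x s)))
        \<le> C * (case i of (s, t) \<Rightarrow> r s t) ^ m"
      unfolding st nth_deriv_append by simp
  qed
qed

lemma smooth_controlled_holder: "pair.bigO 1 (\<lambda>(s, t). smooth_controlled p F x t - smooth_controlled p F x s)"
proof -
  obtain B :: "'v set" where B: "finite B" "\<And>b. bounded_linear (tensor_coord B b)"
    "\<And>n a. component n a = (\<Sum>b\<in>basis_words B n. tensor_coord B b a *\<^sub>R tensor_of b)"
    by (metis ex_tensor_basis)
  define E :: "'v list \<Rightarrow> 'u \<Rightarrow> 'v tensor \<Rightarrow>\<^sub>L 'u" where "E b u = (blinfun_scaleR_left u o\<^sub>L Blinfun (tensor_coord B b))" for b u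
  have E: "blinfun_apply (E b u) a = tensor_coord B b a *\<^sub>R u" for b u a
    by (simp add: E_def bounded_linear_Blinfun_apply[OF B(2)])
  have bE: "bounded_linear (E b)" for b
    unfolding E_def
    by (rule bounded_linear_compose[OF bounded_bilinear.bounded_linear_left[OF bounded_bilinear_blinfun_compose] bounded_linear_blinfun_scaleR_left])
  have eq: "smooth_controlled p F x t = (\<Sum>n<N. \<Sum>b\<in>basis_words B n. E b (nth_deriv F b (x t)))" for t
  proof (rule blinfun_tensor_eqI)
    fix w :: "'v list"
    note m = multilinear_nth_deriv[OF F, of "x t"]
    note l = linear_tensor_lift[OF m]
    have c: "(\<Sum>b\<in>basis_words B n. tensor_coord B b (tensor_of w) *\<^sub>R nth_deriv F b (x t))
      = (if n = length w then nth_deriv F w (x t) else 0)" for n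
    proof -
      have "(\<Sum>b\<in>basis_words B n. tensor_coord B b (tensor_of w) *\<^sub>R nth_deriv F b (x t))
        = tensor_lift (\<lambda>w. nth_deriv F w (x t)) (\<Sum>b\<in>basis_words B n. tensor_coord B b (tensor_of w) *\<^sub>R tensor_of b)"
        by (simp add: linear_sum[OF l] linear_scale[OF l] tensor_lift_tensor_of[OF m])
      also have "\<dots> = tensor_lift (\<lambda>w. nth_deriv F w (x t)) (component n (tensor_of w))" by (simp only: B(3)[symmetric])
      also have "\<dots> = (if n = length w then nth_deriv F w (x t) else 0)"
        by (simp add: tensor_lift_tensor_of[OF m] linear_0[OF l])
      finally show ?thesis .
    qed
    show "blinfun_apply (smooth_controlled p F x t) (tensor_of w)
      = blinfun_apply (\<Sum>n<N. \<Sum>b\<in>basis_words B n. E b (nth_deriv F b (x t))) (tensor_of w)"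
      unfolding smooth_controlled_tensor_of[OF F] blinfun.sum_left E c by simp
  qed
  have "pair.bigO 1 (\<lambda>i. \<Sum>n<N. \<Sum>b\<in>basis_words B n. E b (case i of (s, t) \<Rightarrow> nth_deriv F b (x t) - nth_deriv F b (x s)))"
    by (intro pair.bigO_sum pair.bigO_bounded_linear[OF bE]) (use taylor_path[of 1] in simp)
  then show ?thesis
    unfolding eq by (simp add: case_prod_unfold linear_diff[OF bounded_linear.linear[OF bE]] sum_subtractf)
qed

text \<open>The controlled expansion is Taylor's formula along the path. Since derivatives are
  symmetric, degree \<open>k\<close> of the rough path enters only through the tensor power of the
  increment divided by \<open>k!\<close>.\<close>

theorem smooth_controlled_in_controlled: "smooth_controlled p F x \<in> controlled p \<omega> T \<X>"
  unfolding controlled_def mem_Collect_eq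
proof (intro conjI ballI allI impI)
  let ?H = "smooth_controlled p F x"
  show "blinfun_apply (?H t) a = 0" if "n \<ge> N" "a \<in> tensor_power n" for t n a
  proof -
    have "blinfun_apply (?H t) (component n a) = 0"
      by (rule tensor_linear_eqI[of "\<lambda>a. blinfun_apply (?H t) (component n a)" "\<lambda>_. 0"])
        (use that in \<open>auto simp: smooth_controlled_tensor_of[OF F] linear_zero blinfun.zero_right intro: linear_compose'[OF linear_component linear_blinfun_apply]\<close>)
    then show ?thesis using that(2) by (simp add: tensor_power_iff)
  qed
  show "?H \<in> holder_paths p \<omega> T"
    using continuous_on_if_bigO_1[OF smooth_controlled_holder] smooth_controlled_holder[unfolded pair_bigO_iff[OF order_refl]]
    by (simp add: holder_paths_def)
  fix n and a :: "'v tensor" assume n: "n + 2 \<le> N" and a: "a \<in> tensor_power n"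
  let ?R = "\<lambda>s t a. degree_part n (?H t) a - (\<Sum>k\<le>N - 1 - n. degree_part (n + k) (?H s) (component k (incr \<X> s t) \<otimes>\<^sub>t a))"
  have word: "pair.bigO (N - n) (\<lambda>(s, t). ?R s t (tensor_of w))" if w: "length w = n" for w
  proof (rule pair.bigO_cong[THEN iffD1, OF _ taylor_path[of "N - n" w]])
    fix i assume i: "i \<in> \<Delta>\<^bsub>T\<^esub>"
    obtain s t where st: "i = (s, t)" "0 \<le> s" "s \<le> t" "t \<le> T" using i by (cases i) auto
    have e: "degree_part (n + k) (?H s) (component k (incr \<X> s t) \<otimes>\<^sub>t tensor_of w)
      = (1 / fact k) *\<^sub>R nth_deriv F (replicate k (x t - x s) @ w) (x s)" if k: "k < N - n" for k
    proof -
      note m = multilinear_nth_deriv[OF iter_differentiable_nth_deriv[OF F, of w], of "x s"]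
      have "degree_part (n + k) (?H s) (component k a \<otimes>\<^sub>t tensor_of w) = tensor_lift (\<lambda>u. nth_deriv (nth_deriv F w) u (x s)) (component k a)" for a
      proof (rule tensor_linear_eqI[of "\<lambda>a. degree_part (n + k) (?H s) (component k a \<otimes>\<^sub>t tensor_of w)" "\<lambda>a. tensor_lift (\<lambda>u. nth_deriv (nth_deriv F w) u (x s)) (component k a)"])
        show "linear (\<lambda>a. degree_part (n + k) (?H s) (component k a \<otimes>\<^sub>t tensor_of w))"
          by (rule linear_compose'[OF linear_component linear_compose'[OF linear_tensor_mult_left linear_degree_part]])
        show "linear (\<lambda>a. tensor_lift (\<lambda>u. nth_deriv (nth_deriv F w) u (x s)) (component k a))"
          by (rule linear_compose'[OF linear_component linear_tensor_lift[OF m]])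
        show "degree_part (n + k) (?H s) (component k (tensor_of u) \<otimes>\<^sub>t tensor_of w)
          = tensor_lift (\<lambda>u. nth_deriv (nth_deriv F w) u (x s)) (component k (tensor_of u))" for u
          using k w by (cases "length u = k")
            (auto simp: degree_part_tensor_of smooth_controlled_tensor_of[OF F] tensor_lift_tensor_of[OF m] nth_deriv_append
              linear_0[OF linear_degree_part] linear_0[OF linear_tensor_lift[OF m]])
      qed
      moreover have "tensor_lift (\<lambda>u. nth_deriv (nth_deriv F w) u (x s)) (component k (incr1 \<X> s t))
        = (1 / fact k) *\<^sub>R nth_deriv (nth_deriv F w) (replicate k (x t - x s)) (x s)"
        by (rule symmetric_form_component[OF X st(2-) m nth_deriv_swap[OF iter_differentiable_nth_deriv[OF F]]])
          (use k in simp)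
      ultimately show ?thesis using st by (simp add: nth_deriv_append incr1_eq)
    qed
    have set: "{..N - 1 - n} = {..<N - n}" using n by auto
    show "(case i of (s, t) \<Rightarrow> nth_deriv F w (x t) - (\<Sum>k<N - n. (1 / fact k) *\<^sub>R nth_deriv F (replicate k (x t - x s) @ w) (x s)))
      = (case i of (s, t) \<Rightarrow> ?R s t (tensor_of w))"
      unfolding st(1) prod.case set using e w n by (simp add: degree_part_tensor_of smooth_controlled_tensor_of[OF F])
  qed
  obtain B :: "'v set" where B: "finite B"
    "\<And>n a. component n a = (\<Sum>b\<in>basis_words B n. tensor_coord B b a *\<^sub>R tensor_of b)"
    by (metis ex_tensor_basis)
  have lin: "linear (?R s t)" for s t
    by (intro linear_compose_sub linear_compose_sum ballI linear_degree_part linear_compose'[OF linear_tensor_mult_right linear_degree_part])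
  have "?R s t a = (\<Sum>b\<in>basis_words B n. tensor_coord B b a *\<^sub>R ?R s t (tensor_of b))" for s t
  proof -
    have "?R s t a = ?R s t (\<Sum>b\<in>basis_words B n. tensor_coord B b a *\<^sub>R tensor_of b)"
      using a B(2)[of n a] by (simp add: tensor_power_iff)
    then show ?thesis by (simp only: linear_sum[OF lin] linear_scale[OF lin])
  qed
  moreover have "pair.bigO (N - n) (\<lambda>i. \<Sum>b\<in>basis_words B n. tensor_coord B b a *\<^sub>R (case i of (s, t) \<Rightarrow> ?R s t (tensor_of b)))"
    by (intro pair.bigO_sum pair.bigO_bounded_linear[OF bounded_linear_scaleR_right] word) (simp add: basis_words_def)
  ultimately have "pair.bigO (N - n) (\<lambda>(s, t). ?R s t a)" by (simp only: case_prod_unfold)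
  moreover have "N - n \<ge> 1" using n by simp
  ultimately show "approx_eq p \<omega> T (N - n) (\<lambda>s t. degree_part n (?H t) a)
      (\<lambda>s t. \<Sum>k\<le>N - 1 - n. degree_part (n + k) (?H s) (component k (incr \<X> s t) \<otimes>\<^sub>t a))"
    by (simp only: approx_eq_iff)
qed

end

end

section \<open>Functoriality\<close>

lemma star_cong:
  assumes "p \<ge> 1" "K t = K' t" "H t = H' t"
  shows "star p K H t = star p K' H' t"
  by (simp add: star_eq[OF assms(1)] assms(2,3))

lemma leibniz_cong:
  assumes "K t = K' t" "H t = H' t"
  shows "leibniz p K H t = leibniz p K' H' t"
  by (simp add: leibniz_eq assms)

lemma smooth_controlled_cong:
  assumes "X t = X' t"
  shows "smooth_controlled p F X t = smooth_controlled p F X' t"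
  unfolding smooth_controlled_def assms ..

context rough_setting
begin

theorem rough_lift_star:
  assumes "\<X> \<in> rough_paths p \<omega> T" "H \<in> controlled p \<omega> T \<X>" "K \<in> controlled p \<omega> T (rough_lift p \<omega> T \<X> H)"
  shows "rough_lift p \<omega> T \<X> (star p K H) \<in> rough_paths p \<omega> T"
    "rough_lift p \<omega> T \<X> (star p K H) = rough_lift p \<omega> T (rough_lift p \<omega> T \<X> H) K"
  using is_lift_star[OF assms] rough_lift_eqI[OF assms(1) is_lift_star[OF assms]] by (auto simp: is_lift_def)

theorem push_rough_lift:
  assumes X: "\<X> \<in> rough_paths p \<omega> T" and H: "H \<in> controlled p \<omega> T \<X>" and F: "smooth F"
  shows "push_rough p \<omega> T F (rough_lift p \<omega> T \<X> H) = rough_lift p \<omega> T \<X> (push_controlled p F H)"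
proof -
  let ?H = "rough_lift p \<omega> T \<X> H"
  let ?K = "smooth_controlled p F (path_trace ?H)"
  have "?K \<in> controlled p \<omega> T ?H"
    by (rule smooth_controlled_in_controlled[OF rough_lift_rough_path[OF X H] smooth_imp_iter_differentiable[OF F]])
  then have "push_rough p \<omega> T F ?H = rough_lift p \<omega> T \<X> (star p ?K H)"
    unfolding push_rough_def by (rule rough_lift_star(2)[OF X H, symmetric])
  \<comment> \<open>The trace of the lift of \<open>H\<close> is that of \<open>H\<close> on [0,T]
    only, so the two controlled paths are exchanged by congruence on this interval.\<close>
  also have "\<dots> = rough_lift p \<omega> T \<X> (push_controlled p F H)"
    unfolding push_controlled_def
    by (intro rough_lift_cong[OF X] star_cong[OF p_ge_1] smooth_controlled_cong path_trace_rough_lift[OF X H] refl)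
  finally show ?thesis .
qed

lemma path_trace_push_rough:
  assumes X: "\<X> \<in> rough_paths p \<omega> T" and F: "smooth F" and t: "0 \<le> t" "t \<le> T"
  shows "path_trace (push_rough p \<omega> T F \<X>) t = F (path_trace \<X> t)"
  unfolding push_rough_def
    path_trace_rough_lift[OF X smooth_controlled_in_controlled[OF X smooth_imp_iter_differentiable[OF F]] t]
  by (rule ctrace_smooth_controlled[OF p_ge_1 smooth_imp_iter_differentiable[OF F]])

text \<open>The special case of \<open>push_rough_lift\<close> in which the controlled path is
  \<open>G\<close> of the trace; Faa di Bruno's formula identifies the result.\<close>

theorem push_rough_compose:
  assumes X: "\<X> \<in> rough_paths p \<omega> T" and G: "smooth G" and F: "smooth F"
  shows "push_rough p \<omega> T F (push_rough p \<omega> T G \<X>) = push_rough p \<omega> T (F \<circ> G) \<X>"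
proof -
  note iF = smooth_imp_iter_differentiable[OF F] and iG = smooth_imp_iter_differentiable[OF G]
  have "push_rough p \<omega> T F (push_rough p \<omega> T G \<X>)
    = rough_lift p \<omega> T \<X> (push_controlled p F (smooth_controlled p G (path_trace \<X>)))"
    unfolding push_rough_def[of p \<omega> T G] by (rule push_rough_lift[OF X smooth_controlled_in_controlled[OF X iG] F])
  also have "\<dots> = push_rough p \<omega> T (F \<circ> G) \<X>"
    unfolding push_rough_def push_controlled_def
    by (intro rough_lift_cong[OF X] star_smooth_controlled[OF p_ge_1 iF iG] ctrace_smooth_controlled[OF p_ge_1 iG])
  finally show ?thesis .
qed

end

text \<open>After reassociating, only the two controlled paths coming from \<open>F\<close> and
  \<open>G\<close> are composed, and these combine by Faa di Bruno's formula.\<close>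

theorem push_controlled_compose:
  assumes p: "p \<ge> 1" and G: "smooth G" and F: "smooth F"
  shows "push_controlled p F (push_controlled p G H) t = push_controlled p (F \<circ> G) H t"
proof -
  note iF = smooth_imp_iter_differentiable[OF F] and iG = smooth_imp_iter_differentiable[OF G]
  let ?Y = "ctrace (push_controlled p G H)"
  have Y: "?Y t = G (ctrace H t)"
    unfolding push_controlled_def ctrace_star[OF p] by (rule ctrace_smooth_controlled[OF p iG])
  have "push_controlled p F (push_controlled p G H) t
    = star p (star p (smooth_controlled p F ?Y) (smooth_controlled p G (ctrace H))) H t"
    unfolding push_controlled_def star_assoc[OF p] ..
  also have "\<dots> = push_controlled p (F \<circ> G) H t"
    unfolding push_controlled_def[of p "F \<circ> G"]
    by (rule star_cong[OF p _ refl]) (rule star_smooth_controlled[OF p iF iG], rule Y)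
  finally show ?thesis .
qed

theorem push_controlled_leibniz:
  assumes p: "p \<ge> 1" and A: "smooth A" and B: "smooth B"
  shows "push_controlled p (\<lambda>x. A x o\<^sub>L B x) H t = leibniz p (push_controlled p A H) (push_controlled p B H) t"
  unfolding push_controlled_def star_leibniz[OF p, symmetric]
  by (rule star_cong[OF p leibniz_smooth_controlled[OF smooth_imp_iter_differentiable[OF A] smooth_imp_iter_differentiable[OF B], symmetric] refl])

text \<open>Pulling the inner Leibniz product along \<open>F\<close> and reassociating leaves two
  factors. The first one combines by associativity of \<open>star\<close> and Faa di Bruno's
  formula. The second one is the chain rule: the derivative of \<open>G \<circ> F\<close> at
  \<open>x\<close> is that of \<open>G\<close> at \<open>F x\<close> composed with that of
  \<open>F\<close> at \<open>x\<close>.\<close>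

theorem (in rough_setting) pullback_compose:
  fixes F :: "'v::fin_dim \<Rightarrow> 'w::fin_dim" and G :: "'w \<Rightarrow> 'z::fin_dim" and H :: "real \<Rightarrow> 'z tensor \<Rightarrow>\<^sub>L ('z \<Rightarrow>\<^sub>L 'u::fin_dim)"
  assumes X: "\<X> \<in> rough_paths p \<omega> T" and F: "smooth F" and G: "smooth G" and t: "0 \<le> t" "t \<le> T"
  shows "pullback p \<X> F (pullback p (push_rough p \<omega> T F \<X>) G H) t = pullback p \<X> (G \<circ> F) H t"
proof -
  note iF = smooth_imp_iter_differentiable[OF F] and iG = smooth_imp_iter_differentiable[OF G]
  let ?x = "path_trace \<X>" and ?y = "path_trace (push_rough p \<omega> T F \<X>)"
  let ?F = "smooth_controlled p F ?x" and ?G = "smooth_controlled p G ?y"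
  let ?DF = "smooth_controlled p (deriv_map F) ?x" and ?DG = "smooth_controlled p (deriv_map G) ?y"
  note y = path_trace_push_rough[OF X F t]
  note iDF = iter_differentiable_deriv_map[OF iF] and iDG = iter_differentiable_deriv_map[OF iG]
  have "pullback p \<X> F (pullback p (push_rough p \<omega> T F \<X>) G H) t
    = leibniz p (star p (leibniz p (star p H ?G) ?DG) ?F) ?DF t"
    unfolding pullback_def ..
  also have "\<dots> = leibniz p (leibniz p (star p (star p H ?G) ?F) (star p ?DG ?F)) ?DF t"
    by (rule leibniz_cong) (rule star_leibniz[OF p_ge_1], rule refl)
  also have "\<dots> = leibniz p (star p (star p H ?G) ?F) (leibniz p (star p ?DG ?F) ?DF) t"
    by (rule leibniz_assoc)
  also have "\<dots> = leibniz p (star p H (smooth_controlled p (G \<circ> F) ?x)) (smooth_controlled p (deriv_map (G \<circ> F)) ?x) t"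
  proof (rule leibniz_cong)
    show "star p (star p H ?G) ?F t = star p H (smooth_controlled p (G \<circ> F) ?x) t"
      unfolding star_assoc[OF p_ge_1] by (rule star_cong[OF p_ge_1 refl]) (rule star_smooth_controlled[OF p_ge_1 iG iF], rule y)
    have "leibniz p (star p ?DG ?F) ?DF t = leibniz p (smooth_controlled p (deriv_map G \<circ> F) ?x) ?DF t"
      by (rule leibniz_cong[OF _ refl]) (rule star_smooth_controlled[OF p_ge_1 iDG iF], rule y)
    also have "\<dots> = smooth_controlled p (\<lambda>x. (deriv_map G \<circ> F) x o\<^sub>L deriv_map F x) ?x t"
      by (rule leibniz_smooth_controlled[OF nth_deriv_compose(2)[OF iDG iF] iDF])
    also have "(\<lambda>x. (deriv_map G \<circ> F) x o\<^sub>L deriv_map F x) = deriv_map (G \<circ> F)"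
      by (simp add: fun_eq_iff deriv_map_compose[OF iF iG])
    finally show "leibniz p (star p ?DG ?F) ?DF t = smooth_controlled p (deriv_map (G \<circ> F)) ?x t" .
  qed
  finally show ?thesis unfolding pullback_def .
qed

theorem proposition2p20:
  fixes p T :: real and \<omega> :: "real \<Rightarrow> real \<Rightarrow> real"
    and \<X> :: "'v::fin_dim rough_path"
  assumes "p \<ge> 1" and "T > 0" and "is_control T \<omega>" and "\<X> \<in> rough_paths p \<omega> T"
  shows
    "(\<forall>(H :: real \<Rightarrow> 'v tensor \<Rightarrow>\<^sub>L 'u::fin_dim) (K :: real \<Rightarrow> 'u tensor \<Rightarrow>\<^sub>L 's::fin_dim).
        H \<in> controlled p \<omega> T \<X> \<longrightarrow>
        K \<in> controlled p \<omega> T (rough_lift p \<omega> T \<X> H) \<longrightarrow>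
        rough_lift p \<omega> T \<X> (star p K H) \<in> rough_paths p \<omega> T \<and>
        rough_lift p \<omega> T \<X> (star p K H) = rough_lift p \<omega> T (rough_lift p \<omega> T \<X> H) K) \<and>
     (\<forall>(H :: real \<Rightarrow> 'v tensor \<Rightarrow>\<^sub>L 'u) (F :: 'u \<Rightarrow> 's).
        H \<in> controlled p \<omega> T \<X> \<longrightarrow> smooth F \<longrightarrow>
        push_rough p \<omega> T F (rough_lift p \<omega> T \<X> H) = rough_lift p \<omega> T \<X> (push_controlled p F H)) \<and>
     (\<forall>(G :: 'v \<Rightarrow> 'u) (F :: 'u \<Rightarrow> 's).
        smooth G \<longrightarrow> smooth F \<longrightarrow>
        push_rough p \<omega> T F (push_rough p \<omega> T G \<X>) = push_rough p \<omega> T (F \<circ> G) \<X>) \<and>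

     (\<forall>(H :: real \<Rightarrow> 'v tensor \<Rightarrow>\<^sub>L 'u) (K :: real \<Rightarrow> 'u tensor \<Rightarrow>\<^sub>L 's)
        (J :: real \<Rightarrow> 's tensor \<Rightarrow>\<^sub>L 'r::fin_dim).
        H \<in> controlled p \<omega> T \<X> \<longrightarrow>
        K \<in> controlled p \<omega> T (rough_lift p \<omega> T \<X> H) \<longrightarrow>
        J \<in> controlled p \<omega> T (rough_lift p \<omega> T (rough_lift p \<omega> T \<X> H) K) \<longrightarrow>
        (\<forall>t\<in>{0..T}. star p (star p J K) H t = star p J (star p K H) t)) \<and>
     (\<forall>(H :: real \<Rightarrow> 'v tensor \<Rightarrow>\<^sub>L 'u) (G :: 'u \<Rightarrow> 's) (F :: 's \<Rightarrow> 'r).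
        H \<in> controlled p \<omega> T \<X> \<longrightarrow> smooth G \<longrightarrow> smooth F \<longrightarrow>
        (\<forall>t\<in>{0..T}. push_controlled p F (push_controlled p G H) t = push_controlled p (F \<circ> G) H t)) \<and>

     (\<forall>(H :: real \<Rightarrow> 'v tensor \<Rightarrow>\<^sub>L 'u)
        (K :: real \<Rightarrow> 'u tensor \<Rightarrow>\<^sub>L ('u1::fin_dim \<Rightarrow>\<^sub>L 'u2::fin_dim))
        (J :: real \<Rightarrow> 'u tensor \<Rightarrow>\<^sub>L ('u2 \<Rightarrow>\<^sub>L 'u3::fin_dim)).
        H \<in> controlled p \<omega> T \<X> \<longrightarrow>
        K \<in> controlled p \<omega> T (rough_lift p \<omega> T \<X> H) \<longrightarrow>
        J \<in> controlled p \<omega> T (rough_lift p \<omega> T \<X> H) \<longrightarrow>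
        (\<forall>t\<in>{0..T}. star p (leibniz p J K) H t = leibniz p (star p J H) (star p K H) t)) \<and>
     (\<forall>(H :: real \<Rightarrow> 'v tensor \<Rightarrow>\<^sub>L 'u) (A :: 'u \<Rightarrow> 'u2 \<Rightarrow>\<^sub>L 'u3) (B :: 'u \<Rightarrow> 'u1 \<Rightarrow>\<^sub>L 'u2).
        H \<in> controlled p \<omega> T \<X> \<longrightarrow> smooth A \<longrightarrow> smooth B \<longrightarrow>
        (\<forall>t\<in>{0..T}. push_controlled p (\<lambda>x. A x o\<^sub>L B x) H t
           = leibniz p (push_controlled p A H) (push_controlled p B H) t)) \<and>

     (\<forall>(H :: real \<Rightarrow> 'v tensor \<Rightarrow>\<^sub>L ('u1 \<Rightarrow>\<^sub>L 'u2))
       (K :: real \<Rightarrow> 'v tensor \<Rightarrow>\<^sub>L ('u2 \<Rightarrow>\<^sub>L 'u3))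
       (J :: real \<Rightarrow> 'v tensor \<Rightarrow>\<^sub>L ('u3 \<Rightarrow>\<^sub>L 'u4::fin_dim)).
        H \<in> controlled p \<omega> T \<X> \<longrightarrow>
        K \<in> controlled p \<omega> T \<X> \<longrightarrow>
        J \<in> controlled p \<omega> T \<X> \<longrightarrow>
        (\<forall>t\<in>{0..T}. leibniz p (leibniz p J K) H t = leibniz p J (leibniz p K H) t)) \<and>

     (\<forall>(F :: 'v \<Rightarrow> 'w::fin_dim) (G :: 'w \<Rightarrow> 'z::fin_dim)
       (H :: real \<Rightarrow> 'z tensor \<Rightarrow>\<^sub>L ('z \<Rightarrow>\<^sub>L 'u)).
        smooth F \<longrightarrow> smooth G \<longrightarrow>
        H \<in> controlled p \<omega> T (push_rough p \<omega> T (G \<circ> F) \<X>) \<longrightarrow>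
        (\<forall>t\<in>{0..T}. pullback p \<X> F (pullback p (push_rough p \<omega> T F \<X>) G H) t
           = pullback p \<X> (G \<circ> F) H t))"
proof -
  interpret rough_setting T \<omega> p by unfold_locales (rule assms)+
  note X = assms(4)
  show ?thesis
    by (intro conjI allI impI ballI rough_lift_star[OF X] push_rough_lift[OF X] push_rough_compose[OF X]
        star_assoc[OF p_ge_1] push_controlled_compose[OF p_ge_1] star_leibniz[OF p_ge_1]
        push_controlled_leibniz[OF p_ge_1] leibniz_assoc pullback_compose[OF X]) simp_all
qed

end
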